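(* Let $[\alpha,\beta]\subset\mathbb{R}$ be a compact interval and let $u$ be a weak solution of the Camassa-Holm equation. Then for any pair of characteristics $\alpha(t)$ and $\beta(t)$ of $u$ emanating from $\alpha$ and $\beta$, respectively, the function $$t\mapsto\int_{[\alpha(t),\beta(t)]}(u_x^+(t,x))^2\,dx$$ has locally bounded variation. In particular, there exists the limit $$\lim_{t\to0^+}\int_{[\alpha(t),\beta(t)]}(u_x^+(t,x))^2\,dx=\Lambda_+^{\alpha(\cdot),\beta(\cdot)}.$$ This limit depends on the choice of the characteristics $\alpha(t),\beta(t)$ and can be made unique by selecting, e.g., the leftmost characteristics emanating from $\alpha$ and $\beta$.
   Context: The Camassa-Holm equation is taken in the form $$u_t+uu_x=\int_{\mathbb{R}}\tfrac12\,\mathrm{sgn}(x-y)e^{-|x-y|}\left(u^2(t,y)+\tfrac12u_x^2(t,y)\right)dy,\qquad u(0,x)=u_0(x),$$ for $t\ge 0$, $x\in\mathbb{R}$. A function $u:[0,\infty)\times\mathbb{R}\to\mathbb{R}$ is a weak solution if $u\in C([0,\infty)\times\mathbb{R})$, the function $t\mapsto\int_{\mathbb{R}}(u^2(t,x)+\frac12u_x^2(t,x))dx$ belongs to $L^\infty([0,\infty))$, $u(0,x)=u_0(x)$ for $x\in\mathbb{R}$, and the equation holds in the sense of distributions. A characteristic of $u$ emanating from $\zeta\in\mathbb{R}$ is a function $\zeta:[0,\infty)\to\mathbb{R}$ with $\zeta(0)=\zeta$, $\frac{d}{dt}\zeta(t)=u(t,\zeta(t))$ and $\frac{d}{dt}u(t,\zeta(t))=\int_{\mathbb{R}}\frac12\mathrm{sgn}(\zeta(t)-y)e^{-|\zeta(t)-y|}(u^2(t,y)+\frac12u_x^2(t,y))dy$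 (the last identity for a.e. $t$, with $t\mapsto u(t,\zeta(t))$ Lipschitz). Characteristics are in general not unique. The leftmost characteristic emanating from $\zeta$ is the unique characteristic $\zeta^l(\cdot)$ with $\zeta^l(0)=\zeta$ and $\zeta^l(t)\le\zeta(t)$ for every $t\ge0$ and every characteristic $\zeta(\cdot)$ emanating from $\zeta$. Notation: $f^+=\max(f,0)$, $f^-=\max(-f,0)$, and $u_x^\pm=(u_x)^\pm$. *)

theory Defs
  imports "HOL-Analysis.Analysis"
begin

primrec C_k :: "nat \<Rightarrow> ('a::euclidean_space \<Rightarrow> real) \<Rightarrow> bool" where
  "C_k 0 f \<longleftrightarrow> continuous_on UNIV f"
| "C_k (Suc k) f \<longleftrightarrow>
     (\<forall>x. f differentiable (at x)) \<and> (\<forall>b\<in>Basis. C_k k (\<lambda>x. frechet_derivative f (at x) b))"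

definition test_function_on :: "'a::euclidean_space set \<Rightarrow> ('a \<Rightarrow> real) \<Rightarrow> bool" where
  "test_function_on S \<phi> \<longleftrightarrow>
     (\<forall>k. C_k k \<phi>) \<and> (\<exists>K. compact K \<and> K \<subseteq> S \<and> (\<forall>x. x \<notin> K \<longrightarrow> \<phi> x = 0))"

definition has_weak_derivative :: "(real \<Rightarrow> real) \<Rightarrow> (real \<Rightarrow> real) \<Rightarrow> bool" where
  "has_weak_derivative f g \<longleftrightarrow>
     (\<forall>a b. set_integrable lborel {a..b} f) \<and>
     (\<forall>a b. set_integrable lborel {a..b} g) \<and>
     (\<forall>\<phi>. test_function_on UNIV \<phi> \<longrightarrow>
        (LINT x|lborel. f x * deriv \<phi> x) = - (LINT x|lborel. g x * \<phi> x))"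

definition bounded_variation_on :: "real \<Rightarrow> real \<Rightarrow> (real \<Rightarrow> real) \<Rightarrow> bool" where
  "bounded_variation_on a b f \<longleftrightarrow>
     (\<exists>B. \<forall>(n::nat) p. a \<le> p 0 \<and> (\<forall>i<n. p i \<le> p (Suc i)) \<and> p n \<le> b \<longrightarrow>
        (\<Sum>i<n. \<bar>f (p (Suc i)) - f (p i)\<bar>) \<le> B)"

definition locally_bounded_variation :: "(real \<Rightarrow> real) \<Rightarrow> bool" where
  "locally_bounded_variation f \<longleftrightarrow> (\<forall>T\<ge>0. bounded_variation_on 0 T f)"

text \<open>
  Functions of time and space are curried, with time first; only their values at times
  \<open>t \<ge> 0\<close> matter. The spatial derivative \<open>u_x\<close> is carried along as a
  second function \<open>ux\<close>: for each \<open>t\<close> it is determined by \<open>u\<close> up to a null set of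
  \<open>x\<close>, which affects none of the integrals below.
\<close>

definition CH_source :: "(real \<Rightarrow> real \<Rightarrow> real) \<Rightarrow> (real \<Rightarrow> real \<Rightarrow> real) \<Rightarrow> real \<Rightarrow> real \<Rightarrow> real" where
  "CH_source u ux t x =
     (LINT y|lborel. 1/2 * sgn (x - y) * exp (- \<bar>x - y\<bar>) * ((u t y)\<^sup>2 + 1/2 * (ux t y)\<^sup>2))"

text \<open>
  The energy is an extended nonnegative integral, so that its essential boundedness includes
  finiteness for almost every \<open>t\<close>. In the last clause the test functions are supported in the
  open half plane \<open>t > 0\<close>; the initial datum is attained pointwise.
\<close>

definition CH_weak_solution ::
  "(real \<Rightarrow> real) \<Rightarrow> (real \<Rightarrow> real \<Rightarrow> real) \<Rightarrow> (real \<Rightarrow> real \<Rightarrow> real) \<Rightarrow> bool" where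
  "CH_weak_solution u0 u ux \<longleftrightarrow>
     continuous_on ({0..} \<times> UNIV) (\<lambda>(t, x). u t x) \<and>
     set_borel_measurable borel ({0..} \<times> UNIV) (\<lambda>(t, x). ux t x) \<and>
     (\<forall>t\<ge>0. has_weak_derivative (u t) (ux t)) \<and>
     (\<exists>C::real. AE t in lborel. 0 \<le> t \<longrightarrow>
        (\<integral>\<^sup>+ x. ennreal ((u t x)\<^sup>2 + 1/2 * (ux t x)\<^sup>2) \<partial>lborel) \<le> ennreal C) \<and>
     (\<forall>x. u 0 x = u0 x) \<and>
     (\<forall>\<phi>::real \<times> real \<Rightarrow> real. test_function_on ({0<..} \<times> UNIV) \<phi> \<longrightarrow>
        (LINT (t, x)|lborel. - u t x * deriv (\<lambda>s. \<phi> (s, x)) t + u t x * ux t x * \<phi> (t, x)) =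
        (LINT (t, x)|lborel. CH_source u ux t x * \<phi> (t, x)))"

definition characteristic ::
  "(real \<Rightarrow> real \<Rightarrow> real) \<Rightarrow> (real \<Rightarrow> real \<Rightarrow> real) \<Rightarrow> real \<Rightarrow> (real \<Rightarrow> real) \<Rightarrow> bool" where
  "characteristic u ux z0 z \<longleftrightarrow>
     z 0 = z0 \<and>
     (\<forall>t\<ge>0. (z has_real_derivative u t (z t)) (at t within {0..})) \<and>
     (\<exists>L. L-lipschitz_on {0..} (\<lambda>t. u t (z t))) \<and>
     (AE t in lborel. 0 \<le> t \<longrightarrow>
        ((\<lambda>s. u s (z s)) has_real_derivative CH_source u ux t (z t)) (at t within {0..}))"

definition leftmost_characteristic ::
  "(real \<Rightarrow> real \<Rightarrow> real) \<Rightarrow> (real \<Rightarrow> real \<Rightarrow> real) \<Rightarrow> real \<Rightarrow> (real \<Rightarrow> real) \<Rightarrow> bool" where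
  "leftmost_characteristic u ux z0 z \<longleftrightarrow>
     characteristic u ux z0 z \<and>
     (\<forall>w. characteristic u ux z0 w \<longrightarrow> (\<forall>t\<ge>0. z t \<le> w t))"

text \<open>
  Nothing forces two given characteristics to keep their order; where \<open>b t < a t\<close> the
  interval is empty and the integral is 0.
\<close>

definition positive_energy ::
  "(real \<Rightarrow> real \<Rightarrow> real) \<Rightarrow> (real \<Rightarrow> real) \<Rightarrow> (real \<Rightarrow> real) \<Rightarrow> real \<Rightarrow> real" where
  "positive_energy ux a b t = (LINT x:{a t..b t}|lborel. (max (ux t x) 0)\<^sup>2)"

end

theory Submission
  imports Defs "HOL-Complex_Analysis.Great_Picard" "HOL-Real_Asymp.Real_Asymp"
begin

text \<open>
  Write \<open>E t\<close> for the integral of \<open>(u_x\<^sup>+)\<^sup>2\<close> over the interval between two characteristics \<open>a t\<close>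
  and \<open>b t\<close>. The reason for the bounded variation is one-sided: the energy of positive slopes
  may increase suddenly, but decreases only at a bounded rate. Precisely, \<open>E t + K * t\<close> is
  nondecreasing on every bounded time interval for a suitable constant \<open>K\<close>; since \<open>E\<close> is also
  bounded by the total energy, it has bounded variation there and a limit at \<open>0\<close> from the right.

  The monotonicity is first seen for a pair of ordered characteristics \<open>y \<le> z\<close>. With \<open>d = z - y\<close>
  and \<open>w = u(z) - u(y)\<close> one has \<open>d' = w\<close>, and \<open>w'\<close> is the difference of the source \<open>F\<close> at the
  two points. The kernel of \<open>F\<close> jumps up by one at the origin and elsewhere decreases with slope
  at least \<open>-1/2\<close>, so that difference is at least the energy between the points minus a multiple
  of \<open>d\<close>; by the Cauchy-Schwarz inequality \<open>w' \<ge> w\<^sup>2 / (2 * d) - (C / 2) * d\<close>. For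
  \<open>q = (w\<^sup>+)\<^sup>2 / d\<close> the quadratic terms cancel and \<open>q' \<ge> - C * w\<^sup>+\<close> remains (\<open>q_monotone\<close>, which
  also handles collisions of the two curves). The integral of \<open>(u_x\<^sup>+)\<^sup>2\<close> over an interval is the
  supremum of the sums of \<open>(\<Delta>u\<^sup>+)\<^sup>2 / \<Delta>x\<close> over its partitions: sums are smaller by Cauchy-Schwarz
  (\<open>slope_energy_sum_le\<close>), and equipartitions reach the integral in the limit by Lebesgue
  differentiation and Fatou's lemma (\<open>uxp2_le_of_slope_energies\<close>). Starting from a partition of
  \<open>[a s, b s]\<close>, one runs a characteristic through each partition point, keeping the curves
  ordered by maxima and minima (\<open>fan_of_solutions\<close>), and adds up the inequalities for \<open>q\<close>; the
  sum of the \<open>w\<^sup>+\<close> is bounded independently of the partition. The result is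
  \<open>positive_energy_almost_monotone\<close>.

  For this argument every solution of \<open>z' = u(t, z)\<close> has to satisfy the equation for \<open>u\<close> along
  the curve, although \<open>u\<close> is a solution only in the sense of distributions (\<open>u_along_solution\<close>).
  This is obtained by integrating the equation over the moving window \<open>[z t, z t + \<epsilon>]\<close> and
  letting \<open>\<epsilon>\<close> tend to \<open>0\<close>: the error is at most \<open>\<epsilon>\<close> times the energy in the window. Hence
  characteristics are exactly the solutions of a scalar differential equation with bounded
  continuous right-hand side; they exist by Peano's theorem, are closed under maxima and minima,
  and among those with a given starting point there is a leftmost one, the limit of the
  solutions of \<open>z' = u(t, z) - 1 / n\<close>.

  That the limit depends on the characteristics is shown by the solution that starts from
  \<open>u = 0\<close> and creates a peakon-antipeakon pair,
  \<open>u(t, x) = coth t * (exp (- \<bar>x - q\<bar>) - exp (- \<bar>x + q\<bar>))\<close> with \<open>q = ln (cosh t)\<close>. Both peaks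
  \<open>\<plusminus>q\<close> are characteristics from the origin. Between them \<open>u_x\<^sup>+\<close> carries energy of at least \<open>1\<close>
  for all small \<open>t > 0\<close>, whereas to the right of \<open>q\<close> the slope is negative (\<open>limits_differ\<close>).
\<close>

section \<open>The Lebesgue differentiation theorem on the line\<close>

definition locally_integrable :: "(real \<Rightarrow> real) \<Rightarrow> bool" where
  "locally_integrable f \<longleftrightarrow> (\<forall>a b. set_integrable lborel {a..b} f)"

lemma locally_integrableD: "locally_integrable f \<Longrightarrow> set_integrable lborel {a..b} f"
  by (simp add: locally_integrable_def)

lemma locally_integrable_measurable:
  assumes "locally_integrable f"
  shows "f \<in> borel_measurable borel"
proof (rule borel_measurable_LIMSEQ_real)
  fix n :: nat
  show "(\<lambda>x. indicator {- real n..real n} x *\<^sub>R f x) \<in> borel_measurable borel"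
    using locally_integrableD[OF assms, of "- real n" "real n"]
    unfolding set_integrable_def by auto
next
  fix x :: real
  obtain N :: nat where N: "\<bar>x\<bar> \<le> real N" using real_arch_simple by blast
  have "eventually (\<lambda>n. indicator {- real n..real n} x *\<^sub>R f x = f x) sequentially"
    using eventually_ge_at_top[of N]
  proof eventually_elim
    case (elim n)
    then have "\<bar>x\<bar> \<le> real n" using N by linarith
    then show ?case by (auto simp: indicator_def)
  qed
  then show "(\<lambda>n. indicator {- real n..real n} x *\<^sub>R f x) \<longlonglongrightarrow> f x"
    by (rule tendsto_eventually)
qed

lemma set_integrable_const_Icc: "set_integrable lborel {a..b::real} (\<lambda>t. c :: real)"
  unfolding set_integrable_def
  by (intro integrable_scaleR_left integrable_real_indicator) (auto simp: emeasure_lborel_Icc_eq)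

lemma set_integrable_bounded_Icc:
  fixes f :: "real \<Rightarrow> real"
  assumes "f \<in> borel_measurable borel" "AE t in lborel. t \<in> {a..b} \<longrightarrow> \<bar>f t\<bar> \<le> B"
  shows "set_integrable lborel {a..b} f"
  by (rule set_integrable_bound[OF set_integrable_const_Icc[of a b B]])
     (use assms in \<open>auto simp: set_borel_measurable_def elim!: eventually_mono\<close>)

text \<open>
  A Vitali covering argument. Let \<open>p\<close> be the positive part of \<open>f - \<alpha>\<close>, cut off outside
  \<open>[-N, N]\<close>. The set \<open>f < \<alpha>\<close> has measure zero for the density \<open>p\<close>, hence lies in an open set of
  small \<open>p\<close>-measure. Almost all exceptional points are covered by disjoint intervals inside that
  open set on which \<open>G\<close> grows faster than \<open>\<alpha> + \<eta>\<close>; each of them has \<open>p\<close>-measure at least \<open>\<eta>\<close>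
  times its length, so their total length is small.
\<close>
lemma vitali_upper_derivative:
  fixes f G :: "real \<Rightarrow> real"
  assumes f: "locally_integrable f"
    and G: "\<And>x y. x \<le> y \<Longrightarrow> G y - G x = (LINT t:{x..y}|lborel. f t)"
    and \<eta>: "\<eta> > 0"
  shows "negligible {x. - N < x \<and> x < N \<and> f x < \<alpha> \<and>
      (\<forall>\<delta>>0. \<exists>a b. a \<le> x \<and> x \<le> b \<and> a < b \<and> b - a < \<delta> \<and> G b - G a > (\<alpha> + \<eta>) * (b - a))}"
    (is "negligible ?A")
proof -
  have fm[measurable]: "f \<in> borel_measurable borel"
    using locally_integrable_measurable[OF f] .
  define p where "p x = indicator {-N..N} x * max (f x - \<alpha>) 0" for x
  have pm[measurable]: "p \<in> borel_measurable borel" unfolding p_def by measurable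
  have p_nn: "p x \<ge> 0" for x by (simp add: p_def)
  have int_fa: "set_integrable lborel {a..b} (\<lambda>x. f x - \<alpha>)" for a b
    by (intro set_integral_diff(1) locally_integrableD[OF f] set_integrable_const_Icc)
  have int_p: "integrable lborel p"
  proof (rule Bochner_Integration.integrable_bound)
    show "integrable lborel (\<lambda>x. indicator {-N..N} x *\<^sub>R (f x - \<alpha>))"
      using int_fa[of "-N" N] by (simp add: set_integrable_def)
  qed (auto simp: p_def indicator_def)
  define \<nu> where "\<nu> = density lborel (\<lambda>x. ennreal (p x))"
  have em\<nu>: "emeasure \<nu> X = (\<integral>\<^sup>+x. ennreal (p x) * indicator X x \<partial>lborel)" if "X \<in> sets borel" for X
    unfolding \<nu>_def using that by (subst emeasure_density) auto
  have sets\<nu>[simp]: "sets \<nu> = sets borel" "space \<nu> = UNIV" by (auto simp: \<nu>_def)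
  have fin: "emeasure \<nu> (space \<nu>) \<noteq> \<infinity>"
  proof -
    have "emeasure \<nu> UNIV = (\<integral>\<^sup>+x. ennreal (p x) \<partial>lborel)" by (subst em\<nu>) auto
    also have "\<dots> = ennreal (LINT x|lborel. p x)"
      using int_p p_nn by (intro nn_integral_eq_integral) auto
    finally show ?thesis by simp
  qed
  define E where "E = {x. -N < x \<and> x < N \<and> f x < \<alpha>}"
  have E[measurable]: "E \<in> sets borel" unfolding E_def by measurable
  have \<nu>E: "emeasure \<nu> E = 0"
  proof -
    have "ennreal (p x) * indicator E x = 0" for x
      by (auto simp: p_def E_def max_def indicator_def)
    then have "(\<lambda>x. ennreal (p x) * indicator E x) = (\<lambda>x. 0)" by (intro ext)
    then show ?thesis by (simp only: em\<nu>[OF E] nn_integral_const) simp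
  qed
  show ?thesis
    unfolding negligible_outer
  proof (intro allI impI)
    fix e :: real assume e: "e > 0"
    have "(INF U\<in>{U. E \<subseteq> U \<and> open U}. emeasure \<nu> U) < ennreal (e * \<eta>)"
      using outer_regular[of \<nu> E] fin \<nu>E e \<eta> by simp
    then obtain U where U: "E \<subseteq> U" "open U" and \<nu>U: "emeasure \<nu> U < ennreal (e * \<eta>)"
      by (auto simp: INF_less_iff)
    define U' where "U' = U \<inter> {-N<..<N}"
    have U': "open U'" "U' \<subseteq> U" "U' \<subseteq> {-N..N}" using U by (auto simp: U'_def)
    define K where "K = {i::real\<times>real. fst i < snd i \<and> {fst i..snd i} \<subseteq> U' \<and>
        G (snd i) - G (fst i) > (\<alpha> + \<eta>) * (snd i - fst i)}"
    have cb: "cball ((fst i + snd i)/2) ((snd i - fst i)/2) = {fst i..snd i}"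
      for i :: "real \<times> real"
    proof -
      have "{fst i..snd i} = cball ((fst i + snd i)/2) ((snd i - fst i)/2)"
        by (rule atLeastAtMost_eq_cball)
      then show ?thesis by simp
    qed
    obtain C where C: "countable C" "C \<subseteq> K"
      "pairwise (\<lambda>i j. disjnt {fst i..snd i} {fst j..snd j}) C"
      "negligible (?A - (\<Union>i\<in>C. {fst i..snd i}))"
    proof (rule Vitali_covering_theorem_cballs[of K "\<lambda>i. (snd i - fst i)/2" ?A "\<lambda>i. (fst i + snd i)/2"])
      fix i assume "i \<in> K" then show "0 < (snd i - fst i)/2" by (simp add: K_def)
    next
      fix x d :: real assume x: "x \<in> ?A" and d: "0 < d"
      have "x \<in> U'" using x U by (auto simp: U'_def E_def)
      then obtain r where r: "r > 0" "cball x r \<subseteq> U'"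
        using U'(1) open_contains_cball by blast
      have "min r d > 0" using r d by simp
      then obtain a b where ab: "a \<le> x" "x \<le> b" "a < b" "b - a < min r d"
          "G b - G a > (\<alpha> + \<eta>) * (b - a)"
        using x by blast
      have "{a..b} \<subseteq> cball x r" using ab by (auto simp: dist_real_def)
      then have "(a,b) \<in> K" using ab r by (auto simp: K_def)
      moreover have "x \<in> cball ((a+b)/2) ((b-a)/2)"
        using cb[of "(a,b)"] ab by simp
      ultimately show "\<exists>i. i \<in> K \<and> x \<in> cball ((fst i + snd i)/2) ((snd i - fst i)/2) \<and> (snd i - fst i)/2 < d"
        using ab by (intro exI[of _ "(a,b)"]) auto
    qed (use that in \<open>simp add: cb\<close>)
    define T where "T = (\<Union>i\<in>C. {fst i..snd i})"
    have T[measurable]: "T \<in> sets borel" unfolding T_def using C(1) by (intro sets.countable_UN') auto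
    have disj: "disjoint_family_on (\<lambda>i. {fst i..snd i}) C"
      using C(3) by (auto simp: disjoint_family_on_def pairwise_def disjnt_def)
    \<comment> \<open>This is where the fast growth of \<open>G\<close> enters: the integral of \<open>f - \<alpha>\<close> exceeds \<open>\<eta>\<close> times
        the length.\<close>
    have each: "ennreal \<eta> * emeasure lborel {fst i..snd i} \<le> emeasure \<nu> {fst i..snd i}" if "i \<in> C" for i
    proof -
      define a b where "a = fst i" and "b = snd i"
      have iK: "a < b" "{a..b} \<subseteq> U'" "G b - G a > (\<alpha> + \<eta>) * (b - a)"
        using that C(2) by (auto simp: K_def a_def b_def)
      have "(LINT t:{a..b}|lborel. f t - \<alpha>) = (LINT t:{a..b}|lborel. f t) - (LINT t:{a..b}|lborel. \<alpha>)"
        by (intro set_integral_diff(2) locally_integrableD[OF f] set_integrable_const_Icc)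
      also have "(LINT t:{a..b}|lborel. \<alpha>) = \<alpha> * (b - a)"
        using iK by (simp add: set_lebesgue_integral_def)
      also have "(LINT t:{a..b}|lborel. f t) = G b - G a" using G iK by simp
      finally have "\<eta> * (b - a) \<le> (LINT t:{a..b}|lborel. f t - \<alpha>)"
        using iK(3) by (simp add: algebra_simps)
      also have "\<dots> \<le> (LINT t:{a..b}|lborel. p t)"
      proof (rule set_integral_mono[OF int_fa])
        show "set_integrable lborel {a..b} p"
          unfolding set_integrable_def by (rule integrable_mult_indicator) (auto simp: int_p)
        fix x assume "x \<in> {a..b}"
        then have "x \<in> {-N..N}" using iK(2) U'(3) by blast
        then show "f x - \<alpha> \<le> p x" by (simp add: p_def)
      qed
      finally have le: "\<eta> * (b - a) \<le> (LINT t:{a..b}|lborel. p t)" .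
      have "emeasure \<nu> {a..b} = (\<integral>\<^sup>+x. ennreal (indicator {a..b} x *\<^sub>R p x) \<partial>lborel)"
        by (subst em\<nu>) (auto intro!: nn_integral_cong simp: indicator_def)
      also have "\<dots> = ennreal (LINT t:{a..b}|lborel. p t)"
        unfolding set_lebesgue_integral_def
        by (intro nn_integral_eq_integral integrable_mult_indicator int_p) (auto simp: p_nn)
      finally have "emeasure \<nu> {a..b} = ennreal (LINT t:{a..b}|lborel. p t)" .
      then show ?thesis using le iK \<eta> unfolding a_def[symmetric] b_def[symmetric]
        by (simp add: ennreal_mult'[symmetric] ennreal_leI)
    qed
    have "ennreal \<eta> * emeasure lborel T = (\<integral>\<^sup>+i. ennreal \<eta> * emeasure lborel {fst i..snd i} \<partial>count_space C)"
      unfolding T_def using C(1) disj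
      by (subst emeasure_UN_countable) (auto simp: nn_integral_cmult)
    also have "\<dots> \<le> (\<integral>\<^sup>+i. emeasure \<nu> {fst i..snd i} \<partial>count_space C)"
      by (intro nn_integral_mono) (use each in auto)
    also have "\<dots> = emeasure \<nu> T"
      unfolding T_def using C(1) disj
      by (subst emeasure_UN_countable) auto
    also have "\<dots> \<le> emeasure \<nu> U"
      using C(2) U'(2) U(2) by (intro emeasure_mono) (auto simp: T_def K_def)
    finally have "ennreal \<eta> * emeasure lborel T < ennreal (e * \<eta>)" using \<nu>U by simp
    then have eT: "emeasure lborel T < ennreal e"
      using \<eta> e mult_left_mono[of "ennreal e" "emeasure lborel T" "ennreal \<eta>"]
      by (auto simp: ennreal_mult mult.commute not_le[symmetric])
    have TL: "T \<in> lmeasurable"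
      using eT by (auto simp: fmeasurable_def intro: less_trans)
    have mT: "measure lebesgue T < e"
    proof -
      have "emeasure lborel T = ennreal (measure lborel T)"
        using eT by (intro emeasure_eq_ennreal_measure) auto
      then show ?thesis using eT e by (simp add: ennreal_less_iff)
    qed
    define Z where "Z = ?A - T"
    have Z: "negligible Z" using C(4) by (simp add: Z_def T_def)
    have "T \<union> Z \<in> lmeasurable" using TL Z by (simp add: fmeasurable.Un negligible_imp_measurable)
    moreover have "measure lebesgue (T \<union> Z) \<le> measure lebesgue T + measure lebesgue Z"
      using TL Z by (intro measure_Un_le) (auto simp: negligible_imp_sets)
    then have "measure lebesgue (T \<union> Z) < e"
      using mT Z by (simp add: negligible_imp_measure0)
    ultimately show "\<exists>T. ?A \<subseteq> T \<and> T \<in> lmeasurable \<and> measure lebesgue T < e"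
      by (intro exI[of _ "T \<union> Z"]) (auto simp: Z_def)
  qed
qed

text \<open>
  A failure at \<open>x\<close> with tolerance \<open>e\<close> puts \<open>x\<close> into one of the countably many null sets of
  \<open>vitali_upper_derivative\<close>, for a rational \<open>\<alpha>\<close> slightly above \<open>f x\<close> and a gap \<open>1 / Suc k\<close> below
  \<open>e / 2\<close>.
\<close>
lemma lebesgue_differentiation_upper:
  fixes f G :: "real \<Rightarrow> real"
  assumes f: "locally_integrable f"
    and G: "\<And>x y. x \<le> y \<Longrightarrow> G y - G x = (LINT t:{x..y}|lborel. f t)"
  shows "AE x in lborel. \<forall>e>0. \<exists>\<delta>>0. \<forall>a b. a \<le> x \<and> x \<le> b \<and> a < b \<and> b - a < \<delta> \<longrightarrow>
     G b - G a \<le> (f x + e) * (b - a)"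
proof -
  define B where "B N \<alpha> \<eta> = {x. - N < x \<and> x < N \<and> f x < \<alpha> \<and>
      (\<forall>\<delta>>0. \<exists>a b. a \<le> x \<and> x \<le> b \<and> a < b \<and> b - a < \<delta> \<and> G b - G a > (\<alpha> + \<eta>) * (b - a))}" for N \<alpha> \<eta>
  define Z where "Z = (\<Union>N::nat. \<Union>\<alpha>\<in>\<rat>. \<Union>k::nat. B N \<alpha> (1 / Suc k))"
  have negl: "negligible Z"
    unfolding Z_def
  proof (intro negligible_Union_nat)
    fix N :: nat
    show "negligible (\<Union>\<alpha>\<in>\<rat>. \<Union>k::nat. B N \<alpha> (1 / Suc k))"
    proof (rule negligible_countable_Union)
      show "countable ((\<lambda>\<alpha>. \<Union>k. B N \<alpha> (1 / Suc k)) ` \<rat>)" using countable_rat by auto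
      fix X assume "X \<in> (\<lambda>\<alpha>. \<Union>k. B N \<alpha> (1 / Suc k)) ` \<rat>"
      then obtain \<alpha> where X: "X = (\<Union>k. B N \<alpha> (1 / Suc k))" by auto
      show "negligible X" unfolding X B_def
        by (intro negligible_Union_nat vitali_upper_derivative[OF f G]) auto
    qed
  qed
  have "AE x in lebesgue. \<forall>e>0. \<exists>\<delta>>0. \<forall>a b. a \<le> x \<and> x \<le> b \<and> a < b \<and> b - a < \<delta> \<longrightarrow>
     G b - G a \<le> (f x + e) * (b - a)"
    unfolding eventually_ae_filter_negligible
  proof (intro exI[of _ Z] conjI negl subsetI)
    fix x assume "x \<in> {x. \<not> (\<forall>e>0. \<exists>\<delta>>0. \<forall>a b. a \<le> x \<and> x \<le> b \<and> a < b \<and> b - a < \<delta> \<longrightarrow>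
     G b - G a \<le> (f x + e) * (b - a))}"
    then obtain e where e: "e > 0" and bad: "\<And>\<delta>. \<delta> > 0 \<Longrightarrow> \<exists>a b. a \<le> x \<and> x \<le> b \<and> a < b \<and> b - a < \<delta> \<and>
     G b - G a > (f x + e) * (b - a)" by (auto simp: not_le)
    obtain \<alpha> where \<alpha>: "\<alpha> \<in> \<rat>" "f x < \<alpha>" "\<alpha> < f x + e/2"
      using Rats_dense_in_real[of "f x" "f x + e/2"] e by auto
    obtain k :: nat where k: "1 / Suc k < e/2"
      using nat_approx_posE[of "e/2"] e by auto
    obtain N :: nat where N: "\<bar>x\<bar> < real N" using reals_Archimedean2 by blast
    have "x \<in> B N \<alpha> (1 / Suc k)"
      unfolding B_def mem_Collect_eq
    proof (intro conjI allI impI)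
      fix \<delta> :: real assume "\<delta> > 0"
      then obtain a b where ab: "a \<le> x" "x \<le> b" "a < b" "b - a < \<delta>" "G b - G a > (f x + e) * (b - a)"
        using bad by blast
      have "(\<alpha> + 1 / Suc k) * (b - a) \<le> (f x + e) * (b - a)"
        using \<alpha> k ab by (intro mult_right_mono) linarith+
      then show "\<exists>a b. a \<le> x \<and> x \<le> b \<and> a < b \<and> b - a < \<delta> \<and> G b - G a > (\<alpha> + 1 / Suc k) * (b - a)"
        using ab by (intro exI[of _ a] exI[of _ b]) linarith
    qed (use N \<alpha> in auto)
    then show "x \<in> Z" using \<alpha> by (auto simp: Z_def)
  qed
  then show ?thesis by (simp add: AE_completion_iff)
qed

text \<open>
  The intervals contain \<open>x\<close> at an arbitrary position, as the cells of a partition do. The lower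
  bound is the upper bound for \<open>- f\<close>.
\<close>
theorem lebesgue_differentiation:
  fixes f G :: "real \<Rightarrow> real"
  assumes f: "locally_integrable f"
    and G: "\<And>x y. x \<le> y \<Longrightarrow> G y - G x = (LINT t:{x..y}|lborel. f t)"
  shows "AE x in lborel. \<forall>e>0. \<exists>\<delta>>0. \<forall>a b. a \<le> x \<and> x \<le> b \<and> a < b \<and> b - a < \<delta> \<longrightarrow>
     \<bar>(G b - G a) / (b - a) - f x\<bar> \<le> e"
proof -
  have f': "locally_integrable (\<lambda>x. - f x)"
    using f by (auto simp: locally_integrable_def set_integrable_def)
  have G': "- G y - - G x = (LINT t:{x..y}|lborel. - f t)" if "x \<le> y" for x y
    using G[OF that] by (simp add: set_lebesgue_integral_def)
  have U1: "AE x in lborel. \<forall>e>0. \<exists>\<delta>>0. \<forall>a b. a \<le> x \<and> x \<le> b \<and> a < b \<and> b - a < \<delta> \<longrightarrow>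
     G b - G a \<le> (f x + e) * (b - a)"
    using G by (rule lebesgue_differentiation_upper[OF f])
  have U2: "AE x in lborel. \<forall>e>0. \<exists>\<delta>>0. \<forall>a b. a \<le> x \<and> x \<le> b \<and> a < b \<and> b - a < \<delta> \<longrightarrow>
     - G b - - G a \<le> (- f x + e) * (b - a)"
    using G' by (rule lebesgue_differentiation_upper[OF f'])
  from U1 U2 show ?thesis
  proof eventually_elim
    case (elim x)
    show ?case
    proof (intro allI impI)
      fix e :: real assume e: "e > 0"
      obtain d1 where d1: "d1 > 0" "\<And>a b. a \<le> x \<and> x \<le> b \<and> a < b \<and> b - a < d1 \<Longrightarrow> G b - G a \<le> (f x + e) * (b - a)"
        using elim(1) e by blast
      obtain d2 where d2: "d2 > 0" "\<And>a b. a \<le> x \<and> x \<le> b \<and> a < b \<and> b - a < d2 \<Longrightarrow> - G b - - G a \<le> (- f x + e) * (b - a)"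
        using elim(2) e by blast
      show "\<exists>\<delta>>0. \<forall>a b. a \<le> x \<and> x \<le> b \<and> a < b \<and> b - a < \<delta> \<longrightarrow> \<bar>(G b - G a) / (b - a) - f x\<bar> \<le> e"
      proof (intro exI[of _ "min d1 d2"] conjI allI impI)
        fix a b assume ab: "a \<le> x \<and> x \<le> b \<and> a < b \<and> b - a < min d1 d2"
        then have 1: "(G b - G a) / (b - a) \<le> f x + e"
          using d1(2)[of a b] by (auto simp: pos_divide_le_eq)
        have "(f x - e) * (b - a) \<le> G b - G a"
          using d2(2)[of a b] ab by (auto simp: algebra_simps)
        then have 2: "f x - e \<le> (G b - G a) / (b - a)"
          using ab by (subst pos_le_divide_eq) auto
        show "\<bar>(G b - G a) / (b - a) - f x\<bar> \<le> e" using 1 2 by linarith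
      qed (use d1 d2 in auto)
    qed
  qed
qed

section \<open>Smooth cut-offs and weak derivatives\<close>

text \<open>
  On the real line the recursion for \<open>C_k\<close> is used only through \<open>C_k_SucI\<close> and \<open>C_k_SucE\<close>, which
  speak of ordinary derivatives instead of Frechet derivatives.
\<close>
declare C_k.simps(2) [simp del]

lemma C_k_SucI:
  assumes "\<And>x. (f has_real_derivative g x) (at x)" "C_k k g"
  shows "C_k (Suc k) f"
proof -
  have fd: "frechet_derivative f (at x) = (\<lambda>h. g x * h)" for x
    using assms(1)[of x] by (simp add: has_field_derivative_def frechet_derivative_at[symmetric])
  have "f differentiable (at x)" for x
    using assms(1)[of x] unfolding differentiable_def has_field_derivative_def by blast
  then show ?thesis using assms(2) by (simp add: C_k.simps(2) fd)
qed

lemma C_k_SucE: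
  fixes f :: "real \<Rightarrow> real"
  assumes "C_k (Suc k) f"
  obtains g where "\<And>x. (f has_real_derivative g x) (at x)" "C_k k g"
proof (rule that[of "\<lambda>x. frechet_derivative f (at x) 1"])
  fix x
  define D where "D = frechet_derivative f (at x)"
  have "f differentiable (at x)" using assms by (simp add: C_k.simps(2))
  then have D: "(f has_derivative D) (at x)"
    unfolding D_def using frechet_derivative_works by blast
  have "D h = D 1 * h" for h
    using linear_cmul[OF bounded_linear.linear[OF has_derivative_bounded_linear[OF D]], of h 1]
    by (simp add: mult.commute)
  then have "D = (*) (D 1)" by (rule ext)
  then show "(f has_real_derivative frechet_derivative f (at x) 1) (at x)"
    unfolding D_def[symmetric] has_field_derivative_def using D by simp
qed (use assms in \<open>simp add: C_k.simps(2)\<close>)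

lemma C_k_continuous:
  fixes f :: "real \<Rightarrow> real"
  assumes "C_k k f" shows "continuous_on UNIV f"
proof (cases k)
  case (Suc n)
  with assms have "\<And>x. f differentiable (at x)" by (simp add: C_k.simps(2))
  then show ?thesis by (simp add: continuous_at_imp_continuous_on differentiable_imp_continuous_within)
qed (use assms in auto)

text \<open>
  Sums and scalar multiples are treated together, so that the inductions below, where
  derivatives appear as linear combinations \<open>a * f + b * g\<close>, use a single closure rule.
\<close>
lemma C_k_lin:
  fixes f g :: "real \<Rightarrow> real"
  assumes "C_k k f" "C_k k g"
  shows "C_k k (\<lambda>x. a * f x + b * g x)"
  using assms
proof (induction k arbitrary: f g)
  case 0 then show ?case by (auto intro!: continuous_intros)
next
  case (Suc k)
  obtain f' where f': "\<And>x. (f has_real_derivative f' x) (at x)" "C_k k f'"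
    using Suc.prems(1) C_k_SucE by blast
  obtain g' where g': "\<And>x. (g has_real_derivative g' x) (at x)" "C_k k g'"
    using Suc.prems(2) C_k_SucE by blast
  have "((\<lambda>x. a * f x + b * g x) has_real_derivative a * f' x + b * g' x) (at x)" for x
    by (intro DERIV_add DERIV_cmult f' g')
  then show ?case by (rule C_k_SucI) (intro Suc.IH f' g')
qed

lemma C_k_SucD:
  fixes f :: "real \<Rightarrow> real"
  shows "C_k (Suc k) f \<Longrightarrow> C_k k f"
proof (induction k arbitrary: f)
  case 0
  then have "continuous_on UNIV f" by (rule C_k_continuous)
  then show ?case by simp
next
  case (Suc k)
  obtain g where "\<And>x. (f has_real_derivative g x) (at x)" "C_k (Suc k) g"
    using Suc.prems C_k_SucE by blast
  then show ?case using Suc.IH by (blast intro: C_k_SucI)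
qed

lemma C_k_mult:
  fixes f g :: "real \<Rightarrow> real"
  assumes "C_k k f" "C_k k g"
  shows "C_k k (\<lambda>x. f x * g x)"
  using assms
proof (induction k arbitrary: f g)
  case 0 then show ?case by (auto intro!: continuous_intros)
next
  case (Suc k)
  obtain f' where f': "\<And>x. (f has_real_derivative f' x) (at x)" "C_k k f'"
    using Suc.prems(1) C_k_SucE by blast
  obtain g' where g': "\<And>x. (g has_real_derivative g' x) (at x)" "C_k k g'"
    using Suc.prems(2) C_k_SucE by blast
  have "C_k k (\<lambda>x. 1 * (f' x * g x) + 1 * (f x * g' x))"
    using Suc.prems[THEN C_k_SucD] f' g' by (intro C_k_lin Suc.IH)
  moreover have "((\<lambda>x. f x * g x) has_real_derivative 1 * (f' x * g x) + 1 * (f x * g' x)) (at x)" for x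
    using DERIV_mult[OF f'(1)[of x] g'(1)[of x]] by (simp add: algebra_simps)
  ultimately show ?case by (rule C_k_SucI[rotated])
qed

lemma C_k_affine:
  fixes f :: "real \<Rightarrow> real"
  assumes "C_k k f"
  shows "C_k k (\<lambda>x. f (a * x + b))"
  using assms
proof (induction k arbitrary: f)
  case 0
  then have "continuous_on UNIV f" by simp
  then have "continuous_on UNIV (\<lambda>x. f (a * x + b))"
    by (rule continuous_on_compose2) (auto intro!: continuous_intros)
  then show ?case by simp
next
  case (Suc k)
  obtain f' where f': "\<And>x. (f has_real_derivative f' x) (at x)" "C_k k f'"
    using Suc.prems(1) C_k_SucE by blast
  have "C_k k (\<lambda>x. a * f' (a * x + b) + 0 * f' (a * x + b))"
    by (intro C_k_lin Suc.IH f')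
  moreover have "((\<lambda>x. f (a * x + b)) has_real_derivative (a * f' (a * x + b) + 0 * f' (a * x + b))) (at x)" for x
  proof -
    have "((\<lambda>x. a * x + b) has_real_derivative a) (at x)" by (auto intro!: derivative_eq_intros)
    from DERIV_chain2[OF f'(1) this] show ?thesis by (simp add: mult.commute)
  qed
  ultimately show ?case by (rule C_k_SucI[rotated])
qed

lemma C_k_const: "C_k k (\<lambda>x::real. c::real)"
proof (induction k arbitrary: c)
  case (Suc k) show ?case by (rule C_k_SucI[OF DERIV_const Suc])
qed auto

text \<open>
  The two partial derivatives of a tensor product are again tensor products.
\<close>
lemma C_k_tensor:
  fixes f g :: "real \<Rightarrow> real"
  assumes "C_k k f" "C_k k g"
  shows "C_k k (\<lambda>p. f (fst p) * g (snd p))"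
  using assms
proof (induction k arbitrary: f g)
  case 0
  then have "continuous_on UNIV f" "continuous_on UNIV g" by simp_all
  then have "continuous_on UNIV (\<lambda>p. f (fst p))" "continuous_on UNIV (\<lambda>p. g (snd p))"
    using continuous_on_compose2[of UNIV f UNIV fst] continuous_on_compose2[of UNIV g UNIV snd]
    by (auto simp: continuous_on_fst continuous_on_snd continuous_on_id)
  then show ?case unfolding C_k.simps(1) by (rule continuous_on_mult)
next
  case (Suc k)
  obtain f' where f': "\<And>x. (f has_real_derivative f' x) (at x)" "C_k k f'"
    using Suc.prems(1) C_k_SucE by blast
  obtain g' where g': "\<And>x. (g has_real_derivative g' x) (at x)" "C_k k g'"
    using Suc.prems(2) C_k_SucE by blast
  have d: "((\<lambda>p. f (fst p) * g (snd p)) has_derivative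
      (\<lambda>h. f' (fst p) * fst h * g (snd p) + f (fst p) * (g' (snd p) * snd h))) (at p)" for p :: "real \<times> real"
  proof -
    have 1: "((\<lambda>p. f (fst p)) has_derivative (\<lambda>h. f' (fst p) * fst h)) (at p)"
      by (rule has_derivative_compose[OF has_derivative_fst[OF has_derivative_ident] f'(1)[unfolded has_field_derivative_def]])
    have 2: "((\<lambda>p. g (snd p)) has_derivative (\<lambda>h. g' (snd p) * snd h)) (at p)"
      by (rule has_derivative_compose[OF has_derivative_snd[OF has_derivative_ident] g'(1)[unfolded has_field_derivative_def]])
    show ?thesis using has_derivative_mult[OF 1 2] by (simp add: algebra_simps)
  qed
  have fd: "frechet_derivative (\<lambda>p. f (fst p) * g (snd p)) (at p) =
      (\<lambda>h. f' (fst p) * fst h * g (snd p) + f (fst p) * (g' (snd p) * snd h))" for p :: "real \<times> real"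
    using d by (rule frechet_derivative_at[symmetric])
  have "C_k k (\<lambda>p. f' (fst p) * g (snd p))" "C_k k (\<lambda>p. f (fst p) * g' (snd p))"
    using Suc.prems[THEN C_k_SucD] f' g' by (auto intro!: Suc.IH)
  then have "C_k k (\<lambda>p. frechet_derivative (\<lambda>p. f (fst p) * g (snd p)) (at p) b)"
    if "b \<in> Basis" for b :: "real \<times> real"
    using that by (auto simp: fd Basis_prod_def)
  then show ?case using d unfolding C_k.simps(2) differentiable_def by blast
qed

text \<open>
  The case \<open>n = 0\<close> is the standard smooth function that vanishes on the negative half line. The
  whole family is closed under differentiation up to linear combinations, which turns smoothness
  into a plain induction.
\<close>
definition flat :: "nat \<Rightarrow> real \<Rightarrow> real" where
  "flat n x = (if x > 0 then (1 / x) ^ n * exp (- 1 / x) else 0)"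

lemma flat_tendsto_0: "(flat n \<longlongrightarrow> 0) (at_right 0)"
proof -
  have "((\<lambda>x::real. x ^ n / exp x) \<longlongrightarrow> 0) at_top" by (rule tendsto_power_div_exp_0)
  then have "((\<lambda>x::real. inverse x ^ n / exp (inverse x)) \<longlongrightarrow> 0) (at_right 0)"
    using filterlim_compose filterlim_inverse_at_top_right by blast
  moreover have "eventually (\<lambda>x. inverse x ^ n / exp (inverse x) = flat n x) (at_right 0)"
    unfolding eventually_at_right_field
    by (rule exI[of _ 1]) (auto simp: flat_def exp_minus field_simps)
  ultimately show ?thesis by (rule Lim_transform_eventually)
qed

lemma flat_DERIV:
  "(flat n has_real_derivative (1 * flat (n + 2) x + (- real n) * flat (n + 1) x)) (at x)"
proof -
  consider "x > 0" | "x < 0" | "x = 0" by linarith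
  then show ?thesis
  proof cases
    case 1
    have "((\<lambda>x. (1 / x) ^ n * exp (- 1 / x)) has_real_derivative
        (1 * flat (n + 2) x + (- real n) * flat (n + 1) x)) (at x)"
    proof -
      have d: "((\<lambda>x. 1 / x) has_real_derivative (- ((1 / x) ^ 2))) (at x)"
        using 1 by (auto intro!: derivative_eq_intros simp: power2_eq_square)
      have "((\<lambda>x. (1 / x) ^ n * exp (- (1 / x))) has_real_derivative
          (real n * (1 / x) ^ (n - 1) * (- ((1 / x) ^ 2))) * exp (- (1 / x)) +
          (exp (- (1 / x)) * (- (- ((1 / x) ^ 2)))) * (1 / x) ^ n) (at x)"
        by (intro DERIV_mult DERIV_chain2[OF DERIV_exp] DERIV_minus d)
           (use DERIV_power[OF d, of n] in \<open>simp add: mult_ac\<close>)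
      moreover have "(real n * (1 / x) ^ (n - 1) * (- ((1 / x) ^ 2))) * exp (- (1 / x)) +
          (exp (- (1 / x)) * (- (- ((1 / x) ^ 2)))) * (1 / x) ^ n =
          1 * flat (n + 2) x + (- real n) * flat (n + 1) x"
      proof -
        define y where "y = 1 / x"
        have "flat m x = y ^ m * exp (- y)" for m using 1 by (simp add: flat_def y_def)
        then show ?thesis unfolding y_def[symmetric]
          by (cases n) (simp_all add: algebra_simps power2_eq_square)
      qed
      ultimately show ?thesis by simp
    qed
    then show ?thesis
      by (rule DERIV_cong_ev[THEN iffD1, rotated 3])
         (use 1 eventually_nhds_in_open[of "{0<..}" x] in \<open>auto simp: flat_def elim!: eventually_mono\<close>)
  next
    case 2
    have "((\<lambda>x. 0) has_real_derivative (1 * flat (n + 2) x + (- real n) * flat (n + 1) x)) (at x)"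
      using 2 by (simp add: flat_def)
    then show ?thesis
      by (rule DERIV_cong_ev[THEN iffD1, rotated 3])
         (use 2 eventually_nhds_in_open[of "{..<0}" x] in \<open>auto simp: flat_def elim!: eventually_mono\<close>)
  next
    case 3
    have "((\<lambda>h. flat n h / h) \<longlongrightarrow> 0) (at_right 0)"
    proof (rule Lim_transform_eventually[OF flat_tendsto_0[of "Suc n"]])
      show "\<forall>\<^sub>F x in at_right 0. flat (Suc n) x = flat n x / x"
        unfolding eventually_at_right_field by (rule exI[of _ 1]) (auto simp: flat_def)
    qed
    moreover have "((\<lambda>h. flat n h / h) \<longlongrightarrow> 0) (at_left 0)"
      by (rule tendsto_eventually) (auto simp: flat_def eventually_at_filter)
    ultimately have "((\<lambda>h. flat n h / h) \<longlongrightarrow> 0) (at 0)"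
      by (rule filterlim_split_at[rotated])
    then show ?thesis using 3 by (simp add: flat_def has_field_derivative_iff)
  qed
qed

lemma C_k_flat: "C_k k (flat n)"
proof (induction k arbitrary: n)
  case 0
  have "continuous_on UNIV (flat n)"
    by (rule continuous_at_imp_continuous_on) (use flat_DERIV[of n, THEN DERIV_isCont] in blast)
  then show ?case by simp
next
  case (Suc k)
  show ?case by (rule C_k_SucI[OF flat_DERIV C_k_lin[OF Suc.IH Suc.IH]])
qed

definition bump :: "real \<Rightarrow> real" where
  "bump x = flat 0 (1 - x) * flat 0 (1 + x)"

lemma C_k_bump: "C_k k bump"
proof -
  have "C_k k (\<lambda>x. flat 0 ((-1) * x + 1) * flat 0 (1 * x + 1))"
    by (rule C_k_mult[OF C_k_affine[OF C_k_flat] C_k_affine[OF C_k_flat]])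
  also have "(\<lambda>x. flat 0 ((-1) * x + 1) * flat 0 (1 * x + 1)) = bump"
    by (auto simp: bump_def add.commute)
  finally show ?thesis .
qed

lemma bump_nonneg: "0 \<le> bump x" and bump_le_1: "bump x \<le> 1" and
  bump_pos_iff: "0 < bump x \<longleftrightarrow> \<bar>x\<bar> < 1" and bump_eq_0: "\<bar>x\<bar> \<ge> 1 \<Longrightarrow> bump x = 0"
proof -
  have f: "0 \<le> flat 0 y" "flat 0 y \<le> 1" "0 < flat 0 y \<longleftrightarrow> 0 < y" "y \<le> 0 \<Longrightarrow> flat 0 y = 0" for y
    by (auto simp: flat_def)
  show "0 \<le> bump x" "bump x \<le> 1" unfolding bump_def by (auto intro!: mult_le_one mult_nonneg_nonneg f)
  have "0 < bump x \<longleftrightarrow> flat 0 (1 - x) \<noteq> 0 \<and> flat 0 (1 + x) \<noteq> 0"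
    using f(1)[of "1 - x"] f(1)[of "1 + x"] unfolding bump_def
    by (metis less_eq_real_def mult_eq_0_iff mult_nonneg_nonneg less_numeral_extra(3))
  also have "\<dots> \<longleftrightarrow> \<bar>x\<bar> < 1"
    using f(1,3)[of "1 - x"] f(1,3)[of "1 + x"] by (auto simp: abs_if)
  finally show "0 < bump x \<longleftrightarrow> \<bar>x\<bar> < 1" .
  show "bump x = 0" if "\<bar>x\<bar> \<ge> 1"
    using that f(4)[of "1 - x"] f(4)[of "1 + x"] unfolding bump_def by (cases "x \<ge> 0") auto
qed

text \<open>
  Powers of \<open>1 - bump\<close> tend to \<open>0\<close> exactly where the bump is positive, so these smooth functions
  supported in \<open>[a, b]\<close> converge to the indicator of the open interval without any further
  construction.
\<close>
definition plateau :: "real \<Rightarrow> real \<Rightarrow> nat \<Rightarrow> real \<Rightarrow> real" where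
  "plateau a b n x = 1 - (1 - bump ((2 * x - a - b) / (b - a))) ^ n"

lemma C_k_plateau: "C_k k (plateau a b n)"
proof -
  have B: "C_k k (\<lambda>x. 1 - bump ((2 * x - a - b) / (b - a)))"
  proof -
    have "C_k k (\<lambda>x. (-1) * bump (2 / (b - a) * x + (- a - b) / (b - a)) + 1 * 1)"
      by (rule C_k_lin[OF C_k_affine[OF C_k_bump] C_k_const])
    then show ?thesis by (simp add: diff_divide_distrib add_divide_distrib algebra_simps)
  qed
  have P: "C_k k (\<lambda>x. (1 - bump ((2 * x - a - b) / (b - a))) ^ n)"
  proof (induction n)
    case 0 show ?case using C_k_const[of k 1] by simp
  next
    case (Suc n) show ?case using C_k_mult[OF B Suc] by simp
  qed
  have "C_k k (\<lambda>x. (-1) * (1 - bump ((2 * x - a - b) / (b - a))) ^ n + 1 * 1)"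
    by (rule C_k_lin[OF P C_k_const])
  then show ?thesis by (simp add: plateau_def[abs_def])
qed

lemma plateau_bounds: "0 \<le> plateau a b n x" "plateau a b n x \<le> 1"
  using bump_nonneg bump_le_1 by (auto simp: plateau_def power_le_one)

lemma plateau_inside_iff:
  assumes "a < (b::real)" shows "\<bar>(2 * x - a - b) / (b - a)\<bar> < 1 \<longleftrightarrow> x \<in> {a<..<b}"
proof -
  have "\<bar>(2 * x - a - b) / (b - a)\<bar> < 1 \<longleftrightarrow> \<bar>2 * x - a - b\<bar> < b - a"
    using assms by (simp add: abs_divide)
  also have "\<dots> \<longleftrightarrow> x \<in> {a<..<b}" by (auto simp: abs_if)
  finally show ?thesis .
qed

lemma plateau_outside:
  assumes "a < b" "x \<notin> {a<..<b}" shows "plateau a b n x = 0"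
  using plateau_inside_iff[OF assms(1), of x] assms(2) bump_eq_0[of "(2 * x - a - b) / (b - a)"]
  by (auto simp: plateau_def not_less)

lemma plateau_tendsto:
  assumes "a < b"
  shows "(\<lambda>n. plateau a b n x) \<longlonglongrightarrow> indicator {a<..<b} x"
proof (cases "x \<in> {a<..<b}")
  case True
  define c where "c = 1 - bump ((2 * x - a - b) / (b - a))"
  have "0 < bump ((2 * x - a - b) / (b - a))" "bump ((2 * x - a - b) / (b - a)) \<le> 1"
    using True plateau_inside_iff[OF assms, of x] bump_pos_iff bump_le_1 by auto
  then have "\<bar>c\<bar> < 1" by (auto simp: c_def)
  then have "(\<lambda>n. c ^ n) \<longlonglongrightarrow> 0" by (simp add: LIMSEQ_power_zero)
  from tendsto_diff[OF tendsto_const[of 1] this] show ?thesis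
    using True by (simp add: plateau_def c_def)
qed (use plateau_outside[OF assms] in auto)

definition bump_mass :: real where "bump_mass = integral {-1..1} bump"

lemma bump_cont[continuous_intros]: "continuous_on S f \<Longrightarrow> continuous_on S (\<lambda>x. bump (f x))"
  using C_k_continuous[OF C_k_bump] by (rule continuous_on_compose2) auto

lemma bump_measurable[measurable]: "bump \<in> borel_measurable borel"
  using C_k_continuous[OF C_k_bump] by (rule borel_measurable_continuous_onI)

lemma bump_mass_pos: "bump_mass > 0"
proof -
  have "bump_mass \<ge> 0" unfolding bump_mass_def
    by (intro integral_nonneg integrable_continuous_interval bump_cont continuous_intros)
       (auto simp: bump_nonneg)
  moreover have "bump_mass \<noteq> 0"
  proof
    have bc: "continuous_on {-1..1} bump" by (intro bump_cont continuous_intros)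
    assume "bump_mass = 0"
    then have "(bump has_integral 0) (cbox (-1) 1)"
      using integrable_integral[OF integrable_continuous_interval[of "-1" 1 bump]] bc
      by (simp add: bump_mass_def)
    then have "bump 0 = 0"
      by (rule has_integral_0_cbox_imp_0[rotated 2]) (use bc in \<open>auto simp: bump_nonneg\<close>)
    then show False using bump_pos_iff[of 0] by simp
  qed
  ultimately show ?thesis by simp
qed

text \<open>
  The normalised primitive of the bump rises from \<open>0\<close> to \<open>1\<close> on \<open>[-1, 1]\<close>. Starting the integral
  at \<open>-2\<close>, to the left of the support, keeps \<open>-1\<close> in the interior of the interval on which the
  fundamental theorem of calculus is applied.
\<close>
definition smooth_step :: "real \<Rightarrow> real" where
  "smooth_step x = (if x \<le> -2 then 0 else integral {-2..x} bump / bump_mass)"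

lemma integral_bump_outside: 
  assumes "\<And>x. x \<in> {a..b} \<Longrightarrow> \<bar>x\<bar> \<ge> 1" shows "integral {a..b} bump = 0"
proof -
  have "integral {a..b} bump = integral {a..b} (\<lambda>x. 0)"
    using assms bump_eq_0 by (intro integral_cong) auto
  then show ?thesis by simp
qed

lemma bump_integrable: "bump integrable_on {a..b}"
  by (intro integrable_continuous_interval bump_cont continuous_intros)

lemma smooth_step_left: "x \<le> -1 \<Longrightarrow> smooth_step x = 0"
  by (auto simp: smooth_step_def intro!: integral_bump_outside)

lemma smooth_step_right: 
  assumes "x \<ge> 1" shows "smooth_step x = 1"
proof -
  have "integral {-2..x} bump = integral {-2..-1} bump + integral {-1..x} bump"
    using assms by (intro Henstock_Kurzweil_Integration.integral_combine[symmetric] bump_integrable) auto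
  also have "integral {-1..x} bump = integral {-1..1} bump + integral {1..x} bump"
    using assms by (intro Henstock_Kurzweil_Integration.integral_combine[symmetric] bump_integrable) auto
  also have "integral {-2..-1} bump = 0" by (rule integral_bump_outside) auto
  also have "integral {1..x} bump = 0" by (rule integral_bump_outside) auto
  finally show ?thesis using assms bump_mass_pos by (simp add: smooth_step_def bump_mass_def)
qed

lemma smooth_step_DERIV: "(smooth_step has_real_derivative (1 / bump_mass) * bump x + 0 * bump x) (at x)"
proof (cases "x < -1")
  case True
  have "((\<lambda>x. 0) has_real_derivative (1 / bump_mass) * bump x + 0 * bump x) (at x)"
    using True by (simp add: bump_eq_0)
  then show ?thesis
    by (rule DERIV_cong_ev[THEN iffD1, rotated 3])
       (use True eventually_nhds_in_open[of "{..<-1}" x] smooth_step_left in \<open>auto elim!: eventually_mono\<close>)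
next
  case False
  have "((\<lambda>u. integral {-2..u} bump) has_real_derivative bump x) (at x within {-2..x+1})"
    using False by (intro integral_has_real_derivative bump_cont continuous_intros) auto
  then have "((\<lambda>u. integral {-2..u} bump) has_real_derivative bump x) (at x)"
    using False by (subst (asm) at_within_interior) (auto simp: interior_atLeastAtMost_real)
  then have "((\<lambda>u. integral {-2..u} bump / bump_mass) has_real_derivative (1 / bump_mass) * bump x + 0 * bump x) (at x)"
    using DERIV_cdivide by fastforce
  then show ?thesis
    by (rule DERIV_cong_ev[THEN iffD1, rotated 3])
       (use False eventually_nhds_in_open[of "{-2<..}" x] in \<open>auto simp: smooth_step_def elim!: eventually_mono\<close>)
qed

lemma C_k_smooth_step: "C_k k smooth_step"
proof (cases k)
  case 0
  have "continuous_on UNIV smooth_step"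
    by (rule continuous_at_imp_continuous_on) (use smooth_step_DERIV[THEN DERIV_isCont] in blast)
  then show ?thesis using 0 by simp
next
  case (Suc n)
  show ?thesis unfolding Suc by (rule C_k_SucI[OF smooth_step_DERIV C_k_lin[OF C_k_bump C_k_bump]])
qed

lemma smooth_step_bounds: "0 \<le> smooth_step x" "smooth_step x \<le> 1"
proof -
  have mono: "smooth_step x \<le> smooth_step y" if "x \<le> y" for x y
    using that by (rule DERIV_nonneg_imp_nondecreasing)
      (use smooth_step_DERIV bump_mass_pos bump_nonneg in \<open>force\<close>)
  show "0 \<le> smooth_step x" using mono[of "min x (-1)" x] smooth_step_left[of "min x (-1)"] by simp
  show "smooth_step x \<le> 1" using mono[of x "max x 1"] smooth_step_right[of "max x 1"] by simp
qed

lemma test_function_on_tensor: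
  fixes f g :: "real \<Rightarrow> real"
  assumes "test_function_on S f" "test_function_on T g"
  shows "test_function_on (S \<times> T) (\<lambda>p. f (fst p) * g (snd p))"
proof -
  obtain K L where K: "compact K" "K \<subseteq> S" "\<And>x. x \<notin> K \<Longrightarrow> f x = 0"
    and L: "compact L" "L \<subseteq> T" "\<And>x. x \<notin> L \<Longrightarrow> g x = 0"
    using assms unfolding test_function_on_def by meson
  have "compact (K \<times> L)" "K \<times> L \<subseteq> S \<times> T" using K L by (auto intro: compact_Times)
  moreover have "\<forall>p. p \<notin> K \<times> L \<longrightarrow> f (fst p) * g (snd p) = 0" using K(3) L(3) by auto
  ultimately show ?thesis
    using assms C_k_tensor unfolding test_function_on_def by meson
qed

lemma test_function_plateau:
  assumes "a < b" "{a..b} \<subseteq> S"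
  shows "test_function_on S (plateau a b n)"
proof -
  have "\<forall>x. x \<notin> {a..b} \<longrightarrow> plateau a b n x = 0" using plateau_outside[OF assms(1)] by auto
  then show ?thesis
    using assms(2) C_k_plateau unfolding test_function_on_def by (meson compact_Icc)
qed

lemma compact_support_bounded:
  fixes f :: "'a::euclidean_space \<Rightarrow> real"
  assumes K: "compact K" and f: "continuous_on UNIV f" "\<And>x. x \<notin> K \<Longrightarrow> f x = 0"
  obtains B where "0 \<le> B" "\<And>x. \<bar>f x\<bar> \<le> B"
proof -
  have "bounded (f ` K)"
    by (rule compact_imp_bounded[OF compact_continuous_image[OF continuous_on_subset[OF f(1)] K]]) simp
  then obtain B where B: "\<And>x. x \<in> K \<Longrightarrow> \<bar>f x\<bar> \<le> B" unfolding bounded_iff by auto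
  have "\<bar>f x\<bar> \<le> \<bar>B\<bar>" for x using B[of x] f(2)[of x] by (cases "x \<in> K") auto
  then show thesis using that[of "\<bar>B\<bar>"] by simp
qed

text \<open>
  A derivative vanishes off the closed set \<open>K\<close> together with the function, so \<open>K\<close> and \<open>B\<close> serve
  for both.
\<close>
lemma test_function_derivative:
  fixes \<phi> :: "real \<Rightarrow> real"
  assumes \<phi>: "test_function_on S \<phi>"
  obtains \<phi>' K B where "compact K" "K \<subseteq> S" "\<And>x. (\<phi> has_real_derivative \<phi>' x) (at x)"
    "continuous_on UNIV \<phi>" "continuous_on UNIV \<phi>'" "0 \<le> B" "\<And>x. \<bar>\<phi> x\<bar> \<le> B" "\<And>x. \<bar>\<phi>' x\<bar> \<le> B"
    "\<And>x. x \<notin> K \<Longrightarrow> \<phi> x = 0" "\<And>x. x \<notin> K \<Longrightarrow> \<phi>' x = 0"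
proof -
  obtain K where K: "compact K" "K \<subseteq> S" "\<And>x. x \<notin> K \<Longrightarrow> \<phi> x = 0"
    using \<phi> unfolding test_function_on_def by blast
  have C1: "C_k 1 \<phi>" using \<phi> unfolding test_function_on_def by blast
  obtain \<phi>' where d: "\<And>x. (\<phi> has_real_derivative \<phi>' x) (at x)" "C_k 0 \<phi>'"
    using C1 by (metis C_k_SucE One_nat_def)
  have c: "continuous_on UNIV \<phi>" "continuous_on UNIV \<phi>'"
    using C_k_continuous[OF C1] C_k_continuous[OF d(2)] by auto
  have z: "\<phi>' x = 0" if out: "x \<notin> K" for x
  proof -
    have "open (- K)" using K(1) by (simp add: compact_imp_closed open_Compl)
    then have "eventually (\<lambda>y. \<phi> y = 0) (nhds x)"
      using out K(3) by (auto simp: eventually_nhds intro!: exI[of _ "- K"])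
    then have "((\<lambda>_. 0) has_real_derivative \<phi>' x) (at x)"
      using DERIV_cong_ev[of x x \<phi> "\<lambda>_. 0" "\<phi>' x"] d(1)[of x] by auto
    then show ?thesis using DERIV_unique[OF _ DERIV_const] by blast
  qed
  obtain B1 where B1: "0 \<le> B1" "\<And>x. \<bar>\<phi> x\<bar> \<le> B1" using compact_support_bounded[OF K(1) c(1) K(3)] by blast
  obtain B2 where B2: "0 \<le> B2" "\<And>x. \<bar>\<phi>' x\<bar> \<le> B2" using compact_support_bounded[OF K(1) c(2) z] by blast
  show thesis
  proof (rule that[of K \<phi>' "max B1 B2"])
    show "\<bar>\<phi> x\<bar> \<le> max B1 B2" "\<bar>\<phi>' x\<bar> \<le> max B1 B2" for x using B1(2)[of x] B2(2)[of x] by auto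
  qed (use K d(1) c z B1(1) in auto)
qed

lemma has_bochner_integral_bump: "has_bochner_integral lborel bump bump_mass"
proof -
  have i: "set_integrable lborel {-1..1} bump"
    by (intro borel_integrable_atLeastAtMost' bump_cont continuous_intros)
  have eq: "(\<lambda>x. indicator {-1..1} x *\<^sub>R bump x) = bump"
  proof
    fix x show "indicator {-1..1} x *\<^sub>R bump x = bump x"
      using bump_eq_0[of x] by (cases "x \<in> {-1..1}") (auto simp: abs_if)
  qed
  have "integrable lborel bump" using i unfolding set_integrable_def eq .
  moreover have "(LINT x|lborel. bump x) = bump_mass"
    using set_borel_integral_eq_integral(2)[OF i] unfolding set_lebesgue_integral_def eq
    by (simp add: bump_mass_def)
  ultimately show ?thesis by (simp add: has_bochner_integral_iff)
qed

text \<open>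
  Rescaled bumps of mass one concentrate at \<open>p\<close>. The substitution \<open>t = p + r / k n\<close> fixes the
  bump and moves the scaling into the argument of \<open>D\<close>, where continuity at \<open>p\<close> and dominated
  convergence apply.
\<close>
lemma bump_average_tendsto:
  fixes D :: "real \<Rightarrow> real"
  assumes D: "continuous_on {p - \<delta>..p + \<delta>} D" and \<delta>: "0 < \<delta>"
  defines "k \<equiv> (\<lambda>n. real (Suc n) / \<delta>)"
  shows "integrable lborel (\<lambda>t. D t * (k n / bump_mass * bump (k n * (t - p))))"
    and "(\<lambda>n. LINT t|lborel. D t * (k n / bump_mass * bump (k n * (t - p)))) \<longlonglongrightarrow> D p"
proof -
  \<comment> \<open>Outside \<open>[p - \<delta>, p + \<delta>]\<close> the bumps vanish, so \<open>D\<close> may be cut off there and becomes bounded.\<close>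
  define E where "E t = indicator {p - \<delta>..p + \<delta>} t *\<^sub>R D t" for t
  have Em[measurable]: "E \<in> borel_measurable borel"
    unfolding E_def by (rule borel_measurable_continuous_on_indicator[OF _ D]) simp
  obtain B where B: "\<And>t. t \<in> {p - \<delta>..p + \<delta>} \<Longrightarrow> \<bar>D t\<bar> \<le> B" 
    using compact_imp_bounded[OF compact_continuous_image[OF D compact_Icc]] unfolding bounded_iff
    by (metis image_eqI real_norm_def)
  have B0: "0 \<le> B" using B[of p] \<delta> by force
  have EB: "\<bar>E t\<bar> \<le> B" for t using B[of t] B0 by (auto simp: E_def indicator_def)
  have EBb: "norm (E s * (bump r / bump_mass)) \<le> B * (bump r / bump_mass)" for r s
    unfolding norm_mult using EB[of s] bump_nonneg[of r] bump_mass_pos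
    by (auto simp: abs_divide intro!: mult_right_mono divide_right_mono)
  have k: "k n > 0" "\<delta> * k n \<ge> 1" for n using \<delta> by (auto simp: k_def)
  have DE: "D t * (k n / bump_mass * bump (k n * (t - p))) = E t * (k n / bump_mass * bump (k n * (t - p)))" for t n
  proof (cases "t \<in> {p - \<delta>..p + \<delta>}")
    case False
    then have "\<bar>t - p\<bar> \<ge> \<delta>" by (auto simp: abs_if)
    then have "\<bar>k n * (t - p)\<bar> \<ge> k n * \<delta>" using k(1)[of n] by (simp add: abs_mult)
    then have "bump (k n * (t - p)) = 0" using k(2)[of n] by (intro bump_eq_0) (simp add: mult.commute)
    then show ?thesis by simp
  qed (simp add: E_def)
  have rescaled: "(\<lambda>r. E (p + inverse (k n) * r) * (k n / bump_mass * bump (k n * ((p + inverse (k n) * r) - p))))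
      = (\<lambda>r. k n * (E (p + inverse (k n) * r) * (bump r / bump_mass)))" for n
    using k(1)[of n] by (auto simp: field_simps)
  have int: "integrable lborel (\<lambda>r. E (p + inverse (k n) * r) * (bump r / bump_mass))" for n
  proof (rule Bochner_Integration.integrable_bound)
    show "integrable lborel (\<lambda>r. B * (bump r / bump_mass))"
      using has_bochner_integral_bump by (auto simp: has_bochner_integral_iff)
    show "AE r in lborel. norm (E (p + inverse (k n) * r) * (bump r / bump_mass)) \<le> norm (B * (bump r / bump_mass))"
    proof (rule AE_I2)
      fix r
      have "norm (E (p + inverse (k n) * r) * (bump r / bump_mass)) \<le> B * (bump r / bump_mass)" by (rule EBb)
      then show "norm (E (p + inverse (k n) * r) * (bump r / bump_mass)) \<le> norm (B * (bump r / bump_mass))"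
        by (rule order_trans) (simp only: real_norm_def abs_ge_self)
    qed
  qed measurable
  have "integrable lborel (\<lambda>t. E t * (k n / bump_mass * bump (k n * (t - p))))"
  proof (rule lborel_integrable_real_affine_iff[THEN iffD1])
    show "inverse (k n) \<noteq> 0" using k(1)[of n] by simp
    show "integrable lborel (\<lambda>r. E (p + inverse (k n) * r) * (k n / bump_mass * bump (k n * ((p + inverse (k n) * r) - p))))"
      unfolding rescaled by (intro integrable_mult_right int)
  qed
  then show "integrable lborel (\<lambda>t. D t * (k n / bump_mass * bump (k n * (t - p))))" by (simp only: DE)
  have eq: "(LINT t|lborel. D t * (k n / bump_mass * bump (k n * (t - p)))) =
      (LINT r|lborel. E (p + inverse (k n) * r) * (bump r / bump_mass))" for n
  proof -
    have "(LINT t|lborel. E t * (k n / bump_mass * bump (k n * (t - p)))) =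
      \<bar>inverse (k n)\<bar> *\<^sub>R (LINT r|lborel. E (p + inverse (k n) * r) * (k n / bump_mass * bump (k n * ((p + inverse (k n) * r) - p))))"
      using k(1)[of n] by (intro lborel_integral_real_affine) auto
    also have "\<dots> = (LINT r|lborel. E (p + inverse (k n) * r) * (bump r / bump_mass))"
      unfolding rescaled using k(1)[of n] by simp
    finally show ?thesis by (simp only: DE)
  qed
  have "(\<lambda>n. LINT r|lborel. E (p + inverse (k n) * r) * (bump r / bump_mass)) \<longlonglongrightarrow>
      (LINT r|lborel. D p * (bump r / bump_mass))"
  proof (rule integral_dominated_convergence)
    show "integrable lborel (\<lambda>r. B * (bump r / bump_mass))"
      using has_bochner_integral_bump by (auto simp: has_bochner_integral_iff)
    show "AE r in lborel. norm (E (p + inverse (k n) * r) * (bump r / bump_mass)) \<le> B * (bump r / bump_mass)" for n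
      by (rule AE_I2) (rule EBb)
    have ik: "(\<lambda>n. inverse (k n)) \<longlonglongrightarrow> 0"
    proof -
      have "(\<lambda>n. inverse (real (Suc n)) * \<delta>) \<longlonglongrightarrow> 0 * \<delta>"
        by (intro tendsto_mult_right LIMSEQ_inverse_real_of_nat)
      then show ?thesis by (simp add: k_def field_simps)
    qed
    have "(\<lambda>n. E (p + inverse (k n) * r)) \<longlonglongrightarrow> D p" if "\<bar>r\<bar> < 1" for r
    proof -
      have "(\<lambda>n. p + inverse (k n) * r) \<longlonglongrightarrow> p + 0 * r"
        by (intro tendsto_intros ik)
      moreover have mem: "p + inverse (k n) * r \<in> {p - \<delta>..p + \<delta>}" for n
      proof -
        have "\<bar>inverse (k n) * r\<bar> \<le> inverse (k n) * 1" using k(1)[of n] that by (auto simp: abs_mult)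
        also have "\<dots> \<le> \<delta>" using k[of n] by (simp add: field_simps)
        finally show ?thesis by (auto simp: abs_le_iff)
      qed
      ultimately have "(\<lambda>n. D (p + inverse (k n) * r)) \<longlonglongrightarrow> D p"
        using continuous_on_tendsto_compose[OF D, of "\<lambda>n. p + inverse (k n) * r" p] \<delta> by auto
      then show ?thesis using mem by (simp add: E_def)
    qed
    note lim = this
    show "AE r in lborel. (\<lambda>n. E (p + inverse (k n) * r) * (bump r / bump_mass)) \<longlonglongrightarrow> D p * (bump r / bump_mass)"
    proof (rule AE_I2)
      fix r
      show "(\<lambda>n. E (p + inverse (k n) * r) * (bump r / bump_mass)) \<longlonglongrightarrow> D p * (bump r / bump_mass)"
      proof (cases "\<bar>r\<bar> < 1")
        case True show ?thesis by (rule tendsto_mult_right[OF lim[OF True]])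
      next
        case False
        then have "bump r = 0" by (intro bump_eq_0) simp
        then show ?thesis by simp
      qed
    qed
  qed measurable
  also have "(LINT r|lborel. D p * (bump r / bump_mass)) = D p"
    using has_bochner_integral_bump bump_mass_pos by (simp add: has_bochner_integral_iff)
  finally show "(\<lambda>n. LINT t|lborel. D t * (k n / bump_mass * bump (k n * (t - p)))) \<longlonglongrightarrow> D p"
    by (simp only: eq)
qed

lemma AE_lborel_not_in: "AE t in lborel. t \<noteq> (x::real) \<and> t \<noteq> y"
  using AE_lborel_singleton[of x] AE_lborel_singleton[of y] by eventually_elim auto

text \<open>
  Test with smooth approximations of the indicator of \<open>[x, y]\<close>, namely with the difference of
  two steeper and steeper smooth steps. On the right the integral over \<open>[x, y]\<close> appears in the
  limit; on the left the derivative of the test function consists of two bumps of mass one that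
  pick out \<open>D x\<close> and \<open>D y\<close>.
\<close>
theorem weak_derivative_FTC:
  fixes D g :: "real \<Rightarrow> real"
  assumes S: "open S" "is_interval S"
    and D: "continuous_on S D"
    and g: "\<And>a b. {a..b} \<subseteq> S \<Longrightarrow> set_integrable lborel {a..b} g"
    and weak: "\<And>\<phi>. test_function_on S \<phi> \<Longrightarrow>
      (LINT t|lborel. D t * deriv \<phi> t) = - (LINT t|lborel. g t * \<phi> t)"
    and xy: "x \<in> S" "y \<in> S" "x \<le> y"
  shows "D y - D x = (LINT t:{x..y}|lborel. g t)"
proof -
  obtain d1 d2 where d1: "d1 > 0" "cball x d1 \<subseteq> S" and d2: "d2 > 0" "cball y d2 \<subseteq> S"
    using S(1) xy open_contains_cball by metis
  define \<delta> where "\<delta> = min d1 d2"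
  have \<delta>: "\<delta> > 0" using d1 d2 by (simp add: \<delta>_def)
  have "x - \<delta> \<in> cball x d1" "y + \<delta> \<in> cball y d2" using d1 d2 by (auto simp: \<delta>_def dist_real_def)
  then have "x - \<delta> \<in> S" "y + \<delta> \<in> S" using d1 d2 by auto
  then have sub: "{x - \<delta>..y + \<delta>} \<subseteq> S" using S(2) unfolding is_interval_1 by (meson atLeastAtMost_iff subsetI)
  define k where "k n = real (Suc n) / \<delta>" for n
  have k: "k n > 0" "\<delta> * k n \<ge> 1" for n using \<delta> by (auto simp: k_def)
  define \<psi> where "\<psi> n t = 1 * smooth_step (k n * t + (- k n * x)) + (-1) * smooth_step (k n * t + (- k n * y))" for n t
  have aff: "k n * t + (- k n * p) = k n * (t - p)" for n t p by (simp add: algebra_simps)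
  have supp: "\<psi> n t = 0" if "t \<notin> {x - \<delta>..y + \<delta>}" for n t
  proof (cases "t < x - \<delta>")
    case True
    then have "k n * (t - x) \<le> k n * (- \<delta>)" "k n * (t - y) \<le> k n * (- \<delta>)"
      using k(1)[of n] xy True by (intro mult_left_mono; simp)+
    then show ?thesis using k(2)[of n] unfolding \<psi>_def aff by (simp add: smooth_step_left mult.commute)
  next
    case False
    then have "t > y + \<delta>" using that by auto
    then have "k n * (t - x) \<ge> k n * \<delta>" "k n * (t - y) \<ge> k n * \<delta>"
      using k(1)[of n] xy by (auto intro!: mult_left_mono)
    then show ?thesis using k(2)[of n] unfolding \<psi>_def aff by (simp add: smooth_step_right mult.commute)
  qed
  have test: "test_function_on S (\<psi> n)" for n
    unfolding test_function_on_def
  proof (intro conjI allI exI[of _ "{x - \<delta>..y + \<delta>}"] impI)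
    show "C_k m (\<psi> n)" for m
      unfolding \<psi>_def by (rule C_k_lin[OF C_k_affine[OF C_k_smooth_step] C_k_affine[OF C_k_smooth_step]])
  qed (use sub supp in auto)
  have ds: "((\<lambda>t. smooth_step (k n * t + (- k n * p))) has_real_derivative k n / bump_mass * bump (k n * (t - p))) (at t)" for n t p
  proof -
    have "((\<lambda>t. k n * t + (- k n * p)) has_real_derivative k n) (at t)" by (auto intro!: derivative_eq_intros)
    from DERIV_chain2[OF smooth_step_DERIV this] show ?thesis unfolding aff by (simp add: mult_ac)
  qed
  have d\<psi>: "deriv (\<psi> n) t = k n / bump_mass * bump (k n * (t - x)) - k n / bump_mass * bump (k n * (t - y))" for n t
    using DERIV_add[OF DERIV_cmult[OF ds[of n x t], of 1] DERIV_cmult[OF ds[of n y t], of "-1"]]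
    unfolding \<psi>_def by (intro DERIV_imp_deriv) simp
  have Dx: "continuous_on {x - \<delta>..x + \<delta>} D" "continuous_on {y - \<delta>..y + \<delta>} D"
    using sub xy by (auto intro!: continuous_on_subset[OF D])
  have lhs: "(LINT t|lborel. D t * deriv (\<psi> n) t) =
      (LINT t|lborel. D t * (k n / bump_mass * bump (k n * (t - x)))) -
      (LINT t|lborel. D t * (k n / bump_mass * bump (k n * (t - y))))" for n
    unfolding d\<psi> right_diff_distrib[of "D _" "k n / bump_mass * bump _"]
    by (intro Bochner_Integration.integral_diff bump_average_tendsto(1)[OF _ \<delta>, folded k_def] Dx)
  have "(\<lambda>n. LINT t|lborel. D t * deriv (\<psi> n) t) \<longlonglongrightarrow> D x - D y"
    unfolding lhs
    by (intro tendsto_diff bump_average_tendsto(2)[OF _ \<delta>, folded k_def] Dx)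
  moreover have "(\<lambda>n. - (LINT t|lborel. g t * \<psi> n t)) \<longlonglongrightarrow> - (LINT t|lborel. indicator {x..y} t *\<^sub>R g t)"
  proof (intro tendsto_minus)
    define w where "w t = indicator {x - \<delta>..y + \<delta>} t *\<^sub>R g t" for t
    have w: "integrable lborel w" using g[OF sub] unfolding set_integrable_def w_def .
    have [measurable]: "w \<in> borel_measurable borel" using borel_measurable_integrable[OF w] by simp
    have gw: "g t * \<psi> n t = w t * \<psi> n t" for t n using supp[of t n] by (auto simp: w_def indicator_def)
    have [measurable]: "\<psi> n \<in> borel_measurable borel" for n
      using test[of n] C_k_continuous[of 0 "\<psi> n"] unfolding test_function_on_def
      by (intro borel_measurable_continuous_onI) blast
    have w2: "indicator {x..y} t *\<^sub>R g t = w t * indicator {x..y} t" for t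
      using \<delta> by (auto simp: w_def indicator_def)
    have bd: "\<bar>\<psi> n t\<bar> \<le> 1" for n t
      using smooth_step_bounds[of "k n * t + (- k n * x)"] smooth_step_bounds[of "k n * t + (- k n * y)"]
      unfolding \<psi>_def by linarith
    have lim: "(\<lambda>n. smooth_step (k n * t + (- k n * p))) \<longlonglongrightarrow> (if t < p then 0 else 1)" if "t \<noteq> p" for t p
    proof -
      obtain N :: nat where N: "real N > \<delta> / \<bar>t - p\<bar>" using reals_Archimedean2 by blast
      have big: "k n * \<bar>t - p\<bar> \<ge> 1" if "n \<ge> N" for n
      proof -
        have "\<delta> / \<bar>t - p\<bar> \<le> real (Suc n)" using N that by linarith
        then show ?thesis using \<open>t \<noteq> p\<close> \<delta> by (simp add: k_def field_simps)
      qed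
      have "eventually (\<lambda>n. smooth_step (k n * t + (- k n * p)) = (if t < p then 0 else 1)) sequentially"
        using eventually_ge_at_top[of N]
      proof eventually_elim
        case (elim n)
        show ?case unfolding aff
        proof (cases "t < p")
          case True
          then have "k n * (t - p) \<le> -1" using big[OF elim] by (simp add: algebra_simps)
          then show "smooth_step (k n * (t - p)) = (if t < p then 0 else 1)" using True by (simp add: smooth_step_left)
        next
          case False
          then have "k n * (t - p) \<ge> 1" using big[OF elim] by (simp add: algebra_simps)
          then show "smooth_step (k n * (t - p)) = (if t < p then 0 else 1)" using False by (simp add: smooth_step_right)
        qed
      qed
      then show ?thesis by (rule tendsto_eventually)
    qed
    show "(\<lambda>n. LINT t|lborel. g t * \<psi> n t) \<longlonglongrightarrow> (LINT t|lborel. indicator {x..y} t *\<^sub>R g t)"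
      unfolding gw w2
    proof (rule integral_dominated_convergence)
      show "integrable lborel (\<lambda>t. norm (w t))" using w by simp
      show "AE t in lborel. norm (w t * \<psi> n t) \<le> norm (w t)" for n
        using bd by (intro AE_I2) (auto simp: abs_mult mult_left_le)
      show "AE t in lborel. (\<lambda>n. w t * \<psi> n t) \<longlonglongrightarrow> w t * indicator {x..y} t"
        using AE_lborel_not_in[of x y]
      proof eventually_elim
        case (elim t)
        have "(\<lambda>n. \<psi> n t) \<longlonglongrightarrow> 1 * (if t < x then 0 else 1) + (-1) * (if t < y then 0 else 1)"
          unfolding \<psi>_def using elim by (intro tendsto_intros lim) auto
        moreover have "1 * (if t < x then 0 else 1) + (-1) * (if t < y then 0 else 1) = (indicator {x..y} t :: real)"
          using elim xy by (auto simp: indicator_def)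
        ultimately show ?case by (metis tendsto_mult_left)
      qed
    qed measurable
  qed
  ultimately have "D x - D y = - (LINT t|lborel. indicator {x..y} t *\<^sub>R g t)"
    unfolding weak[OF test] by (rule LIMSEQ_unique)
  then show ?thesis by (simp add: set_lebesgue_integral_def)
qed

section \<open>Scalar differential equations without uniqueness\<close>

text \<open>
  At the initial time \<open>s\<close> the derivative is one-sided, and nothing is said about earlier times.
\<close>
definition solution_from :: "real \<Rightarrow> (real \<Rightarrow> real \<Rightarrow> real) \<Rightarrow> (real \<Rightarrow> real) \<Rightarrow> bool" where
  "solution_from s f z \<longleftrightarrow> (\<forall>t\<ge>s. (z has_real_derivative f t (z t)) (at t within {s..}))"

lemma solution_fromD:
  "solution_from s f z \<Longrightarrow> s \<le> t \<Longrightarrow> (z has_real_derivative f t (z t)) (at t within {s..})"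
  by (simp add: solution_from_def)

lemma solution_from_continuous: "solution_from s f z \<Longrightarrow> continuous_on {s..} z"
  unfolding solution_from_def continuous_on_eq_continuous_within
  by (meson atLeast_iff DERIV_continuous)

lemma solution_from_later:
  assumes "solution_from s f z" "s \<le> s'" shows "solution_from s' f z"
  using assms unfolding solution_from_def
  by (meson DERIV_subset atLeast_subset_iff order_trans)

lemma solution_from_increment:
  assumes z: "solution_from s f z" and st: "s \<le> a" "a \<le> b"
    and c: "\<And>r. a \<le> r \<Longrightarrow> r \<le> b \<Longrightarrow> \<bar>f r (z r) - c\<bar> \<le> e"
  shows "\<bar>z b - z a - c * (b - a)\<bar> \<le> e * (b - a)"
proof -
  have "norm ((z b - c * b) - (z a - c * a)) \<le> e * norm (b - a)"
  proof (rule field_differentiable_bound[where S="{a..b}" and f'="\<lambda>r. f r (z r) - c"])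
    fix r assume r: "r \<in> {a..b}"
    have "(z has_real_derivative f r (z r)) (at r within {a..b})"
      using solution_fromD[OF z, of r] r st by (auto intro: DERIV_subset)
    then show "((\<lambda>r. z r - c * r) has_real_derivative f r (z r) - c) (at r within {a..b})"
      by (auto intro!: derivative_eq_intros)
    show "norm (f r (z r) - c) \<le> e" using c r by auto
  qed (use st in auto)
  then show ?thesis using st by (simp add: algebra_simps)
qed

lemma solution_from_Lipschitz:
  assumes z: "solution_from s f z" and ab: "s \<le> a" "s \<le> b"
    and M: "\<And>t x. s \<le> t \<Longrightarrow> \<bar>f t x\<bar> \<le> M"
  shows "\<bar>z b - z a\<bar> \<le> M * \<bar>b - a\<bar>"
  using solution_from_increment[OF z, of a b 0 M] solution_from_increment[OF z, of b a 0 M] ab M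
  by (cases "a \<le> b") (auto simp: abs_minus_commute)

text \<open>
  At the last time up to which \<open>y \<le> w\<close> the two functions agree, and there \<open>y' < f t (y t) = w'\<close>;
  so \<open>y\<close> stays below \<open>w\<close> a little longer. The strict inequality takes the place of uniqueness.
\<close>
lemma strict_subsolution_le:
  assumes y: "\<And>t. s \<le> t \<Longrightarrow> (y has_real_derivative y' t) (at t within {s..})"
    and less: "\<And>t. s \<le> t \<Longrightarrow> y' t < f t (y t)"
    and w: "solution_from s f w" and init: "y s \<le> w s" and t: "s \<le> t"
  shows "y t \<le> w t"
proof (rule ccontr)
  assume neg: "\<not> y t \<le> w t"
  have cy: "continuous_on {s..} y"
    unfolding continuous_on_eq_continuous_within using y by (meson atLeast_iff DERIV_continuous)
  have cw: "continuous_on {s..} w" using solution_from_continuous[OF w] .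
  define S where "S = {r \<in> {s..t}. y r \<le> w r}"
  have "closed S" unfolding S_def
    by (intro continuous_on_closed_Collect_le continuous_on_subset[OF cy] continuous_on_subset[OF cw]) auto
  then have "compact S" unfolding S_def
    by (metis (no_types, lifting) bounded_closed_interval bounded_subset compact_eq_bounded_closed mem_Collect_eq subsetI)
  moreover have "S \<noteq> {}" using init t by (auto simp: S_def)
  ultimately obtain r where r: "r \<in> S" "\<And>q. q \<in> S \<Longrightarrow> q \<le> r"
    using compact_attains_sup by meson
  have rt: "s \<le> r" "r < t" "y r \<le> w r" using r(1) neg by (auto simp: S_def less_le)
  have above: "y q > w q" if "r < q" "q \<le> t" for q
    using r(2)[of q] that rt by (fastforce simp: S_def)
  have "y r = w r"
  proof -
    have "((\<lambda>q. y q - w q) \<longlongrightarrow> y r - w r) (at r within {s..})"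
      using cy cw rt unfolding continuous_on_def by (intro tendsto_diff) auto
    then have "((\<lambda>q. y q - w q) \<longlongrightarrow> y r - w r) (at_right r)"
      by (rule tendsto_within_subset) (use rt in auto)
    moreover have "eventually (\<lambda>q. 0 \<le> y q - w q) (at_right r)"
      unfolding eventually_at_right[OF rt(2)] using above rt by (intro exI[of _ t]) force
    ultimately have "0 \<le> y r - w r"
      by (rule tendsto_lowerbound) simp
    then show ?thesis using rt by simp
  qed
  have "((\<lambda>q. y q - w q) has_real_derivative y' r - f r (w r)) (at r within {s..})"
    by (intro DERIV_diff y solution_fromD[OF w] rt)
  moreover have "y' r - f r (w r) < 0" using less[OF rt(1)] \<open>y r = w r\<close> by simp
  ultimately obtain d where d: "d > 0" "\<And>h. h > 0 \<Longrightarrow> r + h \<in> {s..} \<Longrightarrow> h < d \<Longrightarrow> y r - w r > y (r + h) - w (r + h)"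
    using has_real_derivative_neg_dec_right by blast
  define h where "h = min (d/2) (t - r)"
  have "h > 0" "h < d" "r + h \<le> t" using d rt by (auto simp: h_def)
  then have "y (r + h) - w (r + h) < 0" using d(2)[of h] rt \<open>y r = w r\<close> by auto
  with above[of "r + h"] \<open>h > 0\<close> \<open>r + h \<le> t\<close> show False by auto
qed

text \<open>
  Where the two solutions meet they have the same derivative \<open>f t (z t)\<close>, and so does their
  maximum.
\<close>
lemma solution_from_max:
  assumes 1: "solution_from s f z1" and 2: "solution_from s f z2"
  shows "solution_from s f (\<lambda>t. max (z1 t) (z2 t))"
proof -
  have strict: "((\<lambda>t. max (a t) (b t)) has_real_derivative f t (max (a t) (b t))) (at t within {s..})"
    if a: "solution_from s f a" and b: "solution_from s f b" and t: "s \<le> t" and less: "a t < b t" for a b t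
  proof -
    have "((\<lambda>r. b r - a r) \<longlongrightarrow> b t - a t) (at t within {s..})"
      using solution_from_continuous[OF a] solution_from_continuous[OF b] t
      unfolding continuous_on_def by (intro tendsto_diff) auto
    then have "eventually (\<lambda>r. b r - a r > 0) (at t within {s..})"
      using less by (intro order_tendstoD) auto
    then obtain d where d: "d > 0" "\<And>r. r \<in> {s..} \<Longrightarrow> r \<noteq> t \<Longrightarrow> dist r t < d \<Longrightarrow> b r - a r > 0"
      by (auto simp: eventually_at)
    have "(b has_real_derivative f t (b t)) (at t within {s..})" using solution_fromD[OF b t] .
    then have "((\<lambda>t. max (a t) (b t)) has_real_derivative f t (b t)) (at t within {s..})"
      by (rule has_field_derivative_transform_within[OF _ d(1)]) (use t d less in \<open>force+\<close>)
    then show ?thesis using less by (simp add: max_def)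
  qed
  show ?thesis unfolding solution_from_def
  proof (intro allI impI)
    fix t assume t: "s \<le> t"
    consider "z1 t < z2 t" | "z2 t < z1 t" | "z1 t = z2 t" by linarith
    then show "((\<lambda>t. max (z1 t) (z2 t)) has_real_derivative f t (max (z1 t) (z2 t))) (at t within {s..})"
    proof cases
      case 1 then show ?thesis using strict[OF assms t] by blast
    next
      case 2 then show ?thesis using strict[OF assms(2,1) t] by (simp add: max.commute)
    next
      case 3
      define c where "c = f t (z1 t)"
      have d1: "(z1 has_derivative (*) c) (at t within {s..})" and d2: "(z2 has_derivative (*) c) (at t within {s..})"
        using solution_fromD[OF 1 t] solution_fromD[OF 2 t] 3 by (auto simp: has_field_derivative_def c_def)
      have "((\<lambda>t. max (z1 t) (z2 t)) has_derivative (*) c) (at t within {s..})"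
        unfolding has_derivative_within_alt
      proof (intro conjI allI impI)
        show "bounded_linear ((*) c)" by (rule bounded_linear_mult_right)
        fix e :: real assume "e > 0"
        obtain e1 where e1: "e1 > 0" "\<forall>y\<in>{s..}. norm (y - t) < e1 \<longrightarrow> norm (z1 y - z1 t - c * (y - t)) \<le> e * norm (y - t)"
          using d1[unfolded has_derivative_within_alt] \<open>e > 0\<close> by blast
        obtain e2 where e2: "e2 > 0" "\<forall>y\<in>{s..}. norm (y - t) < e2 \<longrightarrow> norm (z2 y - z2 t - c * (y - t)) \<le> e * norm (y - t)"
          using d2[unfolded has_derivative_within_alt] \<open>e > 0\<close> by blast
        show "\<exists>d>0. \<forall>y\<in>{s..}. norm (y - t) < d \<longrightarrow>
            norm (max (z1 y) (z2 y) - max (z1 t) (z2 t) - c * (y - t)) \<le> e * norm (y - t)"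
        proof (intro exI[of _ "min e1 e2"] conjI ballI impI)
          fix y assume y: "y \<in> {s..}" "norm (y - t) < min e1 e2"
          show "norm (max (z1 y) (z2 y) - max (z1 t) (z2 t) - c * (y - t)) \<le> e * norm (y - t)"
          proof -
            have "norm (z1 y - z1 t - c * (y - t)) \<le> e * norm (y - t)" "norm (z2 y - z2 t - c * (y - t)) \<le> e * norm (y - t)"
              using e1(2) e2(2) y by auto
            then show ?thesis using 3 by (cases "z1 y \<le> z2 y") (simp_all only: max.absorb1 max.absorb2 max.idem linear)
          qed
        qed (use e1 e2 in auto)
      qed
      then show ?thesis using 3 by (simp add: has_field_derivative_def c_def)
    qed
  qed
qed

lemma solution_from_min:
  assumes 1: "solution_from s f z1" and 2: "solution_from s f z2"
  shows "solution_from s f (\<lambda>t. min (z1 t) (z2 t))"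
  unfolding solution_from_def
proof (intro allI impI)
  fix t assume t: "s \<le> t"
  have "((\<lambda>t. z1 t + z2 t - max (z1 t) (z2 t)) has_real_derivative
      f t (z1 t) + f t (z2 t) - f t (max (z1 t) (z2 t))) (at t within {s..})"
    by (intro DERIV_diff DERIV_add solution_fromD[OF 1 t] solution_fromD[OF 2 t]
        solution_fromD[OF solution_from_max[OF 1 2] t])
  moreover have "(\<lambda>t. z1 t + z2 t - max (z1 t) (z2 t)) = (\<lambda>t. min (z1 t) (z2 t))"
    by (auto simp: max_def min_def)
  moreover have "f t (z1 t) + f t (z2 t) - f t (max (z1 t) (z2 t)) = f t (min (z1 t) (z2 t))"
    by (auto simp: max_def min_def)
  ultimately show "((\<lambda>t. min (z1 t) (z2 t)) has_real_derivative f t (min (z1 t) (z2 t))) (at t within {s..})"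
    by simp
qed

text \<open>
  The compactness argument behind all existence results. Hypothesis \<open>app\<close> is the equation up to
  an error \<open>h n\<close>: if \<open>f\<close> is within \<open>e\<close> of \<open>c\<close> on the part of the plane that \<open>z n\<close> can reach from
  time \<open>s\<close> to time \<open>t\<close>, then \<open>z n\<close> has slope \<open>c\<close> there up to \<open>e\<close> and \<open>h n\<close>. Both Euler step
  functions and exact solutions of perturbed equations satisfy it. The step functions are not
  continuous, which is why the Lipschitz bound, too, has an error term. A diagonal subsequence
  converges at all rational times, hence at all times by the Lipschitz bound.
\<close>
lemma approximate_solutions_compact:
  fixes z :: "nat \<Rightarrow> real \<Rightarrow> real"
  assumes f: "continuous_on ({0..} \<times> UNIV) (\<lambda>(t, x). f t x)"
    and M: "0 \<le> M"
    and h: "h \<longlonglongrightarrow> 0" "\<And>n. 0 \<le> h n"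
    and init: "\<And>n. z n 0 = z0"
    and lip: "\<And>n s t. 0 \<le> s \<Longrightarrow> s \<le> t \<Longrightarrow> \<bar>z n t - z n s\<bar> \<le> M * (t - s) + h n"
    and app: "\<And>n s t c e. \<lbrakk>0 \<le> s; s \<le> t; t - s \<le> 1; 0 \<le> e; e \<le> 1;
        \<And>r x. 0 \<le> r \<Longrightarrow> \<bar>r - s\<bar> \<le> (t - s) + h n \<Longrightarrow> \<bar>x - z n s\<bar> \<le> M * (t - s) + h n \<Longrightarrow> \<bar>f r x - c\<bar> \<le> e\<rbrakk>
        \<Longrightarrow> \<bar>z n t - z n s - c * (t - s)\<bar> \<le> e * (t - s) + h n"
  obtains k \<zeta> where "strict_mono (k :: nat \<Rightarrow> nat)" "\<zeta> 0 = z0" "solution_from 0 f \<zeta>"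
    "\<And>t. 0 \<le> t \<Longrightarrow> (\<lambda>n. z (k n) t) \<longlonglongrightarrow> \<zeta> t"
proof -
  obtain K where "\<forall>n. norm (h n) \<le> K"
    using convergent_imp_Bseq[OF convergentI[OF h(1)]] unfolding Bseq_def by blast
  then have H: "h n \<le> K" for n by (metis abs_ge_self order_trans real_norm_def)
  have bd: "\<exists>B. \<forall>n. norm (z n t) \<le> B" if "t \<in> {0..} \<inter> \<rat>" for t
  proof (intro exI[of _ "\<bar>z0\<bar> + M * t + K"] allI)
    fix n show "norm (z n t) \<le> \<bar>z0\<bar> + M * t + K"
      using lip[of 0 t n] that init[of n] H[of n] unfolding real_norm_def by simp
  qed
  obtain k where k: "strict_mono (k :: nat \<Rightarrow> nat)"
    and kconv: "\<And>t. t \<in> {0..} \<inter> \<rat> \<Longrightarrow> \<exists>l. (\<lambda>n. z (k n) t) \<longlonglongrightarrow> l"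
  proof -
    \<comment> \<open>The subsequence principle asks for one bound at all points, hence the weights.\<close>
    obtain B where B: "\<And>t n. t \<in> {0..} \<inter> \<rat> \<Longrightarrow> \<bar>z n t\<bar> \<le> B t"
      using bd unfolding real_norm_def by metis
    define w where "w t = \<bar>B t\<bar> + 1" for t
    have w: "w t > 0" for t by (simp add: w_def)
    obtain k where k: "strict_mono (k :: nat \<Rightarrow> nat)"
      and kconv: "\<And>t. t \<in> {0..} \<inter> \<rat> \<Longrightarrow> \<exists>l. (\<lambda>n. z (k n) t / w t) \<longlonglongrightarrow> l"
    proof (rule function_convergent_subsequence[of "{0..} \<inter> \<rat>" "\<lambda>n t. z n t / w t" 1])
      show "countable ({0..} \<inter> \<rat> :: real set)" by (rule countable_subset[OF _ countable_rat]) auto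
      fix n and t :: real assume "t \<in> {0..} \<inter> \<rat>"
      then have "\<bar>z n t\<bar> \<le> w t" using B[of t n] by (simp add: w_def)
      then show "norm (z n t / w t) \<le> 1" using w[of t] by (simp add: abs_divide)
    qed blast
    have "\<exists>l. (\<lambda>n. z (k n) t) \<longlonglongrightarrow> l" if t: "t \<in> {0..} \<inter> \<rat>" for t
    proof -
      obtain l where l: "(\<lambda>n. z (k n) t / w t) \<longlonglongrightarrow> l" using kconv[OF t] by blast
      have "(\<lambda>n. w t * (z (k n) t / w t)) \<longlonglongrightarrow> w t * l" by (intro tendsto_mult_left l)
      then show ?thesis using w[of t] by (auto simp: field_simps)
    qed
    with k that show thesis by blast
  qed
  have hk: "(\<lambda>n. h (k n)) \<longlonglongrightarrow> 0" using LIMSEQ_subseq_LIMSEQ[OF h(1) k] by (simp add: o_def)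
  have lip': "\<bar>z n t - z n s\<bar> \<le> M * \<bar>t - s\<bar> + h n" if "0 \<le> s" "0 \<le> t" for s t n
    using lip[of s t n] lip[of t s n] that by (cases "s \<le> t") (auto simp: abs_minus_commute)
  have conv: "convergent (\<lambda>n. z (k n) t)" if t: "0 \<le> t" for t
    unfolding Cauchy_convergent_iff[symmetric]
  proof (rule metric_CauchyI)
    fix e :: real assume e: "e > 0"
    define d where "d = e / (8 * (M + 1))"
    have d: "d > 0" "M * d \<le> e / 8"
      using e M by (auto simp: d_def field_simps)
    obtain q where q: "q \<in> \<rat>" "t < q" "q < t + d"
      using Rats_dense_in_real[of t "t + d"] d by auto
    obtain l where "(\<lambda>n. z (k n) q) \<longlonglongrightarrow> l" using kconv[of q] q t by auto
    then have "Cauchy (\<lambda>n. z (k n) q)" by (rule LIMSEQ_imp_Cauchy)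
    then obtain N1 where N1: "\<And>m n. m \<ge> N1 \<Longrightarrow> n \<ge> N1 \<Longrightarrow> dist (z (k m) q) (z (k n) q) < e / 4"
      using e unfolding Cauchy_def by (meson divide_pos_pos zero_less_numeral)
    have "eventually (\<lambda>n. h (k n) < e / 8) sequentially"
      using order_tendstoD(2)[OF hk, of "e / 8"] e by simp
    then obtain N2 where N2: "\<And>n. n \<ge> N2 \<Longrightarrow> h (k n) < e / 8" by (auto simp: eventually_sequentially)
    have near: "\<bar>z (k n) t - z (k n) q\<bar> < e / 4" if "n \<ge> N2" for n
    proof -
      have "\<bar>z (k n) t - z (k n) q\<bar> \<le> M * \<bar>t - q\<bar> + h (k n)" using lip'[of q t "k n"] t q by simp
      also have "M * \<bar>t - q\<bar> \<le> M * d" using q M by (intro mult_left_mono) auto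
      finally show ?thesis using N2[OF that] d by linarith
    qed
    show "\<exists>N. \<forall>m\<ge>N. \<forall>n\<ge>N. dist (z (k m) t) (z (k n) t) < e"
    proof (intro exI[of _ "max N1 N2"] allI impI)
      fix m n assume mn: "m \<ge> max N1 N2" "n \<ge> max N1 N2"
      have "\<bar>z (k m) q - z (k n) q\<bar> < e / 4" using N1[of m n] mn by (simp add: dist_real_def)
      then show "dist (z (k m) t) (z (k n) t) < e"
      proof -
        have "\<bar>z (k m) t - z (k m) q\<bar> < e / 4" "\<bar>z (k n) t - z (k n) q\<bar> < e / 4"
          using near[of m] near[of n] mn by auto
        then show ?thesis using \<open>\<bar>z (k m) q - z (k n) q\<bar> < e / 4\<close> unfolding dist_real_def by linarith
      qed
    qed
  qed
  define \<zeta> where "\<zeta> t = lim (\<lambda>n. z (k n) t)" for t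
  have lim: "(\<lambda>n. z (k n) t) \<longlonglongrightarrow> \<zeta> t" if "0 \<le> t" for t
    using conv[OF that] by (simp add: \<zeta>_def convergent_LIMSEQ_iff)
  have "\<zeta> 0 = z0" using lim[of 0] by (simp add: init LIMSEQ_const_iff)
  moreover have "solution_from 0 f \<zeta>"
    unfolding solution_from_def has_field_derivative_def
  proof (intro allI impI)
    fix t assume t: "(0::real) \<le> t"
    define c where "c = f t (\<zeta> t)"
    show "(\<zeta> has_derivative (*) (f t (\<zeta> t))) (at t within {0..})"
      unfolding has_derivative_within_alt
    proof (intro conjI allI impI)
      show "bounded_linear ((*) (f t (\<zeta> t)))" by (rule bounded_linear_mult_right)
      fix e0 :: real assume e0: "e0 > 0"
      define e where "e = min e0 1"
      have e: "e > 0" "e \<le> 1" "e \<le> e0" using e0 by (auto simp: e_def)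
      obtain d where d: "d > 0" and
        dd: "\<And>p. p \<in> {0..} \<times> UNIV \<Longrightarrow> dist p (t, \<zeta> t) < d \<Longrightarrow> dist (case p of (t, x) \<Rightarrow> f t x) (f t (\<zeta> t)) < e"
        using f e(1) t unfolding continuous_on_iff
        by (metis (no_types, lifting) UNIV_I atLeast_iff case_prod_conv mem_Sigma_iff)
      have fc: "\<bar>f r x - c\<bar> \<le> e" if "0 \<le> r" "\<bar>r - t\<bar> < d / 2" "\<bar>x - \<zeta> t\<bar> < d / 2" for r x
      proof -
        have "dist (r, x) (t, \<zeta> t) \<le> \<bar>r - t\<bar> + \<bar>x - \<zeta> t\<bar>"
          using sqrt_sum_squares_le_sum_abs[of "r - t" "x - \<zeta> t"] by (simp add: dist_Pair_Pair dist_real_def)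
        then have "dist (r, x) (t, \<zeta> t) < d" using that by linarith
        then show ?thesis using dd[of "(r, x)"] that by (simp add: dist_real_def c_def less_imp_le)
      qed
      define \<delta> where "\<delta> = min 1 (d / (8 * (M + 1)))"
      have \<delta>: "\<delta> > 0" "\<delta> \<le> 1" "M * \<delta> \<le> d / 8" "\<delta> \<le> d / 8"
      proof -
        have "d / (8 * (M + 1)) > 0" using d M by simp
        then show "\<delta> > 0" "\<delta> \<le> 1" by (auto simp: \<delta>_def)
        have "M * \<delta> \<le> M * (d / (8 * (M + 1)))" using M by (intro mult_left_mono) (auto simp: \<delta>_def)
        also have "\<dots> \<le> d / 8" using d M by (simp add: field_simps)
        finally show "M * \<delta> \<le> d / 8" .
        have "\<delta> \<le> d / (8 * (M + 1))" by (simp add: \<delta>_def)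
        also have "\<dots> \<le> d / 8" using d M by (simp add: field_simps)
        finally show "\<delta> \<le> d / 8" .
      qed
      show "\<exists>da>0. \<forall>y\<in>{0..}. norm (y - t) < da \<longrightarrow>
          norm (\<zeta> y - \<zeta> t - f t (\<zeta> t) * (y - t)) \<le> e0 * norm (y - t)"
      proof (intro exI[of _ \<delta>] conjI ballI impI \<delta>)
        fix y assume y: "y \<in> {(0::real)..}" "norm (y - t) < \<delta>"
        define a b where "a = min t y" and "b = max t y"
        have ab: "0 \<le> a" "a \<le> b" "b - a = \<bar>y - t\<bar>" "b - a < \<delta>" "\<bar>a - t\<bar> < \<delta>" "0 \<le> b"
          using y t by (auto simp: a_def b_def)
        have ev1: "eventually (\<lambda>n. h (k n) < d / 16) sequentially"
          using order_tendstoD(2)[OF hk, of "d / 16"] d by simp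
        have ev2: "eventually (\<lambda>n. \<bar>z (k n) t - \<zeta> t\<bar> < d / 16) sequentially"
          using tendstoD[OF lim[OF t], of "d / 16"] d by (simp add: dist_real_def)
        have ev: "eventually (\<lambda>n. \<bar>z (k n) b - z (k n) a - c * (b - a)\<bar> \<le> e * (b - a) + h (k n)) sequentially"
          using ev1 ev2
        proof eventually_elim
          case (elim n)
          show ?case
          proof (rule app)
            fix r x assume r: "0 \<le> r" "\<bar>r - a\<bar> \<le> b - a + h (k n)" and x: "\<bar>x - z (k n) a\<bar> \<le> M * (b - a) + h (k n)"
            have "M * (b - a) \<le> M * \<delta>" using ab M by (intro mult_left_mono) auto
            moreover have "M * \<bar>a - t\<bar> \<le> M * \<delta>" using ab M by (intro mult_left_mono) auto
            moreover have "\<bar>z (k n) a - z (k n) t\<bar> \<le> M * \<bar>a - t\<bar> + h (k n)" using lip' ab t by simp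
            ultimately have "\<bar>x - \<zeta> t\<bar> < d / 2" using x elim \<delta> by linarith
            moreover have "\<bar>r - t\<bar> < d / 2" using r ab elim \<delta> by linarith
            ultimately show "\<bar>f r x - c\<bar> \<le> e" using fc r by blast
          qed (use ab \<delta> e in auto)
        qed
        have "\<bar>\<zeta> b - \<zeta> a - c * (b - a)\<bar> \<le> e * (b - a) + 0"
        proof (rule tendsto_le[OF _ _ _ ev])
          show "(\<lambda>n. e * (b - a) + h (k n)) \<longlonglongrightarrow> e * (b - a) + 0" by (intro tendsto_intros hk)
          show "(\<lambda>n. \<bar>z (k n) b - z (k n) a - c * (b - a)\<bar>) \<longlonglongrightarrow> \<bar>\<zeta> b - \<zeta> a - c * (b - a)\<bar>"
            by (intro tendsto_intros lim ab)
        qed simp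
        also have "\<dots> \<le> e0 * (b - a)" using e ab by (simp add: mult_right_mono)
        finally have "\<bar>\<zeta> b - \<zeta> a - c * (b - a)\<bar> \<le> e0 * \<bar>y - t\<bar>" using ab by simp
        then show "norm (\<zeta> y - \<zeta> t - f t (\<zeta> t) * (y - t)) \<le> e0 * norm (y - t)"
          unfolding a_def b_def c_def by (cases "t \<le> y") (auto simp: min_def max_def algebra_simps abs_minus_commute abs_if split: if_splits)
      qed
    qed
  qed
  ultimately show thesis using that k lim by blast
qed

primrec euler :: "(real \<Rightarrow> real \<Rightarrow> real) \<Rightarrow> real \<Rightarrow> real \<Rightarrow> nat \<Rightarrow> real" where
  "euler f h z0 0 = z0"
| "euler f h z0 (Suc k) = euler f h z0 k + h * f (real k * h) (euler f h z0 k)"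

lemma euler_increment:
  assumes h: "0 < h" and ij: "i \<le> j"
    and c: "\<And>k. i \<le> k \<Longrightarrow> k < j \<Longrightarrow> \<bar>f (real k * h) (euler f h z0 k) - c\<bar> \<le> e"
  shows "\<bar>euler f h z0 j - euler f h z0 i - c * (real (j - i) * h)\<bar> \<le> e * (real (j - i) * h)"
  using ij c
proof (induction j rule: dec_induct)
  case (step j)
  have "\<bar>euler f h z0 j - euler f h z0 i - c * (real (j - i) * h)\<bar> \<le> e * (real (j - i) * h)"
    using step by auto
  moreover have "\<bar>h * (f (real j * h) (euler f h z0 j) - c)\<bar> \<le> h * e"
    using step h by (simp add: abs_mult)
  ultimately have "\<bar>(euler f h z0 j - euler f h z0 i - c * (real (j - i) * h)) + h * (f (real j * h) (euler f h z0 j) - c)\<bar>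
      \<le> e * (real (j - i) * h) + h * e" by linarith
  moreover have "real (Suc j - i) = real (j - i) + 1" using step by (simp add: Suc_diff_le)
  ultimately show ?case by (simp add: algebra_simps)
qed simp

text \<open>
  Euler's method with step size \<open>\<epsilon> n\<close>; between grid points the approximation is kept constant.
\<close>
theorem peano:
  fixes f :: "real \<Rightarrow> real \<Rightarrow> real"
  assumes f: "continuous_on ({0..} \<times> UNIV) (\<lambda>(t, x). f t x)"
    and M: "\<And>t x. 0 \<le> t \<Longrightarrow> \<bar>f t x\<bar> \<le> M"
  obtains z where "z 0 = z0" "solution_from 0 f z"
proof -
  have M0: "0 \<le> M" using M[of 0 0] by linarith
  define \<epsilon> where "\<epsilon> n = 1 / real (Suc n)" for n
  have \<epsilon>: "\<epsilon> n > 0" "\<epsilon> \<longlonglongrightarrow> 0" for n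
    unfolding \<epsilon>_def[abs_def] using LIMSEQ_inverse_real_of_nat by (simp_all add: inverse_eq_divide)
  define idx where "idx n t = nat \<lfloor>t / \<epsilon> n\<rfloor>" for n t
  define z where "z n t = euler f (\<epsilon> n) z0 (idx n t)" for n t
  \<comment> \<open>Rounding \<open>s\<close> and \<open>t\<close> down to the grid changes times by at most \<open>\<epsilon> n\<close> and values by at most
      \<open>M * \<epsilon> n\<close> at each end.\<close>
  define h where "h n = (2 * M + 2) * \<epsilon> n" for n
  have idx: "real (idx n t) * \<epsilon> n \<le> t" "t < real (idx n t) * \<epsilon> n + \<epsilon> n" if "0 \<le> t" for n t
  proof -
    have "0 \<le> t / \<epsilon> n" using that \<epsilon>(1)[of n] by simp
    then have "real (idx n t) \<le> t / \<epsilon> n" "t / \<epsilon> n < real (idx n t) + 1" unfolding idx_def by linarith+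
    then show "real (idx n t) * \<epsilon> n \<le> t" "t < real (idx n t) * \<epsilon> n + \<epsilon> n"
      using \<epsilon>(1)[of n] by (auto simp: field_simps)
  qed
  have idx_mono: "idx n s \<le> idx n t" if "s \<le> t" for n s t
    unfolding idx_def using that \<epsilon>(1)[of n] by (intro nat_mono floor_mono divide_right_mono) auto
  have hbound: "M * \<epsilon> n + 2 * \<epsilon> n + M * \<epsilon> n \<le> h n" "M * \<epsilon> n \<ge> 0" for n
    using \<epsilon>(1)[of n] M0 by (auto simp: h_def algebra_simps)
  have diff: "real (idx n t - idx n s) * \<epsilon> n \<le> (t - s) + \<epsilon> n" "(t - s) - \<epsilon> n \<le> real (idx n t - idx n s) * \<epsilon> n"
     "real (idx n t - idx n s) * \<epsilon> n \<ge> 0"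
    if "0 \<le> s" "s \<le> t" for n s t
    using idx[of s n] idx[of t n] that idx_mono[of s t n] \<epsilon>(1)[of n]
    by (auto simp: of_nat_diff algebra_simps)
  have elip: "\<bar>euler f (\<epsilon> n) z0 j - euler f (\<epsilon> n) z0 i\<bar> \<le> M * (real (j - i) * \<epsilon> n)" if "i \<le> j" for n i j
    using euler_increment[OF \<epsilon>(1)[of n] that, of f z0 0 M] M \<epsilon>(1)[of n] by auto
  show thesis
  proof (rule approximate_solutions_compact[OF f M0, of h z z0])
    show "h \<longlonglongrightarrow> 0" unfolding h_def[abs_def] using tendsto_mult_left[OF \<epsilon>(2), of "2 * M + 2"] by simp
    show "0 \<le> h n" for n using \<epsilon>(1)[of n] M0 by (simp add: h_def)
    show "z n 0 = z0" for n by (simp add: z_def idx_def)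
  next
    fix n and s t :: real assume st: "0 \<le> s" "s \<le> t"
    have "\<bar>z n t - z n s\<bar> \<le> M * (real (idx n t - idx n s) * \<epsilon> n)"
      unfolding z_def by (intro elip idx_mono st)
    also have "\<dots> \<le> M * ((t - s) + \<epsilon> n)" using diff[OF st] M0 by (intro mult_left_mono) auto
    finally show "\<bar>z n t - z n s\<bar> \<le> M * (t - s) + h n"
      using hbound[of n] \<epsilon>(1)[of n] by (auto simp: algebra_simps)
  next
    fix n and s t c e :: real
    assume st: "0 \<le> s" "s \<le> t" "t - s \<le> 1" and e: "0 \<le> e" "e \<le> 1"
      and near: "\<And>r x. 0 \<le> r \<Longrightarrow> \<bar>r - s\<bar> \<le> (t - s) + h n \<Longrightarrow> \<bar>x - z n s\<bar> \<le> M * (t - s) + h n \<Longrightarrow> \<bar>f r x - c\<bar> \<le> e"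
    define L where "L = real (idx n t - idx n s) * \<epsilon> n"
    have 1: "\<bar>euler f (\<epsilon> n) z0 (idx n t) - euler f (\<epsilon> n) z0 (idx n s) - c * L\<bar> \<le> e * L"
      unfolding L_def
    proof (rule euler_increment[OF \<epsilon>(1) idx_mono[OF st(2)]])
      fix k assume k: "idx n s \<le> k" "k < idx n t"
      have kt: "real k * \<epsilon> n \<le> real (idx n t) * \<epsilon> n" "real (idx n s) * \<epsilon> n \<le> real k * \<epsilon> n"
        using k \<epsilon>(1)[of n] by (auto intro: mult_right_mono)
      show "\<bar>f (real k * \<epsilon> n) (euler f (\<epsilon> n) z0 k) - c\<bar> \<le> e"
      proof (rule near)
        show "0 \<le> real k * \<epsilon> n" using \<epsilon>(1)[of n] by simp
        show "\<bar>real k * \<epsilon> n - s\<bar> \<le> t - s + h n"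
          using kt idx[of s n] idx[of t n] st hbound[of n] \<epsilon>(1)[of n] by linarith
        have "\<bar>euler f (\<epsilon> n) z0 k - z n s\<bar> \<le> M * (real (k - idx n s) * \<epsilon> n)"
          unfolding z_def using elip k by blast
        also have "\<dots> \<le> M * ((t - s) + \<epsilon> n)"
        proof (intro mult_left_mono M0)
          have "real k * \<epsilon> n - real (idx n s) * \<epsilon> n \<le> (t - s) + \<epsilon> n"
            using kt idx[of s n] idx[of t n] st by linarith
          then show "real (k - idx n s) * \<epsilon> n \<le> (t - s) + \<epsilon> n"
            using k(1) by (simp add: of_nat_diff left_diff_distrib)
        qed
        finally show "\<bar>euler f (\<epsilon> n) z0 k - z n s\<bar> \<le> M * (t - s) + h n"
          using hbound[of n] \<epsilon>(1)[of n] by (auto simp: algebra_simps)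
      qed
    qed
    have "0 \<le> h n" "0 \<le> M * (t - s)" using hbound[of n] \<epsilon>(1)[of n] M0 st by (linarith, simp)
    then have "\<bar>f s (z n s) - c\<bar> \<le> e" using st by (intro near) auto
    then have c: "\<bar>c\<bar> \<le> M + 1" using M[OF st(1), of "z n s"] e by linarith
    have "\<bar>c * L - c * (t - s)\<bar> = \<bar>c\<bar> * \<bar>L - (t - s)\<bar>" by (simp add: abs_mult[symmetric] algebra_simps)
    also have "\<dots> \<le> (M + 1) * \<epsilon> n"
      using c diff[OF st(1,2), of n] by (intro mult_mono) (auto simp: L_def abs_le_iff)
    finally have 2: "\<bar>c * L - c * (t - s)\<bar> \<le> (M + 1) * \<epsilon> n" .
    have "e * L \<le> e * ((t - s) + \<epsilon> n)" using diff[OF st(1,2), of n] e by (intro mult_left_mono) (auto simp: L_def)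
    also have "\<dots> \<le> e * (t - s) + \<epsilon> n" using e \<epsilon>(1)[of n] by (simp add: algebra_simps mult_left_le)
    finally have "\<bar>z n t - z n s - c * (t - s)\<bar> \<le> e * (t - s) + \<epsilon> n + (M + 1) * \<epsilon> n"
      using 1 2 unfolding z_def by linarith
    then show "\<bar>z n t - z n s - c * (t - s)\<bar> \<le> e * (t - s) + h n"
      using hbound[of n] \<epsilon>(1)[of n] by (auto simp: algebra_simps)
  qed (use that in blast)
qed

text \<open>
  Solutions of \<open>z' = f t z - h\<close> with \<open>h > 0\<close> lie below every solution of \<open>z' = f t z\<close> with the
  same initial value. So does any limit of them as \<open>h\<close> tends to \<open>0\<close>, and such a limit is itself
  a solution.
\<close>
theorem leftmost_solution:
  fixes f :: "real \<Rightarrow> real \<Rightarrow> real"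
  assumes f: "continuous_on ({0..} \<times> UNIV) (\<lambda>(t, x). f t x)"
    and M: "\<And>t x. 0 \<le> t \<Longrightarrow> \<bar>f t x\<bar> \<le> M"
  obtains z where "z 0 = z0" "solution_from 0 f z"
    "\<And>w t. solution_from 0 f w \<Longrightarrow> w 0 = z0 \<Longrightarrow> 0 \<le> t \<Longrightarrow> z t \<le> w t"
proof -
  have M0: "0 \<le> M" using M[of 0 0] by linarith
  define h where "h n = 1 / real (Suc n)" for n
  have h: "h n > 0" "h n \<le> 1" "h \<longlonglongrightarrow> 0" for n
    unfolding h_def[abs_def] using LIMSEQ_inverse_real_of_nat by (simp_all add: inverse_eq_divide)
  have "\<exists>z. z 0 = z0 \<and> solution_from 0 (\<lambda>t x. f t x - h n) z" for n
  proof -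
    have "continuous_on ({0..} \<times> UNIV) (\<lambda>(t, x). f t x - h n)"
      using continuous_on_diff[OF f continuous_on_const[of _ "h n"]] by (simp add: case_prod_unfold)
    then obtain z where "z 0 = z0" "solution_from 0 (\<lambda>t x. f t x - h n) z"
    proof (rule peano[of _ "M + 1" z0])
      show "\<bar>f t x - h n\<bar> \<le> M + 1" if "0 \<le> t" for t x
        using M[OF that, of x] h(1)[of n] h(2)[of n] by linarith
    qed
    then show ?thesis by blast
  qed
  then obtain z where z: "\<And>n. z n 0 = z0" "\<And>n. solution_from 0 (\<lambda>t x. f t x - h n) (z n)"
    by metis
  have lip: "\<bar>z n t - z n s\<bar> \<le> (M + 1) * (t - s)" if "0 \<le> s" "s \<le> t" for n s t
  proof -
    have "\<bar>f t x - h n\<bar> \<le> M + 1" if "0 \<le> t" for t x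
      using M[OF that, of x] h(1)[of n] h(2)[of n] by linarith
    then show ?thesis using solution_from_Lipschitz[OF z(2)[of n], where a=s and b=t and M="M + 1"] that by auto
  qed
  show thesis
  proof (rule approximate_solutions_compact[OF f, of "M + 1" h z z0])
    fix n and s t c e :: real
    assume st: "0 \<le> s" "s \<le> t" "t - s \<le> 1" and e: "0 \<le> e" "e \<le> 1"
      and near: "\<And>r x. 0 \<le> r \<Longrightarrow> \<bar>r - s\<bar> \<le> (t - s) + h n \<Longrightarrow> \<bar>x - z n s\<bar> \<le> (M + 1) * (t - s) + h n \<Longrightarrow> \<bar>f r x - c\<bar> \<le> e"
    have "\<bar>z n t - z n s - c * (t - s)\<bar> \<le> (e + h n) * (t - s)"
    proof (rule solution_from_increment[OF z(2) st(1,2)])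
      fix r assume r: "s \<le> r" "r \<le> t"
      have "(M + 1) * (r - s) \<le> (M + 1) * (t - s)" using r M0 by (intro mult_left_mono) auto
      then have "\<bar>z n r - z n s\<bar> \<le> (M + 1) * (t - s) + h n"
        using lip[of s r n] r st h(1)[of n] by linarith
      then have "\<bar>f r (z n r) - c\<bar> \<le> e" using r st h(1)[of n] by (intro near) auto
      then show "\<bar>f r (z n r) - h n - c\<bar> \<le> e + h n" using h(1)[of n] by linarith
    qed
    also have "\<dots> \<le> e * (t - s) + h n"
      using mult_left_mono[OF st(3), of "h n"] h(1)[of n] by (simp add: distrib_right)
    finally show "\<bar>z n t - z n s - c * (t - s)\<bar> \<le> e * (t - s) + h n" .
  next
    fix k \<zeta> assume k: "strict_mono (k :: nat \<Rightarrow> nat)" "\<zeta> 0 = z0" "solution_from 0 f \<zeta>"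
      and lim: "\<And>t. 0 \<le> t \<Longrightarrow> (\<lambda>n. z (k n) t) \<longlonglongrightarrow> \<zeta> t"
    show thesis
    proof (rule that[OF k(2,3)])
      fix w t assume w: "solution_from 0 f w" "w 0 = z0" and t: "(0::real) \<le> t"
      have "z n t \<le> w t" for n
      proof (rule strict_subsolution_le[OF _ _ w(1) _ t])
        show "(z n has_real_derivative f r (z n r) - h n) (at r within {0..})" if "0 \<le> r" for r
          by (rule solution_fromD[OF z(2) that])
      qed (use h(1)[of n] w z in auto)
      then show "\<zeta> t \<le> w t" by (intro LIMSEQ_le_const2[OF lim[OF t]]) auto
    qed
  next
    fix n and s t :: real assume "0 \<le> s" "s \<le> t"
    then show "\<bar>z n t - z n s\<bar> \<le> (M + 1) * (t - s) + h n" using lip[of s t n] h(1)[of n] by auto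
  qed (use M0 h z in \<open>auto intro: less_imp_le\<close>)
qed

lemma peano_from:
  fixes f :: "real \<Rightarrow> real \<Rightarrow> real"
  assumes f: "continuous_on ({0..} \<times> UNIV) (\<lambda>(t, x). f t x)"
    and M: "\<And>t x. 0 \<le> t \<Longrightarrow> \<bar>f t x\<bar> \<le> M" and s: "0 \<le> s"
  obtains z where "z s = x" "solution_from s f z"
proof -
  have "continuous_on ({0..} \<times> UNIV) (\<lambda>p. case (s + fst p, snd p) of (t, x) \<Rightarrow> f t x)"
    by (rule continuous_on_compose2[OF f]) (use s in \<open>auto intro!: continuous_intros\<close>)
  then have "continuous_on ({0..} \<times> UNIV) (\<lambda>(t, x). f (s + t) x)" by (simp add: case_prod_unfold)
  then obtain y where y: "y 0 = x" "solution_from 0 (\<lambda>t. f (s + t)) y"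
  proof (rule peano[of _ M x])
    show "\<bar>f (s + t) x\<bar> \<le> M" if "0 \<le> t" for t x using M[of "s + t" x] s that by simp
  qed
  have "solution_from s f (\<lambda>t. y (t - s))" unfolding solution_from_def
  proof (intro allI impI)
    fix t assume t: "s \<le> t"
    have "(y has_real_derivative f (s + (t - s)) (y (t - s))) (at (t - s) within {0..})"
      using solution_fromD[OF y(2), of "t - s"] t by simp
    moreover have "(\<lambda>t. t - s) ` {s..} = {0..}"
      by (auto simp: image_iff intro!: bexI[of _ "_ + s"])
    ultimately have "(y has_real_derivative f t (y (t - s))) (at (t - s) within (\<lambda>t. t - s) ` {s..})" by simp
    moreover have "((\<lambda>t. t - s) has_real_derivative 1) (at t within {s..})" by (auto intro!: derivative_eq_intros)
    ultimately show "((\<lambda>t. y (t - s)) has_real_derivative f t (y (t - s))) (at t within {s..})"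
      using DERIV_image_chain[of y "f t (y (t - s))" "\<lambda>t. t - s" t "{s..}" 1] by (simp add: o_def)
  qed
  with y(1) show thesis using that[of "\<lambda>t. y (t - s)"] by simp
qed

text \<open>
  Only times after \<open>s\<close> matter; extending a solution by a constant makes it continuous, hence
  measurable, on the whole line.
\<close>
lemma solution_from_freeze:
  assumes z: "solution_from s f z"
  shows "solution_from s f (\<lambda>t. z (max s t))" "continuous_on UNIV (\<lambda>t. z (max s t))"
proof -
  show "continuous_on UNIV (\<lambda>t. z (max s t))"
    by (rule continuous_on_compose2[OF solution_from_continuous[OF z]]) (auto intro!: continuous_intros)
  show "solution_from s f (\<lambda>t. z (max s t))" unfolding solution_from_def
  proof (intro allI impI)
    fix t assume t: "s \<le> t"
    show "((\<lambda>t. z (max s t)) has_real_derivative f t (z (max s t))) (at t within {s..})"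
      using has_field_derivative_transform_within[OF solution_fromD[OF z t], of 1 "\<lambda>t. z (max s t)"] t
      by (simp add: max_absorb2)
  qed
qed

section \<open>A priori bounds for weak solutions\<close>

definition energy_density :: "(real \<Rightarrow> real \<Rightarrow> real) \<Rightarrow> (real \<Rightarrow> real \<Rightarrow> real) \<Rightarrow> real \<Rightarrow> real \<Rightarrow> real" where
  "energy_density u ux t x = (u t x)\<^sup>2 + 1/2 * (ux t x)\<^sup>2"

text \<open>
  Cauchy-Schwarz against the constant function: expand \<open>(\<bar>g\<bar> - m)\<^sup>2 \<ge> 0\<close> around the mean value of
  \<open>\<bar>g\<bar>\<close>.
\<close>
lemma integral_abs_sq_le:
  fixes g :: "real \<Rightarrow> real"
  assumes g: "set_integrable lborel A g" and g2: "set_integrable lborel A (\<lambda>x. (g x)\<^sup>2)"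
    and A: "A \<in> sets borel" "emeasure lborel A < \<infinity>"
  shows "(LINT x:A|lborel. \<bar>g x\<bar>)\<^sup>2 \<le> measure lborel A * (LINT x:A|lborel. (g x)\<^sup>2)"
proof -
  define a where "a = (LINT x:A|lborel. \<bar>g x\<bar>)"
  define b where "b = (LINT x:A|lborel. (g x)\<^sup>2)"
  define m where "m = measure lborel A"
  have c: "set_integrable lborel A (\<lambda>x. k)" for k :: real
    using A unfolding set_integrable_def by (intro integrable_scaleR_left integrable_real_indicator) auto
  have ga: "set_integrable lborel A (\<lambda>x. \<bar>g x\<bar>)" using set_integrable_abs[OF g] .
  have quad: "0 \<le> b - 2 * k * a + k\<^sup>2 * m" for k
  proof -
    have "0 \<le> (LINT x:A|lborel. (\<bar>g x\<bar> - k)\<^sup>2)"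
      unfolding set_lebesgue_integral_def by (intro integral_nonneg_AE AE_I2) (auto simp: indicator_def)
    also have "\<dots> = (LINT x:A|lborel. ((g x)\<^sup>2 - 2 * k * \<bar>g x\<bar>) + k\<^sup>2)"
      by (simp add: power2_diff algebra_simps)
    also have "\<dots> = (LINT x:A|lborel. (g x)\<^sup>2 - 2 * k * \<bar>g x\<bar>) + (LINT x:A|lborel. k\<^sup>2)"
      by (intro set_integral_add(2) set_integral_diff(1) g2 set_integrable_mult_right c ga)
    also have "(LINT x:A|lborel. (g x)\<^sup>2 - 2 * k * \<bar>g x\<bar>) = b - 2 * k * a"
      using set_integral_diff(2)[OF g2 set_integrable_mult_right[OF ga, of "2 * k"]]
      by (simp add: a_def b_def)
    also have "(LINT x:A|lborel. k\<^sup>2) = k\<^sup>2 * m"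
      using A by (simp add: set_lebesgue_integral_def m_def)
    finally show ?thesis .
  qed
  show ?thesis
  proof (cases "m = 0")
    case True
    have "a = 0"
    proof (rule ccontr)
      assume "a \<noteq> 0"
      have "0 \<le> b - 2 * ((b + 1) / (2 * a)) * a" using quad[of "(b + 1) / (2 * a)"] True by simp
      then show False using \<open>a \<noteq> 0\<close> by simp
    qed
    then show ?thesis using True by (simp add: a_def[symmetric] b_def[symmetric] m_def[symmetric])
  next
    case False
    then have "m > 0" by (simp add: m_def less_le)
    have "0 \<le> b - 2 * (a / m) * a + (a / m)\<^sup>2 * m" by (rule quad)
    also have "\<dots> = b - a\<^sup>2 / m" using \<open>m > 0\<close> by (simp add: field_simps power2_eq_square)
    finally show ?thesis using \<open>m > 0\<close>
      by (simp add: a_def[symmetric] b_def[symmetric] m_def[symmetric] field_simps)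
  qed
qed

definition CH_kernel :: "real \<Rightarrow> real" where
  "CH_kernel z = 1/2 * sgn z * exp (- \<bar>z\<bar>)"

lemma CH_kernel_bound: "\<bar>CH_kernel z\<bar> \<le> 1/2"
  by (simp add: CH_kernel_def abs_mult sgn_if)

lemma CH_kernel_measurable[measurable]: "CH_kernel \<in> borel_measurable borel"
  unfolding CH_kernel_def[abs_def] by measurable

lemma exp_minus_diff_le:
  fixes a b :: real assumes "0 \<le> a" "a \<le> b" shows "exp (- a) - exp (- b) \<le> b - a"
proof -
  have "exp (-a) - exp (-b) = exp (-a) * (1 - exp (- (b - a)))"
    by (simp add: algebra_simps exp_add[symmetric] mult_exp_exp)
  also have "\<dots> \<le> 1 * (1 - exp (- (b - a)))"
    using assms by (intro mult_right_mono) auto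
  also have "1 - exp (- (b - a)) \<le> b - a" using exp_ge_add_one_self[of "- (b - a)"] by linarith
  finally show ?thesis by simp
qed

text \<open>
  The kernel jumps from \<open>-1/2\<close> to \<open>1/2\<close> at the origin and elsewhere decreases with slope at
  least \<open>-1/2\<close>. The jump occurs between the two arguments exactly when \<open>y\<close> lies between \<open>x1\<close> and
  \<open>x2\<close>.
\<close>
lemma CH_kernel_diff_lower:
  assumes "x1 \<le> x2" "y \<noteq> x1" "y \<noteq> x2"
  shows "CH_kernel (x2 - y) - CH_kernel (x1 - y) \<ge> indicator {x1..x2} y - (x2 - x1) / 2"
proof -
  have pos: "CH_kernel (z - y) = E / 2" if "y < z" "E = exp (y - z)" for z E using that by (simp add: CH_kernel_def)
  have neg: "CH_kernel (z - y) = - (E / 2)" if "z < y" "E = exp (z - y)" for z E using that by (simp add: CH_kernel_def)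
  consider "y < x1" | "x2 < y" | "x1 < y" "y < x2" using assms by linarith
  then show ?thesis
  proof cases
    case 1
    define E1 E2 where E: "E1 = exp (y - x1)" "E2 = exp (y - x2)"
    have "E1 - E2 \<le> x2 - x1" using 1 assms exp_minus_diff_le[of "x1 - y" "x2 - y"] by (simp add: E)
    then have "0 - (x2 - x1) / 2 \<le> E2 / 2 - E1 / 2" by (simp add: field_simps)
    moreover have "CH_kernel (x1 - y) = E1 / 2" by (rule pos) (use 1 assms E in auto)
    moreover have "CH_kernel (x2 - y) = E2 / 2" by (rule pos) (use 1 assms E in auto)
    moreover have "indicator {x1..x2} y = (0::real)" using 1 by simp
    ultimately show ?thesis by (simp only:)
  next
    case 2
    define E1 E2 where E: "E1 = exp (x1 - y)" "E2 = exp (x2 - y)"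
    have "E2 - E1 \<le> x2 - x1" using 2 assms exp_minus_diff_le[of "y - x2" "y - x1"] by (simp add: E)
    then have "0 - (x2 - x1) / 2 \<le> - (E2 / 2) - - (E1 / 2)" by (simp add: field_simps)
    moreover have "CH_kernel (x1 - y) = - (E1 / 2)" by (rule neg) (use 2 assms E in auto)
    moreover have "CH_kernel (x2 - y) = - (E2 / 2)" by (rule neg) (use 2 assms E in auto)
    moreover have "indicator {x1..x2} y = (0::real)" using 2 by simp
    ultimately show ?thesis by (simp only:)
  next
    case 3
    define E1 E2 where E: "E1 = exp (x1 - y)" "E2 = exp (y - x2)"
    have "E1 \<ge> 1 + (x1 - y)" "E2 \<ge> 1 + (y - x2)" unfolding E by (rule exp_ge_add_one_self)+
    then have "1 - (x2 - x1) / 2 \<le> E2 / 2 - - (E1 / 2)" by (simp add: field_simps)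
    moreover have "CH_kernel (x1 - y) = - (E1 / 2)" by (rule neg) (use 3 E in auto)
    moreover have "CH_kernel (x2 - y) = E2 / 2" by (rule pos) (use 3 E in auto)
    moreover have "indicator {x1..x2} y = (1::real)" using 3 by simp
    ultimately show ?thesis by (simp only:)
  qed
qed

locale CH_solution =
  fixes u0 :: "real \<Rightarrow> real" and u ux :: "real \<Rightarrow> real \<Rightarrow> real"
  assumes weak_solution: "CH_weak_solution u0 u ux"
begin

abbreviation "h \<equiv> energy_density u ux"
abbreviation "F \<equiv> CH_source u ux"

lemma u_cont: "continuous_on ({0..} \<times> UNIV) (\<lambda>(t, x). u t x)"
  using weak_solution by (simp add: CH_weak_solution_def)

lemma u_cont_compose:
  assumes "continuous_on S f" "continuous_on S g" "\<And>s. s \<in> S \<Longrightarrow> 0 \<le> f s"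
  shows "continuous_on S (\<lambda>s. u (f s) (g s))"
proof -
  have "continuous_on S (\<lambda>s. case (f s, g s) of (t, x) \<Rightarrow> u t x)"
    by (rule continuous_on_compose2[OF u_cont continuous_on_Pair[OF assms(1,2)]]) (use assms(3) in auto)
  then show ?thesis by simp
qed

lemma u_cont_x: "0 \<le> t \<Longrightarrow> continuous_on S (u t)"
  using u_cont_compose[of S "\<lambda>_. t" "\<lambda>x. x"] by (simp add: continuous_on_id)

text \<open>
  Borel functions on the whole plane that agree with \<open>u\<close>, \<open>ux\<close>, the energy density and the
  source at nonnegative times. Setting \<open>U\<close> and \<open>V\<close> to zero before time \<open>0\<close> makes measurability,
  also along curves, automatic.
\<close>
definition U :: "real \<Rightarrow> real \<Rightarrow> real" where "U t x = (if 0 \<le> t then u t x else 0)"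
definition V :: "real \<Rightarrow> real \<Rightarrow> real" where "V t x = (if 0 \<le> t then ux t x else 0)"

lemma U_measurable[measurable]: "(\<lambda>p. U (fst p) (snd p)) \<in> borel_measurable borel"
proof -
  have "(\<lambda>p. indicator ({0..} \<times> UNIV) p *\<^sub>R (case p of (t, x) \<Rightarrow> u t x)) \<in> borel_measurable borel"
    by (rule borel_measurable_continuous_on_indicator[OF _ u_cont]) (auto intro!: borel_closed closed_Times)
  also have "(\<lambda>p. indicator ({0..} \<times> UNIV) p *\<^sub>R (case p of (t, x) \<Rightarrow> u t x)) = (\<lambda>p. U (fst p) (snd p))"
    by (auto simp: U_def indicator_def)
  finally show ?thesis .
qed

lemma V_measurable[measurable]: "(\<lambda>p. V (fst p) (snd p)) \<in> borel_measurable borel"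
proof -
  have "(\<lambda>p. indicator ({0..} \<times> UNIV) p *\<^sub>R (case p of (t, x) \<Rightarrow> ux t x)) \<in> borel_measurable borel"
    using weak_solution by (simp add: CH_weak_solution_def set_borel_measurable_def)
  also have "(\<lambda>p. indicator ({0..} \<times> UNIV) p *\<^sub>R (case p of (t, x) \<Rightarrow> ux t x)) = (\<lambda>p. V (fst p) (snd p))"
    by (auto simp: V_def indicator_def)
  finally show ?thesis .
qed

lemma U_compose[measurable (raw)]:
  "f \<in> borel_measurable M \<Longrightarrow> g \<in> borel_measurable M \<Longrightarrow> (\<lambda>z. U (f z) (g z)) \<in> borel_measurable M"
  using measurable_compose[OF borel_measurable_Pair U_measurable, of f M g] by simp

lemma V_compose[measurable (raw)]:
  "f \<in> borel_measurable M \<Longrightarrow> g \<in> borel_measurable M \<Longrightarrow> (\<lambda>z. V (f z) (g z)) \<in> borel_measurable M"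
  using measurable_compose[OF borel_measurable_Pair V_measurable, of f M g] by simp

definition H :: "real \<Rightarrow> real \<Rightarrow> real" where "H t x = (U t x)\<^sup>2 + 1/2 * (V t x)\<^sup>2"
definition G :: "real \<Rightarrow> real \<Rightarrow> real" where "G t x = (LINT y|lborel. CH_kernel (x - y) * H t y)"

lemma UVGH: "0 \<le> t \<Longrightarrow> U t = u t" "0 \<le> t \<Longrightarrow> V t = ux t" "0 \<le> t \<Longrightarrow> H t = h t" "0 \<le> t \<Longrightarrow> G t = F t"
  by (auto simp: U_def V_def H_def G_def CH_source_def energy_density_def CH_kernel_def fun_eq_iff)

lemma H_compose[measurable (raw)]:
  "f \<in> borel_measurable M \<Longrightarrow> g \<in> borel_measurable M \<Longrightarrow> (\<lambda>z. H (f z) (g z)) \<in> borel_measurable M"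
  unfolding H_def
  by (intro borel_measurable_add borel_measurable_times borel_measurable_const borel_measurable_power
      U_compose V_compose)

lemma G_measurable: "(\<lambda>p. G (fst p) (snd p)) \<in> borel_measurable (borel \<Otimes>\<^sub>M borel)"
  unfolding G_def
proof (rule lborel.borel_measurable_lebesgue_integral)
  show "(\<lambda>(x, y). CH_kernel (snd x - y) * H (fst x) y) \<in> borel_measurable ((borel \<Otimes>\<^sub>M borel) \<Otimes>\<^sub>M lborel)"
    by measurable
qed

lemma G_compose[measurable (raw)]:
  assumes "f \<in> borel_measurable M" "g \<in> borel_measurable M" shows "(\<lambda>z. G (f z) (g z)) \<in> borel_measurable M"
  using measurable_compose[OF measurable_Pair[OF assms] G_measurable] by simp

lemma ux_locally_integrable: "0 \<le> t \<Longrightarrow> locally_integrable (ux t)"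
  using weak_solution by (simp add: CH_weak_solution_def has_weak_derivative_def locally_integrable_def)

lemma u_FTC:
  assumes t: "0 \<le> t" and xy: "x \<le> y"
  shows "u t y - u t x = (LINT z:{x..y}|lborel. ux t z)"
proof (rule weak_derivative_FTC[of UNIV])
  show "(LINT z|lborel. u t z * deriv \<phi> z) = - (LINT z|lborel. ux t z * \<phi> z)" if "test_function_on UNIV \<phi>" for \<phi>
    using weak_solution t that by (simp add: CH_weak_solution_def has_weak_derivative_def)
qed (use t xy u_cont_x ux_locally_integrable locally_integrableD in auto)

definition C :: real where
  "C = (SOME C. 0 \<le> C \<and> (AE t in lborel. 0 \<le> t \<longrightarrow> (\<integral>\<^sup>+x. ennreal (h t x) \<partial>lborel) \<le> ennreal C))"

lemma C: "0 \<le> C" "AE t in lborel. 0 \<le> t \<longrightarrow> (\<integral>\<^sup>+x. ennreal (h t x) \<partial>lborel) \<le> ennreal C"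
proof -
  obtain B where B: "AE t in lborel. 0 \<le> t \<longrightarrow> (\<integral>\<^sup>+x. ennreal (h t x) \<partial>lborel) \<le> ennreal B"
    using weak_solution unfolding CH_weak_solution_def energy_density_def by blast
  have "AE t in lborel. 0 \<le> t \<longrightarrow> (\<integral>\<^sup>+x. ennreal (h t x) \<partial>lborel) \<le> ennreal (max B 0)"
    using B by eventually_elim (auto intro: order_trans ennreal_leI)
  then have "0 \<le> max B 0 \<and> (AE t in lborel. 0 \<le> t \<longrightarrow> (\<integral>\<^sup>+x. ennreal (h t x) \<partial>lborel) \<le> ennreal (max B 0))" by simp
  then have "0 \<le> C \<and> (AE t in lborel. 0 \<le> t \<longrightarrow> (\<integral>\<^sup>+x. ennreal (h t x) \<partial>lborel) \<le> ennreal C)"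
    unfolding C_def by (rule someI)
  then show "0 \<le> C" "AE t in lborel. 0 \<le> t \<longrightarrow> (\<integral>\<^sup>+x. ennreal (h t x) \<partial>lborel) \<le> ennreal C" by auto
qed

text \<open>
  The energy bound holds for almost every time only. At the other times the energy may be
  infinite, and the source may then be a Bochner integral with the default value \<open>0\<close>, so
  statements about it are confined to good times.
\<close>
definition good :: "real \<Rightarrow> bool" where
  "good t \<longleftrightarrow> 0 \<le> t \<and> (\<integral>\<^sup>+x. ennreal (h t x) \<partial>lborel) \<le> ennreal C"

lemma AE_good: "AE t in lborel. 0 \<le> t \<longrightarrow> good t"
  using C(2) by eventually_elim (simp add: good_def)

lemma h_nonneg: "0 \<le> h t x" by (simp add: energy_density_def)

lemma h_measurable: assumes "0 \<le> t" shows "h t \<in> borel_measurable borel"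
proof -
  have "(\<lambda>x. H t x) \<in> borel_measurable borel" by (rule H_compose) (rule borel_measurable_const measurable_ident_sets[OF refl])+
  then show ?thesis by (simp only: UVGH(3)[OF assms])
qed

lemma ux_measurable: assumes "0 \<le> t" shows "ux t \<in> borel_measurable borel"
proof -
  have "(\<lambda>x. V t x) \<in> borel_measurable borel" by (rule V_compose) (rule borel_measurable_const measurable_ident_sets[OF refl])+
  then show ?thesis by (simp only: UVGH(2)[OF assms])
qed

lemma u_measurable: assumes "0 \<le> t" shows "u t \<in> borel_measurable borel"
proof -
  have "(\<lambda>x. U t x) \<in> borel_measurable borel" by (rule U_compose) (rule borel_measurable_const measurable_ident_sets[OF refl])+
  then show ?thesis by (simp only: UVGH(1)[OF assms])
qed

lemma good_nonneg: "good t \<Longrightarrow> 0 \<le> t" by (simp add: good_def)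

lemma good_h: 
  assumes "good t"
  shows "integrable lborel (h t)" "(LINT x|lborel. h t x) \<le> C"
proof -
  have le: "(\<integral>\<^sup>+x. ennreal (h t x) \<partial>lborel) \<le> ennreal C" "0 \<le> t" using assms by (auto simp: good_def)
  have m: "h t \<in> borel_measurable lborel" using h_measurable le by simp
  show i: "integrable lborel (h t)"
  proof (rule integrableI_nonneg[OF m])
    show "AE x in lborel. 0 \<le> h t x" using h_nonneg by simp
    show "(\<integral>\<^sup>+x. ennreal (h t x) \<partial>lborel) < \<infinity>" by (rule le_less_trans[OF le(1)]) simp
  qed
  have "ennreal (LINT x|lborel. h t x) \<le> ennreal C"
    using nn_integral_eq_integral[OF i] h_nonneg le(1) by simp
  then show "(LINT x|lborel. h t x) \<le> C" using C(1) by (simp add: ennreal_le_iff)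
qed

lemma good_ux2:
  assumes "good t"
  shows "integrable lborel (\<lambda>x. (ux t x)\<^sup>2)" "(LINT x|lborel. (ux t x)\<^sup>2) \<le> 2 * C"
proof -
  have t: "0 \<le> t" using assms by (rule good_nonneg)
  have [measurable]: "ux t \<in> borel_measurable borel" using t by (rule ux_measurable)
  have le: "(ux t x)\<^sup>2 \<le> 2 * h t x" for x by (simp add: energy_density_def)
  have i: "integrable lborel (\<lambda>x. 2 * h t x)" using good_h(1)[OF assms] by simp
  show i2: "integrable lborel (\<lambda>x. (ux t x)\<^sup>2)"
    by (rule Bochner_Integration.integrable_bound[OF i]) (use le h_nonneg in auto)
  have "(LINT x|lborel. (ux t x)\<^sup>2) \<le> (LINT x|lborel. 2 * h t x)"
    by (rule integral_mono[OF i2 i le])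
  then show "(LINT x|lborel. (ux t x)\<^sup>2) \<le> 2 * C" using good_h(2)[OF assms] by simp
qed

lemma good_ux2_set:
  assumes "good t" "A \<in> sets borel"
  shows "set_integrable lborel A (\<lambda>x. (ux t x)\<^sup>2)" "(LINT x:A|lborel. (ux t x)\<^sup>2) \<le> 2 * C"
    "0 \<le> (LINT x:A|lborel. (ux t x)\<^sup>2)"
proof -
  show i: "set_integrable lborel A (\<lambda>x. (ux t x)\<^sup>2)"
    unfolding set_integrable_def by (rule integrable_mult_indicator) (use assms good_ux2 in auto)
  have "(LINT x:A|lborel. (ux t x)\<^sup>2) \<le> (LINT x|lborel. (ux t x)\<^sup>2)"
    unfolding set_lebesgue_integral_def
    by (rule integral_mono) (use i good_ux2[OF assms(1)] in \<open>auto simp: set_integrable_def indicator_def\<close>)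
  then show "(LINT x:A|lborel. (ux t x)\<^sup>2) \<le> 2 * C" using good_ux2(2)[OF assms(1)] by simp
  show "0 \<le> (LINT x:A|lborel. (ux t x)\<^sup>2)"
    unfolding set_lebesgue_integral_def by (rule integral_nonneg_AE) (auto simp: indicator_def)
qed

lemma integral_abs_ux_sq:
  assumes "good t" "x \<le> y"
  shows "(LINT z:{x..y}|lborel. \<bar>ux t z\<bar>)\<^sup>2 \<le> (y - x) * (LINT z:{x..y}|lborel. (ux t z)\<^sup>2)"
  using integral_abs_sq_le[of "{x..y}" "ux t"] assms good_ux2_set(1)[OF assms(1), of "{x..y}"]
    locally_integrableD[OF ux_locally_integrable[OF good_nonneg[OF assms(1)]]]
  by simp

lemma integral_abs_ux_le:
  assumes "good t" "x \<le> y"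
  shows "(LINT z:{x..y}|lborel. \<bar>ux t z\<bar>) \<le> sqrt (2 * C * (y - x))"
proof (rule real_le_rsqrt)
  show "(LINT z:{x..y}|lborel. \<bar>ux t z\<bar>)\<^sup>2 \<le> 2 * C * (y - x)"
    using integral_abs_ux_sq[OF assms] mult_left_mono[OF good_ux2_set(2)[OF assms(1), of "{x..y}"], of "y - x"] assms(2)
    by (simp add: mult.commute)
qed

lemma integral_abs_ux_nonneg: "0 \<le> (LINT z:{x..y}|lborel. \<bar>ux t z\<bar>)"
  unfolding set_lebesgue_integral_def by (rule integral_nonneg_AE) (auto simp: indicator_def)

lemma u_diff_le:
  assumes "0 \<le> t" "x \<le> z" "z \<le> y" "x \<le> w" "w \<le> y"
  shows "\<bar>u t z - u t w\<bar> \<le> (LINT z:{x..y}|lborel. \<bar>ux t z\<bar>)"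
proof -
  note li = locally_integrableD[OF ux_locally_integrable[OF assms(1)]]
  have *: "\<bar>u t b - u t a\<bar> \<le> (LINT z:{x..y}|lborel. \<bar>ux t z\<bar>)" if "x \<le> a" "a \<le> b" "b \<le> y" for a b
  proof -
    have "\<bar>u t b - u t a\<bar> \<le> (LINT z:{a..b}|lborel. \<bar>ux t z\<bar>)"
      unfolding u_FTC[OF assms(1) that(2)]
      using set_integral_norm_bound[OF li] by simp
    also have "\<dots> \<le> (LINT z:{x..y}|lborel. \<bar>ux t z\<bar>)"
      unfolding set_lebesgue_integral_def
      by (rule integral_mono) (use set_integrable_abs[OF li] that in \<open>auto simp: set_integrable_def indicator_def\<close>)
    finally show ?thesis .
  qed
  show ?thesis using *[of z w] *[of w z] assms by (cases "z \<le> w") (auto simp: abs_minus_commute)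
qed

lemma AE_dense:
  assumes "AE t in lborel. 0 \<le> t \<longrightarrow> P t" "0 \<le> (t::real)" "e > 0"
  obtains s where "t < s" "s < t + e" "P s"
proof -
  have "\<exists>s. t < s \<and> s < t + e \<and> P s"
  proof (rule ccontr)
    assume neg: "\<not> (\<exists>s. t < s \<and> s < t + e \<and> P s)"
    have "AE s in lborel. s \<notin> {t<..<t + e}"
      using assms(1) by eventually_elim (use neg assms(2) in force)
    then have "emeasure lborel {t<..<t + e} = 0"
      by (subst (asm) AE_iff_measurable[where N="{t<..<t + e}"]) auto
    then show False using assms(3) by simp
  qed
  then show thesis using that by blast
qed

text \<open>
  Good times are dense, so an inequality between continuous functions of time passes from them
  to all times.
\<close>
lemma good_extend:
  assumes cont: "continuous_on {0..} (f :: real \<Rightarrow> real)" and le: "\<And>t. good t \<Longrightarrow> f t \<le> B" and t: "0 \<le> t"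
  shows "f t \<le> B"
proof (rule ccontr)
  assume neg: "\<not> f t \<le> B"
  then obtain d where d: "d > 0" "\<And>s. s \<in> {0..} \<Longrightarrow> dist s t < d \<Longrightarrow> dist (f s) (f t) < f t - B"
    using cont t unfolding continuous_on_iff by (metis atLeast_iff diff_gt_0_iff_gt not_le)
  obtain s where s: "t < s" "s < t + d" "good s" using AE_dense[OF AE_good t d(1)] by blast
  then have "\<bar>f s - f t\<bar> < f t - B" using d(2)[of s] t by (simp add: dist_real_def)
  then show False using le[OF s(3)] by linarith
qed

lemma u_Holder:
  assumes "0 \<le> t" "x \<le> y" shows "(u t y - u t x)\<^sup>2 \<le> 2 * C * (y - x)"
proof (rule good_extend[OF _ _ assms(1)])
  show "continuous_on {0..} (\<lambda>t. (u t y - u t x)\<^sup>2)"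
    by (intro continuous_intros u_cont_compose) auto
  fix t assume g: "good t"
  have "\<bar>u t y - u t x\<bar> \<le> (LINT z:{x..y}|lborel. \<bar>ux t z\<bar>)"
    using u_diff_le[OF good_nonneg[OF g], of x y y x] assms by simp
  then have "(u t y - u t x)\<^sup>2 \<le> (LINT z:{x..y}|lborel. \<bar>ux t z\<bar>)\<^sup>2"
    using abs_le_square_iff[of "u t y - u t x" "LINT z:{x..y}|lborel. \<bar>ux t z\<bar>"] integral_abs_ux_nonneg[of x y t] by simp
  also have "\<dots> \<le> (sqrt (2 * C * (y - x)))\<^sup>2"
    by (intro power_mono integral_abs_ux_le integral_abs_ux_nonneg g assms)
  finally show "(u t y - u t x)\<^sup>2 \<le> 2 * C * (y - x)" using assms C(1) by simp
qed

definition M :: real where "M = C + sqrt (2 * C) + 1"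

lemma M_pos: "M > 0" using C(1) by (simp add: M_def add_nonneg_pos)

text \<open>
  If \<open>\<bar>u\<bar>\<close> exceeds \<open>sqrt (2 * C)\<close> by \<open>m\<close> at some point \<open>x\<close>, then by Hoelder continuity \<open>\<bar>u\<bar> \<ge> m\<close>
  on \<open>[x, x + 1]\<close>, and the energy bound gives \<open>m\<^sup>2 \<le> C\<close>.
\<close>
lemma u_bound: assumes "0 \<le> t" shows "\<bar>u t x\<bar> \<le> M"
proof (rule good_extend[OF _ _ assms])
  show "continuous_on {0..} (\<lambda>t. \<bar>u t x\<bar>)" by (intro continuous_intros u_cont_compose) auto
  fix t assume g: "good t"
  have t: "0 \<le> t" using g by (rule good_nonneg)
  define m where "m = \<bar>u t x\<bar> - sqrt (2 * C)"
  show "\<bar>u t x\<bar> \<le> M"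
  proof (cases "m \<le> 0")
    case True then show ?thesis using C(1) by (simp add: m_def M_def)
  next
    case False
    have low: "m\<^sup>2 \<le> h t y" if "y \<in> {x..x+1}" for y
    proof -
      have "\<bar>u t y - u t x\<bar> \<le> sqrt (2 * C)"
      proof (rule real_le_rsqrt)
        have "(u t y - u t x)\<^sup>2 \<le> 2 * C * (y - x)" using u_Holder[OF t, of x y] that by simp
        also have "\<dots> \<le> 2 * C * 1" using that C(1) by (intro mult_left_mono) auto
        finally show "\<bar>u t y - u t x\<bar>\<^sup>2 \<le> 2 * C" by simp
      qed
      then have "m \<le> \<bar>u t y\<bar>" by (simp add: m_def)
      then have "m\<^sup>2 \<le> \<bar>u t y\<bar>\<^sup>2" using False by (intro power_mono) auto
      moreover have "\<bar>u t y\<bar>\<^sup>2 \<le> h t y" by (simp add: energy_density_def)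
      ultimately show ?thesis by linarith
    qed
    have "m\<^sup>2 = (LINT y|lborel. indicator {x..x+1} y * m\<^sup>2)" by simp
    also have "\<dots> \<le> (LINT y|lborel. h t y)"
    proof (rule integral_mono[OF _ good_h(1)[OF g]])
      show "integrable lborel (\<lambda>y. indicator {x..x+1} y * m\<^sup>2)"
        by (intro integrable_mult_left integrable_real_indicator) (auto simp: emeasure_lborel_Icc_eq)
    qed (use low h_nonneg in \<open>auto simp: indicator_def\<close>)
    finally have "m\<^sup>2 \<le> C" using good_h(2)[OF g] by simp
    moreover have "2 * m \<le> m\<^sup>2 + 1" using zero_le_power2[of "m - 1"] by (simp add: power2_diff)
    ultimately have "m \<le> C + 1" using C(1) by linarith
    then show ?thesis by (simp add: m_def M_def)
  qed
qed

lemma kernel_h_integrable: 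
  assumes "good t" shows "integrable lborel (\<lambda>y. CH_kernel (x - y) * h t y)"
proof (rule Bochner_Integration.integrable_bound[OF good_h(1)[OF assms]])
  have [measurable]: "h t \<in> borel_measurable borel" using h_measurable good_nonneg assms by simp
  show "(\<lambda>y. CH_kernel (x - y) * h t y) \<in> borel_measurable lborel" by measurable
  show "AE y in lborel. norm (CH_kernel (x - y) * h t y) \<le> norm (h t y)"
    using CH_kernel_bound by (intro AE_I2) (auto simp: abs_mult intro!: mult_left_le_one_le order_trans[OF CH_kernel_bound])
qed

lemma F_eq: "F t x = (LINT y|lborel. CH_kernel (x - y) * h t y)"
  by (simp add: CH_source_def CH_kernel_def energy_density_def)

lemma F_bound: assumes "good t" shows "\<bar>F t x\<bar> \<le> C / 2"
proof -
  have "\<bar>F t x\<bar> \<le> (LINT y|lborel. \<bar>CH_kernel (x - y) * h t y\<bar>)"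
    unfolding F_eq using integral_norm_bound[of lborel "\<lambda>y. CH_kernel (x - y) * h t y"] by simp
  also have "\<dots> \<le> (LINT y|lborel. 1/2 * h t y)"
  proof (rule integral_mono)
    show "integrable lborel (\<lambda>y. \<bar>CH_kernel (x - y) * h t y\<bar>)"
      by (rule integrable_abs[OF kernel_h_integrable[OF assms]])
    show "integrable lborel (\<lambda>y. 1/2 * h t y)" using good_h(1)[OF assms] by simp
    fix y
    have "\<bar>CH_kernel (x - y) * h t y\<bar> = \<bar>CH_kernel (x - y)\<bar> * h t y" by (simp only: abs_mult abs_of_nonneg[OF h_nonneg])
    also have "\<dots> \<le> 1/2 * h t y" by (intro mult_right_mono CH_kernel_bound h_nonneg)
    finally show "\<bar>CH_kernel (x - y) * h t y\<bar> \<le> 1/2 * h t y" .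
  qed
  finally show ?thesis using good_h(2)[OF assms] by simp
qed

text \<open>
  The source increases by at least the energy between the two points, up to a multiple of their
  distance. This one-sided estimate is the origin of all monotonicity below.
\<close>
lemma F_diff_lower:
  assumes g: "good t" and xy: "x \<le> y"
  shows "F t y - F t x \<ge> (LINT z:{x..y}|lborel. h t z) - C / 2 * (y - x)"
proof -
  have hi: "integrable lborel (h t)" by (rule good_h(1)[OF g])
  have i1: "integrable lborel (\<lambda>z. indicator {x..y} z * h t z)"
    using integrable_mult_indicator[OF _ hi, of "{x..y}"] by simp
  have "(LINT z:{x..y}|lborel. h t z) - (y - x) / 2 * (LINT z|lborel. h t z)
      = (LINT z|lborel. (indicator {x..y} z - (y - x) / 2) * h t z)"
    using i1 hi by (simp add: set_lebesgue_integral_def left_diff_distrib)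
  also have "\<dots> \<le> (LINT z|lborel. (CH_kernel (y - z) - CH_kernel (x - z)) * h t z)"
  proof (rule integral_mono_AE)
    show "integrable lborel (\<lambda>z. (indicator {x..y} z - (y - x) / 2) * h t z)"
      using i1 hi by (simp add: left_diff_distrib)
    show "integrable lborel (\<lambda>z. (CH_kernel (y - z) - CH_kernel (x - z)) * h t z)"
      using kernel_h_integrable[OF g] by (simp add: left_diff_distrib)
    show "AE z in lborel. (indicator {x..y} z - (y - x) / 2) * h t z \<le> (CH_kernel (y - z) - CH_kernel (x - z)) * h t z"
      using AE_lborel_not_in[of x y]
      by eventually_elim (use CH_kernel_diff_lower[OF xy] h_nonneg in \<open>auto intro!: mult_right_mono\<close>)
  qed
  also have "\<dots> = F t y - F t x"
    using kernel_h_integrable[OF g] by (simp add: F_eq left_diff_distrib)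
  finally have "(LINT z:{x..y}|lborel. h t z) - (y - x) / 2 * (LINT z|lborel. h t z) \<le> F t y - F t x" .
  moreover have "(y - x) / 2 * (LINT z|lborel. h t z) \<le> (y - x) / 2 * C"
    using good_h(2)[OF g] xy by (intro mult_left_mono) auto
  moreover have "(y - x) / 2 * C = C / 2 * (y - x)" by simp
  ultimately show ?thesis by linarith
qed

lemma CH_kernel_cont: "z \<noteq> 0 \<Longrightarrow> isCont CH_kernel z"
  unfolding CH_kernel_def[abs_def] by (intro continuous_intros) auto

lemma F_tendsto:
  assumes g: "good t" and x: "x \<longlonglongrightarrow> z"
  shows "(\<lambda>n. F t (x n)) \<longlonglongrightarrow> F t z"
  unfolding F_eq
proof (rule integral_dominated_convergence[OF _ _ good_h(1)[OF g]])
  have [measurable]: "h t \<in> borel_measurable borel" using h_measurable good_nonneg g by simp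
  show "(\<lambda>y. CH_kernel (z - y) * h t y) \<in> borel_measurable lborel"
    "(\<lambda>y. CH_kernel (x n - y) * h t y) \<in> borel_measurable lborel" for n by measurable
  show "AE y in lborel. norm (CH_kernel (x n - y) * h t y) \<le> h t y" for n
    using CH_kernel_bound h_nonneg by (intro AE_I2) (auto simp: abs_mult intro!: mult_left_le_one_le order_trans[OF CH_kernel_bound])
  show "AE y in lborel. (\<lambda>n. CH_kernel (x n - y) * h t y) \<longlonglongrightarrow> CH_kernel (z - y) * h t y"
    using AE_lborel_singleton[of z]
  proof eventually_elim
    case (elim y)
    have "(\<lambda>n. CH_kernel (x n - y)) \<longlonglongrightarrow> CH_kernel (z - y)"
      using elim by (intro isCont_tendsto_compose[OF CH_kernel_cont] tendsto_intros x) auto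
    then show ?case by (rule tendsto_mult_right)
  qed
qed

lemma F_cont: "good t \<Longrightarrow> continuous_on S (F t)"
  unfolding continuous_on_sequentially using F_tendsto by (auto simp: o_def)

end

section \<open>Spatial averages of a weak solution\<close>

text \<open>
  Fubini's theorem in the form used for the weak equation, where sections are controlled at
  almost every time only.
\<close>
lemma integrable_prodI:
  fixes \<Phi> :: "real \<times> real \<Rightarrow> real"
  assumes \<Phi>: "\<Phi> \<in> borel_measurable borel"
    and supp: "\<And>t x. t \<notin> {a..b} \<Longrightarrow> \<Phi> (t, x) = 0"
    and sec: "AE t in lborel. t \<in> {a..b} \<longrightarrow>
      integrable lborel (\<lambda>x. \<Phi> (t, x)) \<and> (LINT x|lborel. \<bar>\<Phi> (t, x)\<bar>) \<le> B"
  shows "integrable lborel \<Phi>"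
    and "(LINT p|lborel. \<Phi> p) = (LINT t|lborel. LINT x|lborel. \<Phi> (t, x))"
    and "integrable lborel (\<lambda>t. LINT x|lborel. \<Phi> (t, x))"
proof -
  have m: "\<Phi> \<in> borel_measurable (lborel \<Otimes>\<^sub>M lborel)"
    using \<Phi> by (simp add: lborel_prod)
  have mt: "(\<lambda>t. LINT x|lborel. \<bar>\<Phi> (t, x)\<bar>) \<in> borel_measurable lborel"
  proof (rule lborel.borel_measurable_lebesgue_integral)
    have "(\<lambda>p. \<bar>\<Phi> p\<bar>) \<in> borel_measurable (lborel \<Otimes>\<^sub>M lborel)" by (rule borel_measurable_abs[OF m])
    then show "(\<lambda>(t, x). \<bar>\<Phi> (t, x)\<bar>) \<in> borel_measurable (lborel \<Otimes>\<^sub>M lborel)" by (simp add: case_prod_unfold)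
  qed
  have *: "integrable (lborel \<Otimes>\<^sub>M lborel) \<Phi>"
  proof (rule lborel_pair.Fubini_integrable[OF m])
    show "integrable lborel (\<lambda>t. LINT x|lborel. norm (\<Phi> (t, x)))"
    proof (rule Bochner_Integration.integrable_bound)
      show "integrable lborel (\<lambda>t. indicator {a..b} t * B)"
        by (intro integrable_mult_left integrable_real_indicator) (auto simp: emeasure_lborel_Icc_eq)
      show "(\<lambda>t. LINT x|lborel. norm (\<Phi> (t, x))) \<in> borel_measurable lborel" using mt by simp
      show "AE t in lborel. norm (LINT x|lborel. norm (\<Phi> (t, x))) \<le> norm (indicator {a..b} t * B)"
        using sec
      proof eventually_elim
        case (elim t)
        have "0 \<le> (LINT x|lborel. \<bar>\<Phi> (t, x)\<bar>)" by simp
        then show ?case using elim supp[of t] by (cases "t \<in> {a..b}") auto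
      qed
    qed
    show "AE t in lborel. integrable lborel (\<lambda>x. \<Phi> (t, x))"
      using sec
    proof eventually_elim
      case (elim t)
      have "(\<lambda>x. \<Phi> (t, x)) = (\<lambda>x. 0)" if "t \<notin> {a..b}" using supp[OF that] by auto
      then show ?case using elim by (cases "t \<in> {a..b}") auto
    qed
  qed
  then show "integrable lborel \<Phi>" by (simp add: lborel_prod)
  show "(LINT p|lborel. \<Phi> p) = (LINT t|lborel. LINT x|lborel. \<Phi> (t, x))"
    using lborel_pair.integral_fst'[OF *] by (simp add: lborel_prod)
  show "integrable lborel (\<lambda>t. LINT x|lborel. \<Phi> (t, x))"
    using lborel_pair.integrable_fst'[OF *] .
qed

text \<open>
  Weights for averages over an interval. Smooth plateaus are admissible in the weak formulation;
  indicators are what the argument needs in the end.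
\<close>
definition window :: "real \<Rightarrow> real \<Rightarrow> (real \<Rightarrow> real) \<Rightarrow> bool" where
  "window a b \<eta> \<longleftrightarrow> a \<le> b \<and> \<eta> \<in> borel_measurable borel \<and> (\<forall>x. 0 \<le> \<eta> x \<and> \<eta> x \<le> 1) \<and> (\<forall>x. x \<notin> {a..b} \<longrightarrow> \<eta> x = 0)"

lemma window_indicator: "a \<le> b \<Longrightarrow> window a b (indicator {a..b})"
  by (auto simp: window_def)

lemma window_plateau: "a < b \<Longrightarrow> window a b (plateau a b n)"
  using plateau_bounds plateau_outside C_k_continuous[OF C_k_plateau[of 0 a b n]]
  by (auto simp: window_def intro!: borel_measurable_continuous_onI)

lemma window_le_indicator: "window a b \<eta> \<Longrightarrow> \<bar>\<eta> x\<bar> \<le> indicator {a..b} x"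
  unfolding window_def by (cases "x \<in> {a..b}") auto

lemma window_mult:
  fixes f :: "real \<Rightarrow> real"
  assumes w: "window a b \<eta>" and f: "set_integrable lborel {a..b} f"
  shows "integrable lborel (\<lambda>x. f x * \<eta> x)"
    and "(LINT x|lborel. \<bar>f x * \<eta> x\<bar>) \<le> (LINT x:{a..b}|lborel. \<bar>f x\<bar>)"
proof -
  have fi: "integrable lborel (\<lambda>x. indicator {a..b} x * f x)"
    using f by (simp add: set_integrable_def)
  have eq: "f x * \<eta> x = (indicator {a..b} x * f x) * \<eta> x" for x
    using w by (auto simp: window_def indicator_def)
  have fm: "(\<lambda>x. indicator {a..b} x * f x) \<in> borel_measurable lborel" using fi by auto
  have \<eta>m: "\<eta> \<in> borel_measurable lborel" using w by (simp add: window_def)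
  have le: "\<bar>f x * \<eta> x\<bar> \<le> indicator {a..b} x * \<bar>f x\<bar>" for x
    using mult_left_mono[OF window_le_indicator[OF w, of x], of "\<bar>f x\<bar>"] by (simp add: abs_mult mult.commute)
  show i: "integrable lborel (\<lambda>x. f x * \<eta> x)"
  proof (rule Bochner_Integration.integrable_bound[OF fi])
    show "(\<lambda>x. f x * \<eta> x) \<in> borel_measurable lborel"
      unfolding eq by (intro borel_measurable_times fm \<eta>m)
    show "AE x in lborel. norm (f x * \<eta> x) \<le> norm (indicator {a..b} x * f x)"
      using le by (intro AE_I2) (auto simp: abs_mult)
  qed
  show "(LINT x|lborel. \<bar>f x * \<eta> x\<bar>) \<le> (LINT x:{a..b}|lborel. \<bar>f x\<bar>)"
    unfolding set_lebesgue_integral_def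
    by (rule integral_mono) (use i set_integrable_abs[OF f] le in \<open>auto simp: set_integrable_def\<close>)
qed

context CH_solution
begin

text \<open>
  The rate of change of \<open>u\<close> at a fixed point of space: source minus transport.
\<close>
definition flux :: "real \<Rightarrow> real \<Rightarrow> real" where "flux t x = G t x - U t x * V t x"

lemma flux_compose[measurable (raw)]:
  "f \<in> borel_measurable M' \<Longrightarrow> g \<in> borel_measurable M' \<Longrightarrow> (\<lambda>z. flux (f z) (g z)) \<in> borel_measurable M'"
  unfolding flux_def by (intro borel_measurable_diff borel_measurable_times G_compose U_compose V_compose)

lemma G_section:
  assumes g: "good t" and ab: "a \<le> b"
  shows "set_integrable lborel {a..b} (G t)" "(LINT x:{a..b}|lborel. \<bar>G t x\<bar>) \<le> C / 2 * (b - a)"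
proof -
  note t = good_nonneg[OF g]
  have b: "\<bar>G t x\<bar> \<le> C / 2" for x using F_bound[OF g] t by (simp add: UVGH)
  show i: "set_integrable lborel {a..b} (G t)"
    using t F_cont[OF g] by (simp add: UVGH borel_integrable_atLeastAtMost')
  have "(LINT x:{a..b}|lborel. \<bar>G t x\<bar>) \<le> (LINT x:{a..b}|lborel. C / 2)"
    by (rule set_integral_mono[OF set_integrable_abs[OF i] set_integrable_const_Icc b])
  then show "(LINT x:{a..b}|lborel. \<bar>G t x\<bar>) \<le> C / 2 * (b - a)"
    using ab by (simp add: set_lebesgue_integral_def mult.commute)
qed

lemma UV_section:
  assumes g: "good t" and ab: "a \<le> b"
  shows "set_integrable lborel {a..b} (\<lambda>x. U t x * V t x)"
    "(LINT x:{a..b}|lborel. \<bar>U t x * V t x\<bar>) \<le> M * sqrt (2 * C * (b - a))"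
proof -
  note t = good_nonneg[OF g]
  have v: "set_integrable lborel {a..b} (\<lambda>x. M * \<bar>ux t x\<bar>)"
    using locally_integrableD[OF ux_locally_integrable[OF t]] by (intro set_integrable_mult_right set_integrable_abs)
  have le: "\<bar>u t x * ux t x\<bar> \<le> M * \<bar>ux t x\<bar>" for x
    using u_bound[OF t, of x] by (simp add: abs_mult mult_right_mono)
  have [measurable]: "u t \<in> borel_measurable borel" "ux t \<in> borel_measurable borel"
    using u_measurable ux_measurable t by auto
  have i: "set_integrable lborel {a..b} (\<lambda>x. u t x * ux t x)"
    by (rule set_integrable_bound[OF v]) (use le M_pos in \<open>auto simp: set_borel_measurable_def abs_mult\<close>)
  then show "set_integrable lborel {a..b} (\<lambda>x. U t x * V t x)" using t by (simp add: UVGH)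
  have "(LINT x:{a..b}|lborel. \<bar>u t x * ux t x\<bar>) \<le> (LINT x:{a..b}|lborel. M * \<bar>ux t x\<bar>)"
    by (rule set_integral_mono[OF set_integrable_abs[OF i] v]) (use le in auto)
  also have "\<dots> = M * (LINT x:{a..b}|lborel. \<bar>ux t x\<bar>)" by simp
  also have "\<dots> \<le> M * sqrt (2 * C * (b - a))"
    using M_pos by (intro mult_left_mono integral_abs_ux_le g ab) auto
  finally show "(LINT x:{a..b}|lborel. \<bar>U t x * V t x\<bar>) \<le> M * sqrt (2 * C * (b - a))"
    using t by (simp add: UVGH)
qed

text \<open>
  Bounds the integral of \<open>\<bar>flux t\<bar>\<close> over intervals of length \<open>d\<close> at good times: the source is
  bounded, and the transport term is estimated by Cauchy-Schwarz.
\<close>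
definition flux_bound :: "real \<Rightarrow> real" where
  "flux_bound d = C / 2 * d + M * sqrt (2 * C * d)"

lemma flux_section:
  assumes g: "good t" and ab: "a \<le> b"
  shows "set_integrable lborel {a..b} (flux t)" "(LINT x:{a..b}|lborel. \<bar>flux t x\<bar>) \<le> flux_bound (b - a)"
proof -
  note 1 = G_section[OF g ab] and 2 = UV_section[OF g ab]
  show i: "set_integrable lborel {a..b} (flux t)"
    unfolding flux_def[abs_def] by (intro set_integral_diff(1) 1 2)
  have "(LINT x:{a..b}|lborel. \<bar>flux t x\<bar>) \<le> (LINT x:{a..b}|lborel. \<bar>G t x\<bar> + \<bar>U t x * V t x\<bar>)"
    by (rule set_integral_mono) (use i 1 2 in \<open>auto simp: flux_def intro!: set_integrable_abs set_integral_add(1)\<close>)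
  also have "\<dots> = (LINT x:{a..b}|lborel. \<bar>G t x\<bar>) + (LINT x:{a..b}|lborel. \<bar>U t x * V t x\<bar>)"
    by (intro set_integral_add(2) set_integrable_abs 1 2)
  finally show "(LINT x:{a..b}|lborel. \<bar>flux t x\<bar>) \<le> flux_bound (b - a)"
    using 1 2 by (simp add: flux_bound_def)
qed

lemma flux_window:
  assumes g: "good t" and w: "window a b \<eta>"
  shows "integrable lborel (\<lambda>x. flux t x * \<eta> x)" "(LINT x|lborel. \<bar>flux t x * \<eta> x\<bar>) \<le> flux_bound (b - a)"
    "\<bar>LINT x|lborel. flux t x * \<eta> x\<bar> \<le> flux_bound (b - a)"
proof -
  have ab: "a \<le> b" using w by (simp add: window_def)
  note f = flux_section[OF g ab] and m = window_mult[OF w]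
  show "integrable lborel (\<lambda>x. flux t x * \<eta> x)" by (rule m(1)[OF f(1)])
  show 2: "(LINT x|lborel. \<bar>flux t x * \<eta> x\<bar>) \<le> flux_bound (b - a)" using m(2)[OF f(1)] f(2) by simp
  have "\<bar>LINT x|lborel. flux t x * \<eta> x\<bar> \<le> (LINT x|lborel. \<bar>flux t x * \<eta> x\<bar>)"
    using integral_norm_bound[of lborel "\<lambda>x. flux t x * \<eta> x"] by simp
  from this 2 show "\<bar>LINT x|lborel. flux t x * \<eta> x\<bar> \<le> flux_bound (b - a)" by (rule order_trans)
qed

lemma AE_good_Icc: "0 \<le> a \<Longrightarrow> AE t in lborel. t \<in> {a..b} \<longrightarrow> good t"
  using AE_good by eventually_elim auto

lemma flux_time_integrable:
  assumes w: "window a b \<eta>" and T: "0 \<le> t1"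
  shows "set_integrable lborel {t1..t2} (\<lambda>t. LINT x|lborel. flux t x * \<eta> x)"
proof -
  have [measurable]: "\<eta> \<in> borel_measurable borel" using w by (simp add: window_def)
  have "integrable lborel (\<lambda>t. LINT x|lborel. (case (t, x) of (t, x) \<Rightarrow> indicator {t1..t2} t * (flux t x * \<eta> x)))"
  proof (rule integrable_prodI(3)[where a=t1 and b=t2 and B="flux_bound (b - a)"])
    show "(\<lambda>(t, x). indicator {t1..t2} t * (flux t x * \<eta> x)) \<in> borel_measurable borel"
      by (simp add: borel_prod[symmetric])
    show "AE t in lborel. t \<in> {t1..t2} \<longrightarrow> integrable lborel (\<lambda>x. case (t, x) of (t, x) \<Rightarrow> indicator {t1..t2} t * (flux t x * \<eta> x))
       \<and> (LINT x|lborel. \<bar>case (t, x) of (t, x) \<Rightarrow> indicator {t1..t2} t * (flux t x * \<eta> x)\<bar>) \<le> flux_bound (b - a)"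
      using AE_good_Icc[OF T, of t2] by eventually_elim (use flux_window[OF _ w] in simp)
  qed auto
  then show ?thesis by (simp add: set_integrable_def)
qed

lemma u_section_bound:
  assumes t: "0 \<le> t" and w: "window a b \<eta>"
  shows "integrable lborel (\<lambda>x. u t x * \<eta> x)" "(LINT x|lborel. \<bar>u t x * \<eta> x\<bar>) \<le> M * (b - a)"
proof -
  have ab: "a \<le> b" using w by (simp add: window_def)
  have i: "set_integrable lborel {a..b} (u t)" by (rule borel_integrable_atLeastAtMost') (rule u_cont_x[OF t])
  show "integrable lborel (\<lambda>x. u t x * \<eta> x)" by (rule window_mult(1)[OF w i])
  have "(LINT x:{a..b}|lborel. \<bar>u t x\<bar>) \<le> (LINT x:{a..b}|lborel. M)"
    by (rule set_integral_mono[OF set_integrable_abs[OF i] set_integrable_const_Icc u_bound[OF t]])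
  then show "(LINT x|lborel. \<bar>u t x * \<eta> x\<bar>) \<le> M * (b - a)"
    using window_mult(2)[OF w i] ab by (simp add: set_lebesgue_integral_def mult.commute)
qed

lemma averaged_u_cont:
  assumes w: "window a b \<eta>"
  shows "continuous_on {0..} (\<lambda>t. LINT x|lborel. u t x * \<eta> x)"
  unfolding continuous_on_sequentially o_def
proof (intro allI ballI impI, elim conjE)
  fix s :: "nat \<Rightarrow> real" and t assume t: "t \<in> {0..}" and s: "\<forall>n. s n \<in> {0..}" "s \<longlonglongrightarrow> t"
  have [measurable]: "\<eta> \<in> borel_measurable borel" using w by (simp add: window_def)
  have um: "u r \<in> borel_measurable borel" if "0 \<le> r" for r using u_measurable[OF that] .
  show "(\<lambda>n. LINT x|lborel. u (s n) x * \<eta> x) \<longlonglongrightarrow> (LINT x|lborel. u t x * \<eta> x)"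
  proof (rule integral_dominated_convergence[where w="\<lambda>x. M * indicator {a..b} x"])
    show "integrable lborel (\<lambda>x. M * indicator {a..b} x)"
      by (intro integrable_mult_right integrable_real_indicator) (auto simp: emeasure_lborel_Icc_eq)
    show "(\<lambda>x. u t x * \<eta> x) \<in> borel_measurable lborel" using um[of t] t by simp
    show "(\<lambda>x. u (s n) x * \<eta> x) \<in> borel_measurable lborel" for n using um[of "s n"] s by simp
    show "AE x in lborel. (\<lambda>n. u (s n) x * \<eta> x) \<longlonglongrightarrow> u t x * \<eta> x"
    proof (intro AE_I2 tendsto_mult_right)
      fix x
      have "continuous_on {0..} (\<lambda>t. u t x)" by (intro u_cont_compose continuous_intros) auto
      then show "(\<lambda>n. u (s n) x) \<longlonglongrightarrow> u t x"
        using s t unfolding continuous_on_sequentially o_def by blast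
    qed
    show "AE x in lborel. norm (u (s n) x * \<eta> x) \<le> M * indicator {a..b} x" for n
    proof (rule AE_I2)
      fix x show "norm (u (s n) x * \<eta> x) \<le> M * indicator {a..b} x"
        using u_bound[of "s n" x] s window_le_indicator[OF w, of x] M_pos
        by (auto simp: abs_mult intro!: mult_mono)
    qed
  qed
qed

text \<open>
  Test the equation with the tensor product of \<open>\<psi>\<close> and a plateau, and integrate over space
  first.
\<close>
lemma averaged_weak_derivative:
  assumes ab: "a < b" and \<psi>: "test_function_on {0<..} \<psi>"
  shows "(LINT t|lborel. (LINT x|lborel. u t x * plateau a b n x) * deriv \<psi> t)
      = - (LINT t|lborel. (LINT x|lborel. flux t x * plateau a b n x) * \<psi> t)"
proof -
  define \<eta> where "\<eta> = plateau a b n"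
  have w: "window a b \<eta>" unfolding \<eta>_def by (rule window_plateau[OF ab])
  have \<eta>m[measurable]: "\<eta> \<in> borel_measurable borel" using w by (simp add: window_def)
  obtain \<psi>' K B where K: "compact K" "K \<subseteq> {0<..}" and d: "\<And>t. (\<psi> has_real_derivative \<psi>' t) (at t)"
    and cont: "continuous_on UNIV \<psi>" "continuous_on UNIV \<psi>'"
    and B: "0 \<le> B" "\<And>t. \<bar>\<psi> t\<bar> \<le> B" "\<And>t. \<bar>\<psi>' t\<bar> \<le> B"
    and zK: "\<And>t. t \<notin> K \<Longrightarrow> \<psi> t = 0" "\<And>t. t \<notin> K \<Longrightarrow> \<psi>' t = 0"
    by (rule test_function_derivative[OF \<psi>]) (rule that)
  obtain T where T: "\<And>t. t \<in> K \<Longrightarrow> t \<le> T" using compact_imp_bounded[OF K(1)]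
    by (meson bounded_has_Sup(1) UNIV_I bounded_imp_bdd_above bdd_above_def)
  have deriv: "deriv \<psi> t = \<psi>' t" for t using d by (rule DERIV_imp_deriv)
  have m[measurable]: "\<psi> \<in> borel_measurable borel" "\<psi>' \<in> borel_measurable borel"
    using cont by (auto intro: borel_measurable_continuous_onI)
  have z: "\<psi> t = 0" "\<psi>' t = 0" if "t \<notin> {0..T}" for t
    using that K(2) T by (force intro: zK)+
  have z0: "\<psi> t = 0" "\<psi>' t = 0" if "t < 0" for t using z[of t] that by auto
  \<comment> \<open>The three terms of the weak equation: \<open>- u \<phi>_t\<close> (up to sign), \<open>u u_x \<phi>\<close> and \<open>F \<phi>\<close>.\<close>
  define \<Phi>1 where "\<Phi>1 = (\<lambda>(t, x). U t x * \<psi>' t * \<eta> x)"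
  define \<Phi>2 where "\<Phi>2 = (\<lambda>(t, x). U t x * V t x * (\<psi> t * \<eta> x))"
  define \<Phi>3 where "\<Phi>3 = (\<lambda>(t, x). G t x * (\<psi> t * \<eta> x))"
  have meas: "\<Phi>1 \<in> borel_measurable borel" "\<Phi>2 \<in> borel_measurable borel" "\<Phi>3 \<in> borel_measurable borel"
    unfolding \<Phi>1_def \<Phi>2_def \<Phi>3_def by (simp_all add: borel_prod[symmetric])
  have scaled: "integrable lborel (\<lambda>x. c * f x) \<and> (LINT x|lborel. \<bar>c * f x\<bar>) \<le> B * L"
    if "integrable lborel f" "(LINT x|lborel. \<bar>f x\<bar>) \<le> L" "\<bar>c\<bar> \<le> B" for f :: "real \<Rightarrow> real" and c L
  proof -
    have "(LINT x|lborel. \<bar>c * f x\<bar>) = \<bar>c\<bar> * (LINT x|lborel. \<bar>f x\<bar>)" by (simp add: abs_mult)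
    also have "\<dots> \<le> B * L" using that by (intro mult_mono) (auto intro: order_trans[OF abs_ge_zero])
    finally show ?thesis using that by simp
  qed
  have sec1: "AE t in lborel. t \<in> {0..T} \<longrightarrow> integrable lborel (\<lambda>x. \<Phi>1 (t, x)) \<and>
      (LINT x|lborel. \<bar>\<Phi>1 (t, x)\<bar>) \<le> B * (M * (b - a))"
  proof (intro AE_I2 impI)
    fix t assume "t \<in> {0..T}"
    then have t: "0 \<le> t" by simp
    have "\<Phi>1 (t, x) = \<psi>' t * (u t x * \<eta> x)" for x using t by (simp add: \<Phi>1_def UVGH)
    then show "integrable lborel (\<lambda>x. \<Phi>1 (t, x)) \<and> (LINT x|lborel. \<bar>\<Phi>1 (t, x)\<bar>) \<le> B * (M * (b - a))"
      using scaled[OF u_section_bound[OF t w] B(3)] by simp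
  qed
  have sec2: "AE t in lborel. t \<in> {0..T} \<longrightarrow> integrable lborel (\<lambda>x. \<Phi>2 (t, x)) \<and>
      (LINT x|lborel. \<bar>\<Phi>2 (t, x)\<bar>) \<le> B * (M * sqrt (2 * C * (b - a)))"
    using AE_good_Icc[of 0 T, simplified]
  proof eventually_elim
    case (elim t)
    show ?case
    proof
      assume "t \<in> {0..T}"
      then have g: "good t" using elim by auto
      note uv = UV_section[OF g less_imp_le[OF ab]]
      have "\<Phi>2 (t, x) = \<psi> t * (U t x * V t x * \<eta> x)" for x by (simp add: \<Phi>2_def)
      then show "integrable lborel (\<lambda>x. \<Phi>2 (t, x)) \<and> (LINT x|lborel. \<bar>\<Phi>2 (t, x)\<bar>) \<le> B * (M * sqrt (2 * C * (b - a)))"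
        using scaled[OF window_mult(1)[OF w uv(1)] order_trans[OF window_mult(2)[OF w uv(1)] uv(2)] B(2)[of t]] by simp
    qed
  qed
  have sec3: "AE t in lborel. t \<in> {0..T} \<longrightarrow> integrable lborel (\<lambda>x. \<Phi>3 (t, x)) \<and>
      (LINT x|lborel. \<bar>\<Phi>3 (t, x)\<bar>) \<le> B * (C / 2 * (b - a))"
    using AE_good_Icc[of 0 T, simplified]
  proof eventually_elim
    case (elim t)
    show ?case
    proof
      assume "t \<in> {0..T}"
      then have g: "good t" using elim by auto
      note uv = G_section[OF g less_imp_le[OF ab]]
      have "\<Phi>3 (t, x) = \<psi> t * (G t x * \<eta> x)" for x by (simp add: \<Phi>3_def)
      then show "integrable lborel (\<lambda>x. \<Phi>3 (t, x)) \<and> (LINT x|lborel. \<bar>\<Phi>3 (t, x)\<bar>) \<le> B * (C / 2 * (b - a))"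
        using scaled[OF window_mult(1)[OF w uv(1)] order_trans[OF window_mult(2)[OF w uv(1)] uv(2)] B(2)[of t]] by simp
    qed
  qed
  have s1: "t \<notin> {0..T} \<Longrightarrow> \<Phi>1 (t, x) = 0" and s2: "t \<notin> {0..T} \<Longrightarrow> \<Phi>2 (t, x) = 0"
    and s3: "t \<notin> {0..T} \<Longrightarrow> \<Phi>3 (t, x) = 0" for t x using z[of t] by (auto simp: \<Phi>1_def \<Phi>2_def \<Phi>3_def)
  note P1 = integrable_prodI[OF meas(1) s1 sec1] and P2 = integrable_prodI[OF meas(2) s2 sec2]
    and P3 = integrable_prodI[OF meas(3) s3 sec3]
  have test: "test_function_on ({0<..} \<times> UNIV) (\<lambda>p. \<psi> (fst p) * \<eta> (snd p))"
    unfolding \<eta>_def by (intro test_function_on_tensor \<psi> test_function_plateau ab) simp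
  have dp: "deriv (\<lambda>s. \<psi> s * \<eta> x) t = \<psi>' t * \<eta> x" for t x
    by (rule DERIV_imp_deriv) (rule DERIV_cmult_right[OF d])
  have weak: "(LINT (t, x)|lborel. - u t x * (\<psi>' t * \<eta> x) + u t x * ux t x * (\<psi> t * \<eta> x)) =
      (LINT (t, x)|lborel. F t x * (\<psi> t * \<eta> x))"
  proof -
    have "\<forall>\<phi>::real \<times> real \<Rightarrow> real. test_function_on ({0<..} \<times> UNIV) \<phi> \<longrightarrow>
        (LINT (t, x)|lborel. - u t x * deriv (\<lambda>s. \<phi> (s, x)) t + u t x * ux t x * \<phi> (t, x)) =
        (LINT (t, x)|lborel. F t x * \<phi> (t, x))"
      using weak_solution unfolding CH_weak_solution_def by blast
    from this[rule_format, OF test] show ?thesis by (simp add: dp)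
  qed
  have e1: "(\<lambda>(t, x). - u t x * (\<psi>' t * \<eta> x) + u t x * ux t x * (\<psi> t * \<eta> x)) = (\<lambda>p. \<Phi>2 p - \<Phi>1 p)"
    using z0 by (auto simp: \<Phi>1_def \<Phi>2_def U_def V_def fun_eq_iff)
  have e3: "(\<lambda>(t, x). F t x * (\<psi> t * \<eta> x)) = \<Phi>3"
  proof -
    have "F t x * (\<psi> t * \<eta> x) = \<Phi>3 (t, x)" for t x
      using z0(1)[of t] UVGH(4)[of t] by (cases "0 \<le> t") (auto simp: \<Phi>3_def)
    then show ?thesis by auto
  qed
  have "(LINT p|lborel. \<Phi>2 p) - (LINT p|lborel. \<Phi>1 p) = (LINT p|lborel. \<Phi>3 p)"
    using weak unfolding e1 e3 using P1(1) P2(1) by simp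
  then have "(LINT p|lborel. \<Phi>1 p) = - ((LINT p|lborel. \<Phi>3 p) - (LINT p|lborel. \<Phi>2 p))" by simp
  also have "(LINT p|lborel. \<Phi>3 p) - (LINT p|lborel. \<Phi>2 p) = (LINT t|lborel. (LINT x|lborel. \<Phi>3 (t, x)) - (LINT x|lborel. \<Phi>2 (t, x)))"
    using Bochner_Integration.integral_diff[OF P3(3) P2(3)] P2(2) P3(2) by simp
  also have "\<dots> = (LINT t|lborel. (LINT x|lborel. flux t x * \<eta> x) * \<psi> t)"
  proof (rule integral_cong_AE)
    show "(\<lambda>t. (LINT x|lborel. \<Phi>3 (t, x)) - (LINT x|lborel. \<Phi>2 (t, x))) \<in> borel_measurable lborel"
      using P2(3) P3(3) by (intro borel_measurable_diff) auto
    have [measurable]: "(\<lambda>t. LINT x|lborel. flux t x * \<eta> x) \<in> borel_measurable lborel"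
      by (rule lborel.borel_measurable_lebesgue_integral) measurable
    show "(\<lambda>t. (LINT x|lborel. flux t x * \<eta> x) * \<psi> t) \<in> borel_measurable lborel" by measurable
    show "AE t in lborel. (LINT x|lborel. \<Phi>3 (t, x)) - (LINT x|lborel. \<Phi>2 (t, x)) = (LINT x|lborel. flux t x * \<eta> x) * \<psi> t"
      using sec2 sec3
    proof eventually_elim
      case (elim t)
      show ?case
      proof (cases "t \<in> {0..T}")
        case True
        then have "(LINT x|lborel. \<Phi>3 (t, x)) - (LINT x|lborel. \<Phi>2 (t, x)) = (LINT x|lborel. \<Phi>3 (t, x) - \<Phi>2 (t, x))"
          using elim by simp
        also have "\<dots> = (LINT x|lborel. flux t x * \<eta> x * \<psi> t)"
          by (rule Bochner_Integration.integral_cong) (auto simp: \<Phi>2_def \<Phi>3_def flux_def algebra_simps)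
        finally show ?thesis by simp
      next
        case False
        then show ?thesis using z[of t] by (simp add: s2 s3)
      qed
    qed
  qed
  also have "(LINT p|lborel. \<Phi>1 p) = (LINT t|lborel. (LINT x|lborel. u t x * \<eta> x) * deriv \<psi> t)"
  proof -
    have "(LINT x|lborel. \<Phi>1 (t, x)) = (LINT x|lborel. u t x * \<eta> x) * deriv \<psi> t" for t
    proof (cases "0 \<le> t")
      case True
      have "(LINT x|lborel. \<Phi>1 (t, x)) = (LINT x|lborel. (u t x * \<eta> x) * \<psi>' t)"
        using True by (intro Bochner_Integration.integral_cong) (auto simp: \<Phi>1_def UVGH)
      then show ?thesis by (simp add: deriv)
    qed (use z0[of t] in \<open>simp add: \<Phi>1_def deriv\<close>)
    then have "(\<lambda>t. LINT x|lborel. \<Phi>1 (t, x)) = (\<lambda>t. (LINT x|lborel. u t x * \<eta> x) * deriv \<psi> t)" by (rule ext)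
    moreover have "(LINT p|lborel. \<Phi>1 p) = (LINT t|lborel. LINT x|lborel. \<Phi>1 (t, x))" using P1(2) by simp
    ultimately show ?thesis by (simp only:)
  qed
  finally show ?thesis unfolding \<eta>_def .
qed

lemma averaged_u_increment:
  assumes ab: "a < b" and t: "0 < t1" "t1 \<le> t2"
  shows "(LINT x|lborel. u t2 x * plateau a b n x) - (LINT x|lborel. u t1 x * plateau a b n x)
      = (LINT t:{t1..t2}|lborel. LINT x|lborel. flux t x * plateau a b n x)"
proof (rule weak_derivative_FTC[of "{0<..}"])
  show "continuous_on {0<..} (\<lambda>t. LINT x|lborel. u t x * plateau a b n x)"
    by (rule continuous_on_subset[OF averaged_u_cont[OF window_plateau[OF ab]]]) auto
  show "set_integrable lborel {c..d} (\<lambda>t. LINT x|lborel. flux t x * plateau a b n x)" if "{c..d} \<subseteq> {0<..}" for c d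
  proof (cases "c \<le> d")
    case True
    then have "c \<in> {0<..}" using that by (meson atLeastAtMost_iff order_refl subsetD)
    then show ?thesis using flux_time_integrable[OF window_plateau[OF ab], of c d n] by simp
  qed (simp add: set_integrable_def)
  show "(LINT t|lborel. (LINT x|lborel. u t x * plateau a b n x) * deriv \<phi> t) =
      - (LINT t|lborel. (LINT x|lborel. flux t x * plateau a b n x) * \<phi> t)" if "test_function_on {0<..} \<phi>" for \<phi>
    by (rule averaged_weak_derivative[OF ab that])
qed (use t in \<open>auto simp: is_interval_1\<close>)

end

section \<open>Primitives, and averages over intervals\<close>

lemma lebesgue_differentiation_DERIV:
  fixes f G :: "real \<Rightarrow> real"
  assumes f: "locally_integrable f"
    and G: "\<And>x y. x \<le> y \<Longrightarrow> G y - G x = (LINT t:{x..y}|lborel. f t)"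
  shows "AE x in lborel. (G has_real_derivative f x) (at x)"
proof -
  have "AE x in lborel. \<forall>e>0. \<exists>\<delta>>0. \<forall>a b. a \<le> x \<and> x \<le> b \<and> a < b \<and> b - a < \<delta> \<longrightarrow>
     \<bar>(G b - G a) / (b - a) - f x\<bar> \<le> e"
    using G by (rule lebesgue_differentiation[OF f])
  then show ?thesis
  proof eventually_elim
    case (elim x)
    show ?case unfolding has_field_derivative_def has_derivative_within_alt
    proof (intro conjI allI impI)
      show "bounded_linear ((*) (f x))" by (rule bounded_linear_mult_right)
      fix e :: real assume "e > 0"
      then obtain \<delta> where \<delta>: "\<delta> > 0" "\<And>a b. a \<le> x \<Longrightarrow> x \<le> b \<Longrightarrow> a < b \<Longrightarrow> b - a < \<delta> \<Longrightarrow> \<bar>(G b - G a) / (b - a) - f x\<bar> \<le> e"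
        using elim by meson
      have *: "\<bar>G b - G a - f x * (b - a)\<bar> \<le> e * (b - a)" if "a \<le> x" "x \<le> b" "b - a < \<delta>" for a b
      proof (cases "a < b")
        case True
        have "\<bar>(G b - G a) / (b - a) - f x\<bar> * (b - a) \<le> e * (b - a)"
          using \<delta>(2)[of a b] that True by (intro mult_right_mono) auto
        moreover have "\<bar>(G b - G a) / (b - a) - f x\<bar> * (b - a) = \<bar>((G b - G a) / (b - a) - f x) * (b - a)\<bar>"
          using True by (simp add: abs_mult)
        moreover have "((G b - G a) / (b - a) - f x) * (b - a) = G b - G a - f x * (b - a)"
          using True by (simp add: left_diff_distrib[of "(G b - G a) / (b - a)"])
        ultimately show ?thesis by simp
      next
        case False
        then have "a = b" using that by simp
        then show ?thesis by simp
      qed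
      show "\<exists>d>0. \<forall>y\<in>UNIV. norm (y - x) < d \<longrightarrow> norm (G y - G x - f x * (y - x)) \<le> e * norm (y - x)"
      proof (intro exI[of _ \<delta>] conjI ballI impI \<delta>)
        fix y assume "norm (y - x) < \<delta>"
        then show "norm (G y - G x - f x * (y - x)) \<le> e * norm (y - x)"
          by (cases "x \<le> y") (use *[of x y] in simp, use *[of y x] in \<open>simp add: abs_le_iff algebra_simps\<close>)
      qed
    qed
  qed
qed

text \<open>
  A primitive with signs, so that \<open>prim_diff\<close> holds on the whole line.
\<close>
definition prim :: "(real \<Rightarrow> real) \<Rightarrow> real \<Rightarrow> real" where
  "prim f x = (if 0 \<le> x then (LINT t:{0..x}|lborel. f t) else - (LINT t:{x..0}|lborel. f t))"

lemma set_integral_Icc_combine: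
  fixes f :: "real \<Rightarrow> real"
  assumes f: "locally_integrable f" and "a \<le> b" "b \<le> c"
  shows "(LINT t:{a..c}|lborel. f t) = (LINT t:{a..b}|lborel. f t) + (LINT t:{b..c}|lborel. f t)"
proof -
  have "(LINT t:{a..c}|lborel. f t) = (LINT t:{a..b} \<union> {b..c}|lborel. f t)"
    using assms by (simp add: ivl_disj_un_two_touch)
  also have "\<dots> = (LINT t:{a..b}|lborel. f t) + (LINT t:{b..c}|lborel. f t)"
  proof (rule set_integral_Un_AE)
    show "AE x in lborel. \<not> (x \<in> {a..b} \<and> x \<in> {b..c})"
      using AE_lborel_singleton[of b] by eventually_elim auto
  qed (auto intro: locally_integrableD[OF f])
  finally show ?thesis .
qed

lemma prim_diff:
  assumes f: "locally_integrable f" and xy: "x \<le> y"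
  shows "prim f y - prim f x = (LINT t:{x..y}|lborel. f t)"
proof -
  consider "0 \<le> x" | "x < 0" "0 \<le> y" | "y < 0" by linarith
  then show ?thesis
  proof cases
    case 1 then show ?thesis using set_integral_Icc_combine[OF f, of 0 x y] xy by (simp add: prim_def)
  next
    case 2 then show ?thesis using set_integral_Icc_combine[OF f, of x 0 y] by (simp add: prim_def)
  next
    case 3 then show ?thesis using set_integral_Icc_combine[OF f, of x y 0] xy by (simp add: prim_def)
  qed
qed

lemma locally_integrable_continuous: "continuous_on UNIV f \<Longrightarrow> locally_integrable f"
  unfolding locally_integrable_def
  by (intro allI borel_integrable_atLeastAtMost') (auto intro: continuous_on_subset)

lemma set_integral_const_Icc: "a \<le> b \<Longrightarrow> (LINT t:{a..b}|lborel. c) = c * (b - a :: real)"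
  by (simp add: set_lebesgue_integral_def)

lemma set_integral_near_const:
  fixes f :: "real \<Rightarrow> real"
  assumes f: "set_integrable lborel {a..b} f" and ab: "a \<le> b"
    and near: "AE t in lborel. t \<in> {a..b} \<longrightarrow> \<bar>f t - c\<bar> \<le> e"
  shows "\<bar>(LINT t:{a..b}|lborel. f t) - c * (b - a)\<bar> \<le> e * (b - a)"
proof -
  have i: "set_integrable lborel {a..b} (\<lambda>t. f t - c)"
    by (intro set_integral_diff(1) f set_integrable_const_Icc)
  have "(LINT t:{a..b}|lborel. f t) - c * (b - a) = (LINT t:{a..b}|lborel. f t - c)"
    using set_integral_diff(2)[OF f set_integrable_const_Icc[of a b c]] set_integral_const_Icc[OF ab, of c] by simp
  also have "\<bar>\<dots>\<bar> \<le> (LINT t:{a..b}|lborel. \<bar>f t - c\<bar>)"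
    using set_integral_norm_bound[OF i] by simp
  also have "\<dots> \<le> (LINT t:{a..b}|lborel. e)"
    by (rule set_integral_mono_AE[OF set_integrable_abs[OF i] set_integrable_const_Icc]) (use near in auto)
  finally show ?thesis using set_integral_const_Icc[OF ab, of e] by simp
qed

lemma prim_DERIV:
  assumes f: "continuous_on UNIV f"
  shows "(prim f has_real_derivative f x) (at x)"
  unfolding has_field_derivative_def has_derivative_within_alt
proof (intro conjI allI impI)
  show "bounded_linear ((*) (f x))" by (rule bounded_linear_mult_right)
  fix e :: real assume "e > 0"
  then obtain d where d: "d > 0" "\<And>y. dist y x < d \<Longrightarrow> dist (f y) (f x) < e"
    using f unfolding continuous_on_iff by (meson UNIV_I)
  note li = locally_integrable_continuous[OF f]
  have *: "\<bar>prim f b - prim f a - f x * (b - a)\<bar> \<le> e * (b - a)" if "a \<le> b" "\<bar>a - x\<bar> < d" "\<bar>b - x\<bar> < d" for a b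
    unfolding prim_diff[OF li that(1)]
  proof (rule set_integral_near_const[OF locally_integrableD[OF li] that(1)], intro AE_I2 impI)
    fix t assume "t \<in> {a..b}"
    then have "\<bar>t - x\<bar> < d" using that by (auto simp: abs_if split: if_splits)
    then show "\<bar>f t - f x\<bar> \<le> e" using d(2)[of t] by (simp add: dist_real_def)
  qed
  show "\<exists>d>0. \<forall>y\<in>UNIV. norm (y - x) < d \<longrightarrow> norm (prim f y - prim f x - f x * (y - x)) \<le> e * norm (y - x)"
  proof (intro exI[of _ d] conjI ballI impI d)
    fix y assume "norm (y - x) < d"
    then show "norm (prim f y - prim f x - f x * (y - x)) \<le> e * norm (y - x)"
      using *[of x y] *[of y x] d(1) by (cases "x \<le> y") (auto simp: algebra_simps abs_minus_commute)
  qed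
qed

lemma prim_increment:
  assumes f: "continuous_on UNIV f" and near: "\<And>t. min x y \<le> t \<Longrightarrow> t \<le> max x y \<Longrightarrow> \<bar>f t - c\<bar> \<le> e"
  shows "\<bar>prim f y - prim f x - c * (y - x)\<bar> \<le> e * \<bar>y - x\<bar>"
proof -
  note li = locally_integrable_continuous[OF f]
  have *: "\<bar>prim f b - prim f a - c * (b - a)\<bar> \<le> e * (b - a)" if "a \<le> b" "min x y \<le> a" "b \<le> max x y" for a b
    unfolding prim_diff[OF li that(1)]
    by (rule set_integral_near_const[OF locally_integrableD[OF li] that(1)], intro AE_I2 impI near) (use that in auto)
  show ?thesis by (cases "x \<le> y") (use *[of x y] in simp, use *[of y x] in \<open>simp add: abs_le_iff algebra_simps\<close>)
qed

lemma DERIV_difference_quotients: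
  assumes "(f has_real_derivative D) (at x)"
  shows "(\<lambda>n. (f (x + 1 / real (Suc n)) - f x) / (1 / real (Suc n))) \<longlonglongrightarrow> D"
proof -
  have "((\<lambda>h. (f (x + h) - f x) / h) \<longlongrightarrow> D) (at 0)" using assms by (simp add: DERIV_def)
  moreover have "filterlim (\<lambda>n. 1 / real (Suc n)) (at 0) sequentially"
    unfolding filterlim_at using LIMSEQ_inverse_real_of_nat by (simp add: inverse_eq_divide)
  ultimately show ?thesis by (rule filterlim_compose)
qed

text \<open>
  Test functions live in the open half plane \<open>t > 0\<close>; continuity extends their consequences to
  the initial time.
\<close>
lemma increment_formula_from_0:
  assumes D: "continuous_on {0..} (D :: real \<Rightarrow> real)" and g: "\<And>b. set_integrable lborel {0..b} g"
    and inc: "\<And>a b. 0 < a \<Longrightarrow> a \<le> b \<Longrightarrow> D b - D a = (LINT t:{a..b}|lborel. g t)"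
    and ab: "0 \<le> a" "a \<le> b"
  shows "D b - D a = (LINT t:{a..b}|lborel. g t)"
proof -
  consider "0 < a" | "a = 0" "b = 0" | "a = 0" "0 < b" using ab by linarith
  then show ?thesis
  proof cases
    case 1 then show ?thesis using inc ab by simp
  next
    case 2
    have "(LINT t:{0..0}|lborel. g t) = (LINT t|(lborel :: real measure). (0 :: real))"
      unfolding set_lebesgue_integral_def
    proof (rule integral_cong_AE)
      show "(\<lambda>t. indicator {0..0} t *\<^sub>R g t) \<in> borel_measurable lborel"
        using g[of 0] unfolding set_integrable_def by auto
      show "AE t in lborel. indicator {0..0} t *\<^sub>R g t = 0"
        using AE_lborel_singleton[of "0::real"] by eventually_elim auto
    qed simp
    then show ?thesis using 2 by simp
  next
    case 3
    define s where "s n = b / real (Suc n)" for n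
    have s: "0 < s n" "s n \<le> b" for n using 3 by (auto simp: s_def field_simps)
    have s0: "s \<longlonglongrightarrow> 0"
      using tendsto_mult_left[OF LIMSEQ_inverse_real_of_nat, of b] by (simp add: s_def[abs_def] divide_inverse)
    have gm: "(\<lambda>t. indicator {0..b} t *\<^sub>R g t) \<in> borel_measurable lborel" and gi: "integrable lborel (\<lambda>t. indicator {0..b} t *\<^sub>R g t)"
      using g[of b] unfolding set_integrable_def by auto
    have "(\<lambda>n. LINT t|lborel. indicator {s n..b} t *\<^sub>R g t) \<longlonglongrightarrow> (LINT t|lborel. indicator {0..b} t *\<^sub>R g t)"
    proof (rule integral_dominated_convergence[where w="\<lambda>t. norm (indicator {0..b} t *\<^sub>R g t)"])
      show "(\<lambda>t. indicator {s n..b} t *\<^sub>R g t) \<in> borel_measurable lborel" for n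
      proof -
        have "(\<lambda>t. indicator {s n..b} t *\<^sub>R (indicator {0..b} t *\<^sub>R g t)) \<in> borel_measurable lborel"
          by (intro borel_measurable_scaleR gm) auto
        also have "(\<lambda>t. indicator {s n..b} t *\<^sub>R (indicator {0..b} t *\<^sub>R g t)) = (\<lambda>t. indicator {s n..b} t *\<^sub>R g t)"
          using s(1)[of n] by (auto simp: indicator_def)
        finally show ?thesis .
      qed
      show "AE t in lborel. norm (indicator {s n..b} t *\<^sub>R g t) \<le> norm (indicator {0..b} t *\<^sub>R g t)" for n
        using s(1)[of n] by (intro AE_I2) (auto simp: indicator_def)
      show "AE t in lborel. (\<lambda>n. indicator {s n..b} t *\<^sub>R g t) \<longlonglongrightarrow> indicator {0..b} t *\<^sub>R g t"
        using AE_lborel_singleton[of "0::real"]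
      proof eventually_elim
        case (elim t)
        have "eventually (\<lambda>n. indicator {s n..b} t = (indicator {0..b} t :: real)) sequentially"
        proof (cases "t > 0")
          case True
          have "eventually (\<lambda>n. s n < t) sequentially" using order_tendstoD(2)[OF s0 True] .
          then show ?thesis by eventually_elim (use True in \<open>auto simp: indicator_def\<close>)
        next
          case False
          then have "t < 0" using elim by simp
          then have "t \<notin> {s n..b}" "t \<notin> {0..b}" for n using s(1)[of n] by auto
          then show ?thesis by simp
        qed
        then have "(\<lambda>n. indicator {s n..b} t) \<longlonglongrightarrow> (indicator {0..b} t :: real)" by (rule tendsto_eventually)
        then show ?case by (intro tendsto_scaleR tendsto_const)
      qed
    qed (use gm gi in auto)
    then have "(\<lambda>n. D b - D (s n)) \<longlonglongrightarrow> (LINT t:{0..b}|lborel. g t)"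
      using inc[OF s] by (simp add: set_lebesgue_integral_def)
    moreover have "(\<lambda>n. D b - D (s n)) \<longlonglongrightarrow> D b - D 0"
      by (intro tendsto_diff tendsto_const continuous_on_tendsto_compose[OF D s0]) (use s(1) in \<open>auto simp: less_imp_le\<close>)
    ultimately show ?thesis using 3 LIMSEQ_unique by blast
  qed
qed

lemma plateau_integral_tendsto:
  assumes ab: "a < b" and f: "set_integrable lborel {a..b} f"
  shows "(\<lambda>n. LINT x|lborel. f x * plateau a b n x) \<longlonglongrightarrow> (LINT x:{a..b}|lborel. f x)"
  unfolding set_lebesgue_integral_def
proof (rule integral_dominated_convergence[where w="\<lambda>x. norm (indicator {a..b} x *\<^sub>R f x)"])
  show "(\<lambda>x. indicator {a..b} x *\<^sub>R f x) \<in> borel_measurable lborel"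
    "integrable lborel (\<lambda>x. norm (indicator {a..b} x *\<^sub>R f x))"
    using f unfolding set_integrable_def by auto
  show "(\<lambda>x. f x * plateau a b n x) \<in> borel_measurable lborel" for n
    using window_mult(1)[OF window_plateau[OF ab] f] by auto
  show "AE x in lborel. norm (f x * plateau a b n x) \<le> norm (indicator {a..b} x *\<^sub>R f x)" for n
  proof (rule AE_I2)
    fix x show "norm (f x * plateau a b n x) \<le> norm (indicator {a..b} x *\<^sub>R f x)"
      using mult_left_mono[OF window_le_indicator[OF window_plateau[OF ab], of n x], of "\<bar>f x\<bar>"]
      by (simp add: abs_mult mult.commute)
  qed
  show "AE x in lborel. (\<lambda>n. f x * plateau a b n x) \<longlonglongrightarrow> indicator {a..b} x *\<^sub>R f x"
    using AE_lborel_not_in[of a b]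
  proof eventually_elim
    case (elim x)
    then have "indicator {a..b} x = (indicator {a<..<b} x :: real)" by (auto simp: indicator_def)
    then show ?case using tendsto_mult_left[OF plateau_tendsto[OF ab, of x], of "f x"] by (simp add: mult.commute)
  qed
qed

context CH_solution
begin

lemma u_li: "0 \<le> t \<Longrightarrow> locally_integrable (u t)"
  by (intro locally_integrable_continuous u_cont_x)

lemma flux_li: "good t \<Longrightarrow> locally_integrable (flux t)"
  unfolding locally_integrable_def
proof (intro allI)
  fix a b assume "good t" then show "set_integrable lborel {a..b} (flux t)"
    by (cases "a \<le> b") (simp add: flux_section(1), simp add: set_integrable_def)
qed

lemma flux_integral_le:
  assumes "good t" "a \<le> b" shows "\<bar>LINT x:{a..b}|lborel. flux t x\<bar> \<le> flux_bound (b - a)"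
  using set_integral_norm_bound[OF flux_section(1)[OF assms]] flux_section(2)[OF assms] by simp

lemma flux_window_time_integrable:
  assumes "0 \<le> t1" "a \<le> b"
  shows "set_integrable lborel {t1..t2} (\<lambda>t. LINT x:{a..b}|lborel. flux t x)"
  using flux_time_integrable[OF window_indicator[OF assms(2)] assms(1), of t2]
  by (simp add: set_lebesgue_integral_def mult.commute)

lemma u_window_cont:
  assumes "a \<le> b" shows "continuous_on {0..} (\<lambda>t. LINT x:{a..b}|lborel. u t x)"
  using averaged_u_cont[OF window_indicator[OF assms]] by (simp add: set_lebesgue_integral_def mult.commute)

text \<open>
  Passing from plateaus to the indicator of \<open>[a, b]\<close>: dominated convergence, with \<open>flux_bound\<close>
  as majorant.
\<close>
lemma u_window_increment:
  assumes ab: "a < b" and t: "0 \<le> t1" "t1 \<le> t2"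
  shows "(LINT x:{a..b}|lborel. u t2 x) - (LINT x:{a..b}|lborel. u t1 x)
      = (LINT t:{t1..t2}|lborel. LINT x:{a..b}|lborel. flux t x)"
proof (rule increment_formula_from_0[OF _ _ _ t])
  show "continuous_on {0..} (\<lambda>t. LINT x:{a..b}|lborel. u t x)" using ab by (intro u_window_cont) simp
  show "set_integrable lborel {0..c} (\<lambda>t. LINT x:{a..b}|lborel. flux t x)" for c
    using ab by (intro flux_window_time_integrable) auto
  fix c d :: real assume cd: "0 < c" "c \<le> d"
  have lu: "(\<lambda>n. LINT x|lborel. u t x * plateau a b n x) \<longlonglongrightarrow> (LINT x:{a..b}|lborel. u t x)" if "0 \<le> t" for t
    by (rule plateau_integral_tendsto[OF ab locally_integrableD[OF u_li[OF that]]])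
  have lf: "(\<lambda>n. LINT t|lborel. indicator {c..d} t *\<^sub>R (LINT x|lborel. flux t x * plateau a b n x)) \<longlonglongrightarrow>
      (LINT t|lborel. indicator {c..d} t *\<^sub>R (LINT x:{a..b}|lborel. flux t x))"
  proof (rule integral_dominated_convergence[where w="\<lambda>t. indicator {c..d} t *\<^sub>R flux_bound (b - a)"])
    show "integrable lborel (\<lambda>t. indicator {c..d} t *\<^sub>R flux_bound (b - a))"
      using set_integrable_const_Icc[of c d] unfolding set_integrable_def .
    show "(\<lambda>t. indicator {c..d} t *\<^sub>R (LINT x:{a..b}|lborel. flux t x)) \<in> borel_measurable lborel"
      using flux_window_time_integrable[of c a b d] cd ab unfolding set_integrable_def by auto
    show "(\<lambda>t. indicator {c..d} t *\<^sub>R (LINT x|lborel. flux t x * plateau a b n x)) \<in> borel_measurable lborel" for n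
      using flux_time_integrable[OF window_plateau[OF ab], of c d n] cd unfolding set_integrable_def by auto
    have good: "AE t in lborel. t \<in> {c..d} \<longrightarrow> good t" using AE_good_Icc[of c d] cd by simp
    show "AE t in lborel. norm (indicator {c..d} t *\<^sub>R (LINT x|lborel. flux t x * plateau a b n x)) \<le> indicator {c..d} t *\<^sub>R flux_bound (b - a)" for n
      using good by eventually_elim (use flux_window(3)[OF _ window_plateau[OF ab]] in \<open>auto simp: indicator_def\<close>)
    show "AE t in lborel. (\<lambda>n. indicator {c..d} t *\<^sub>R (LINT x|lborel. flux t x * plateau a b n x)) \<longlonglongrightarrow>
        indicator {c..d} t *\<^sub>R (LINT x:{a..b}|lborel. flux t x)"
      using good
    proof eventually_elim
      case (elim t)
      show ?case
      proof (cases "t \<in> {c..d}")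
        case True
        then have "good t" using elim by simp
        then show ?thesis
          by (intro tendsto_scaleR tendsto_const plateau_integral_tendsto[OF ab flux_section(1)]) (use ab in auto)
      qed simp
    qed
  qed
  have "(\<lambda>n. LINT t|lborel. indicator {c..d} t *\<^sub>R (LINT x|lborel. flux t x * plateau a b n x)) \<longlonglongrightarrow>
     (LINT x:{a..b}|lborel. u d x) - (LINT x:{a..b}|lborel. u c x)"
    using tendsto_diff[OF lu[of d] lu[of c]] cd averaged_u_increment[OF ab cd]
    by (simp add: set_lebesgue_integral_def)
  with lf show "(LINT x:{a..b}|lborel. u d x) - (LINT x:{a..b}|lborel. u c x) = (LINT t:{c..d}|lborel. LINT x:{a..b}|lborel. flux t x)"
    unfolding set_lebesgue_integral_def using LIMSEQ_unique by blast
qed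

end

section \<open>The equation along a solution curve\<close>

context CH_solution
begin

lemma prim_u_diff: "0 \<le> t \<Longrightarrow> x \<le> y \<Longrightarrow> prim (u t) y - prim (u t) x = (LINT z:{x..y}|lborel. u t z)"
  by (rule prim_diff[OF u_li])

lemma flux_bound_small:
  assumes "e > 0" obtains d where "d > 0" "\<And>r. 0 \<le> r \<Longrightarrow> r \<le> d \<Longrightarrow> flux_bound r \<le> e"
proof -
  have "isCont flux_bound 0" unfolding flux_bound_def[abs_def] by (intro continuous_intros)
  moreover have "flux_bound 0 = 0" by (simp add: flux_bound_def)
  ultimately obtain d where d: "d > 0" "\<And>r. \<bar>r\<bar> < d \<Longrightarrow> \<bar>flux_bound r\<bar> < e"
    using assms unfolding continuous_at_eps_delta by (metis diff_zero dist_real_def)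
  show thesis
  proof (rule that[of "d / 2"])
    fix r assume "0 \<le> r" "r \<le> d / 2"
    then have "\<bar>r\<bar> < d" using d(1) by simp
    from d(2)[OF this] show "flux_bound r \<le> e" by linarith
  qed (use d(1) in simp)
qed

text \<open>
  Two windows of equal length differ by two intervals of length \<open>\<bar>x - y\<bar>\<close>.
\<close>
lemma flux_window_shift:
  assumes g: "good t" and \<epsilon>: "0 \<le> \<epsilon>"
  shows "\<bar>(LINT z:{x..x+\<epsilon>}|lborel. flux t z) - (LINT z:{y..y+\<epsilon>}|lborel. flux t z)\<bar> \<le> 2 * flux_bound \<bar>x - y\<bar>"
proof -
  note li = flux_li[OF g]
  have *: "\<bar>prim (flux t) b - prim (flux t) a\<bar> \<le> flux_bound \<bar>b - a\<bar>" for a b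
    using flux_integral_le[OF g, of a b] flux_integral_le[OF g, of b a] prim_diff[OF li, of a b] prim_diff[OF li, of b a]
    by (cases "a \<le> b") (auto simp: abs_minus_commute)
  have "(LINT z:{x..x+\<epsilon>}|lborel. flux t z) = prim (flux t) (x + \<epsilon>) - prim (flux t) x"
    "(LINT z:{y..y+\<epsilon>}|lborel. flux t z) = prim (flux t) (y + \<epsilon>) - prim (flux t) y"
    using prim_diff[OF li] \<epsilon> by simp_all
  moreover have "\<bar>prim (flux t) (x + \<epsilon>) - prim (flux t) (y + \<epsilon>)\<bar> \<le> flux_bound \<bar>x - y\<bar>"
    using *[of "x + \<epsilon>" "y + \<epsilon>"] by simp
  moreover have "\<bar>prim (flux t) x - prim (flux t) y\<bar> \<le> flux_bound \<bar>x - y\<bar>" using * .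
  ultimately show ?thesis by linarith
qed

lemma u_near:
  assumes t: "0 \<le> t" and e: "e > 0"
  obtains d where "d > 0" "\<And>r y. 0 \<le> r \<Longrightarrow> \<bar>r - t\<bar> < d \<Longrightarrow> \<bar>y - x\<bar> < d \<Longrightarrow> \<bar>u r y - u t x\<bar> \<le> e"
proof -
  have "(t, x) \<in> {0..} \<times> UNIV" using t by simp
  then obtain d where d: "d > 0" "\<And>p. p \<in> {0..} \<times> UNIV \<Longrightarrow> dist p (t, x) < d \<Longrightarrow>
      dist (case p of (t, x) \<Rightarrow> u t x) (case (t, x) of (t, x) \<Rightarrow> u t x) < e"
    using u_cont e unfolding continuous_on_iff by meson
  show thesis
  proof (rule that[of "d / 2"])
    fix r y assume r: "0 \<le> r" "\<bar>r - t\<bar> < d / 2" "\<bar>y - x\<bar> < d / 2"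
    have "dist (r, y) (t, x) \<le> \<bar>r - t\<bar> + \<bar>y - x\<bar>"
      using sqrt_sum_squares_le_sum_abs[of "r - t" "y - x"] by (simp add: dist_Pair_Pair dist_real_def)
    then have "dist (r, y) (t, x) < d" using r by linarith
    then show "\<bar>u r y - u t x\<bar> \<le> e" using d(2)[of "(r, y)"] r by (simp add: dist_real_def)
  qed (use d in simp)
qed

text \<open>
  The rate of change of the integral of \<open>u\<close> over \<open>[z t, z t + \<epsilon>]\<close> when the window moves with
  velocity \<open>u t (z t)\<close>: the flux inside, plus what enters and leaves through the two moving
  ends.
\<close>
definition window_rate :: "(real \<Rightarrow> real) \<Rightarrow> real \<Rightarrow> real \<Rightarrow> real" where
  "window_rate z \<epsilon> t = (LINT x:{z t..z t + \<epsilon>}|lborel. flux t x) + (U t (z t + \<epsilon>) - U t (z t)) * U t (z t)"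

lemma window_rate_measurable:
  assumes [measurable]: "z \<in> borel_measurable borel"
  shows "window_rate z \<epsilon> \<in> borel_measurable borel"
proof -
  have "(\<lambda>t. LINT x|lborel. (if z t \<le> x \<and> x \<le> z t + \<epsilon> then 1 else 0) * flux t x) \<in> borel_measurable lborel"
    by (rule lborel.borel_measurable_lebesgue_integral) measurable
  then have [measurable]: "(\<lambda>t. LINT x:{z t..z t + \<epsilon>}|lborel. flux t x) \<in> borel_measurable borel"
    by (simp add: set_lebesgue_integral_def indicator_def of_bool_def)
  show ?thesis unfolding window_rate_def[abs_def] by measurable
qed

lemma window_rate_bound:
  assumes g: "good t" and \<epsilon>: "0 \<le> \<epsilon>"
  shows "\<bar>window_rate z \<epsilon> t\<bar> \<le> flux_bound \<epsilon> + 2 * M * M"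
proof -
  note t = good_nonneg[OF g]
  have "\<bar>(U t (z t + \<epsilon>) - U t (z t)) * U t (z t)\<bar> \<le> (2 * M) * M"
    unfolding abs_mult using u_bound[OF t, of "z t + \<epsilon>"] u_bound[OF t, of "z t"] t
    by (intro mult_mono) (auto simp: UVGH)
  moreover have "\<bar>LINT x:{z t..z t + \<epsilon>}|lborel. flux t x\<bar> \<le> flux_bound \<epsilon>"
    using flux_integral_le[OF g, of "z t" "z t + \<epsilon>"] \<epsilon> by simp
  ultimately show ?thesis unfolding window_rate_def by linarith
qed

lemma window_rate_li:
  assumes "z \<in> borel_measurable borel" "0 \<le> \<epsilon>" "0 \<le> s"
  shows "locally_integrable (\<lambda>t. indicator {s..} t * window_rate z \<epsilon> t)"
  unfolding locally_integrable_def
proof (intro allI set_integrable_bounded_Icc)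
  show "(\<lambda>t. indicator {s..} t * window_rate z \<epsilon> t) \<in> borel_measurable borel"
    using window_rate_measurable[OF assms(1)] by (intro borel_measurable_times) auto
  fix a b
  show "AE t in lborel. t \<in> {a..b} \<longrightarrow> \<bar>indicator {s..} t * window_rate z \<epsilon> t\<bar> \<le> \<bar>flux_bound \<epsilon> + 2 * M * M\<bar>"
    using AE_good
    by eventually_elim (use window_rate_bound[OF _ assms(2), of _ z] assms(3) in \<open>force simp: indicator_def\<close>)
qed

text \<open>
  Neither the integral of \<open>u\<close> over the moving window nor the time integral of its rate needs to
  be differentiable at a given time, but their difference has derivative \<open>0\<close> everywhere. Near a
  time \<open>t0\<close>, freeze the window during a short time interval \<open>[a, b]\<close>, apply the formula for
  windows at rest, and compare.
\<close>
lemma moving_window_increment: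
  assumes s: "0 \<le> s" and z: "solution_from s u z" and zm: "z \<in> borel_measurable borel"
    and \<epsilon>: "0 < \<epsilon>" and t: "s \<le> t1" "t1 \<le> t2"
  shows "(LINT x:{z t2..z t2 + \<epsilon>}|lborel. u t2 x) - (LINT x:{z t1..z t1 + \<epsilon>}|lborel. u t1 x)
      = (LINT t:{t1..t2}|lborel. window_rate z \<epsilon> t)"
proof -
  \<comment> \<open>\<open>I\<close> is the integral over the window. Multiplying the rate by an indicator makes \<open>S\<close>
      locally integrable on the whole line, also to the left of \<open>s\<close>.\<close>
  define I where "I t = prim (u t) (z t + \<epsilon>) - prim (u t) (z t)" for t
  define S where "S t = indicator {s..} t * window_rate z \<epsilon> t" for t
  have S_li: "locally_integrable S" unfolding S_def[abs_def] using window_rate_li[OF zm _ s] \<epsilon> by simp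
  have Lip: "\<bar>z b - z a\<bar> \<le> M * \<bar>b - a\<bar>" if "s \<le> a" "s \<le> b" for a b
    using solution_from_Lipschitz[OF z that] u_bound s by auto
  have deriv: "((\<lambda>t. I t - prim S t) has_real_derivative 0) (at t0 within {s..})" if t0: "t0 \<in> {s..}" for t0
    unfolding has_field_derivative_def has_derivative_within_alt
  proof (intro conjI allI impI)
    show "bounded_linear ((*) (0::real))" by (rule bounded_linear_mult_right)
    fix e0 :: real assume e0: "e0 > 0"
    define e where "e = e0 / (1 + 8 * M)"
    have e: "e > 0" "(1 + 8 * M) * e = e0" using e0 M_pos by (auto simp: e_def add_pos_pos)
    define c0 c1 where "c0 = u t0 (z t0)" and "c1 = u t0 (z t0 + \<epsilon>)"
    have t0': "0 \<le> t0" using t0 s by simp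
    obtain d0 where d0: "d0 > 0" "\<And>r y. 0 \<le> r \<Longrightarrow> \<bar>r - t0\<bar> < d0 \<Longrightarrow> \<bar>y - z t0\<bar> < d0 \<Longrightarrow> \<bar>u r y - c0\<bar> \<le> e"
      using u_near[OF t0' e(1), of "z t0"] unfolding c0_def by blast
    obtain d1 where d1: "d1 > 0" "\<And>r y. 0 \<le> r \<Longrightarrow> \<bar>r - t0\<bar> < d1 \<Longrightarrow> \<bar>y - (z t0 + \<epsilon>)\<bar> < d1 \<Longrightarrow> \<bar>u r y - c1\<bar> \<le> e"
      using u_near[OF t0' e(1), of "z t0 + \<epsilon>"] unfolding c1_def by blast
    have "e / 2 > 0" using e by simp
    then obtain d2 where d2: "d2 > 0" "\<And>r. 0 \<le> r \<Longrightarrow> r \<le> d2 \<Longrightarrow> flux_bound r \<le> e / 2"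
      using flux_bound_small by blast
    define d where "d = min (min d0 d1) d2 / (2 * (M + 1))"
    have d: "d > 0" "M * d < d0" "M * d < d1" "2 * (M * d) \<le> d2" "d \<le> d0" "d \<le> d1"
    proof -
      define q where "q = min (min d0 d1) d2"
      have q: "q > 0" "q \<le> d0" "q \<le> d1" "q \<le> d2" using d0 d1 d2 by (auto simp: q_def)
      have dq: "d = q / (2 * (M + 1))" by (simp add: d_def q_def)
      have "d * (2 * (M + 1)) = q" using eq_divide_eq[of d q "2 * (M + 1)"] dq M_pos by auto
      then have eq: "2 * d + 2 * (M * d) = q" by (simp add: algebra_simps)
      show "d > 0" using q M_pos by (simp add: dq)
      moreover have "0 < M * d" using M_pos \<open>d > 0\<close> by simp
      ultimately show "M * d < d0" "M * d < d1" "2 * (M * d) \<le> d2" "d \<le> d0" "d \<le> d1" using eq q by linarith+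
    qed
    have est: "\<bar>(I b - prim S b) - (I a - prim S a)\<bar> \<le> e0 * (b - a)"
      if ab: "s \<le> a" "a \<le> b" "\<bar>a - t0\<bar> < d" "\<bar>b - t0\<bar> < d" for a b
    proof -
      have a0: "0 \<le> a" "0 \<le> b" using ab s by auto
      have zr: "\<bar>z r - z t0\<bar> \<le> M * d" "\<bar>z r - z a\<bar> \<le> 2 * (M * d)" "\<bar>r - t0\<bar> < d" if "a \<le> r" "r \<le> b" for r
      proof -
        show r: "\<bar>r - t0\<bar> < d" using that ab by linarith
        have "\<bar>z r - z t0\<bar> \<le> M * \<bar>r - t0\<bar>" using Lip[of t0 r] t0 that ab by simp
        also have "\<dots> \<le> M * d" using r M_pos by (intro mult_left_mono) auto
        finally show "\<bar>z r - z t0\<bar> \<le> M * d" .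
        have "\<bar>z r - z a\<bar> \<le> M * \<bar>r - a\<bar>" using Lip[of a r] that ab by simp
        also have "\<dots> \<le> M * (2 * d)" using M_pos that ab by (intro mult_left_mono) linarith+
        finally show "\<bar>z r - z a\<bar> \<le> 2 * (M * d)" by simp
      qed
      have uc: "continuous_on UNIV (u b)" by (rule u_cont_x[OF a0(2)])
      have zab: "\<bar>z b - z a\<bar> \<le> M * (b - a)" using Lip[of a b] ab by simp
      have p0: "\<bar>prim (u b) (z b) - prim (u b) (z a) - c0 * (z b - z a)\<bar> \<le> e * (M * (b - a))"
      proof -
        have "\<bar>prim (u b) (z b) - prim (u b) (z a) - c0 * (z b - z a)\<bar> \<le> e * \<bar>z b - z a\<bar>"
        proof (rule prim_increment[OF uc])
          fix y assume y: "min (z a) (z b) \<le> y" "y \<le> max (z a) (z b)"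
          have "\<bar>y - z t0\<bar> \<le> M * d" using y zr(1)[of a] zr(1)[of b] ab by (auto simp: min_def max_def split: if_splits)
          then show "\<bar>u b y - c0\<bar> \<le> e" using d ab a0 by (intro d0(2)) auto
        qed
        then show ?thesis using mult_left_mono[OF zab less_imp_le[OF e(1)]] by linarith
      qed
      have p1: "\<bar>prim (u b) (z b + \<epsilon>) - prim (u b) (z a + \<epsilon>) - c1 * (z b - z a)\<bar> \<le> e * (M * (b - a))"
      proof -
        have "\<bar>prim (u b) (z b + \<epsilon>) - prim (u b) (z a + \<epsilon>) - c1 * ((z b + \<epsilon>) - (z a + \<epsilon>))\<bar> \<le> e * \<bar>(z b + \<epsilon>) - (z a + \<epsilon>)\<bar>"
        proof (rule prim_increment[OF uc])
          fix y assume y: "min (z a + \<epsilon>) (z b + \<epsilon>) \<le> y" "y \<le> max (z a + \<epsilon>) (z b + \<epsilon>)"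
          have "\<bar>y - (z t0 + \<epsilon>)\<bar> \<le> M * d" using y zr(1)[of a] zr(1)[of b] ab by (auto simp: min_def max_def split: if_splits)
          then show "\<bar>u b y - c1\<bar> \<le> e" using d ab a0 by (intro d1(2)) auto
        qed
        then have "\<bar>prim (u b) (z b + \<epsilon>) - prim (u b) (z a + \<epsilon>) - c1 * (z b - z a)\<bar> \<le> e * \<bar>z b - z a\<bar>" by simp
        then show ?thesis using mult_left_mono[OF zab less_imp_le[OF e(1)]] by linarith
      qed
      have c: "\<bar>c0\<bar> \<le> M" "\<bar>c1\<bar> \<le> M" unfolding c0_def c1_def using u_bound t0' by auto
      have zc: "\<bar>z b - z a - c0 * (b - a)\<bar> \<le> e * (b - a)"
      proof (rule solution_from_increment[OF z ab(1,2)])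
        fix r assume r: "a \<le> r" "r \<le> b"
        show "\<bar>u r (z r) - c0\<bar> \<le> e" using zr[OF r] d r a0 by (intro d0(2)) auto
      qed
      have k: "\<bar>(c1 - c0) * (z b - z a) - (c1 - c0) * c0 * (b - a)\<bar> \<le> 2 * M * (e * (b - a))"
      proof -
        have "(c1 - c0) * (z b - z a) - (c1 - c0) * c0 * (b - a) = (c1 - c0) * (z b - z a - c0 * (b - a))"
          by (simp add: algebra_simps)
        then show ?thesis using zc c by (simp only: abs_mult) (intro mult_mono; auto)
      qed
      define W where "W t = (LINT x:{z a..z a + \<epsilon>}|lborel. flux t x)" for t
      have W_int: "set_integrable lborel {a..b} W"
        unfolding W_def[abs_def] using flux_window_time_integrable[OF a0(1), of "z a" "z a + \<epsilon>" b] \<epsilon> by simp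
      have time: "(prim (u b) (z a + \<epsilon>) - prim (u b) (z a)) - (prim (u a) (z a + \<epsilon>) - prim (u a) (z a)) = (LINT t:{a..b}|lborel. W t)"
        unfolding W_def using u_window_increment[of "z a" "z a + \<epsilon>" a b] ab a0 \<epsilon> by (simp add: prim_u_diff)
      have SW: "\<bar>(LINT t:{a..b}|lborel. W t - S t) - (- ((c1 - c0) * c0)) * (b - a)\<bar> \<le> (e + 4 * M * e) * (b - a)"
      proof (rule set_integral_near_const)
        show "set_integrable lborel {a..b} (\<lambda>t. W t - S t)"
          by (intro set_integral_diff(1) W_int locally_integrableD[OF S_li])
        show "AE t in lborel. t \<in> {a..b} \<longrightarrow> \<bar>W t - S t - (- ((c1 - c0) * c0))\<bar> \<le> e + 4 * M * e"
          using AE_good_Icc[OF a0(1), of b]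
        proof eventually_elim
          case (elim r)
          show ?case
          proof
            assume "r \<in> {a..b}"
            then have r: "a \<le> r" "r \<le> b" and g: "good r" and r0: "0 \<le> r" using elim a0 by auto
            define v0 v1 where "v0 = u r (z r)" and "v1 = u r (z r + \<epsilon>)"
            define X where "X = (LINT x:{z r..z r + \<epsilon>}|lborel. flux r x)"
            have St: "S r = X + (v1 - v0) * v0"
              using r ab r0 by (simp add: S_def window_rate_def UVGH v0_def v1_def X_def)
            have "\<bar>X - W r\<bar> \<le> 2 * flux_bound \<bar>z r - z a\<bar>"
              unfolding X_def W_def using flux_window_shift[OF g, of \<epsilon> "z r" "z a"] \<epsilon> by simp
            also have "\<dots> \<le> 2 * (e / 2)" using zr(2)[OF r] d by (intro mult_left_mono d2(2)) auto
            finally have 1: "\<bar>X - W r\<bar> \<le> e" by simp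
            have v: "\<bar>v0 - c0\<bar> \<le> e" "\<bar>v1 - c1\<bar> \<le> e" "\<bar>v0\<bar> \<le> M" "\<bar>v1\<bar> \<le> M"
              unfolding v0_def v1_def using zr[OF r] d r0 u_bound[OF r0] by (auto intro!: d0(2) d1(2))
            have eq: "(v1 - v0) * v0 - (c1 - c0) * c0 = ((v1 - c1) - (v0 - c0)) * v0 + (c1 - c0) * (v0 - c0)"
              by (simp add: algebra_simps)
            have A: "\<bar>((v1 - c1) - (v0 - c0)) * v0\<bar> \<le> (2 * e) * M"
              unfolding abs_mult using v e by (intro mult_mono) auto
            have B: "\<bar>(c1 - c0) * (v0 - c0)\<bar> \<le> (2 * M) * e"
              unfolding abs_mult using v c by (intro mult_mono) auto
            have "\<bar>(v1 - v0) * v0 - (c1 - c0) * c0\<bar> \<le> (2 * e) * M + (2 * M) * e"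
              unfolding eq by (rule order_trans[OF abs_triangle_ineq add_mono[OF A B]])
            then have "\<bar>(v1 - v0) * v0 - (c1 - c0) * c0\<bar> \<le> 4 * M * e" by (simp add: mult_ac)
            then show "\<bar>W r - S r - (- ((c1 - c0) * c0))\<bar> \<le> e + 4 * M * e" unfolding St using 1 by linarith
          qed
        qed
      qed (rule ab(2))
      have split: "(LINT t:{a..b}|lborel. W t - S t) = (LINT t:{a..b}|lborel. W t) - (prim S b - prim S a)"
        using prim_diff[OF S_li ab(2)] set_integral_diff(2)[OF W_int locally_integrableD[OF S_li]] by simp
      \<comment> \<open>Four errors: moving the left end, moving the right end, replacing the velocity of the
          window by its value at \<open>t0\<close>, and comparing the flux in the resting and in the moving
          window.\<close>
      define A0 where "A0 = prim (u b) (z b) - prim (u b) (z a) - c0 * (z b - z a)"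
      define A1 where "A1 = prim (u b) (z b + \<epsilon>) - prim (u b) (z a + \<epsilon>) - c1 * (z b - z a)"
      define A2 where "A2 = (c1 - c0) * (z b - z a) - (c1 - c0) * c0 * (b - a)"
      define A3 where "A3 = (LINT t:{a..b}|lborel. W t - S t) - (- ((c1 - c0) * c0)) * (b - a)"
      have "(I b - prim S b) - (I a - prim S a) = A1 - A0 + A2 + A3"
        unfolding A0_def A1_def A2_def A3_def split time[symmetric] I_def by (simp add: algebra_simps)
      also have "\<bar>\<dots>\<bar> \<le> \<bar>A1\<bar> + \<bar>A0\<bar> + \<bar>A2\<bar> + \<bar>A3\<bar>" by linarith
      also have "\<dots> \<le> e * (M * (b - a)) + e * (M * (b - a)) + 2 * M * (e * (b - a)) + (e + 4 * M * e) * (b - a)"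
        using p0 p1 k SW unfolding A0_def A1_def A2_def A3_def by (intro add_mono)
      also have "\<dots> = ((1 + 8 * M) * e) * (b - a)" by (simp add: algebra_simps)
      finally show ?thesis unfolding e(2) .
    qed
    show "\<exists>d>0. \<forall>y\<in>{s..}. norm (y - t0) < d \<longrightarrow>
        norm (I y - prim S y - (I t0 - prim S t0) - 0 * (y - t0)) \<le> e0 * norm (y - t0)"
    proof (intro exI[of _ d] conjI ballI impI d(1))
      fix y assume y: "y \<in> {s..}" "norm (y - t0) < d"
      show "norm (I y - prim S y - (I t0 - prim S t0) - 0 * (y - t0)) \<le> e0 * norm (y - t0)"
        using est[of t0 y] est[of y t0] y t0 d(1) by (cases "t0 \<le> y") (auto simp: abs_minus_commute)
    qed
  qed
  obtain k where k: "\<And>t. t \<in> {s..} \<Longrightarrow> I t - prim S t = k"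
    using has_field_derivative_zero_constant[of "{s..}" "\<lambda>t. I t - prim S t"] deriv by auto
  have "I t2 - I t1 = prim S t2 - prim S t1" using k[of t1] k[of t2] t by simp
  also have "\<dots> = (LINT t:{t1..t2}|lborel. S t)" by (rule prim_diff[OF S_li t(2)])
  also have "\<dots> = (LINT t:{t1..t2}|lborel. window_rate z \<epsilon> t)"
    unfolding set_lebesgue_integral_def using t by (intro Bochner_Integration.integral_cong) (auto simp: S_def indicator_def)
  finally show ?thesis using s t \<epsilon> by (simp add: I_def prim_u_diff)
qed

text \<open>
  By the fundamental theorem in space the boundary terms equal the integral of
  \<open>u t (z t) * ux t x\<close>, so only the difference \<open>u t x - u t (z t)\<close> is left in the transport
  term. It is small of the order of the integral of \<open>\<bar>ux\<bar>\<close>, and the product is controlled by the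
  energy in the window.
\<close>
lemma window_rate_eq:
  assumes g: "good t" and \<epsilon>: "0 < \<epsilon>"
  shows "window_rate z \<epsilon> t = (LINT x:{z t..z t + \<epsilon>}|lborel. F t x) -
     (LINT x:{z t..z t + \<epsilon>}|lborel. (u t x - u t (z t)) * ux t x)"
    "set_integrable lborel {z t..z t + \<epsilon>} (F t)"
    "\<bar>LINT x:{z t..z t + \<epsilon>}|lborel. (u t x - u t (z t)) * ux t x\<bar> \<le> \<epsilon> * (LINT x:{z t..z t + \<epsilon>}|lborel. (ux t x)\<^sup>2)"
proof -
  note t = good_nonneg[OF g]
  define A where "A = {z t..z t + \<epsilon>}"
  have le: "z t \<le> z t + \<epsilon>" using \<epsilon> by simp
  have iux: "set_integrable lborel A (ux t)" unfolding A_def by (rule locally_integrableD[OF ux_locally_integrable[OF t]])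
  show iF: "set_integrable lborel {z t..z t + \<epsilon>} (F t)" using G_section(1)[OF g le] t by (simp add: UVGH)
  have iuux: "set_integrable lborel A (\<lambda>x. u t x * ux t x)" using UV_section(1)[OF g le] t by (simp add: UVGH A_def)
  have c: "set_integrable lborel A (\<lambda>x. u t (z t) * ux t x)" using iux by (rule set_integrable_mult_right)
  have e1: "(LINT x:A|lborel. flux t x) = (LINT x:A|lborel. F t x) - (LINT x:A|lborel. u t x * ux t x)"
    unfolding flux_def UVGH(1)[OF t] UVGH(2)[OF t] UVGH(4)[OF t] using iF iuux unfolding A_def by (intro set_integral_diff(2))
  have e2: "(u t (z t + \<epsilon>) - u t (z t)) * u t (z t) = (LINT x:A|lborel. u t (z t) * ux t x)"
    unfolding u_FTC[OF t le] A_def by simp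
  have e3: "(LINT x:A|lborel. (u t x - u t (z t)) * ux t x) = (LINT x:A|lborel. u t x * ux t x) - (LINT x:A|lborel. u t (z t) * ux t x)"
    unfolding left_diff_distrib by (rule set_integral_diff(2)[OF iuux c])
  show "window_rate z \<epsilon> t = (LINT x:{z t..z t + \<epsilon>}|lborel. F t x) -
     (LINT x:{z t..z t + \<epsilon>}|lborel. (u t x - u t (z t)) * ux t x)"
    using e1 e2 e3 t unfolding window_rate_def by (simp add: UVGH A_def)
  have i3: "set_integrable lborel A (\<lambda>x. (u t x - u t (z t)) * ux t x)"
    unfolding left_diff_distrib by (rule set_integral_diff(1)[OF iuux c])
  define L where "L = (LINT x:A|lborel. \<bar>ux t x\<bar>)"
  have "\<bar>LINT x:A|lborel. (u t x - u t (z t)) * ux t x\<bar> \<le> (LINT x:A|lborel. \<bar>(u t x - u t (z t)) * ux t x\<bar>)"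
    using set_integral_norm_bound[OF i3] by simp
  also have "\<dots> \<le> (LINT x:A|lborel. L * \<bar>ux t x\<bar>)"
  proof (rule set_integral_mono[OF set_integrable_abs[OF i3]])
    show "set_integrable lborel A (\<lambda>x. L * \<bar>ux t x\<bar>)" using iux by (intro set_integrable_mult_right set_integrable_abs)
    fix x assume "x \<in> A"
    then have "\<bar>u t x - u t (z t)\<bar> \<le> L"
      unfolding L_def A_def using \<epsilon> by (intro u_diff_le[OF t]) auto
    then show "\<bar>(u t x - u t (z t)) * ux t x\<bar> \<le> L * \<bar>ux t x\<bar>" by (simp add: abs_mult mult_right_mono)
  qed
  also have "\<dots> = L\<^sup>2" by (simp add: L_def power2_eq_square)
  also have "\<dots> \<le> \<epsilon> * (LINT x:A|lborel. (ux t x)\<^sup>2)"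
    unfolding L_def A_def using integral_abs_ux_sq[OF g le] by simp
  finally show "\<bar>LINT x:{z t..z t + \<epsilon>}|lborel. (u t x - u t (z t)) * ux t x\<bar> \<le> \<epsilon> * (LINT x:{z t..z t + \<epsilon>}|lborel. (ux t x)\<^sup>2)"
    unfolding A_def .
qed

text \<open>
  Divide the formula for the moving window by its length \<open>\<epsilon>\<close> and let \<open>\<epsilon>\<close> tend to \<open>0\<close>. At a good
  time the transport term is at most the energy in a shrinking window, hence tends to \<open>0\<close>; it is
  bounded by the total energy, so dominated convergence in time applies.
\<close>
theorem u_along_solution:
  assumes s: "0 \<le> s" and z: "solution_from s u z" and zm: "z \<in> borel_measurable borel"
    and t: "s \<le> t1" "t1 \<le> t2"
  shows "u t2 (z t2) - u t1 (z t1) = (LINT t:{t1..t2}|lborel. G t (z t))"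
proof -
  define \<epsilon> where "\<epsilon> n = 1 / real (Suc n)" for n
  have \<epsilon>: "\<epsilon> n > 0" "\<epsilon> n \<le> 1" for n by (auto simp: \<epsilon>_def)
  have \<epsilon>0: "\<epsilon> \<longlonglongrightarrow> 0" using LIMSEQ_inverse_real_of_nat by (simp add: \<epsilon>_def[abs_def] inverse_eq_divide)
  have quot: "(\<lambda>n. (LINT x:{y..y + \<epsilon> n}|lborel. f x) / \<epsilon> n) \<longlonglongrightarrow> f y" if "continuous_on UNIV f" for f y
  proof -
    have "(LINT x:{y..y + \<epsilon> n}|lborel. f x) = prim f (y + \<epsilon> n) - prim f y" for n
      using prim_diff[OF locally_integrable_continuous[OF that], of y "y + \<epsilon> n"] \<epsilon>(1)[of n] by simp
    then show ?thesis using DERIV_difference_quotients[OF prim_DERIV[OF that, of y]] by (simp add: \<epsilon>_def)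
  qed
  have lhs: "(\<lambda>n. (LINT x:{z t..z t + \<epsilon> n}|lborel. u t x) / \<epsilon> n) \<longlonglongrightarrow> u t (z t)" if "0 \<le> t" for t
    by (rule quot[OF u_cont_x[OF that]])
  have good: "AE t in lborel. t \<in> {t1..t2} \<longrightarrow> good t" using AE_good_Icc[of t1 t2] s t by simp
  have Gm: "(\<lambda>t. G t (z t)) \<in> borel_measurable borel" using zm by (intro G_compose) auto
  have "(\<lambda>n. LINT t|lborel. indicator {t1..t2} t *\<^sub>R (window_rate z (\<epsilon> n) t / \<epsilon> n)) \<longlonglongrightarrow>
      (LINT t|lborel. indicator {t1..t2} t *\<^sub>R G t (z t))"
  proof (rule integral_dominated_convergence[where w="\<lambda>t. indicator {t1..t2} t *\<^sub>R (C / 2 + 2 * C)"])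
    show "(\<lambda>t. indicator {t1..t2} t *\<^sub>R G t (z t)) \<in> borel_measurable lborel" using Gm by simp
    show "(\<lambda>t. indicator {t1..t2} t *\<^sub>R (window_rate z (\<epsilon> n) t / \<epsilon> n)) \<in> borel_measurable lborel" for n
      using window_rate_measurable[OF zm] by simp
    show "integrable lborel (\<lambda>t. indicator {t1..t2} t *\<^sub>R (C / 2 + 2 * C))"
      using set_integrable_const_Icc unfolding set_integrable_def .
    show "AE t in lborel. norm (indicator {t1..t2} t *\<^sub>R (window_rate z (\<epsilon> n) t / \<epsilon> n)) \<le> indicator {t1..t2} t *\<^sub>R (C / 2 + 2 * C)" for n
      using good
    proof eventually_elim
      case (elim t)
      show ?case
      proof (cases "t \<in> {t1..t2}")
        case True
        then have g: "good t" using elim by simp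
        note r = window_rate_eq[OF g \<epsilon>(1)[of n], of z]
        have "\<bar>LINT x:{z t..z t + \<epsilon> n}|lborel. F t x\<bar> \<le> C / 2 * \<epsilon> n"
          using set_integral_near_const[OF r(2), of 0 "C / 2"] F_bound[OF g] \<epsilon>(1)[of n] by simp
        moreover have "\<epsilon> n * (LINT x:{z t..z t + \<epsilon> n}|lborel. (ux t x)\<^sup>2) \<le> \<epsilon> n * (2 * C)"
          using \<epsilon>(1)[of n] good_ux2_set(2)[OF g] by (intro mult_left_mono) auto
        ultimately have "\<bar>window_rate z (\<epsilon> n) t\<bar> \<le> C / 2 * \<epsilon> n + \<epsilon> n * (2 * C)" using r(1,3) by linarith
        then have "\<bar>window_rate z (\<epsilon> n) t\<bar> \<le> (C / 2 + 2 * C) * \<epsilon> n" by (simp add: algebra_simps)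
        then show ?thesis using True \<epsilon>(1)[of n] by (simp add: abs_divide pos_divide_le_eq)
      qed simp
    qed
    show "AE t in lborel. (\<lambda>n. indicator {t1..t2} t *\<^sub>R (window_rate z (\<epsilon> n) t / \<epsilon> n)) \<longlonglongrightarrow> indicator {t1..t2} t *\<^sub>R G t (z t)"
      using good
    proof eventually_elim
      case (elim t)
      show ?case
      proof (cases "t \<in> {t1..t2}")
        case True
        then have g: "good t" using elim by simp
        note tt = good_nonneg[OF g]
        define E where "E n = (LINT x:{z t..z t + \<epsilon> n}|lborel. (ux t x)\<^sup>2)" for n
        define N where "N n = (LINT x:{z t..z t + \<epsilon> n}|lborel. (u t x - u t (z t)) * ux t x)" for n
        have E0: "E \<longlonglongrightarrow> 0"
        proof -
          have "(\<lambda>n. LINT x|lborel. indicator {z t..z t + \<epsilon> n} x *\<^sub>R (ux t x)\<^sup>2) \<longlonglongrightarrow> (LINT x|(lborel::real measure). 0)"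
          proof (rule integral_dominated_convergence[where w="\<lambda>x. (ux t x)\<^sup>2"])
            have [measurable]: "ux t \<in> borel_measurable borel" using ux_measurable[OF tt] .
            show "(\<lambda>x. indicator {z t..z t + \<epsilon> n} x *\<^sub>R (ux t x)\<^sup>2) \<in> borel_measurable lborel" for n by measurable
            show "integrable lborel (\<lambda>x. (ux t x)\<^sup>2)" by (rule good_ux2(1)[OF g])
            show "AE x in lborel. norm (indicator {z t..z t + \<epsilon> n} x *\<^sub>R (ux t x)\<^sup>2) \<le> (ux t x)\<^sup>2" for n
              by (intro AE_I2) (auto simp: indicator_def)
            show "AE x in lborel. (\<lambda>n. indicator {z t..z t + \<epsilon> n} x *\<^sub>R (ux t x)\<^sup>2) \<longlonglongrightarrow> 0"
              using AE_lborel_singleton[of "z t"]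
            proof eventually_elim
              case (elim x)
              have "eventually (\<lambda>n. indicator {z t..z t + \<epsilon> n} x *\<^sub>R (ux t x)\<^sup>2 = 0) sequentially"
              proof (cases "x < z t")
                case False
                then have "x - z t > 0" using elim by simp
                from order_tendstoD(2)[OF \<epsilon>0 this] show ?thesis by eventually_elim (auto simp: indicator_def)
              qed simp
              then show ?case by (rule tendsto_eventually)
            qed
          qed simp
          then show ?thesis by (simp add: E_def[abs_def] set_lebesgue_integral_def)
        qed
        have "\<bar>N n / \<epsilon> n\<bar> \<le> E n" for n
        proof -
          have "\<bar>N n\<bar> \<le> \<epsilon> n * E n" unfolding N_def E_def by (rule window_rate_eq(3)[OF g \<epsilon>(1)])
          then show ?thesis using \<epsilon>(1)[of n] by (simp add: abs_divide pos_divide_le_eq mult.commute)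
        qed
        then have N0: "(\<lambda>n. N n / \<epsilon> n) \<longlonglongrightarrow> 0"
          by (intro Lim_null_comparison[OF _ E0] always_eventually allI) simp
        have "(\<lambda>n. (LINT x:{z t..z t + \<epsilon> n}|lborel. F t x) / \<epsilon> n - N n / \<epsilon> n) \<longlonglongrightarrow> F t (z t) - 0"
          by (intro tendsto_diff N0 quot[OF F_cont[OF g]])
        then have "(\<lambda>n. window_rate z (\<epsilon> n) t / \<epsilon> n) \<longlonglongrightarrow> G t (z t)"
          using window_rate_eq(1)[OF g \<epsilon>(1), of z] tt by (simp add: N_def diff_divide_distrib UVGH)
        then show ?thesis by (intro tendsto_scaleR tendsto_const)
      qed simp
    qed
  qed
  moreover have "(LINT t|lborel. indicator {t1..t2} t *\<^sub>R (window_rate z (\<epsilon> n) t / \<epsilon> n)) =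
      (LINT x:{z t2..z t2 + \<epsilon> n}|lborel. u t2 x) / \<epsilon> n - (LINT x:{z t1..z t1 + \<epsilon> n}|lborel. u t1 x) / \<epsilon> n" for n
  proof -
    have "(LINT t|lborel. indicator {t1..t2} t *\<^sub>R (window_rate z (\<epsilon> n) t / \<epsilon> n)) = (LINT t:{t1..t2}|lborel. window_rate z (\<epsilon> n) t) / \<epsilon> n"
      unfolding set_lebesgue_integral_def by (simp only: scaleR_conv_of_real times_divide_eq_right integral_divide_zero)
    then show ?thesis unfolding moving_window_increment[OF s z zm \<epsilon>(1)[of n] t, symmetric] by (simp only: diff_divide_distrib)
  qed
  ultimately have "(\<lambda>n. (LINT x:{z t2..z t2 + \<epsilon> n}|lborel. u t2 x) / \<epsilon> n - (LINT x:{z t1..z t1 + \<epsilon> n}|lborel. u t1 x) / \<epsilon> n) \<longlonglongrightarrow>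
      (LINT t:{t1..t2}|lborel. G t (z t))" by (simp add: set_lebesgue_integral_def)
  moreover have "(\<lambda>n. (LINT x:{z t2..z t2 + \<epsilon> n}|lborel. u t2 x) / \<epsilon> n - (LINT x:{z t1..z t1 + \<epsilon> n}|lborel. u t1 x) / \<epsilon> n) \<longlonglongrightarrow>
      u t2 (z t2) - u t1 (z t1)"
    using s t by (intro tendsto_diff lhs) auto
  ultimately show ?thesis using LIMSEQ_unique by blast
qed

text \<open>
  Integrating the source along the curve gives the Lipschitz bound, since the source is bounded,
  and its derivative almost everywhere by Lebesgue differentiation.
\<close>
theorem solution_is_characteristic:
  assumes z: "solution_from 0 u z"
  shows "characteristic u ux (z 0) z"
proof -
  \<comment> \<open>Constant continuation to negative times, for measurability on the whole line.\<close>
  define Z where "Z t = z (max 0 t)" for t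
  have Zz: "Z t = z t" if "0 \<le> t" for t using that by (simp add: Z_def)
  have "continuous_on UNIV Z" unfolding Z_def
    by (rule continuous_on_compose2[OF solution_from_continuous[OF z]]) (auto intro!: continuous_intros)
  then have Zm: "Z \<in> borel_measurable borel" by (rule borel_measurable_continuous_onI)
  have Zs: "solution_from 0 u Z" unfolding solution_from_def
  proof (intro allI impI)
    fix t :: real assume t: "0 \<le> t"
    show "(Z has_real_derivative u t (Z t)) (at t within {0..})"
      using has_field_derivative_transform_within[OF solution_fromD[OF z t], of 1 Z] t by (simp add: Zz)
  qed
  define g where "g t = indicator {0..} t * G t (Z t)" for t
  have gm: "g \<in> borel_measurable borel"
    unfolding g_def[abs_def] by (intro borel_measurable_times G_compose) (use Zm in auto)
  have gb: "AE t in lborel. \<bar>g t\<bar> \<le> C / 2"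
    using AE_good
  proof eventually_elim
    case (elim t)
    show ?case using C(1) F_bound[of t "Z t"] elim UVGH(4)[of t] by (cases "0 \<le> t") (auto simp: g_def)
  qed
  have g_li: "locally_integrable g" unfolding locally_integrable_def
    using gb by (intro allI set_integrable_bounded_Icc[OF gm, where B="C / 2"]) (auto elim: eventually_mono)
  have inc: "u b (z b) - u a (z a) = prim g b - prim g a" if "0 \<le> a" "a \<le> b" for a b
  proof -
    have "u b (Z b) - u a (Z a) = (LINT t:{a..b}|lborel. G t (Z t))" by (rule u_along_solution[OF _ Zs Zm that]) simp
    also have "\<dots> = (LINT t:{a..b}|lborel. g t)"
      unfolding set_lebesgue_integral_def using that by (intro Bochner_Integration.integral_cong) (auto simp: g_def indicator_def)
    also have "\<dots> = prim g b - prim g a" by (rule prim_diff[OF g_li that(2), symmetric])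
    finally show ?thesis using that by (simp add: Zz)
  qed
  have lip: "\<bar>u b (z b) - u a (z a)\<bar> \<le> C / 2 * (b - a)" if ab: "0 \<le> a" "a \<le> b" for a b
  proof -
    have "AE t in lborel. t \<in> {a..b} \<longrightarrow> \<bar>g t - 0\<bar> \<le> C / 2" using gb by eventually_elim simp
    from set_integral_near_const[OF locally_integrableD[OF g_li] ab(2) this]
    show ?thesis by (simp add: inc[OF ab] prim_diff[OF g_li ab(2)])
  qed
  show ?thesis unfolding characteristic_def
  proof (intro conjI exI[of _ "C / 2"])
    show "\<forall>t\<ge>0. (z has_real_derivative u t (z t)) (at t within {0..})" using z by (simp add: solution_from_def)
    show "(C / 2)-lipschitz_on {0..} (\<lambda>t. u t (z t))"
    proof (rule lipschitz_onI)
      fix a b :: real assume "a \<in> {0..}" "b \<in> {0..}"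
      then show "dist (u a (z a)) (u b (z b)) \<le> C / 2 * dist a b"
        using lip[of a b] lip[of b a] by (cases "a \<le> b") (auto simp: dist_real_def abs_minus_commute)
    qed (use C(1) in simp)
    have "AE t in lborel. (prim g has_real_derivative g t) (at t)"
      using prim_diff[OF g_li] by (rule lebesgue_differentiation_DERIV[OF g_li])
    then show "AE t in lborel. 0 \<le> t \<longrightarrow> ((\<lambda>s. u s (z s)) has_real_derivative F t (z t)) (at t within {0..})"
    proof eventually_elim
      case (elim t)
      show ?case
      proof
        assume t: "0 \<le> t"
        have "((\<lambda>s. prim g s + (u 0 (z 0) - prim g 0)) has_real_derivative g t) (at t within {0..})"
          using elim by (auto intro!: derivative_eq_intros intro: has_field_derivative_at_within)
        moreover have "g t = F t (z t)" using t by (simp add: g_def UVGH Zz)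
        ultimately have d: "((\<lambda>s. prim g s + (u 0 (z 0) - prim g 0)) has_real_derivative F t (z t)) (at t within {0..})" by simp
        show "((\<lambda>s. u s (z s)) has_real_derivative F t (z t)) (at t within {0..})"
        proof (rule has_field_derivative_transform_within[OF d, of 1])
          fix r assume "r \<in> {(0::real)..}"
          then show "prim g r + (u 0 (z 0) - prim g 0) = u r (z r)" using inc[of 0 r] by simp
        qed (use t in auto)
      qed
    qed
  qed simp
qed

lemma characteristic_solution: "characteristic u ux \<zeta> z \<Longrightarrow> solution_from 0 u z \<and> z 0 = \<zeta>"
  by (simp add: characteristic_def solution_from_def)

end

section \<open>Partition sums and the energy of the positive slopes\<close>

definition grid :: "real \<Rightarrow> real \<Rightarrow> nat \<Rightarrow> nat \<Rightarrow> real" where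
  "grid a b n i = a + real i * ((b - a) / real n)"

lemma grid_facts:
  assumes "a < b" "0 < n"
  shows "grid a b n 0 = a" "grid a b n n = b" "grid a b n (Suc i) - grid a b n i = (b - a) / n"
    "grid a b n i < grid a b n (Suc i)"
  using assms by (auto simp: grid_def field_simps)

text \<open>
  The step functions with the values \<open>\<phi>\<close> of the difference quotients on the cells of the
  equipartition have integrals bounded by \<open>B\<close>. By Lebesgue differentiation they converge to
  \<open>\<phi> \<circ> g\<close> almost everywhere, since the cells containing a point shrink to it; Fatou's lemma
  concludes.
\<close>
lemma nn_integral_le_of_partition_sums:
  fixes f g \<phi> :: "real \<Rightarrow> real"
  assumes g: "locally_integrable g" and fg: "\<And>x y. x \<le> y \<Longrightarrow> f y - f x = (LINT t:{x..y}|lborel. g t)"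
    and \<phi>: "continuous_on UNIV \<phi>" "\<And>r. 0 \<le> \<phi> r" and ab: "a < b"
    and B: "\<And>n. (\<Sum>i<Suc n. \<phi> ((f (grid a b (Suc n) (Suc i)) - f (grid a b (Suc n) i)) / ((b - a) / Suc n)) * ((b - a) / Suc n)) \<le> B"
  shows "(\<integral>\<^sup>+x\<in>{a..b}. ennreal (\<phi> (g x)) \<partial>lborel) \<le> ennreal B"
proof -
  define \<delta> where "\<delta> n = (b - a) / Suc n" for n
  have \<delta>: "\<delta> n > 0" for n using ab by (simp add: \<delta>_def)
  have \<delta>0: "\<delta> \<longlonglongrightarrow> 0"
    using tendsto_mult_left[OF LIMSEQ_inverse_real_of_nat, of "b - a"] by (simp add: \<delta>_def[abs_def] divide_inverse)
  define p where "p n i = grid a b (Suc n) i" for n i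
  have p: "p n i = a + real i * \<delta> n" for n i by (simp add: p_def grid_def \<delta>_def)
  define c where "c n i = \<phi> ((f (p n (Suc i)) - f (p n i)) / \<delta> n)" for n i
  have c0: "0 \<le> c n i" for n i by (simp add: c_def \<phi>(2))
  define G where "G n x = (\<Sum>i<Suc n. c n i * indicator {p n i..<p n (Suc i)} x)" for n x
  have Gm[measurable]: "G n \<in> borel_measurable borel" for n unfolding G_def[abs_def] by measurable
  have G0: "0 \<le> G n x" for n x unfolding G_def by (intro sum_nonneg mult_nonneg_nonneg c0) auto
  have intG: "(\<integral>\<^sup>+x. ennreal (G n x) \<partial>lborel) \<le> ennreal B" for n
  proof -
    have "(\<integral>\<^sup>+x. ennreal (G n x) \<partial>lborel) = (\<integral>\<^sup>+x. (\<Sum>i<Suc n. ennreal (c n i) * indicator {p n i..<p n (Suc i)} x) \<partial>lborel)"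
    proof (rule nn_integral_cong)
      fix x
      have "ennreal (G n x) = (\<Sum>i<Suc n. ennreal (c n i * indicator {p n i..<p n (Suc i)} x))"
        unfolding G_def by (rule sum_ennreal[symmetric]) (simp add: c0)
      also have "\<dots> = (\<Sum>i<Suc n. ennreal (c n i) * indicator {p n i..<p n (Suc i)} x)"
        by (rule sum.cong) (simp_all add: indicator_def)
      finally show "ennreal (G n x) = (\<Sum>i<Suc n. ennreal (c n i) * indicator {p n i..<p n (Suc i)} x)" .
    qed
    also have "\<dots> = (\<Sum>i<Suc n. \<integral>\<^sup>+x. ennreal (c n i) * indicator {p n i..<p n (Suc i)} x \<partial>lborel)"
      by (rule nn_integral_sum) auto
    also have "\<dots> = (\<Sum>i<Suc n. ennreal (c n i * \<delta> n))"
    proof (intro sum.cong refl)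
      fix i
      have "(\<integral>\<^sup>+x. ennreal (c n i) * indicator {p n i..<p n (Suc i)} x \<partial>lborel) = ennreal (c n i) * emeasure lborel {p n i..<p n (Suc i)}"
        by (rule nn_integral_cmult_indicator) auto
      also have "emeasure lborel {p n i..<p n (Suc i)} = ennreal (\<delta> n)"
        using \<delta>[of n] by (simp add: p algebra_simps)
      finally show "(\<integral>\<^sup>+x. ennreal (c n i) * indicator {p n i..<p n (Suc i)} x \<partial>lborel) = ennreal (c n i * \<delta> n)"
        using c0[of n i] \<delta>[of n] by (simp add: ennreal_mult)
    qed
    also have "\<dots> = ennreal (\<Sum>i<Suc n. c n i * \<delta> n)"
      using c0 \<delta> by (intro sum_ennreal) (simp add: less_imp_le)
    also have "\<dots> \<le> ennreal B" using B[of n] by (intro ennreal_leI) (simp add: c_def p_def \<delta>_def)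
    finally show ?thesis .
  qed
  have ld: "AE x in lborel. \<forall>e>0. \<exists>d>0. \<forall>a b. a \<le> x \<and> x \<le> b \<and> a < b \<and> b - a < d \<longrightarrow>
     \<bar>(f b - f a) / (b - a) - g x\<bar> \<le> e"
    using fg by (rule lebesgue_differentiation[OF g])
  have conv: "AE x in lborel. ennreal (\<phi> (g x)) * indicator {a..b} x \<le> liminf (\<lambda>n. ennreal (G n x))"
    using ld AE_lborel_singleton[of b]
  proof eventually_elim
    case (elim x)
    show ?case
    proof (cases "x \<in> {a..b}")
      case True
      then have x: "a \<le> x" "x < b" using elim(2) by auto
      define k where "k n = nat \<lfloor>(x - a) / \<delta> n\<rfloor>" for n
      have k: "p n (k n) \<le> x" "x < p n (Suc (k n))" for n
      proof -
        have "0 \<le> (x - a) / \<delta> n" using x \<delta>[of n] by simp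
        then have "real (k n) \<le> (x - a) / \<delta> n" "(x - a) / \<delta> n < real (k n) + 1" unfolding k_def by linarith+
        then show "p n (k n) \<le> x" "x < p n (Suc (k n))" using \<delta>[of n] by (auto simp: p field_simps)
      qed
      have pmono: "p n i \<le> p n j" if "i \<le> j" for n i j using that \<delta>[of n] by (simp add: p mult_right_mono)
      have pn: "p n (Suc n) = b" for n using ab by (simp add: p \<delta>_def)
      have kn: "k n < Suc n" for n
      proof (rule ccontr)
        assume "\<not> k n < Suc n"
        then have "p n (Suc n) \<le> p n (k n)" by (intro pmono) simp
        then show False using k(1)[of n] x pn[of n] by simp
      qed
      have ind: "indicator {p n i..<p n (Suc i)} x = (if i = k n then 1 else 0 :: real)" for n i
      proof (cases "i = k n")
        case False
        then consider "Suc i \<le> k n" | "Suc (k n) \<le> i" by linarith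
        then have "x \<notin> {p n i..<p n (Suc i)}"
        proof cases
          case 1 then show ?thesis using pmono[OF 1, of n] k(1)[of n] by auto
        next
          case 2 then show ?thesis using pmono[OF 2, of n] k(2)[of n] by auto
        qed
        then show ?thesis using False by simp
      qed (use k in auto)
      have Gx: "G n x = c n (k n)" for n
      proof -
        have "G n x = (\<Sum>i<Suc n. if i = k n then c n i else 0)" unfolding G_def ind by (intro sum.cong) auto
        also have "\<dots> = c n (k n)" using kn[of n] by (subst sum.delta) auto
        finally show ?thesis .
      qed
      have "(\<lambda>n. (f (p n (Suc (k n))) - f (p n (k n))) / \<delta> n) \<longlonglongrightarrow> g x"
      proof (rule LIMSEQ_I)
        fix r :: real assume "0 < r"
        then have "r / 2 > 0" by simp
        then obtain d where d: "d > 0" "\<And>a b. a \<le> x \<Longrightarrow> x \<le> b \<Longrightarrow> a < b \<Longrightarrow> b - a < d \<Longrightarrow> \<bar>(f b - f a) / (b - a) - g x\<bar> \<le> r / 2"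
          using elim(1) by meson
        obtain N where N: "\<And>n. n \<ge> N \<Longrightarrow> \<delta> n < d"
          using order_tendstoD(2)[OF \<delta>0 d(1)] by (auto simp: eventually_sequentially)
        show "\<exists>N. \<forall>n\<ge>N. norm ((f (p n (Suc (k n))) - f (p n (k n))) / \<delta> n - g x) < r"
        proof (intro exI[of _ N] allI impI)
          fix n assume n: "N \<le> n"
          have w: "p n (Suc (k n)) - p n (k n) = \<delta> n" by (simp add: p algebra_simps)
          have "\<bar>(f (p n (Suc (k n))) - f (p n (k n))) / (p n (Suc (k n)) - p n (k n)) - g x\<bar> \<le> r / 2"
            using k[of n] w N[OF n] \<delta>[of n] by (intro d(2)) auto
          then show "norm ((f (p n (Suc (k n))) - f (p n (k n))) / \<delta> n - g x) < r"
            unfolding w using \<open>0 < r\<close> by simp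
        qed
      qed
      then have "(\<lambda>n. \<phi> ((f (p n (Suc (k n))) - f (p n (k n))) / \<delta> n)) \<longlonglongrightarrow> \<phi> (g x)"
        using continuous_on_tendsto_compose[OF \<phi>(1)] by auto
      then have "(\<lambda>n. ennreal (G n x)) \<longlonglongrightarrow> ennreal (\<phi> (g x))" unfolding Gx c_def by (rule tendsto_ennrealI)
      then show ?thesis using True by (simp add: lim_imp_Liminf)
    qed simp
  qed
  have "(\<integral>\<^sup>+x\<in>{a..b}. ennreal (\<phi> (g x)) \<partial>lborel) \<le> (\<integral>\<^sup>+x. liminf (\<lambda>n. ennreal (G n x)) \<partial>lborel)"
    by (rule nn_integral_mono_AE[OF conv])
  also have "\<dots> \<le> liminf (\<lambda>n. \<integral>\<^sup>+x. ennreal (G n x) \<partial>lborel)"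
    by (rule nn_integral_liminf) simp
  also have "\<dots> \<le> ennreal B"
    by (rule order_trans[OF Liminf_mono[of _ "\<lambda>_. ennreal B"]]) (use intG in \<open>auto simp: Liminf_const\<close>)
  finally show ?thesis .
qed

lemma sum_set_integral_partition:
  fixes f :: "real \<Rightarrow> real"
  assumes f: "locally_integrable f" and p: "\<forall>i<n. p i \<le> p (Suc i)"
  shows "(\<Sum>i<n. LINT t:{p i..p (Suc i)}|lborel. f t) = prim f (p n) - prim f (p 0)"
  using p
proof (induction n)
  case (Suc n)
  have "(\<Sum>i<Suc n. LINT t:{p i..p (Suc i)}|lborel. f t) = (prim f (p n) - prim f (p 0)) + (LINT t:{p n..p (Suc n)}|lborel. f t)"
    using Suc by simp
  then show ?case using prim_diff[OF f, of "p n" "p (Suc n)"] Suc.prems by simp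
qed simp

lemma ordered_le: "\<forall>i<n. p i \<le> (p (Suc i) :: real) \<Longrightarrow> p 0 \<le> p n"
  by (induction n) (auto intro: order_trans)

context CH_solution
begin

lemma good_ux2_li: "good t \<Longrightarrow> locally_integrable (\<lambda>x. (ux t x)\<^sup>2)"
  unfolding locally_integrable_def using good_ux2_set(1) by simp

lemma slope_square_le:
  assumes g: "good t" and xy: "x \<le> y"
  shows "(u t y - u t x)\<^sup>2 / (y - x) \<le> (LINT z:{x..y}|lborel. (ux t z)\<^sup>2)"
proof (cases "x = y")
  case True then show ?thesis using good_ux2_set(3)[OF g, of "{y..y}"] by simp
next
  case False
  have "\<bar>u t y - u t x\<bar> \<le> (LINT z:{x..y}|lborel. \<bar>ux t z\<bar>)"
    using u_diff_le[OF good_nonneg[OF g], of x y y x] xy by simp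
  then have "(u t y - u t x)\<^sup>2 \<le> (LINT z:{x..y}|lborel. \<bar>ux t z\<bar>)\<^sup>2"
    using abs_le_square_iff[of "u t y - u t x" "LINT z:{x..y}|lborel. \<bar>ux t z\<bar>"] integral_abs_ux_nonneg[of x y t] by simp
  also have "\<dots> \<le> (y - x) * (LINT z:{x..y}|lborel. (ux t z)\<^sup>2)" by (rule integral_abs_ux_sq[OF g xy])
  finally show ?thesis using False xy by (simp add: pos_divide_le_eq mult.commute)
qed

lemma slope_squares_sum_good:
  assumes g: "good t" and p: "\<forall>i<n. p i \<le> p (Suc i)"
  shows "(\<Sum>i<n. (u t (p (Suc i)) - u t (p i))\<^sup>2 / (p (Suc i) - p i)) \<le> 2 * C"
proof -
  note li = good_ux2_li[OF g]
  have "(\<Sum>i<n. (u t (p (Suc i)) - u t (p i))\<^sup>2 / (p (Suc i) - p i)) \<le> (\<Sum>i<n. LINT z:{p i..p (Suc i)}|lborel. (ux t z)\<^sup>2)"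
    using p by (intro sum_mono slope_square_le g) simp
  also have "\<dots> = (LINT z:{p 0..p n}|lborel. (ux t z)\<^sup>2)"
    using sum_set_integral_partition[OF li p] prim_diff[OF li ordered_le[OF p]] by simp
  also have "\<dots> \<le> 2 * C" by (rule good_ux2_set(2)[OF g]) simp
  finally show ?thesis .
qed

text \<open>
  For a fixed partition the left-hand side is continuous in time, so the bound at good times
  holds always.
\<close>
lemma slope_squares_sum:
  assumes t: "0 \<le> t" and p: "\<forall>i<n. p i \<le> p (Suc i)"
  shows "(\<Sum>i<n. (u t (p (Suc i)) - u t (p i))\<^sup>2 / (p (Suc i) - p i)) \<le> 2 * C"
proof (rule good_extend[OF _ _ t])
  show "continuous_on {0..} (\<lambda>t. \<Sum>i<n. (u t (p (Suc i)) - u t (p i))\<^sup>2 / (p (Suc i) - p i))"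
    unfolding divide_inverse by (intro continuous_on_sum continuous_on_mult_right continuous_intros u_cont_compose) auto
qed (rule slope_squares_sum_good[OF _ p])

text \<open>
  The energy is bounded by assumption at almost every time only, while the claim concerns every
  time. Partition sums carry the bound over, because they are continuous in time.
\<close>
lemma ux2_all_times:
  assumes t: "0 \<le> t" and ab: "a \<le> b"
  shows "set_integrable lborel {a..b} (\<lambda>x. (ux t x)\<^sup>2)" "(LINT x:{a..b}|lborel. (ux t x)\<^sup>2) \<le> 2 * C"
proof -
  have [measurable]: "ux t \<in> borel_measurable borel" by (rule ux_measurable[OF t])
  have le: "(\<integral>\<^sup>+x\<in>{a..b}. ennreal ((ux t x)\<^sup>2) \<partial>lborel) \<le> ennreal (2 * C)"
  proof (cases "a = b")
    case True
    have "(\<integral>\<^sup>+x\<in>{a..b}. ennreal ((ux t x)\<^sup>2) \<partial>lborel) = (\<integral>\<^sup>+x. 0 \<partial>(lborel :: real measure))"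
      by (rule nn_integral_cong_AE) (use AE_lborel_singleton[of b] True in \<open>auto elim!: eventually_mono\<close>)
    then show ?thesis by simp
  next
    case False
    then have ab: "a < b" using ab by simp
    show ?thesis
    proof (rule nn_integral_le_of_partition_sums[OF ux_locally_integrable[OF t] u_FTC[OF t] _ _ ab, of "\<lambda>r. r\<^sup>2"])
      fix n
      have eq: "(v / d)\<^sup>2 * d = v\<^sup>2 / d" for v d :: real by (simp add: power2_eq_square)
      have "(\<Sum>i<Suc n. (u t (grid a b (Suc n) (Suc i)) - u t (grid a b (Suc n) i))\<^sup>2 / (grid a b (Suc n) (Suc i) - grid a b (Suc n) i)) \<le> 2 * C"
        by (rule slope_squares_sum[OF t]) (use grid_facts(4)[OF ab, of "Suc n"] in \<open>auto intro: less_imp_le\<close>)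
      then show "(\<Sum>i<Suc n. ((u t (grid a b (Suc n) (Suc i)) - u t (grid a b (Suc n) i)) / ((b - a) / real (Suc n)))\<^sup>2 * ((b - a) / real (Suc n))) \<le> 2 * C"
        unfolding eq using grid_facts(3)[OF ab, of "Suc n"] by (simp del: sum.lessThan_Suc of_nat_Suc)
    qed (auto intro!: continuous_intros)
  qed
  have eq: "ennreal ((ux t x)\<^sup>2) * indicator {a..b} x = ennreal (indicator {a..b} x *\<^sub>R (ux t x)\<^sup>2)" for x
    by (simp add: indicator_def)
  show i: "set_integrable lborel {a..b} (\<lambda>x. (ux t x)\<^sup>2)" unfolding set_integrable_def
  proof (rule integrableI_nonneg)
    show "(\<integral>\<^sup>+x. ennreal (indicator {a..b} x *\<^sub>R (ux t x)\<^sup>2) \<partial>lborel) < \<infinity>"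
      using le unfolding eq by (rule le_less_trans) simp
  qed (auto simp: indicator_def)
  have "(\<integral>\<^sup>+x. ennreal (indicator {a..b} x *\<^sub>R (ux t x)\<^sup>2) \<partial>lborel) = ennreal (LINT x:{a..b}|lborel. (ux t x)\<^sup>2)"
    using i unfolding set_integrable_def set_lebesgue_integral_def by (intro nn_integral_eq_integral) (auto simp: indicator_def)
  then show "(LINT x:{a..b}|lborel. (ux t x)\<^sup>2) \<le> 2 * C" using le C(1) unfolding eq by (simp add: ennreal_le_iff)
qed

abbreviation "uxp t x \<equiv> max (ux t x) 0"

lemma uxp2_li:
  assumes t: "0 \<le> t" shows "locally_integrable (\<lambda>x. (uxp t x)\<^sup>2)"
  unfolding locally_integrable_def
proof (intro allI)
  have [measurable]: "ux t \<in> borel_measurable borel" by (rule ux_measurable[OF t])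
  fix a b :: real
  show "set_integrable lborel {a..b} (\<lambda>x. (uxp t x)\<^sup>2)"
  proof (cases "a \<le> b")
    case True
    show ?thesis
      by (rule set_integrable_bound[OF ux2_all_times(1)[OF t True]])
         (auto simp: set_borel_measurable_def max_def)
  qed (simp add: set_integrable_def)
qed

lemma uxp2_bounds:
  assumes t: "0 \<le> t"
  shows "(LINT x:{a..b}|lborel. (uxp t x)\<^sup>2) \<le> 2 * C" "0 \<le> (LINT x:{a..b}|lborel. (uxp t x)\<^sup>2)"
proof -
  show "0 \<le> (LINT x:{a..b}|lborel. (uxp t x)\<^sup>2)"
    unfolding set_lebesgue_integral_def by (rule integral_nonneg_AE) (auto simp: indicator_def)
  show "(LINT x:{a..b}|lborel. (uxp t x)\<^sup>2) \<le> 2 * C"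
  proof (cases "a \<le> b")
    case True
    have "(LINT x:{a..b}|lborel. (uxp t x)\<^sup>2) \<le> (LINT x:{a..b}|lborel. (ux t x)\<^sup>2)"
      by (rule set_integral_mono[OF locally_integrableD[OF uxp2_li[OF t]] ux2_all_times(1)[OF t True]]) (auto simp: max_def)
    then show ?thesis using ux2_all_times(2)[OF t True] by simp
  qed (use C(1) in \<open>simp add: set_lebesgue_integral_def\<close>)
qed

text \<open>
  The least possible integral of \<open>(u_x\<^sup>+)\<^sup>2\<close> over \<open>[x, y]\<close> for the given end values. For \<open>x = y\<close>
  the value is \<open>0\<close> by the convention for division.
\<close>
definition slope_energy :: "real \<Rightarrow> real \<Rightarrow> real \<Rightarrow> real" where
  "slope_energy t x y = (max (u t y - u t x) 0)\<^sup>2 / (y - x)"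

text \<open>
  \<open>u t y - u t x\<close> is at most the integral of \<open>u_x\<^sup>+\<close>; then use Cauchy-Schwarz.
\<close>
lemma slope_energy_le:
  assumes t: "0 \<le> t" and xy: "x \<le> y"
  shows "slope_energy t x y \<le> (LINT z:{x..y}|lborel. (uxp t z)\<^sup>2)"
proof (cases "x = y")
  case True then show ?thesis using uxp2_bounds(2)[OF t, of y y] by (simp add: slope_energy_def)
next
  case False
  note li = locally_integrableD[OF ux_locally_integrable[OF t], of x y]
  have [measurable]: "ux t \<in> borel_measurable borel" by (rule ux_measurable[OF t])
  have lip: "set_integrable lborel {x..y} (uxp t)"
    by (rule set_integrable_bound[OF li]) (auto simp: set_borel_measurable_def max_def)
  have pos: "0 \<le> (LINT z:{x..y}|lborel. uxp t z)"
    unfolding set_lebesgue_integral_def by (rule integral_nonneg_AE) (auto simp: indicator_def)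
  have "u t y - u t x \<le> (LINT z:{x..y}|lborel. uxp t z)"
    unfolding u_FTC[OF t xy] by (rule set_integral_mono[OF li lip]) simp
  then have "(max (u t y - u t x) 0)\<^sup>2 \<le> (LINT z:{x..y}|lborel. \<bar>uxp t z\<bar>)\<^sup>2"
    using pos by (intro power_mono) auto
  also have "\<dots> \<le> measure lborel {x..y} * (LINT z:{x..y}|lborel. (uxp t z)\<^sup>2)"
    by (rule integral_abs_sq_le[OF lip locally_integrableD[OF uxp2_li[OF t]]]) (auto simp: emeasure_lborel_Icc_eq)
  finally show ?thesis using False xy by (simp add: slope_energy_def pos_divide_le_eq mult.commute)
qed

lemma slope_energy_sum_le:
  assumes t: "0 \<le> t" and p: "\<forall>i<n. p i \<le> p (Suc i)"
  shows "(\<Sum>i<n. slope_energy t (p i) (p (Suc i))) \<le> (LINT z:{p 0..p n}|lborel. (uxp t z)\<^sup>2)"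
proof -
  have "(\<Sum>i<n. slope_energy t (p i) (p (Suc i))) \<le> (\<Sum>i<n. LINT z:{p i..p (Suc i)}|lborel. (uxp t z)\<^sup>2)"
    using p by (intro sum_mono slope_energy_le t) simp
  also have "\<dots> = (LINT z:{p 0..p n}|lborel. (uxp t z)\<^sup>2)"
    using sum_set_integral_partition[OF uxp2_li[OF t] p] prim_diff[OF uxp2_li[OF t] ordered_le[OF p]] by simp
  finally show ?thesis .
qed

lemma uxp2_le_of_slope_energies:
  assumes t: "0 \<le> t" and ab: "a < b"
    and B: "\<And>n. (\<Sum>i<Suc n. slope_energy t (grid a b (Suc n) i) (grid a b (Suc n) (Suc i))) \<le> B" and B0: "0 \<le> B"
  shows "(LINT x:{a..b}|lborel. (uxp t x)\<^sup>2) \<le> B"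
proof -
  have le: "(\<integral>\<^sup>+x\<in>{a..b}. ennreal ((uxp t x)\<^sup>2) \<partial>lborel) \<le> ennreal B"
  proof (rule nn_integral_le_of_partition_sums[OF ux_locally_integrable[OF t] u_FTC[OF t] _ _ ab, of "\<lambda>r. (max r 0)\<^sup>2"])
    fix n
    have eq: "(max (v / d) 0)\<^sup>2 * d = (max v 0)\<^sup>2 / d" if "d > 0" for v d :: real
      using that by (simp add: power2_eq_square max_def divide_le_0_iff zero_le_divide_iff)
    have d: "(b - a) / real (Suc n) > 0" using ab by simp
    show "(\<Sum>i<Suc n. (max ((u t (grid a b (Suc n) (Suc i)) - u t (grid a b (Suc n) i)) / ((b - a) / real (Suc n))) 0)\<^sup>2 * ((b - a) / real (Suc n))) \<le> B"
      unfolding eq[OF d] using B[of n] grid_facts(3)[OF ab, of "Suc n"]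
      by (simp add: slope_energy_def del: sum.lessThan_Suc of_nat_Suc)
  qed (auto intro!: continuous_intros)
  have eq: "ennreal ((uxp t x)\<^sup>2) * indicator {a..b} x = ennreal (indicator {a..b} x *\<^sub>R (uxp t x)\<^sup>2)" for x
    by (simp add: indicator_def)
  have "(\<integral>\<^sup>+x. ennreal (indicator {a..b} x *\<^sub>R (uxp t x)\<^sup>2) \<partial>lborel) = ennreal (LINT x:{a..b}|lborel. (uxp t x)\<^sup>2)"
    using locally_integrableD[OF uxp2_li[OF t], of a b] unfolding set_integrable_def set_lebesgue_integral_def
    by (intro nn_integral_eq_integral) (auto simp: indicator_def)
  then show ?thesis using le B0 unfolding eq by (simp add: ennreal_le_iff)
qed

end

section \<open>The energy between two characteristics\<close>

text \<open>
  The lower right Dini derivative is nonnegative. For each \<open>e\<close> the set of times at which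
  \<open>f t \<ge> f a - e * (t - a)\<close> has a largest element, and this can only be \<open>b\<close>.
\<close>
lemma dini_nondecreasing:
  fixes f :: "real \<Rightarrow> real"
  assumes ab: "a \<le> b" and f: "continuous_on {a..b} f"
    and dini: "\<And>t e. a \<le> t \<Longrightarrow> t < b \<Longrightarrow> 0 < e \<Longrightarrow>
      \<exists>\<delta>>0. \<forall>r. t < r \<and> r < t + \<delta> \<and> r \<le> b \<longrightarrow> f r - f t \<ge> - e * (r - t)"
  shows "f a \<le> f b"
proof (rule field_le_epsilon)
  fix e0 :: real assume e0: "e0 > 0"
  define e where "e = e0 / (b - a + 1)"
  have e: "e > 0" "e * (b - a) \<le> e0"
    using e0 ab by (auto simp: e_def field_simps)
  define S where "S = {t \<in> {a..b}. f a - e * (t - a) \<le> f t}"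
  have "closed S" unfolding S_def
    by (intro continuous_on_closed_Collect_le f continuous_intros)
  then have "compact S" unfolding S_def
    by (metis (no_types, lifting) bounded_closed_interval bounded_subset compact_eq_bounded_closed mem_Collect_eq subsetI)
  moreover have "S \<noteq> {}" using ab by (auto simp: S_def)
  ultimately obtain t where t: "t \<in> S" "\<And>r. r \<in> S \<Longrightarrow> r \<le> t"
    using compact_attains_sup by meson
  have "t = b"
  proof (rule ccontr)
    assume "t \<noteq> b"
    then have tb: "a \<le> t" "t < b" using t(1) by (auto simp: S_def)
    obtain \<delta> where \<delta>: "\<delta> > 0" "\<And>r. t < r \<Longrightarrow> r < t + \<delta> \<Longrightarrow> r \<le> b \<Longrightarrow> f r - f t \<ge> - e * (r - t)"
      using dini[OF tb e(1)] by blast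
    define r where "r = min (t + \<delta> / 2) b"
    have r: "t < r" "r < t + \<delta>" "r \<le> b" using \<delta>(1) tb by (auto simp: r_def)
    have "f a - e * (t - a) \<le> f t" using t(1) by (simp add: S_def)
    then have "f a - e * (r - a) \<le> f r" using \<delta>(2)[OF r] by (simp add: algebra_simps)
    then have "r \<in> S" using r tb by (simp add: S_def)
    then show False using t(2) r by force
  qed
  then have "f a - e * (b - a) \<le> f b" using t(1) by (simp add: S_def)
  then show "f a \<le> f b + e0" using e(2) by linarith
qed

context CH_solution
begin

lemma F_diff_lower_slope:
  assumes g: "good t" and xy: "x \<le> y"
  shows "F t y - F t x \<ge> (u t y - u t x)\<^sup>2 / (2 * (y - x)) - C / 2 * (y - x)"
proof -
  have "(u t y - u t x)\<^sup>2 / (y - x) \<le> (LINT z:{x..y}|lborel. (ux t z)\<^sup>2)" by (rule slope_square_le[OF g xy])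
  also have "\<dots> \<le> (LINT z:{x..y}|lborel. 2 * h t z)"
  proof (rule set_integral_mono)
    show "set_integrable lborel {x..y} (\<lambda>z. (ux t z)\<^sup>2)" by (rule good_ux2_set(1)[OF g]) simp
    show "set_integrable lborel {x..y} (\<lambda>z. 2 * h t z)"
      unfolding set_integrable_def by (rule integrable_mult_indicator) (use good_h(1)[OF g] in auto)
  qed (simp add: energy_density_def)
  also have "\<dots> = 2 * (LINT z:{x..y}|lborel. h t z)" by simp
  finally have "(u t y - u t x)\<^sup>2 / (y - x) / 2 \<le> (LINT z:{x..y}|lborel. h t z)"
    by (rule divide_le_eq_numeral1(1)[THEN iffD2, OF order_trans]) (simp only: mult.commute order_refl)
  then have "(u t y - u t x)\<^sup>2 / (2 * (y - x)) \<le> (LINT z:{x..y}|lborel. h t z)"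
    by (simp only: divide_divide_eq_left mult.commute[of _ 2])
  then show ?thesis using F_diff_lower[OF g xy] by linarith
qed

end

text \<open>
  Two ordered solution curves. They may touch, coincide for a while and separate again.
\<close>
locale CH_pair = CH_solution +
  fixes s :: real and y z :: "real \<Rightarrow> real"
  assumes s: "0 \<le> s" and y: "solution_from s u y" and z: "solution_from s u z"
    and yc: "continuous_on UNIV y" and zc: "continuous_on UNIV z"
    and ordered: "\<And>t. s \<le> t \<Longrightarrow> y t \<le> z t"
begin

text \<open>
  Distance, difference of the values of \<open>u\<close>, positive slope energy between the two curves, and a
  primitive of \<open>w\<^sup>+\<close>. The maximum with \<open>0\<close> makes \<open>w\<close> continuous on the whole line.
\<close>
definition d :: "real \<Rightarrow> real" where "d t = z t - y t"
definition w :: "real \<Rightarrow> real" where "w t = u (max 0 t) (z t) - u (max 0 t) (y t)"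
definition q :: "real \<Rightarrow> real" where "q t = (max (w t) 0)\<^sup>2 / d t"
definition W :: "real \<Rightarrow> real" where "W = prim (\<lambda>t. max (w t) 0)"

lemma w_eq: "s \<le> t \<Longrightarrow> w t = u t (z t) - u t (y t)" using s by (simp add: w_def max_absorb2)

lemma q_eq: "s \<le> t \<Longrightarrow> q t = slope_energy t (y t) (z t)" by (simp add: q_def slope_energy_def w_eq d_def)

lemma w_cont: "continuous_on S w" and wp_cont: "continuous_on S (\<lambda>t. max (w t) 0)"
proof -
  have "continuous_on UNIV w" unfolding w_def[abs_def]
    by (intro continuous_on_diff u_cont_compose continuous_on_max continuous_on_const continuous_on_id yc zc) auto
  then show *: "continuous_on S w" for S by (rule continuous_on_subset) simp
  show "continuous_on S (\<lambda>t. max (w t) 0)" by (intro continuous_on_max * continuous_on_const)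
qed

lemma d_cont: "continuous_on S d"
  unfolding d_def[abs_def] by (intro continuous_on_diff continuous_on_subset[OF yc] continuous_on_subset[OF zc]) auto

lemma d_nonneg: "s \<le> t \<Longrightarrow> 0 \<le> d t" using ordered by (simp add: d_def)

lemma d_DERIV: assumes "s \<le> t" shows "(d has_real_derivative w t) (at t within {s..})"
  using DERIV_diff[OF solution_fromD[OF z assms] solution_fromD[OF y assms]]
  unfolding d_def[abs_def] w_eq[OF assms] .

lemma W_cont: "continuous_on S W"
  unfolding W_def by (rule continuous_at_imp_continuous_on) (use prim_DERIV[OF wp_cont, THEN DERIV_isCont] in blast)

lemma W_increment: "a \<le> b \<Longrightarrow> W b - W a = (LINT t:{a..b}|lborel. max (w t) 0)"
  unfolding W_def by (rule prim_diff[OF locally_integrable_continuous[OF wp_cont]])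

lemma W_mono: assumes "a \<le> b" shows "W a \<le> W b"
proof -
  have "0 \<le> (LINT t:{a..b}|lborel. max (w t) 0)"
    unfolding set_lebesgue_integral_def by (rule integral_nonneg_AE) (auto simp: indicator_def)
  then show ?thesis using W_increment[OF assms] by simp
qed

lemma q_nonneg: "s \<le> t \<Longrightarrow> 0 \<le> q t" unfolding q_def using d_nonneg by simp

text \<open>
  The derivative of \<open>w\<close> exists almost everywhere only, so its lower bound is stated in
  integrated form, with a constant \<open>\<omega>\<close> below the bound on the time interval.
\<close>
lemma w_increment_ge:
  assumes ab: "s \<le> a" "a \<le> b" and low: "\<And>t. a \<le> t \<Longrightarrow> t \<le> b \<Longrightarrow> \<omega> \<le> (w t)\<^sup>2 / (2 * d t) - C / 2 * d t"
  shows "w b - w a \<ge> \<omega> * (b - a)"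
proof -
  have a0: "0 \<le> a" using ab s by simp
  define J where "J t = G t (z t) - G t (y t)" for t
  have ym: "y \<in> borel_measurable borel" and zm: "z \<in> borel_measurable borel"
    using yc zc by (auto intro: borel_measurable_continuous_onI)
  have i: "set_integrable lborel {a..b} (\<lambda>t. G t (x t))" if "x \<in> borel_measurable borel" for x
  proof (rule set_integrable_bounded_Icc[where B="C / 2"])
    show "(\<lambda>t. G t (x t)) \<in> borel_measurable borel" using that by (intro G_compose) auto
    show "AE t in lborel. t \<in> {a..b} \<longrightarrow> \<bar>G t (x t)\<bar> \<le> C / 2"
      using AE_good_Icc[OF a0, of b] by eventually_elim (use F_bound UVGH(4) good_nonneg in \<open>auto simp: fun_eq_iff\<close>)
  qed
  have "w b - w a = (LINT t:{a..b}|lborel. G t (z t)) - (LINT t:{a..b}|lborel. G t (y t))"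
    using u_along_solution[OF s z zm ab] u_along_solution[OF s y ym ab] w_eq[of a] w_eq[of b] ab by simp
  also have "\<dots> = (LINT t:{a..b}|lborel. J t)"
    unfolding J_def by (rule set_integral_diff(2)[OF i[OF zm] i[OF ym], symmetric])
  also have "\<dots> \<ge> (LINT t:{a..b}|lborel. \<omega>)"
  proof (rule set_integral_mono_AE[OF set_integrable_const_Icc])
    show "set_integrable lborel {a..b} J" unfolding J_def[abs_def] by (rule set_integral_diff(1)[OF i[OF zm] i[OF ym]])
    show "AE t \<in> {a..b} in lborel. \<omega> \<le> J t"
      using AE_good_Icc[OF a0, of b]
    proof eventually_elim
      case (elim t)
      show ?case
      proof
        assume t: "t \<in> {a..b}"
        then have g: "good t" using elim by simp
        have "\<omega> \<le> (w t)\<^sup>2 / (2 * d t) - C / 2 * d t" using low t by simp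
        also have "\<dots> \<le> F t (z t) - F t (y t)"
          using F_diff_lower_slope[OF g ordered, of t] t ab w_eq[of t] by (simp add: d_def)
        finally show "\<omega> \<le> J t" using good_nonneg[OF g] by (simp add: J_def UVGH)
      qed
    qed
  qed
  finally show ?thesis using set_integral_const_Icc[OF ab(2), of \<omega>] by simp
qed

text \<open>
  \<open>(v\<^sup>+)\<^sup>2 / D\<close> is a convex function of \<open>(v, D)\<close>, and the right-hand side is its tangent plane at
  the points with \<open>v = p * D\<close>.
\<close>
lemma tangent_inequality:
  fixes p :: real assumes "0 \<le> p" "0 < D"
  shows "(max v 0)\<^sup>2 / D \<ge> 2 * p * v - p\<^sup>2 * D"
proof -
  have "(max v 0)\<^sup>2 - (2 * p * max v 0 - p\<^sup>2 * D) * D = (max v 0 - p * D)\<^sup>2"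
    by (simp add: power2_eq_square algebra_simps)
  then have "(2 * p * max v 0 - p\<^sup>2 * D) * D \<le> (max v 0)\<^sup>2" using zero_le_power2[of "max v 0 - p * D"] by linarith
  then have "2 * p * max v 0 - p\<^sup>2 * D \<le> (max v 0)\<^sup>2 / D"
    using assms by (simp only: pos_le_divide_eq)
  moreover have "2 * p * v \<le> 2 * p * max v 0" using assms by (intro mult_left_mono) auto
  ultimately show ?thesis by linarith
qed

text \<open>
  Formally, with \<open>p = w\<^sup>+ / d\<close>, one has \<open>q' = 2 * p * w' - p\<^sup>2 * d'\<close>, and inserting \<open>d' = w\<close> and
  \<open>w' \<ge> w\<^sup>2 / (2 * d) - (C / 2) * d\<close> leaves \<open>q' \<ge> - C * w\<^sup>+\<close>. Since \<open>w\<close> need not be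
  differentiable, the tangent plane at time \<open>t\<close> bounds \<open>q r\<close> from below, and only increments of
  \<open>w\<close> and \<open>d\<close> are needed.
\<close>
lemma q_monotone_apart:
  assumes ab: "s \<le> a" "a \<le> b" and apart: "\<And>t. a \<le> t \<Longrightarrow> t \<le> b \<Longrightarrow> 0 < d t"
  shows "q a + C * W a \<le> q b + C * W b"
proof (rule dini_nondecreasing[OF ab(2)])
  show "continuous_on {a..b} (\<lambda>t. q t + C * W t)" unfolding q_def[abs_def]
    by (intro continuous_on_add continuous_on_mult_left continuous_on_divide continuous_on_power wp_cont d_cont W_cont)
       (use apart in force)
  fix t e :: real assume t: "a \<le> t" "t < b" and e: "0 < e"
  have st: "s \<le> t" using t ab by simp
  have dt: "0 < d t" using apart t by simp
  define v where "v = max (w t) 0"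
  define p where "p = v / d t"
  have p: "0 \<le> p" "p * d t = v" using dt by (auto simp: p_def v_def)
  have vw: "p * w t = p * v" by (auto simp: p_def v_def max_def)
  have C0: "0 \<le> C" by (rule C(1))
  \<comment> \<open>Three quantities vary by at most \<open>e'\<close> over the short time interval; the denominator
      collects the factors with which these errors enter at the end.\<close>
  define e' where "e' = e / (2 * p + p\<^sup>2 + C + 1)"
  have den: "2 * p + p\<^sup>2 + C + 1 > 0" using p C0 by (intro add_nonneg_pos add_nonneg_nonneg) auto
  have e': "e' > 0" "(2 * p + p\<^sup>2 + C) * e' \<le> e"
  proof -
    show "e' > 0" using e den by (simp add: e'_def)
    have "(2 * p + p\<^sup>2 + C + 1) * e' = e" using den by (simp add: e'_def)
    then show "(2 * p + p\<^sup>2 + C) * e' \<le> e" using \<open>e' > 0\<close> by (simp add: distrib_right)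
  qed
  define om where "om r = (w r)\<^sup>2 / (2 * d r) - C / 2 * d r" for r
  have "continuous_on {a..b} om" unfolding om_def[abs_def]
    by (intro continuous_on_diff continuous_on_divide continuous_on_mult continuous_on_const continuous_on_power w_cont d_cont)
       (use apart in force)
  then obtain \<delta>1 where \<delta>1: "\<delta>1 > 0" "\<And>r. r \<in> {a..b} \<Longrightarrow> \<bar>r - t\<bar> < \<delta>1 \<Longrightarrow> \<bar>om r - om t\<bar> < e'"
    using t e'(1) unfolding continuous_on_iff dist_real_def by (metis atLeastAtMost_iff less_imp_le)
  obtain \<delta>2 where \<delta>2: "\<delta>2 > 0" "\<And>r. \<bar>r - t\<bar> < \<delta>2 \<Longrightarrow> \<bar>max (w r) 0 - v\<bar> < e'"
    using wp_cont[of UNIV] e'(1) unfolding continuous_on_iff dist_real_def v_def by (metis UNIV_I)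
  obtain \<delta>3 where \<delta>3: "\<delta>3 > 0" "\<And>r. r \<in> {s..} \<Longrightarrow> norm (r - t) < \<delta>3 \<Longrightarrow> norm (d r - d t - w t * (r - t)) \<le> e' * norm (r - t)"
    using d_DERIV[OF st] e'(1) unfolding has_field_derivative_def has_derivative_within_alt by meson
  show "\<exists>\<delta>>0. \<forall>r. t < r \<and> r < t + \<delta> \<and> r \<le> b \<longrightarrow> (q r + C * W r) - (q t + C * W t) \<ge> - e * (r - t)"
  proof (intro exI[of _ "min \<delta>1 (min \<delta>2 \<delta>3)"] conjI allI impI)
    fix r assume "t < r \<and> r < t + min \<delta>1 (min \<delta>2 \<delta>3) \<and> r \<le> b"
    then have r: "t < r" "r < t + \<delta>1" "r < t + \<delta>2" "r < t + \<delta>3" "r \<le> b" by auto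
    define H where "H = r - t"
    have H: "H > 0" using r by (simp add: H_def)
    have wr: "w r - w t \<ge> (om t - e') * H"
      unfolding H_def
    proof (rule w_increment_ge[OF st])
      fix r' assume "t \<le> r'" "r' \<le> r"
      then have "\<bar>om r' - om t\<bar> < e'" using r t by (intro \<delta>1(2)) auto
      then show "om t - e' \<le> (w r')\<^sup>2 / (2 * d r') - C / 2 * d r'" unfolding om_def[of r', symmetric] by linarith
    qed (use r in simp)
    have dr: "d r - d t \<le> (w t + e') * H"
    proof -
      have "\<bar>d r - d t - w t * (r - t)\<bar> \<le> e' * \<bar>r - t\<bar>" using \<delta>3(2)[of r] r st by simp
      then show ?thesis using r by (simp add: H_def distrib_right)
    qed
    have Wr: "W r - W t \<ge> (v - e') * H"
    proof -
      have "\<bar>(LINT q:{t..r}|lborel. max (w q) 0) - v * (r - t)\<bar> \<le> e' * (r - t)"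
      proof (rule set_integral_near_const)
        show "set_integrable lborel {t..r} (\<lambda>q. max (w q) 0)" by (rule borel_integrable_atLeastAtMost'[OF wp_cont])
        show "AE q in lborel. q \<in> {t..r} \<longrightarrow> \<bar>max (w q) 0 - v\<bar> \<le> e'"
          using \<delta>2(2) r by (intro AE_I2 impI) (force intro: less_imp_le)
      qed (use r in simp)
      then show ?thesis using W_increment[of t r] r by (simp add: H_def left_diff_distrib)
    qed
    have qt: "q t = 2 * p * w t - p\<^sup>2 * d t"
    proof -
      have "q t = p * v" by (simp add: q_def p_def v_def power2_eq_square)
      moreover have "p\<^sup>2 * d t = p * v" using p(2) by (simp add: power2_eq_square mult.assoc)
      moreover have "2 * p * w t = 2 * (p * v)" using vw by simp
      ultimately show ?thesis by linarith
    qed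
    have "q r \<ge> 2 * p * w r - p\<^sup>2 * d r"
      unfolding q_def using p(1) apart r t by (intro tangent_inequality) auto
    then have "q r - q t \<ge> 2 * p * (w r - w t) - p\<^sup>2 * (d r - d t)"
      unfolding qt by (simp add: algebra_simps)
    moreover have "2 * p * (w r - w t) \<ge> 2 * p * ((om t - e') * H)" using wr p by (intro mult_left_mono) auto
    moreover have "p\<^sup>2 * (d r - d t) \<le> p\<^sup>2 * ((w t + e') * H)" using dr by (intro mult_left_mono) auto
    moreover have "C * (W r - W t) \<ge> C * ((v - e') * H)" using Wr C0 by (intro mult_left_mono) auto
    ultimately have "(q r + C * W r) - (q t + C * W t) \<ge>
        2 * p * ((om t - e') * H) - p\<^sup>2 * ((w t + e') * H) + C * ((v - e') * H)"
      by (simp add: algebra_simps)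
    also have "2 * p * ((om t - e') * H) - p\<^sup>2 * ((w t + e') * H) + C * ((v - e') * H) =
        (2 * p * om t - p\<^sup>2 * w t + C * v) * H - ((2 * p + p\<^sup>2 + C) * e') * H"
      by (simp add: algebra_simps)
    \<comment> \<open>The cancellation of the quadratic terms.\<close>
    also have "2 * p * om t - p\<^sup>2 * w t + C * v = 0"
    proof -
      have "2 * p * om t = p * (w t)\<^sup>2 / d t - C * (p * d t)"
        using dt by (simp add: om_def field_simps power2_eq_square)
      also have "p * (w t)\<^sup>2 / d t = p\<^sup>2 * w t"
      proof -
        have "p * (w t)\<^sup>2 = (p * w t) * w t" by (simp add: power2_eq_square)
        also have "\<dots> = (p * v) * w t" by (simp only: vw)
        also have "\<dots> = v * (p * w t)" by (simp only: mult_ac)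
        finally have "p * (w t)\<^sup>2 / d t = (v / d t) * (p * w t)" by simp
        moreover have "v / d t = p" by (simp add: p_def)
        ultimately show ?thesis by (simp only: power2_eq_square mult.assoc)
      qed
      finally show ?thesis using p(2) by simp
    qed
    finally have "(q r + C * W r) - (q t + C * W t) \<ge> - (((2 * p + p\<^sup>2 + C) * e') * H)" by simp
    moreover have "((2 * p + p\<^sup>2 + C) * e') * H \<le> e * H" using e'(2) H by (intro mult_right_mono) auto
    ultimately show "(q r + C * W r) - (q t + C * W t) \<ge> - e * (r - t)" by (simp add: H_def)
  qed (use \<delta>1 \<delta>2 \<delta>3 in auto)
qed

text \<open>
  At a collision \<open>d = 0\<close>, and \<open>q = 0\<close> by the convention for division. Without a collision this
  is \<open>q_monotone_apart\<close>; otherwise consider the first one from time \<open>a\<close> on. If \<open>w \<le> 0\<close> at some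
  time before it, then \<open>q\<close> vanishes at that time, and \<open>q a\<close> has already been paid for. If
  \<open>w > 0\<close> up to the collision, the distance would have increased, so the collision takes place
  at time \<open>a\<close> and \<open>q a = 0\<close>. In both cases what is left is \<open>q b \<ge> 0\<close> and the monotonicity of
  \<open>W\<close>.
\<close>
lemma q_monotone:
  assumes ab: "s \<le> a" "a \<le> b"
  shows "q a + C * W a \<le> q b + C * W b"
proof -
  have Wm: "C * W t \<le> C * W b" if "t \<le> b" for t using W_mono[OF that] C(1) by (intro mult_left_mono)
  have qb: "0 \<le> q b" using q_nonneg ab by simp
  show ?thesis
  proof (cases "\<forall>t. a \<le> t \<and> t \<le> b \<longrightarrow> 0 < d t")
    case True then show ?thesis by (intro q_monotone_apart ab) auto
  next
    case False
    define Z where "Z = {t \<in> {a..b}. d t \<le> 0}"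
    have "closed Z" unfolding Z_def by (intro continuous_on_closed_Collect_le d_cont continuous_intros)
    then have "compact Z" unfolding Z_def
      by (metis (no_types, lifting) bounded_closed_interval bounded_subset compact_eq_bounded_closed mem_Collect_eq subsetI)
    moreover have "Z \<noteq> {}" using False by (force simp: Z_def not_less)
    ultimately obtain r where r: "r \<in> Z" "\<And>t. t \<in> Z \<Longrightarrow> r \<le> t"
      using compact_attains_inf by meson
    have rab: "a \<le> r" "r \<le> b" and dr: "d r = 0" using r(1) d_nonneg[of r] ab by (auto simp: Z_def)
    have before: "0 < d t" if "a \<le> t" "t < r" for t using r(2)[of t] that rab by (force simp: Z_def not_le)
    show ?thesis
    proof (cases "\<exists>t. a \<le> t \<and> t < r \<and> w t \<le> 0")
      case True
      then obtain t where t: "a \<le> t" "t < r" "w t \<le> 0" by blast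
      have "q a + C * W a \<le> q t + C * W t"
        using before t ab by (intro q_monotone_apart) auto
      also have "q t = 0" using t(3) by (simp add: q_def max_def)
      finally show ?thesis using Wm[of t] t rab qb by simp
    next
      case False
      then have pos: "0 < w t" if "a \<le> t" "t < r" for t using that by (force simp: not_le)
      have "a = r"
      proof (rule ccontr)
        assume "a \<noteq> r"
        then have ar: "a < r" using rab by simp
        have "\<exists>x\<in>{a<..<r}. d r - d a = w x * (r - a)"
        proof (rule mvt_simple[OF ar])
          fix x assume "a \<le> x" "x \<le> r"
          then have "(d has_real_derivative w x) (at x within {a..r})"
            using d_DERIV[of x] ab by (auto intro: DERIV_subset)
          then show "(d has_derivative (\<lambda>h. w x * h)) (at x within {a..r})"
            by (simp add: has_field_derivative_def)
        qed
        then obtain x where x: "x \<in> {a<..<r}" "d r - d a = w x * (r - a)" by blast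
        have "0 < w x * (r - a)" using pos[of x] x(1) ar by simp
        then show False using x(2) dr before[of a] ar by simp
      qed
      then have "q a = 0" using dr by (simp add: q_def)
      then show ?thesis using Wm[OF ab(2)] qb by simp
    qed
  qed
qed

text \<open>
  This bound can be summed over many pairs of neighbours: the distances add up to the total
  width, and the quotients to at most the integral of \<open>ux\<^sup>2\<close>.
\<close>
lemma w_plus_le:
  assumes t: "s \<le> t"
  shows "max (w t) 0 \<le> (d t + (w t)\<^sup>2 / d t) / 2"
proof (cases "d t = 0")
  case True
  then have "w t = 0" using w_eq[OF t] by (simp add: d_def)
  then show ?thesis using True by simp
next
  case False
  then have D: "0 < d t" using d_nonneg[OF t] by simp
  have "(\<bar>w t\<bar> - d t)\<^sup>2 = (w t)\<^sup>2 - 2 * \<bar>w t\<bar> * d t + d t * d t"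
    by (simp only: power2_diff power2_abs) (simp add: power2_eq_square)
  then have "2 * \<bar>w t\<bar> * d t \<le> d t * d t + (w t)\<^sup>2" using zero_le_power2[of "\<bar>w t\<bar> - d t"] by linarith
  then have "\<bar>w t\<bar> \<le> (d t + (w t)\<^sup>2 / d t) / 2" using D by (simp add: field_simps power2_eq_square)
  moreover have "0 \<le> (d t + (w t)\<^sup>2 / d t) / 2" using D by simp
  ultimately show ?thesis by simp
qed

end

context CH_solution
begin

text \<open>
  The loss on the right is independent of the number \<open>n\<close> of curves, because by \<open>w_plus_le\<close> the
  sum of the \<open>w\<^sup>+\<close> is at most \<open>(D + 2 * C) / 2\<close> at every time.
\<close>
lemma slope_energy_sum_monotone:
  assumes s: "0 \<le> s" and st: "s \<le> t"
    and X: "\<And>i. i \<le> n \<Longrightarrow> solution_from s u (X i)" "\<And>i. i \<le> n \<Longrightarrow> continuous_on UNIV (X i)"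
    and ord: "\<And>i r. i < n \<Longrightarrow> s \<le> r \<Longrightarrow> X i r \<le> X (Suc i) r"
    and width: "\<And>r. s \<le> r \<Longrightarrow> r \<le> t \<Longrightarrow> X n r - X 0 r \<le> D"
  shows "(\<Sum>i<n. slope_energy s (X i s) (X (Suc i) s)) \<le>
     (\<Sum>i<n. slope_energy t (X i t) (X (Suc i) t)) + C * ((D / 2 + C) * (t - s))"
proof -
  have P: "CH_pair u0 u ux s (X i) (X (Suc i))" if "i < n" for i
  proof -
    have i: "i \<le> n" "Suc i \<le> n" using that by auto
    show ?thesis
      by (rule CH_pair.intro[OF CH_solution_axioms
          CH_pair_axioms.intro[OF s X(1)[OF i(1)] X(1)[OF i(2)] X(2)[OF i(1)] X(2)[OF i(2)] ord[OF that]]])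
  qed
  define wp where "wp i r = max (CH_pair.w u (X i) (X (Suc i)) r) 0" for i r
  have wp_int: "set_integrable lborel {s..t} (wp i)" if "i < n" for i
    unfolding wp_def by (rule borel_integrable_atLeastAtMost'[OF CH_pair.wp_cont[OF P[OF that]]])
  have each: "slope_energy s (X i s) (X (Suc i) s) \<le> slope_energy t (X i t) (X (Suc i) t) + C * (LINT r:{s..t}|lborel. wp i r)"
    if "i < n" for i
  proof -
    interpret CH_pair u0 u ux s "X i" "X (Suc i)" by (rule P[OF that])
    have "q s \<le> q t + C * (W t - W s)" using q_monotone[of s t] st by (simp add: algebra_simps)
    then show ?thesis using q_eq[of s] q_eq[of t] st W_increment[OF st] by (simp add: wp_def)
  qed
  have "(\<Sum>i<n. slope_energy s (X i s) (X (Suc i) s)) \<le> (\<Sum>i<n. slope_energy t (X i t) (X (Suc i) t) + C * (LINT r:{s..t}|lborel. wp i r))"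
    by (intro sum_mono each) simp
  also have "\<dots> = (\<Sum>i<n. slope_energy t (X i t) (X (Suc i) t)) + C * (\<Sum>i<n. LINT r:{s..t}|lborel. wp i r)"
    by (simp add: sum.distrib sum_distrib_left)
  also have "(\<Sum>i<n. LINT r:{s..t}|lborel. wp i r) = (LINT r:{s..t}|lborel. \<Sum>i<n. wp i r)"
    unfolding set_lebesgue_integral_def scaleR_sum_right
    by (rule Bochner_Integration.integral_sum[symmetric]) (use wp_int in \<open>auto simp: set_integrable_def\<close>)
  finally have main: "(\<Sum>i<n. slope_energy s (X i s) (X (Suc i) s)) \<le>
      (\<Sum>i<n. slope_energy t (X i t) (X (Suc i) t)) + C * (LINT r:{s..t}|lborel. \<Sum>i<n. wp i r)" .
  have "(LINT r:{s..t}|lborel. \<Sum>i<n. wp i r) \<le> (LINT r:{s..t}|lborel. D / 2 + C)"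
  proof (rule set_integral_mono[OF _ set_integrable_const_Icc])
    show "set_integrable lborel {s..t} (\<lambda>r. \<Sum>i<n. wp i r)"
      unfolding set_integrable_def scaleR_sum_right
      by (rule Bochner_Integration.integrable_sum) (use wp_int in \<open>auto simp: set_integrable_def\<close>)
    fix r assume "r \<in> {s..t}"
    then have r: "s \<le> r" "r \<le> t" "0 \<le> r" using s by auto
    have "(\<Sum>i<n. wp i r) \<le> (\<Sum>i<n. ((X (Suc i) r - X i r) + (u r (X (Suc i) r) - u r (X i r))\<^sup>2 / (X (Suc i) r - X i r)) / 2)"
    proof (intro sum_mono)
      fix i assume "i \<in> {..<n}"
      then have "i < n" by simp
      then interpret CH_pair u0 u ux s "X i" "X (Suc i)" by (rule P)
      show "wp i r \<le> ((X (Suc i) r - X i r) + (u r (X (Suc i) r) - u r (X i r))\<^sup>2 / (X (Suc i) r - X i r)) / 2"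
        using w_plus_le[OF r(1)] by (simp add: wp_def w_eq[OF r(1)] d_def)
    qed
    also have "\<dots> = ((\<Sum>i<n. X (Suc i) r - X i r) + (\<Sum>i<n. (u r (X (Suc i) r) - u r (X i r))\<^sup>2 / (X (Suc i) r - X i r))) / 2"
      by (simp add: sum.distrib sum_divide_distrib[symmetric])
    also have "(\<Sum>i<n. X (Suc i) r - X i r) = X n r - X 0 r" by (rule sum_lessThan_telescope)
    also have "((X n r - X 0 r) + (\<Sum>i<n. (u r (X (Suc i) r) - u r (X i r))\<^sup>2 / (X (Suc i) r - X i r))) / 2 \<le> (D + 2 * C) / 2"
      using width[OF r(1,2)] slope_squares_sum[OF r(3), of n "\<lambda>i. X i r"] ord[OF _ r(1)]
      by (intro divide_right_mono add_mono) auto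
    also have "\<dots> = D / 2 + C" by simp
    finally show "(\<Sum>i<n. wp i r) \<le> D / 2 + C" .
  qed
  also have "\<dots> = (D / 2 + C) * (t - s)" by (rule set_integral_const_Icc[OF st])
  finally have "C * (LINT r:{s..t}|lborel. \<Sum>i<n. wp i r) \<le> C * ((D / 2 + C) * (t - s))"
    using C(1) by (intro mult_left_mono)
  then show ?thesis using main by linarith
qed

text \<open>
  Start a solution at each partition point; then successive maxima with the previous curve and
  minima with the right boundary \<open>b\<close> order the curves without changing their starting points.
\<close>
lemma fan_of_solutions:
  assumes s: "0 \<le> s" and a: "solution_from s u a" "continuous_on UNIV a" and b: "solution_from s u b" "continuous_on UNIV b"
    and ab: "\<And>r. s \<le> r \<Longrightarrow> a r \<le> b r"
    and p: "p 0 = a s" "p n = b s" "\<And>i. p i \<le> p (Suc i)" and n: "0 < n"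
  obtains X where "X 0 = a" "X n = b" "\<And>i. solution_from s u (X i)" "\<And>i. continuous_on UNIV (X i)"
    "\<And>i r. i < n \<Longrightarrow> s \<le> r \<Longrightarrow> X i r \<le> X (Suc i) r" "\<And>i. i \<le> n \<Longrightarrow> X i s = p i"
proof -
  have "\<exists>y. y s = x \<and> solution_from s u y \<and> continuous_on UNIV y" for x
  proof -
    obtain y where y: "y s = x" "solution_from s u y" by (rule peano_from[OF u_cont u_bound s])
    show ?thesis using solution_from_freeze[OF y(2)] y(1) by (intro exI[of _ "\<lambda>t. y (max s t)"]) simp
  qed
  then obtain Y0 where Y0: "\<And>x. Y0 x s = x" "\<And>x. solution_from s u (Y0 x)" "\<And>x. continuous_on UNIV (Y0 x)" by metis
  \<comment> \<open>Choosing \<open>b\<close> itself at the last point makes the fan end with \<open>b\<close>.\<close>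
  define Y where "Y i = (if i = n then b else Y0 (p i))" for i
  have Y: "Y i s = p i" "solution_from s u (Y i)" "continuous_on UNIV (Y i)" for i
    using Y0 b p(2) by (auto simp: Y_def)
  define X where "X = rec_nat a (\<lambda>i f. (\<lambda>r. min (b r) (max (f r) (Y (Suc i) r))))"
  have X0: "X 0 = a" and XS: "X (Suc i) = (\<lambda>r. min (b r) (max (X i r) (Y (Suc i) r)))" for i
    by (simp_all add: X_def)
  have Xsol: "solution_from s u (X i) \<and> continuous_on UNIV (X i)" for i
  proof (induction i)
    case (Suc i)
    then show ?case unfolding XS
      by (intro conjI solution_from_min solution_from_max continuous_on_min continuous_on_max b Y) auto
  qed (use X0 a in simp)
  have Xb: "X i r \<le> b r" if "s \<le> r" for i r using ab[OF that] by (cases i) (auto simp: X0 XS)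
  have Xord: "X i r \<le> X (Suc i) r" if "s \<le> r" for i r using Xb[OF that, of i] by (simp add: XS)
  have pmono: "p i \<le> p j" if "i \<le> j" for i j using lift_Suc_mono_le[of p i j] p(3) that by blast
  have Xs: "X i s = p i" if "i \<le> n" for i
    using that
  proof (induction i)
    case (Suc i)
    have "p (Suc i) \<le> b s" using pmono[OF Suc.prems] p(2) by simp
    then show ?case using Suc p(3)[of i] by (simp add: XS Y)
  qed (simp add: X0 p)
  have Xn: "X n = b"
  proof -
    obtain m where m: "n = Suc m" using n by (cases n) auto
    have "X n r = b r" for r using m by (simp add: XS Y_def min_def max_def)
    then show ?thesis by (rule ext)
  qed
  show thesis by (rule that[of X]) (use X0 Xn Xsol Xord Xs in auto)
qed

text \<open>
  At time \<open>s\<close> the energy is the supremum of the slope energies of equipartitions. Each of them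
  is transported by a fan of solutions to slope energies of some partition at time \<open>t\<close>, which
  stay below the energy there.
\<close>
lemma uxp_energy_almost_monotone:
  assumes s: "0 \<le> s" and st: "s \<le> t" and a: "solution_from s u a" and b: "solution_from s u b"
    and ab: "\<And>r. s \<le> r \<Longrightarrow> a r \<le> b r" and width: "\<And>r. s \<le> r \<Longrightarrow> r \<le> t \<Longrightarrow> b r - a r \<le> D"
  shows "(LINT x:{a s..b s}|lborel. (uxp s x)\<^sup>2) \<le>
     (LINT x:{a t..b t}|lborel. (uxp t x)\<^sup>2) + C * ((D / 2 + C) * (t - s))"
proof -
  have D0: "0 \<le> D" using ab[of s] width[of s] st by linarith
  have t: "0 \<le> t" using s st by simp
  define R where "R = (LINT x:{a t..b t}|lborel. (uxp t x)\<^sup>2) + C * ((D / 2 + C) * (t - s))"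
  have R0: "0 \<le> R" unfolding R_def using uxp2_bounds(2)[OF t, of "a t" "b t"] C(1) D0 st
    by (intro add_nonneg_nonneg mult_nonneg_nonneg) auto
  show ?thesis
  proof (cases "a s = b s")
    case True
    have "(LINT x:{a s..b s}|lborel. (uxp s x)\<^sup>2) = prim (\<lambda>x. (uxp s x)\<^sup>2) (b s) - prim (\<lambda>x. (uxp s x)\<^sup>2) (a s)"
      using prim_diff[OF uxp2_li[OF s], of "a s" "b s"] True by simp
    then show ?thesis using True R0 unfolding R_def by simp
  next
    case False
    then have less: "a s < b s" using ab[of s] by simp
    define A where "A r = a (max s r)" for r
    define B where "B r = b (max s r)" for r
    have AB: "solution_from s u A" "continuous_on UNIV A" "solution_from s u B" "continuous_on UNIV B"
      unfolding A_def B_def using solution_from_freeze[OF a] solution_from_freeze[OF b] by auto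
    have eq: "A r = a r" "B r = b r" if "s \<le> r" for r using that by (auto simp: A_def B_def max_absorb2)
    have "(LINT x:{a s..b s}|lborel. (uxp s x)\<^sup>2) \<le> R"
    proof (rule uxp2_le_of_slope_energies[OF s less _ R0])
      fix n
      define p where "p = grid (a s) (b s) (Suc n)"
      note gr = grid_facts[OF less, of "Suc n"]
      obtain X where X: "X 0 = A" "X (Suc n) = B" "\<And>i. solution_from s u (X i)" "\<And>i. continuous_on UNIV (X i)"
        "\<And>i r. i < Suc n \<Longrightarrow> s \<le> r \<Longrightarrow> X i r \<le> X (Suc i) r" "\<And>i. i \<le> Suc n \<Longrightarrow> X i s = p i"
      proof (rule fan_of_solutions[OF s AB, of p "Suc n"])
        show "A r \<le> B r" if "s \<le> r" for r using ab[OF that] eq[OF that] by simp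
        show "p 0 = A s" "p (Suc n) = B s" using gr eq[of s] by (simp_all add: p_def)
        show "p i \<le> p (Suc i)" for i using gr(4)[of i] by (simp add: p_def)
      qed auto
      have "(\<Sum>i<Suc n. slope_energy s (p i) (p (Suc i))) = (\<Sum>i<Suc n. slope_energy s (X i s) (X (Suc i) s))"
        by (rule sum.cong) (use X(6) in auto)
      also have "\<dots> \<le> (\<Sum>i<Suc n. slope_energy t (X i t) (X (Suc i) t)) + C * ((D / 2 + C) * (t - s))"
      proof (rule slope_energy_sum_monotone[OF s st, where X=X and n="Suc n"])
        show "X (Suc n) r - X 0 r \<le> D" if "s \<le> r" "r \<le> t" for r
          using width[OF that] eq[OF that(1)] by (simp add: X(1,2))
      qed (use X(3-5) in blast)+
      also have "(\<Sum>i<Suc n. slope_energy t (X i t) (X (Suc i) t)) \<le> (LINT x:{X 0 t..X (Suc n) t}|lborel. (uxp t x)\<^sup>2)"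
        by (rule slope_energy_sum_le[OF t]) (use X(5)[OF _ st] in auto)
      finally show "(\<Sum>i<Suc n. slope_energy s (grid (a s) (b s) (Suc n) i) (grid (a s) (b s) (Suc n) (Suc i))) \<le> R"
        using X(1,2) eq[OF st] by (simp add: R_def p_def)
    qed
    then show ?thesis by (simp add: R_def)
  qed
qed

text \<open>
  The integral over an empty interval is \<open>0\<close>, as is that over \<open>[a t, a t]\<close>. Hence the two
  characteristics may be assumed to be ordered.
\<close>
lemma positive_energy_max:
  assumes t: "0 \<le> t"
  shows "positive_energy ux a (\<lambda>r. max (a r) (b r)) t = positive_energy ux a b t"
proof (cases "a t \<le> b t")
  case True then show ?thesis by (simp add: positive_energy_def max_absorb2)
next
  case False
  have "(LINT x:{a t..a t}|lborel. (uxp t x)\<^sup>2) = 0" using prim_diff[OF uxp2_li[OF t], of "a t" "a t"] by simp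
  then show ?thesis using False by (simp add: positive_energy_def max_absorb1 set_lebesgue_integral_def)
qed

lemma positive_energy_bounds:
  assumes "0 \<le> t" shows "0 \<le> positive_energy ux a b t" "positive_energy ux a b t \<le> 2 * C"
  using uxp2_bounds[OF assms, of "a t" "b t"] by (auto simp: positive_energy_def)

theorem positive_energy_almost_monotone:
  assumes a: "solution_from 0 u a" and b: "solution_from 0 u b"
  obtains K where "0 \<le> K" "\<And>s t. 0 \<le> s \<Longrightarrow> s \<le> t \<Longrightarrow> t \<le> T \<Longrightarrow>
    positive_energy ux a b s + K * s \<le> positive_energy ux a b t + K * t"
proof -
  define D where "D = \<bar>b 0 - a 0\<bar> + 2 * M * \<bar>T\<bar>"
  define K where "K = C * (D / 2 + C)"
  have D0: "0 \<le> D" unfolding D_def using M_pos by (intro add_nonneg_nonneg mult_nonneg_nonneg) auto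
  have K0: "0 \<le> K" unfolding K_def using C(1) D0 by (intro mult_nonneg_nonneg) auto
  define B where "B r = max (a r) (b r)" for r
  have B: "solution_from 0 u B" unfolding B_def by (rule solution_from_max[OF a b])
  have width: "B r - a r \<le> D" if r: "0 \<le> r" "r \<le> T" for r
  proof -
    have "\<bar>a r - a 0\<bar> \<le> M * \<bar>r - 0\<bar>" "\<bar>b r - b 0\<bar> \<le> M * \<bar>r - 0\<bar>"
      by (rule solution_from_Lipschitz[OF a] solution_from_Lipschitz[OF b]; use r u_bound in simp)+
    moreover have "M * \<bar>r - 0\<bar> \<le> M * \<bar>T\<bar>" using r M_pos by (intro mult_left_mono) auto
    ultimately have "b r - a r \<le> D" unfolding D_def by linarith
    then show ?thesis using D0 by (simp add: B_def)
  qed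
  have "positive_energy ux a b s + K * s \<le> positive_energy ux a b t + K * t"
    if st: "0 \<le> s" "s \<le> t" "t \<le> T" for s t
  proof -
    have "positive_energy ux a B s \<le> positive_energy ux a B t + C * ((D / 2 + C) * (t - s))"
      unfolding positive_energy_def
      by (rule uxp_energy_almost_monotone[OF st(1,2) solution_from_later[OF a st(1)] solution_from_later[OF B st(1)]])
         (use st width in \<open>auto simp: B_def\<close>)
    moreover have "positive_energy ux a B s = positive_energy ux a b s" "positive_energy ux a B t = positive_energy ux a b t"
      unfolding B_def using st by (intro positive_energy_max; simp)+
    moreover have "C * ((D / 2 + C) * (t - s)) = K * t - K * s"
      unfolding K_def by (simp only: right_diff_distrib mult.assoc)
    ultimately show ?thesis by linarith
  qed
  with K0 show thesis using that by blast
qed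

theorem positive_energy_bounded_variation:
  assumes a: "solution_from 0 u a" and b: "solution_from 0 u b"
  shows "locally_bounded_variation (positive_energy ux a b)"
  unfolding locally_bounded_variation_def bounded_variation_on_def
proof (intro allI impI)
  fix T :: real assume T: "0 \<le> T"
  define E where "E = positive_energy ux a b"
  obtain K where K: "0 \<le> K" "\<And>s t. 0 \<le> s \<Longrightarrow> s \<le> t \<Longrightarrow> t \<le> T \<Longrightarrow> E s + K * s \<le> E t + K * t"
    unfolding E_def using positive_energy_almost_monotone[OF a b, of T] by blast
  show "\<exists>B. \<forall>n p. 0 \<le> p 0 \<and> (\<forall>i<n. p i \<le> p (Suc i)) \<and> p n \<le> T \<longrightarrow>
      (\<Sum>i<n. \<bar>positive_energy ux a b (p (Suc i)) - positive_energy ux a b (p i)\<bar>) \<le> B"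
  proof (intro exI[of _ "2 * C + 2 * K * T"] allI impI, elim conjE)
    fix n :: nat and p :: "nat \<Rightarrow> real"
    assume p: "0 \<le> p 0" "\<forall>i<n. p i \<le> p (Suc i)" "p n \<le> T"
    have mono: "p i \<le> p j" if "i \<le> j" "j \<le> n" for i j
      using that
    proof (induction j rule: dec_induct)
      case (step j)
      then have "p i \<le> p j" "p j \<le> p (Suc j)" using p(2) by auto
      then show ?case by (rule order_trans)
    qed simp
    \<comment> \<open>A decrease of \<open>E\<close> is at most \<open>K\<close> times the elapsed time.\<close>
    have each: "\<bar>E (p (Suc i)) - E (p i)\<bar> \<le> (E (p (Suc i)) - E (p i)) + 2 * K * (p (Suc i) - p i)" if "i < n" for i
    proof -
      have "0 \<le> p i" "p i \<le> p (Suc i)" "p (Suc i) \<le> T"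
        using mono[of 0 i] mono[of "Suc i" n] p that by auto
      from K(2)[OF this] show ?thesis using mult_left_mono[OF \<open>p i \<le> p (Suc i)\<close> K(1)]
        by (auto simp: abs_if algebra_simps)
    qed
    have "(\<Sum>i<n. \<bar>E (p (Suc i)) - E (p i)\<bar>) \<le> (\<Sum>i<n. (E (p (Suc i)) - E (p i)) + 2 * K * (p (Suc i) - p i))"
      by (intro sum_mono each) simp
    also have "\<dots> = (E (p n) - E (p 0)) + 2 * K * (p n - p 0)"
      using sum_lessThan_telescope[of "\<lambda>i. E (p i)" n]
      by (simp add: sum.distrib sum_distrib_left[symmetric] sum_lessThan_telescope)
    also have "\<dots> \<le> 2 * C + 2 * K * T"
    proof (intro add_mono mult_left_mono)
      have "0 \<le> p n" using mono[of 0 n] p by simp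
      then show "E (p n) - E (p 0) \<le> 2 * C"
        unfolding E_def using positive_energy_bounds(2)[of "p n" a b] positive_energy_bounds(1)[OF p(1), of a b] by simp
    qed (use p K(1) in auto)
    finally show "(\<Sum>i<n. \<bar>positive_energy ux a b (p (Suc i)) - positive_energy ux a b (p i)\<bar>) \<le> 2 * C + 2 * K * T"
      unfolding E_def .
  qed
qed

text \<open>
  A nondecreasing function that is bounded below tends to its infimum.
\<close>
theorem positive_energy_right_limit:
  assumes a: "solution_from 0 u a" and b: "solution_from 0 u b"
  shows "\<exists>\<Lambda>. (positive_energy ux a b \<longlongrightarrow> \<Lambda>) (at_right 0)"
proof -
  define E where "E = positive_energy ux a b"
  obtain K where K: "0 \<le> K" "\<And>s t. 0 \<le> s \<Longrightarrow> s \<le> t \<Longrightarrow> t \<le> 1 \<Longrightarrow> E s + K * s \<le> E t + K * t"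
    unfolding E_def using positive_energy_almost_monotone[OF a b, of 1] by blast
  define f where "f t = E t + K * t" for t
  define l where "l = Inf (f ` {0<..<1})"
  have low: "0 \<le> f t" if "0 < t" for t
    using positive_energy_bounds(1)[of t a b] that K(1) by (simp add: f_def E_def)
  have bdd: "bdd_below (f ` {0<..<1})" using low by (intro bdd_belowI[of _ 0]) auto
  have "(f \<longlongrightarrow> l) (at_right 0)"
  proof (rule order_tendstoI)
    fix c assume "c < l"
    have "c < f t" if "0 < t" "t < 1" for t
      using cInf_lower[OF _ bdd, of "f t"] that \<open>c < l\<close> unfolding l_def by force
    then show "\<forall>\<^sub>F t in at_right 0. c < f t"
      unfolding eventually_at_right_field by (intro exI[of _ 1]) auto
  next
    fix c assume "l < c"
    then obtain r where r: "0 < r" "r < 1" "f r < c"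
      unfolding l_def using cInf_less_iff[of "f ` {0<..<1}" c] bdd by auto
    have "f t < c" if "0 < t" "t < r" for t using K(2)[of t r] that r by (simp add: f_def)
    then show "\<forall>\<^sub>F t in at_right 0. f t < c"
      unfolding eventually_at_right_field using r by (intro exI[of _ r]) auto
  qed
  then have "((\<lambda>t. f t - K * t) \<longlongrightarrow> l - K * 0) (at_right 0)" by (intro tendsto_intros)
  then show ?thesis unfolding f_def E_def by auto
qed

end

section \<open>Piecewise smooth functions\<close>

lemma FTC_finite_exceptions:
  fixes f g :: "real \<Rightarrow> real"
  assumes ab: "a \<le> b" and S: "finite S" and f: "continuous_on {a..b} f"
    and d: "\<And>x. a < x \<Longrightarrow> x < b \<Longrightarrow> x \<notin> S \<Longrightarrow> (f has_real_derivative g x) (at x)"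
    and g: "set_integrable lborel {a..b} g"
  shows "(LINT x:{a..b}|lborel. g x) = f b - f a"
proof -
  have "(g has_integral f b - f a) {a..b}"
    by (rule fundamental_theorem_of_calculus_interior_strong[OF S ab _ f])
       (use d in \<open>auto simp: has_real_derivative_iff_has_vector_derivative[symmetric]\<close>)
  then show ?thesis using set_borel_integral_eq_integral(2)[OF g] by (simp add: integral_unique)
qed

text \<open>
  Integrate the product rule for \<open>f * \<phi>\<close> over an interval that contains the support of \<open>\<phi>\<close>.
\<close>
lemma weak_derivative_of_piecewise_C1:
  fixes f g :: "real \<Rightarrow> real"
  assumes f: "continuous_on UNIV f" and S: "finite S"
    and d: "\<And>x. x \<notin> S \<Longrightarrow> (f has_real_derivative g x) (at x)" and g: "locally_integrable g"
  shows "has_weak_derivative f g"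
  unfolding has_weak_derivative_def
proof (intro conjI allI impI)
  show "set_integrable lborel {a..b} f" for a b by (rule locally_integrableD[OF locally_integrable_continuous[OF f]])
  show "set_integrable lborel {a..b} g" for a b by (rule locally_integrableD[OF g])
  fix \<phi> :: "real \<Rightarrow> real" assume \<phi>: "test_function_on UNIV \<phi>"
  obtain \<phi>' K B where K: "compact K" and d\<phi>: "\<And>x. (\<phi> has_real_derivative \<phi>' x) (at x)"
    and c: "continuous_on UNIV \<phi>" "continuous_on UNIV \<phi>'" and B: "\<And>x. \<bar>\<phi> x\<bar> \<le> B"
    and zK: "\<And>x. x \<notin> K \<Longrightarrow> \<phi> x = 0" "\<And>x. x \<notin> K \<Longrightarrow> \<phi>' x = 0"
    by (rule test_function_derivative[OF \<phi>]) (rule that)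
  obtain R where R: "\<And>x. x \<in> K \<Longrightarrow> \<bar>x\<bar> \<le> R" using compact_imp_bounded[OF K] unfolding bounded_iff real_norm_def by blast
  define T where "T = \<bar>R\<bar> + 1"
  have deriv: "deriv \<phi> x = \<phi>' x" for x using d\<phi> by (rule DERIV_imp_deriv)
  have z: "\<phi> x = 0" "\<phi>' x = 0" if "x \<notin> {- T<..<T}" for x
  proof -
    have "x \<notin> K" using that R[of x] by (auto simp: T_def abs_le_iff)
    then show "\<phi> x = 0" "\<phi>' x = 0" by (rule zK)+
  qed
  have i1: "set_integrable lborel {- T..T} (\<lambda>x. f x * \<phi>' x)"
    by (intro locally_integrableD locally_integrable_continuous continuous_on_mult f c)
  have [measurable]: "g \<in> borel_measurable borel" "\<phi> \<in> borel_measurable borel"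
    using locally_integrable_measurable[OF g] c by (auto intro: borel_measurable_continuous_onI)
  have i2: "set_integrable lborel {- T..T} (\<lambda>x. g x * \<phi> x)"
  proof (rule set_integrable_bound[where f="\<lambda>x. B * \<bar>g x\<bar>"])
    show "set_integrable lborel {- T..T} (\<lambda>x. B * \<bar>g x\<bar>)"
      by (intro set_integrable_mult_right set_integrable_abs locally_integrableD[OF g])
    show "AE x in lborel. x \<in> {- T..T} \<longrightarrow> norm (g x * \<phi> x) \<le> norm (B * \<bar>g x\<bar>)"
    proof (intro AE_I2 impI)
      fix x assume "x \<in> {- T..T}"
      then have "\<bar>\<phi> x\<bar> * \<bar>g x\<bar> \<le> B * \<bar>g x\<bar>" using B by (intro mult_right_mono) auto
      then show "norm (g x * \<phi> x) \<le> norm (B * \<bar>g x\<bar>)" by (simp add: abs_mult mult.commute) (metis abs_ge_self abs_mult_pos abs_ge_zero order_trans)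
    qed
  qed (simp add: set_borel_measurable_def)
  have "(LINT x:{- T..T}|lborel. g x * \<phi> x + f x * \<phi>' x) = f T * \<phi> T - f (- T) * \<phi> (- T)"
  proof (rule FTC_finite_exceptions[OF _ S])
    show "continuous_on {- T..T} (\<lambda>x. f x * \<phi> x)"
      by (intro continuous_on_mult continuous_on_subset[OF f] continuous_on_subset[OF c(1)]) auto
    show "((\<lambda>x. f x * \<phi> x) has_real_derivative g x * \<phi> x + f x * \<phi>' x) (at x)" if "x \<notin> S" for x
      using DERIV_mult[OF d[OF that] d\<phi>[of x]] by (simp add: algebra_simps)
  qed (use i1 i2 in \<open>auto simp: T_def intro: set_integral_add(1)\<close>)
  also have "\<dots> = 0" using z by simp
  finally have "(LINT x:{- T..T}|lborel. g x * \<phi> x) + (LINT x:{- T..T}|lborel. f x * \<phi>' x) = 0"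
    using set_integral_add(2)[OF i2 i1] by simp
  moreover have "(LINT x:{- T..T}|lborel. k x) = (LINT x|lborel. k x)" if k: "\<And>x. x \<notin> {- T<..<T} \<Longrightarrow> k x = 0" for k :: "real \<Rightarrow> real"
    unfolding set_lebesgue_integral_def
  proof (rule Bochner_Integration.integral_cong[OF refl])
    fix x show "indicator {- T..T} x *\<^sub>R k x = k x"
    proof (cases "x \<in> {- T..T}")
      case False
      then have "x \<notin> {- T<..<T}" by auto
      then show ?thesis using k[of x] by simp
    qed simp
  qed
  then have "(LINT x:{- T..T}|lborel. g x * \<phi> x) = (LINT x|lborel. g x * \<phi> x)"
    "(LINT x:{- T..T}|lborel. f x * \<phi>' x) = (LINT x|lborel. f x * \<phi>' x)"
    using z by simp_all
  ultimately show "(LINT x|lborel. f x * deriv \<phi> x) = - (LINT x|lborel. g x * \<phi> x)" by (simp add: deriv)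
qed

text \<open>
  If \<open>P' = - F\<close> and \<open>F' = h - P\<close>, then \<open>(exp y * (F + P))' = exp y * h\<close> and
  \<open>(exp (- y) * (F - P))' = exp (- y) * h\<close>. This gives an explicit primitive of the integrand on
  either side of \<open>x\<close>; the constant \<open>F x\<close> in \<open>A2\<close> makes it continuous at \<open>x\<close>.
\<close>
lemma kernel_integral:
  fixes h P F :: "real \<Rightarrow> real"
  assumes h: "integrable lborel h" and P: "continuous_on UNIV P" "\<And>y. \<bar>P y\<bar> \<le> B" and F: "continuous_on UNIV F" "\<And>y. \<bar>F y\<bar> \<le> B"
    and S: "finite S"
    and dP: "\<And>y. y \<notin> S \<Longrightarrow> (P has_real_derivative - F y) (at y)"
    and dF: "\<And>y. y \<notin> S \<Longrightarrow> (F has_real_derivative h y - P y) (at y)"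
  shows "(LINT y|lborel. CH_kernel (x - y) * h y) = F x"
proof -
  define A1 where "A1 y = exp (y - x) * (F y + P y) / 2" for y
  define A2 where "A2 y = F x - exp (x - y) * (F y - P y) / 2" for y
  define A where "A y = (if y \<le> x then A1 y else A2 y)" for y
  have [measurable]: "h \<in> borel_measurable borel" using h by auto
  have i: "integrable lborel (\<lambda>y. CH_kernel (x - y) * h y)"
  proof (rule Bochner_Integration.integrable_bound[OF h])
    show "AE y in lborel. norm (CH_kernel (x - y) * h y) \<le> norm (h y)"
      by (intro AE_I2) (auto simp: abs_mult intro!: mult_left_le_one_le order_trans[OF CH_kernel_bound])
  qed measurable
  have Ac: "continuous_on UNIV A"
  proof -
    have "continuous_on ({y. y \<le> x} \<union> {y. x \<le> y}) (\<lambda>y. if y \<le> x then A1 y else A2 y)"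
      by (rule continuous_on_cases)
         (auto simp: A1_def[abs_def] A2_def[abs_def] closed_Collect_le field_simps
           intro!: continuous_intros continuous_on_subset[OF P(1)] continuous_on_subset[OF F(1)])
    moreover have "{y. y \<le> x} \<union> {y. x \<le> y} = UNIV" by auto
    ultimately show ?thesis by (simp add: A_def[abs_def])
  qed
  have dA: "(A has_real_derivative CH_kernel (x - y) * h y) (at y)" if y: "y \<notin> insert x S" for y
  proof (cases "y < x")
    case True
    have e: "((\<lambda>y. exp (y - x)) has_real_derivative exp (y - x)) (at y)" by (auto intro!: derivative_eq_intros)
    have "(A1 has_real_derivative (exp (y - x) * (F y + P y) + (h y - P y + - F y) * exp (y - x)) / 2) (at y)"
      unfolding A1_def[abs_def] using y by (intro DERIV_cdivide DERIV_mult e DERIV_add dF dP) auto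
    moreover have "(exp (y - x) * (F y + P y) + (h y - P y + - F y) * exp (y - x)) / 2 = CH_kernel (x - y) * h y"
      using True by (simp add: CH_kernel_def algebra_simps)
    ultimately have "(A1 has_real_derivative CH_kernel (x - y) * h y) (at y)" by simp
    then show ?thesis
      by (rule DERIV_cong_ev[THEN iffD1, rotated 3])
         (use True eventually_nhds_in_open[of "{..<x}" y] in \<open>auto simp: A_def elim!: eventually_mono\<close>)
  next
    case False
    then have xy: "x < y" using y by auto
    have e: "((\<lambda>y. exp (x - y)) has_real_derivative - exp (x - y)) (at y)" by (auto intro!: derivative_eq_intros)
    have "(A2 has_real_derivative 0 - (- exp (x - y) * (F y - P y) + (h y - P y - - F y) * exp (x - y)) / 2) (at y)"
      unfolding A2_def[abs_def] using y by (intro DERIV_diff DERIV_const DERIV_cdivide DERIV_mult e dF dP) auto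
    moreover have "0 - (- exp (x - y) * (F y - P y) + (h y - P y - - F y) * exp (x - y)) / 2 = CH_kernel (x - y) * h y"
      using xy by (simp add: CH_kernel_def algebra_simps)
    ultimately have "(A2 has_real_derivative CH_kernel (x - y) * h y) (at y)" by simp
    then show ?thesis
      by (rule DERIV_cong_ev[THEN iffD1, rotated 3])
         (use xy eventually_nhds_in_open[of "{x<..}" y] in \<open>auto simp: A_def elim!: eventually_mono\<close>)
  qed
  have eq: "(LINT y|lborel. indicator {x - real n..x + real n} y * (CH_kernel (x - y) * h y)) = A (x + real n) - A (x - real n)" for n
  proof -
    have "(LINT y:{x - real n..x + real n}|lborel. CH_kernel (x - y) * h y) = A (x + real n) - A (x - real n)"
    proof (rule FTC_finite_exceptions[where S="insert x S"])
      show "set_integrable lborel {x - real n..x + real n} (\<lambda>y. CH_kernel (x - y) * h y)"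
        unfolding set_integrable_def by (rule integrable_mult_indicator[OF _ i]) simp
    qed (use S dA continuous_on_subset[OF Ac] in auto)
    then show ?thesis by (simp add: set_lebesgue_integral_def)
  qed
  have "(\<lambda>n. LINT y|lborel. indicator {x - real n..x + real n} y * (CH_kernel (x - y) * h y)) \<longlonglongrightarrow> (LINT y|lborel. CH_kernel (x - y) * h y)"
  proof (rule integral_dominated_convergence[where w="\<lambda>y. norm (CH_kernel (x - y) * h y)"])
    show "AE y in lborel. (\<lambda>n. indicator {x - real n..x + real n} y * (CH_kernel (x - y) * h y)) \<longlonglongrightarrow> CH_kernel (x - y) * h y"
    proof (rule AE_I2)
      fix y
      obtain N :: nat where N: "\<bar>y - x\<bar> \<le> real N" using real_arch_simple by blast
      have "eventually (\<lambda>n. indicator {x - real n..x + real n} y * (CH_kernel (x - y) * h y) = CH_kernel (x - y) * h y) sequentially"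
        using eventually_ge_at_top[of N]
      proof eventually_elim
        case (elim n)
        then have "\<bar>y - x\<bar> \<le> real n" using N by linarith
        then have "y \<in> {x - real n..x + real n}" by (auto simp: abs_le_iff)
        then show ?case by simp
      qed
      then show "(\<lambda>n. indicator {x - real n..x + real n} y * (CH_kernel (x - y) * h y)) \<longlonglongrightarrow> CH_kernel (x - y) * h y"
        by (rule tendsto_eventually)
    qed
    show "integrable lborel (\<lambda>y. norm (CH_kernel (x - y) * h y))" by (rule integrable_norm[OF i])
    show "AE y in lborel. norm (indicator {x - real n..x + real n} y * (CH_kernel (x - y) * h y)) \<le> norm (CH_kernel (x - y) * h y)" for n
      by (intro AE_I2) (simp add: indicator_def)
  qed measurable
  moreover have "(\<lambda>n. A (x + real n) - A (x - real n)) \<longlonglongrightarrow> F x - 0"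
  proof (rule tendsto_diff)
    have e0: "(\<lambda>n. B * exp (- real n)) \<longlonglongrightarrow> B * 0"
    proof (intro tendsto_mult tendsto_const)
      have "filterlim (\<lambda>n. - real n) at_bot sequentially"
        using filterlim_real_sequentially by (simp add: filterlim_uminus_at_bot)
      then show "(\<lambda>n. exp (- real n)) \<longlonglongrightarrow> 0" by (rule filterlim_compose[OF exp_at_bot])
    qed
    have bd: "\<bar>exp (- real n) * v / 2\<bar> \<le> B * exp (- real n)" if "\<bar>v\<bar> \<le> 2 * B" for n v
      using that mult_left_mono[OF that, of "exp (- real n)"] by (simp add: abs_mult)
    have "(\<lambda>n. A (x - real n)) \<longlonglongrightarrow> 0"
    proof (rule Lim_null_comparison)
      show "eventually (\<lambda>n. norm (A (x - real n)) \<le> B * exp (- real n)) sequentially"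
      proof (intro always_eventually allI)
        fix n
        have "\<bar>F (x - real n) + P (x - real n)\<bar> \<le> 2 * B" using P(2)[of "x - real n"] F(2)[of "x - real n"] by linarith
        from bd[OF this, of n] show "norm (A (x - real n)) \<le> B * exp (- real n)" by (simp add: A_def A1_def)
      qed
    qed (use e0 in simp)
    then show "(\<lambda>n. A (x - real n)) \<longlonglongrightarrow> 0" .
    have Ax: "A (x + real n) = F x - exp (- real n) * (F (x + real n) - P (x + real n)) / 2" for n
      by (cases "n = 0") (auto simp: A_def A1_def A2_def field_simps)
    have "(\<lambda>n. exp (- real n) * (F (x + real n) - P (x + real n)) / 2) \<longlonglongrightarrow> 0"
    proof (rule Lim_null_comparison)
      show "eventually (\<lambda>n. norm (exp (- real n) * (F (x + real n) - P (x + real n)) / 2) \<le> B * exp (- real n)) sequentially"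
      proof (intro always_eventually allI)
        fix n
        have "\<bar>F (x + real n) - P (x + real n)\<bar> \<le> 2 * B" using P(2)[of "x + real n"] F(2)[of "x + real n"] by linarith
        from bd[OF this, of n] show "norm (exp (- real n) * (F (x + real n) - P (x + real n)) / 2) \<le> B * exp (- real n)" by simp
      qed
    qed (use e0 in simp)
    from tendsto_diff[OF tendsto_const[of "F x"] this] show "(\<lambda>n. A (x + real n)) \<longlonglongrightarrow> F x" unfolding Ax by simp
  qed
  ultimately show ?thesis unfolding eq using LIMSEQ_unique by fastforce
qed

section \<open>An expanding peakon-antipeakon pair\<close>

text \<open>
  Between the peaks \<open>\<plusminus>q\<close>, where \<open>exp \<bar>x\<bar> < cosh t\<close>, the solution is \<open>2 * sinh x / sinh t\<close>;
  outside it is \<open>\<plusminus> sinh t * exp (- \<bar>x\<bar>)\<close>. The clamped form is continuous by inspection for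
  \<open>t > 0\<close> and bounded by \<open>sinh t\<close>, hence continuous at \<open>t = 0\<close> as well.

  The functions \<open>pair_ux\<close>, \<open>pair_ut\<close> and \<open>pair_F\<close> are the derivatives and the source; \<open>pair_P\<close>
  is the convolution of the energy density with \<open>exp (- \<bar>x\<bar>) / 2\<close>, so that \<open>pair_F\<close> is minus its
  derivative.
\<close>
definition pair_u :: "real \<Rightarrow> real \<Rightarrow> real" where
  "pair_u t x = max (- (sinh t * exp (- \<bar>x\<bar>))) (min (sinh t * exp (- \<bar>x\<bar>)) (2 * sinh x / sinh t))"

definition pair_ux :: "real \<Rightarrow> real \<Rightarrow> real" where
  "pair_ux t x = (if exp \<bar>x\<bar> < cosh t then 2 * cosh x / sinh t else - (sinh t * exp (- \<bar>x\<bar>)))"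

definition pair_ut :: "real \<Rightarrow> real \<Rightarrow> real" where
  "pair_ut t x = (if exp \<bar>x\<bar> < cosh t then - (2 * sinh x * cosh t / (sinh t)\<^sup>2) else sgn x * cosh t * exp (- \<bar>x\<bar>))"

definition pair_F :: "real \<Rightarrow> real \<Rightarrow> real" where
  "pair_F t x = (if exp \<bar>x\<bar> < cosh t then 2 * sinh x * (2 * cosh x - cosh t) / (sinh t)\<^sup>2
     else sgn x * (cosh t * exp (- \<bar>x\<bar>) - (sinh t)\<^sup>2 * (exp (- \<bar>x\<bar>))\<^sup>2))"

definition pair_P :: "real \<Rightarrow> real \<Rightarrow> real" where
  "pair_P t x = (if exp \<bar>x\<bar> < cosh t then 2 * cosh x * (cosh t - cosh x) / (sinh t)\<^sup>2
     else cosh t * exp (- \<bar>x\<bar>) - (sinh t)\<^sup>2 * (exp (- \<bar>x\<bar>))\<^sup>2 / 2)"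

definition pair_q :: "real \<Rightarrow> real" where "pair_q t = ln (cosh t)"

lemma exp_pair_q: "exp (pair_q t) = cosh t" by (simp add: pair_q_def cosh_real_pos)

lemma inside_iff: "exp \<bar>x\<bar> < cosh t \<longleftrightarrow> \<bar>x\<bar> < pair_q t"
  unfolding exp_pair_q[symmetric] by simp

lemma cosh_gt_1: "0 < t \<Longrightarrow> 1 < cosh (t :: real)"
  using cosh_real_strict_mono[of 0 t] by (simp only: cosh_0)

lemma pair_q_pos: "0 < t \<Longrightarrow> 0 < pair_q t"
  using cosh_gt_1[of t] by (simp add: pair_q_def)

lemma cosh_sq: "(cosh t)\<^sup>2 = 1 + (sinh (t::real))\<^sup>2" using cosh_square_eq[of t] by simp

text \<open>
  The two branches of the clamped form cross exactly at the peaks.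
\<close>
lemma clamp_iff:
  fixes t x :: real
  assumes t: "0 < t" and x: "0 \<le> x"
  shows "2 * sinh x / sinh t \<le> sinh t * exp (- x) \<longleftrightarrow> exp x \<le> cosh t"
proof -
  have s: "0 < sinh t" using t by simp
  have "2 * sinh x / sinh t \<le> sinh t * exp (- x) \<longleftrightarrow> 2 * sinh x * exp x \<le> (sinh t)\<^sup>2"
    using s by (simp add: field_simps power2_eq_square exp_minus)
  also have "2 * sinh x * exp x = (exp x)\<^sup>2 - 1"
    by (simp add: sinh_def algebra_simps power2_eq_square mult_exp_exp)
  also have "(exp x)\<^sup>2 - 1 \<le> (sinh t)\<^sup>2 \<longleftrightarrow> (exp x)\<^sup>2 \<le> (cosh t)\<^sup>2" unfolding cosh_sq by linarith
  also have "\<dots> \<longleftrightarrow> exp x \<le> cosh t" by (rule power2_le_iff_abs_le[THEN trans]) (simp_all add: cosh_real_nonneg)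
  finally show ?thesis .
qed

lemma pair_u_eq:
  assumes t: "0 < t"
  shows "exp \<bar>x\<bar> \<le> cosh t \<Longrightarrow> pair_u t x = 2 * sinh x / sinh t"
    and "cosh t \<le> exp \<bar>x\<bar> \<Longrightarrow> pair_u t x = sgn x * (sinh t * exp (- \<bar>x\<bar>))"
proof -
  define A where "A = sinh t * exp (- \<bar>x\<bar>)"
  define B where "B = 2 * sinh x / sinh t"
  have s: "0 < sinh t" using t by simp
  have A0: "0 < A" using s by (simp add: A_def)
  have absB: "\<bar>B\<bar> = 2 * sinh \<bar>x\<bar> / sinh t" using s by (simp add: B_def abs_mult sinh_real_abs)
  have iff: "\<bar>B\<bar> \<le> A \<longleftrightarrow> exp \<bar>x\<bar> \<le> cosh t" unfolding absB A_def by (rule clamp_iff[OF t]) simp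
  have u: "pair_u t x = max (- A) (min A B)" by (simp add: pair_u_def A_def B_def)
  show "pair_u t x = 2 * sinh x / sinh t" if "exp \<bar>x\<bar> \<le> cosh t"
    using iff that unfolding u B_def[symmetric] by (auto simp: abs_le_iff min_def max_def)
  show "pair_u t x = sgn x * (sinh t * exp (- \<bar>x\<bar>))" if out: "cosh t \<le> exp \<bar>x\<bar>"
  proof -
    have "1 < cosh t" using cosh_gt_1[OF t] .
    then have x0: "x \<noteq> 0" using out by auto
    have ge: "A \<le> \<bar>B\<bar>"
    proof (cases "exp \<bar>x\<bar> = cosh t")
      case True
      have "2 * sinh \<bar>x\<bar> * exp \<bar>x\<bar> = (exp \<bar>x\<bar>)\<^sup>2 - 1"
        by (simp add: sinh_def algebra_simps power2_eq_square mult_exp_exp)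
      then have "2 * sinh \<bar>x\<bar> * exp \<bar>x\<bar> = (sinh t)\<^sup>2" using True by (simp add: cosh_sq)
      then show ?thesis unfolding absB A_def using s by (simp add: field_simps power2_eq_square exp_minus)
    qed (use iff out in linarith)
    show ?thesis
    proof (cases "0 < x")
      case True
      then have "0 \<le> B" using s by (simp add: B_def)
      then show ?thesis using True ge A0 unfolding u A_def[symmetric] by (simp add: min_def max_def)
    next
      case False
      then have "x < 0" using x0 by simp
      then have "B \<le> 0" using s by (simp add: B_def divide_nonpos_pos)
      then show ?thesis using \<open>x < 0\<close> ge A0 unfolding u A_def[symmetric] by (auto simp: min_def max_def)
    qed
  qed
qed

lemma pair_u_0: "pair_u 0 x = 0" "pair_ux 0 x = 0"
  by (auto simp: pair_u_def pair_ux_def)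

lemma pair_u_bound: assumes "0 \<le> t" shows "\<bar>pair_u t x\<bar> \<le> sinh t"
proof -
  have "0 \<le> sinh t * exp (- \<bar>x\<bar>)" "sinh t * exp (- \<bar>x\<bar>) \<le> sinh t" using assms by (auto intro: mult_left_le)
  then show ?thesis unfolding pair_u_def by (auto simp: min_def max_def)
qed

lemma pair_u_cont: "continuous_on ({0..} \<times> UNIV) (\<lambda>(t, x). pair_u t x)"
  unfolding continuous_on_eq_continuous_within
proof (intro ballI)
  fix p :: "real \<times> real" assume p: "p \<in> {0..} \<times> UNIV"
  obtain t x where tx: "p = (t, x)" by (cases p)
  have t: "0 \<le> t" using p tx by simp
  show "continuous (at p within {0..} \<times> UNIV) (\<lambda>(t, x). pair_u t x)"
  proof (cases "t = 0")
    case False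
    have "isCont (\<lambda>p. pair_u (fst p) (snd p)) (t, x)"
      unfolding pair_u_def using False t by (intro continuous_intros) auto
    then show ?thesis unfolding tx by (simp add: case_prod_unfold continuous_at_imp_continuous_at_within)
  next
    case True
    have "((\<lambda>p. sinh (fst p)) \<longlongrightarrow> 0) (at p within {0..} \<times> UNIV)"
      using True tx by (auto intro!: tendsto_eq_intros)
    then have "((\<lambda>(t, x). pair_u t x) \<longlongrightarrow> 0) (at p within {0..} \<times> UNIV)"
      by (rule Lim_null_comparison[rotated])
         (auto simp: eventually_at_filter intro!: always_eventually pair_u_bound)
    then show ?thesis using True tx by (simp add: continuous_within pair_u_0)
  qed
qed

lemma pair_u_cont_x: "0 \<le> t \<Longrightarrow> continuous_on UNIV (pair_u t)"
proof -
  assume t: "0 \<le> t"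
  have "continuous_on UNIV (\<lambda>x. case (t, x) of (t, x) \<Rightarrow> pair_u t x)"
    by (rule continuous_on_compose2[OF pair_u_cont]) (use t in \<open>auto intro!: continuous_intros\<close>)
  then show ?thesis by simp
qed

lemma hyperbolic_measurable[measurable]:
  "(sinh :: real \<Rightarrow> real) \<in> borel_measurable borel" "(cosh :: real \<Rightarrow> real) \<in> borel_measurable borel"
  by (auto intro!: borel_measurable_continuous_onI continuous_intros)

lemma pair_measurable:
  "(\<lambda>p. pair_u (fst p) (snd p)) \<in> borel_measurable borel"
  "(\<lambda>p. pair_ux (fst p) (snd p)) \<in> borel_measurable borel"
  "(\<lambda>p. pair_ut (fst p) (snd p)) \<in> borel_measurable borel"
  "(\<lambda>p. pair_F (fst p) (snd p)) \<in> borel_measurable borel"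
  unfolding pair_u_def pair_ux_def pair_ut_def pair_F_def borel_prod[symmetric] by measurable

lemma pair_ux_measurable_x[measurable]: "pair_ux t \<in> borel_measurable borel"
  unfolding pair_ux_def[abs_def] by measurable

lemma sinh_cosh_le_exp: "\<bar>sinh x\<bar> \<le> exp \<bar>x\<bar>" "cosh x \<le> exp \<bar>x\<bar>" for x :: real
proof -
  have "exp x \<le> exp \<bar>x\<bar>" "exp (- x) \<le> exp \<bar>x\<bar>" "0 < exp x" "0 < exp (- x)" by auto
  then show "\<bar>sinh x\<bar> \<le> exp \<bar>x\<bar>" "cosh x \<le> exp \<bar>x\<bar>" unfolding sinh_def cosh_def
    by (auto simp: abs_if field_simps)
qed

lemma pair_ux_bound: assumes t: "0 < t" shows "\<bar>pair_ux t x\<bar> \<le> 2 * cosh t / sinh t + sinh t"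
proof -
  have s: "0 < sinh t" "0 < cosh t" using t by simp_all
  have "cosh x \<le> exp \<bar>x\<bar>" by (rule sinh_cosh_le_exp)
  then have 1: "2 * cosh x / sinh t \<le> 2 * cosh t / sinh t" if "exp \<bar>x\<bar> < cosh t"
    using that s by (intro divide_right_mono) auto
  have 2: "sinh t * exp (- \<bar>x\<bar>) \<le> sinh t" "0 \<le> sinh t * exp (- \<bar>x\<bar>)" using s by (auto intro: mult_left_le)
  have 3: "0 \<le> 2 * cosh x / sinh t" "0 \<le> 2 * cosh t / sinh t" using s by (simp_all add: cosh_real_nonneg)
  show ?thesis unfolding pair_ux_def using 1 2 3 by auto
qed

lemma DERIV_three_pieces:
  fixes f fl fi fr :: "real \<Rightarrow> real"
  assumes x: "x \<noteq> q" "x \<noteq> - q"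
    and inner: "\<And>y. \<bar>y\<bar> < q \<Longrightarrow> f y = fi y" "\<bar>x\<bar> < q \<Longrightarrow> (fi has_real_derivative D) (at x)"
    and right: "\<And>y. q < y \<Longrightarrow> f y = fr y" "q < x \<Longrightarrow> (fr has_real_derivative D) (at x)"
    and left: "\<And>y. y < - q \<Longrightarrow> f y = fl y" "x < - q \<Longrightarrow> (fl has_real_derivative D) (at x)"
  shows "(f has_real_derivative D) (at x)"
proof -
  have *: "(f has_real_derivative D) (at x)"
    if "open A" "x \<in> A" "\<And>y. y \<in> A \<Longrightarrow> f y = k y" "(k has_real_derivative D) (at x)" for A k
  proof -
    have "eventually (\<lambda>y. f y = k y) (nhds x)"
      using eventually_nhds_in_open[OF that(1,2)] by eventually_elim (rule that(3))
    then show ?thesis using DERIV_cong_ev[of x x f k D D] that(4) by simp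
  qed
  consider "- q < x" "x < q" | "q < x" | "x < - q" using x by linarith
  then show ?thesis
  proof cases
    case 1 then show ?thesis by (intro *[of "{- q<..<q}" fi] inner) auto
  next
    case 2 then show ?thesis by (intro *[of "{q<..}" fr] right) auto
  next
    case 3 then show ?thesis by (intro *[of "{..< - q}" fl] left) auto
  qed
qed

lemma right_of_interface:
  assumes "0 < t" "pair_q t < y" shows "\<not> exp y < cosh t" "cosh t \<le> exp y" "\<bar>y\<bar> = y" "sgn y = 1"
proof -
  have "exp (pair_q t) < exp y" using assms by simp
  then show "\<not> exp y < cosh t" "cosh t \<le> exp y" unfolding exp_pair_q by simp_all
  show "\<bar>y\<bar> = y" "sgn y = 1" using pair_q_pos[OF assms(1)] assms(2) by simp_all
qed

lemma left_of_interface: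
  assumes "0 < t" "y < - pair_q t" shows "\<not> exp (- y) < cosh t" "cosh t \<le> exp (- y)" "\<bar>y\<bar> = - y" "sgn y = - 1"
  using right_of_interface[of t "- y"] assms by (simp_all add: sgn_minus)

lemma pair_u_DERIV_x:
  assumes t: "0 < t" and x: "x \<noteq> pair_q t" "x \<noteq> - pair_q t"
  shows "(pair_u t has_real_derivative pair_ux t x) (at x)"
proof (rule DERIV_three_pieces[OF x])
  note e = inside_iff[of _ t, THEN iffD2] and er = right_of_interface[OF t] and el = left_of_interface[OF t] and u = pair_u_eq[OF t]
  show "pair_u t y = 2 * sinh y / sinh t" if "\<bar>y\<bar> < pair_q t" for y using e[OF that] u(1)[of y] by simp
  show "pair_u t y = sinh t * exp (- y)" if "pair_q t < y" for y using er[OF that] u(2)[of y] by simp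
  show "pair_u t y = - (sinh t * exp y)" if "y < - pair_q t" for y using el[OF that] u(2)[of y] by simp
  show "((\<lambda>y. 2 * sinh y / sinh t) has_real_derivative pair_ux t x) (at x)" if "\<bar>x\<bar> < pair_q t"
    using e[OF that] by (auto simp: pair_ux_def intro!: derivative_eq_intros)
  show "((\<lambda>y. sinh t * exp (- y)) has_real_derivative pair_ux t x) (at x)" if "pair_q t < x"
    using er[OF that] by (auto simp: pair_ux_def intro!: derivative_eq_intros)
  show "((\<lambda>y. - (sinh t * exp y)) has_real_derivative pair_ux t x) (at x)" if "x < - pair_q t"
    using el[OF that] by (auto simp: pair_ux_def intro!: derivative_eq_intros)
qed

abbreviation "pair_h \<equiv> energy_density pair_u pair_ux"

lemma pair_h_eq:
  assumes t: "0 < t"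
  shows "exp \<bar>x\<bar> < cosh t \<Longrightarrow> pair_h t x = (4 * (sinh x)\<^sup>2 + 2 * (cosh x)\<^sup>2) / (sinh t)\<^sup>2"
    "\<not> exp \<bar>x\<bar> < cosh t \<Longrightarrow> pair_h t x = 3 / 2 * (sinh t)\<^sup>2 * (exp (- \<bar>x\<bar>))\<^sup>2"
proof -
  show "pair_h t x = (4 * (sinh x)\<^sup>2 + 2 * (cosh x)\<^sup>2) / (sinh t)\<^sup>2" if "exp \<bar>x\<bar> < cosh t"
    using that pair_u_eq(1)[OF t, of x]
    by (simp add: energy_density_def pair_ux_def power_divide power_mult_distrib add_divide_distrib)
  show "pair_h t x = 3 / 2 * (sinh t)\<^sup>2 * (exp (- \<bar>x\<bar>))\<^sup>2" if "\<not> exp \<bar>x\<bar> < cosh t"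
  proof -
    have "x \<noteq> 0" using that cosh_gt_1[OF t] by auto
    then have "(sgn x)\<^sup>2 = 1" by (simp add: sgn_if)
    then show ?thesis using that pair_u_eq(2)[OF t, of x]
      by (simp add: energy_density_def pair_ux_def power_mult_distrib)
  qed
qed

lemma pair_P_DERIV:
  assumes t: "0 < t" and x: "x \<noteq> pair_q t" "x \<noteq> - pair_q t"
  shows "(pair_P t has_real_derivative - pair_F t x) (at x)"
proof (rule DERIV_three_pieces[OF x])
  note e = inside_iff[of _ t, THEN iffD2] and er = right_of_interface[OF t] and el = left_of_interface[OF t]
  show "pair_P t y = 2 * cosh y * (cosh t - cosh y) / (sinh t)\<^sup>2" if "\<bar>y\<bar> < pair_q t" for y
    using e[OF that] by (simp add: pair_P_def)
  show "pair_P t y = cosh t * exp (- y) - (sinh t)\<^sup>2 * (exp (- y))\<^sup>2 / 2" if "pair_q t < y" for y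
    using er[OF that] by (simp add: pair_P_def)
  show "pair_P t y = cosh t * exp y - (sinh t)\<^sup>2 * (exp y)\<^sup>2 / 2" if "y < - pair_q t" for y
    using el[OF that] by (simp add: pair_P_def)
  have s: "sinh t \<noteq> 0" using t by simp
  show "((\<lambda>y. 2 * cosh y * (cosh t - cosh y) / (sinh t)\<^sup>2) has_real_derivative - pair_F t x) (at x)" if "\<bar>x\<bar> < pair_q t"
    using e[OF that] s by (auto simp: pair_F_def field_simps intro!: derivative_eq_intros)
  show "((\<lambda>y. cosh t * exp (- y) - (sinh t)\<^sup>2 * (exp (- y))\<^sup>2 / 2) has_real_derivative - pair_F t x) (at x)" if "pair_q t < x"
    using er[OF that] by (auto simp: pair_F_def power2_eq_square intro!: derivative_eq_intros)
  show "((\<lambda>y. cosh t * exp y - (sinh t)\<^sup>2 * (exp y)\<^sup>2 / 2) has_real_derivative - pair_F t x) (at x)" if "x < - pair_q t"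
    using el[OF that] by (auto simp: pair_F_def power2_eq_square intro!: derivative_eq_intros)
qed

lemma pair_F_DERIV:
  assumes t: "0 < t" and x: "x \<noteq> pair_q t" "x \<noteq> - pair_q t"
  shows "(pair_F t has_real_derivative pair_h t x - pair_P t x) (at x)"
proof (rule DERIV_three_pieces[OF x])
  note e = inside_iff[of _ t, THEN iffD2] and er = right_of_interface[OF t] and el = left_of_interface[OF t] and hh = pair_h_eq[OF t]
  show "pair_F t y = 2 * sinh y * (2 * cosh y - cosh t) / (sinh t)\<^sup>2" if "\<bar>y\<bar> < pair_q t" for y
    using e[OF that] by (simp add: pair_F_def)
  show "pair_F t y = cosh t * exp (- y) - (sinh t)\<^sup>2 * (exp (- y))\<^sup>2" if "pair_q t < y" for y
    using er[OF that] by (simp add: pair_F_def)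
  show "pair_F t y = (sinh t)\<^sup>2 * (exp y)\<^sup>2 - cosh t * exp y" if "y < - pair_q t" for y
    using el[OF that] by (simp add: pair_F_def)
  have s: "sinh t \<noteq> 0" using t by simp
  show "((\<lambda>y. 2 * sinh y * (2 * cosh y - cosh t) / (sinh t)\<^sup>2) has_real_derivative pair_h t x - pair_P t x) (at x)" if "\<bar>x\<bar> < pair_q t"
    using e[OF that] s hh(1)[OF e[OF that]]
    by (auto simp: pair_P_def field_simps power2_eq_square intro!: derivative_eq_intros)
  show "((\<lambda>y. cosh t * exp (- y) - (sinh t)\<^sup>2 * (exp (- y))\<^sup>2) has_real_derivative pair_h t x - pair_P t x) (at x)" if "pair_q t < x"
    using er[OF that] hh(2)[of x] by (auto simp: pair_P_def power2_eq_square algebra_simps intro!: derivative_eq_intros)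
  show "((\<lambda>y. (sinh t)\<^sup>2 * (exp y)\<^sup>2 - cosh t * exp y) has_real_derivative pair_h t x - pair_P t x) (at x)" if "x < - pair_q t"
    using el[OF that] hh(2)[of x] by (auto simp: pair_P_def power2_eq_square algebra_simps intro!: derivative_eq_intros)
qed

text \<open>
  Both formulas for \<open>pair_P\<close>, and both for \<open>pair_F\<close>, agree at the peaks.
\<close>
lemma interface_values:
  fixes t x :: real
  assumes t: "0 < t" and x: "exp \<bar>x\<bar> = cosh t"
  shows "2 * cosh x * (cosh t - cosh x) / (sinh t)\<^sup>2 = cosh t * exp (- \<bar>x\<bar>) - (sinh t)\<^sup>2 * (exp (- \<bar>x\<bar>))\<^sup>2 / 2"
    "2 * sinh x * (2 * cosh x - cosh t) / (sinh t)\<^sup>2 = sgn x * (cosh t * exp (- \<bar>x\<bar>) - (sinh t)\<^sup>2 * (exp (- \<bar>x\<bar>))\<^sup>2)"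
proof -
  define c where "c = cosh t"
  have c: "1 < c" unfolding c_def by (rule cosh_gt_1[OF t])
  have s: "(sinh t)\<^sup>2 = c\<^sup>2 - 1" using cosh_sq[of t] by (simp add: c_def)
  have x0: "x \<noteq> 0" using x c by (auto simp: c_def)
  have em: "exp (- \<bar>x\<bar>) = 1 / c" using x by (simp add: exp_minus c_def divide_inverse)
  have ch: "cosh x = (c + 1 / c) / 2"
    using x em by (cases "0 \<le> x") (auto simp: cosh_def c_def)
  have sh: "sinh x = sgn x * ((c - 1 / c) / 2)"
    using x em x0 by (cases "0 \<le> x") (auto simp: sinh_def c_def sgn_if)
  have c0: "c \<noteq> 0" "c\<^sup>2 - 1 \<noteq> 0"
  proof -
    have "1 < c * c" by (rule less_1_mult[OF c c])
    then show "c \<noteq> 0" "c\<^sup>2 - 1 \<noteq> 0" using c by (auto simp: power2_eq_square)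
  qed
  have 1: "2 * ((c + 1 / c) / 2) * (c - (c + 1 / c) / 2) = (c\<^sup>2 - 1) * ((c\<^sup>2 + 1) / (2 * c\<^sup>2))"
    using c0(1) by (simp add: field_simps power2_eq_square)
  show "2 * cosh x * (cosh t - cosh x) / (sinh t)\<^sup>2 = cosh t * exp (- \<bar>x\<bar>) - (sinh t)\<^sup>2 * (exp (- \<bar>x\<bar>))\<^sup>2 / 2"
    unfolding ch em s c_def[symmetric] 1 using c0 by (simp add: field_simps power2_eq_square)
  have 2: "((c - 1 / c) / 2) * (2 * ((c + 1 / c) / 2) - c) = (c\<^sup>2 - 1) * (1 / (2 * c\<^sup>2))"
    using c0(1) by (simp add: field_simps power2_eq_square)
  have "2 * (sgn x * ((c - 1 / c) / 2)) * (2 * ((c + 1 / c) / 2) - c) / (c\<^sup>2 - 1)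
      = 2 * sgn x * (((c - 1 / c) / 2) * (2 * ((c + 1 / c) / 2) - c)) / (c\<^sup>2 - 1)" by (simp only: mult.assoc)
  also have "\<dots> = sgn x * (1 / c\<^sup>2)" unfolding 2 using c0 by simp
  also have "1 / c\<^sup>2 = c * (1 / c) - (c\<^sup>2 - 1) * (1 / c)\<^sup>2" using c0(1) by (simp add: field_simps power2_eq_square)
  finally show "2 * sinh x * (2 * cosh x - cosh t) / (sinh t)\<^sup>2 = sgn x * (cosh t * exp (- \<bar>x\<bar>) - (sinh t)\<^sup>2 * (exp (- \<bar>x\<bar>))\<^sup>2)"
    unfolding ch sh em s c_def[symmetric] .
qed

lemma pair_PF_cont:
  assumes t: "0 < t"
  shows "continuous_on UNIV (pair_P t)" "continuous_on UNIV (pair_F t)"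
proof -
  define I where "I = {x::real. exp \<bar>x\<bar> \<le> cosh t}"
  define J where "J = {x::real. cosh t \<le> exp \<bar>x\<bar>}"
  have cl: "closed I" "closed J" unfolding I_def J_def by (auto intro!: closed_Collect_le continuous_intros)
  have un: "I \<union> J = UNIV" unfolding I_def J_def by auto
  have s: "(sinh t)\<^sup>2 \<noteq> 0" using t by simp
  have J0: "x \<noteq> 0" if "x \<in> J" for x using that cosh_gt_1[OF t] by (auto simp: J_def)
  have "continuous_on (I \<union> J) (pair_P t)" unfolding pair_P_def[abs_def]
  proof (rule continuous_on_cases[OF cl])
    show "\<forall>x. x \<in> I \<and> \<not> exp \<bar>x\<bar> < cosh t \<or> x \<in> J \<and> exp \<bar>x\<bar> < cosh t \<longrightarrow>
        2 * cosh x * (cosh t - cosh x) / (sinh t)\<^sup>2 = cosh t * exp (- \<bar>x\<bar>) - (sinh t)\<^sup>2 * (exp (- \<bar>x\<bar>))\<^sup>2 / 2"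
      using interface_values(1)[OF t] by (force simp: I_def J_def)
  qed (use s in \<open>auto intro!: continuous_intros\<close>)
  then show "continuous_on UNIV (pair_P t)" unfolding un .
  have "continuous_on (I \<union> J) (pair_F t)" unfolding pair_F_def[abs_def]
  proof (rule continuous_on_cases[OF cl])
    show "\<forall>x. x \<in> I \<and> \<not> exp \<bar>x\<bar> < cosh t \<or> x \<in> J \<and> exp \<bar>x\<bar> < cosh t \<longrightarrow>
        2 * sinh x * (2 * cosh x - cosh t) / (sinh t)\<^sup>2 = sgn x * (cosh t * exp (- \<bar>x\<bar>) - (sinh t)\<^sup>2 * (exp (- \<bar>x\<bar>))\<^sup>2)"
      using interface_values(2)[OF t] by (force simp: I_def J_def)
    show "continuous_on J (\<lambda>x. sgn x * (cosh t * exp (- \<bar>x\<bar>) - (sinh t)\<^sup>2 * (exp (- \<bar>x\<bar>))\<^sup>2))"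
      by (intro continuous_on_mult continuous_on_sgn) (use J0 in \<open>auto intro!: continuous_intros\<close>)
  qed (use s in \<open>auto intro!: continuous_intros\<close>)
  then show "continuous_on UNIV (pair_F t)" unfolding un .
qed

text \<open>
  A crude bound in terms of \<open>c = cosh t\<close> and \<open>s = sinh t\<close> that is monotone in both, hence
  uniform for times in a compact subinterval of \<open>(0, \<infinity>)\<close>.
\<close>
definition pair_bound :: "real \<Rightarrow> real \<Rightarrow> real" where
  "pair_bound c s = 6 * c\<^sup>2 / s\<^sup>2 + c + c\<^sup>2"

lemma pair_bounds:
  assumes t: "0 < t"
  shows "\<bar>pair_P t x\<bar> \<le> pair_bound (cosh t) (sinh t)" "\<bar>pair_F t x\<bar> \<le> pair_bound (cosh t) (sinh t)"
    "\<bar>pair_ut t x\<bar> \<le> pair_bound (cosh t) (sinh t)"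
proof -
  define c s where "c = cosh t" and "s = sinh t"
  have c: "1 \<le> c" and s: "0 < s" and sc: "s\<^sup>2 \<le> c\<^sup>2" using t cosh_sq[of t] by (auto simp: c_def s_def cosh_real_ge_1)
  have B: "pair_bound c s = 6 * c\<^sup>2 / s\<^sup>2 + c + c\<^sup>2" by (simp add: pair_bound_def)
  have B0: "0 \<le> 6 * c\<^sup>2 / s\<^sup>2" "0 \<le> c" "0 \<le> c\<^sup>2" using c by auto
  have frac: "\<bar>v / s\<^sup>2\<bar> \<le> pair_bound c s" if "\<bar>v\<bar> \<le> 6 * c\<^sup>2" for v
  proof -
    have "\<bar>v / s\<^sup>2\<bar> \<le> 6 * c\<^sup>2 / s\<^sup>2" using that s by (simp add: abs_divide divide_right_mono)
    then show ?thesis using B B0 by linarith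
  qed
  define e where "e = exp (- \<bar>x\<bar>)"
  have e: "0 < e" "e \<le> 1" by (auto simp: e_def)
  have ce: "0 \<le> c * e" "c * e \<le> c" using e c by (auto intro: mult_left_le)
  have se: "0 \<le> s\<^sup>2 * e\<^sup>2" "s\<^sup>2 * e\<^sup>2 \<le> c\<^sup>2"
  proof -
    have "e\<^sup>2 \<le> 1" using e by (simp add: power_le_one)
    then have "s\<^sup>2 * e\<^sup>2 \<le> s\<^sup>2 * 1" by (intro mult_left_mono) auto
    then show "0 \<le> s\<^sup>2 * e\<^sup>2" "s\<^sup>2 * e\<^sup>2 \<le> c\<^sup>2" using sc by auto
  qed
  have sg: "\<bar>sgn x * v\<bar> \<le> \<bar>v\<bar>" for v by (simp add: abs_mult sgn_if)
  have hyp: "\<bar>sinh x\<bar> \<le> c" "\<bar>cosh x\<bar> \<le> c" if "exp \<bar>x\<bar> < c"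
    using that sinh_cosh_le_exp[of x] cosh_real_nonneg[of x] by auto
  show "\<bar>pair_P t x\<bar> \<le> pair_bound (cosh t) (sinh t)"
  proof (cases "exp \<bar>x\<bar> < c")
    case True
    have "\<bar>2 * cosh x * (c - cosh x)\<bar> \<le> (2 * c) * (2 * c)"
    proof -
      have "\<bar>c - cosh x\<bar> \<le> 2 * c" using hyp(2)[OF True] c unfolding abs_le_iff by linarith
      then show ?thesis unfolding abs_mult using hyp(2)[OF True] c by (intro mult_mono) auto
    qed
    then have "\<bar>2 * cosh x * (c - cosh x)\<bar> \<le> 6 * c\<^sup>2" using B0 by (simp add: power2_eq_square)
    from frac[OF this] show ?thesis using True by (simp add: pair_P_def c_def s_def)
  next
    case False
    have "\<bar>c * e - s\<^sup>2 * e\<^sup>2 / 2\<bar> \<le> c + c\<^sup>2" unfolding abs_le_iff using ce se c by (intro conjI; linarith)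
    then have "\<bar>c * e - s\<^sup>2 * e\<^sup>2 / 2\<bar> \<le> pair_bound c s" using B B0 by linarith
    then show ?thesis using False by (simp add: pair_P_def c_def s_def e_def)
  qed
  show "\<bar>pair_F t x\<bar> \<le> pair_bound (cosh t) (sinh t)"
  proof (cases "exp \<bar>x\<bar> < c")
    case True
    have "\<bar>2 * sinh x * (2 * cosh x - c)\<bar> \<le> (2 * c) * (3 * c)"
    proof -
      have "\<bar>2 * cosh x - c\<bar> \<le> 3 * c" using hyp(2)[OF True] c unfolding abs_le_iff by linarith
      then show ?thesis unfolding abs_mult using hyp(1)[OF True] c by (intro mult_mono) auto
    qed
    then have "\<bar>2 * sinh x * (2 * cosh x - c)\<bar> \<le> 6 * c\<^sup>2" by (simp add: power2_eq_square)
    from frac[OF this] show ?thesis using True by (simp add: pair_F_def c_def s_def)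
  next
    case False
    have "\<bar>c * e - s\<^sup>2 * e\<^sup>2\<bar> \<le> c + c\<^sup>2" unfolding abs_le_iff using ce se c by (intro conjI; linarith)
    then have "\<bar>sgn x * (c * e - s\<^sup>2 * e\<^sup>2)\<bar> \<le> c + c\<^sup>2" using sg by (rule order_trans[rotated])
    then have "\<bar>sgn x * (c * e - s\<^sup>2 * e\<^sup>2)\<bar> \<le> pair_bound c s" using B B0 by linarith
    then show ?thesis using False by (simp add: pair_F_def c_def s_def e_def)
  qed
  show "\<bar>pair_ut t x\<bar> \<le> pair_bound (cosh t) (sinh t)"
  proof (cases "exp \<bar>x\<bar> < c")
    case True
    have "\<bar>- (2 * sinh x * c)\<bar> \<le> (2 * c) * c"
      unfolding abs_minus_cancel abs_mult using hyp[OF True] c by (intro mult_mono) auto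
    then have "\<bar>- (2 * sinh x * c)\<bar> \<le> 6 * c\<^sup>2" using B0 by (simp add: power2_eq_square)
    from frac[OF this] show ?thesis using True by (simp add: pair_ut_def c_def s_def)
  next
    case False
    have "\<bar>sgn x * (c * e)\<bar> \<le> c" using sg[of "c * e"] ce by linarith
    then have "\<bar>sgn x * (c * e)\<bar> \<le> pair_bound c s" using B B0 by linarith
    then show ?thesis using False by (simp add: pair_ut_def c_def s_def e_def mult.assoc)
  qed
qed

text \<open>
  The energy density at \<open>x\<close> is dominated by \<open>k \<bar>x\<bar>\<close>, where \<open>k\<close> is an exponential on either side
  of the peak; by \<open>exp q = cosh t\<close> its two integrals are at most \<open>3\<close> and \<open>1\<close>. The energy bound
  does not degenerate as \<open>t\<close> tends to \<open>0\<close>, although \<open>u\<close> itself tends to \<open>0\<close>.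
\<close>
lemma pair_energy:
  assumes "0 \<le> t" shows "(\<integral>\<^sup>+x. ennreal (pair_h t x) \<partial>lborel) \<le> ennreal 8"
proof (cases "t = 0")
  case True then show ?thesis by (simp add: energy_density_def pair_u_0)
next
  case False
  then have t: "0 < t" using assms by simp
  define s c where "s = sinh t" and "c = cosh t"
  define q where "q = pair_q t"
  have s: "0 < s" and c: "1 < c" using t cosh_gt_1[OF t] by (auto simp: s_def c_def)
  have q: "0 < q" "exp q = c" using pair_q_pos[OF t] exp_pair_q by (auto simp: q_def c_def)
  define k1 k2 where "k1 x = 6 / s\<^sup>2 * exp (2 * x)" and "k2 x = 3 / 2 * s\<^sup>2 * exp (- (2 * x))" for x
  define k where "k x = ennreal (k1 x) * indicator {0..q} x + ennreal (k2 x) * indicator {q..} x" for x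
  have [measurable]: "k1 \<in> borel_measurable borel" "k2 \<in> borel_measurable borel"
    unfolding k1_def[abs_def] k2_def[abs_def] by measurable
  have km[measurable]: "k \<in> borel_measurable borel" unfolding k_def[abs_def] by measurable
  have e2: "exp (2 * y) = (exp y)\<^sup>2" for y :: real by (simp add: exp_double)
  have hk: "ennreal (pair_h t x) \<le> k \<bar>x\<bar>" for x
  proof (cases "exp \<bar>x\<bar> < c")
    case True
    have "(sinh x)\<^sup>2 \<le> (exp \<bar>x\<bar>)\<^sup>2" "(cosh x)\<^sup>2 \<le> (exp \<bar>x\<bar>)\<^sup>2"
      using power_mono[OF sinh_cosh_le_exp(1)[of x], of 2] power_mono[OF sinh_cosh_le_exp(2)[of x], of 2]
      by (auto simp: cosh_real_nonneg)
    then have "4 * (sinh x)\<^sup>2 + 2 * (cosh x)\<^sup>2 \<le> 6 * exp (2 * \<bar>x\<bar>)" unfolding e2 by linarith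
    then have "pair_h t x \<le> k1 \<bar>x\<bar>"
      using True pair_h_eq(1)[OF t, of x] s by (simp add: c_def s_def k1_def divide_right_mono)
    moreover have "\<bar>x\<bar> \<in> {0..q}" using True inside_iff[of x t] by (simp add: c_def q_def)
    ultimately show ?thesis unfolding k_def
      by (auto intro!: add_increasing2 ennreal_leI)
  next
    case False
    then have "pair_h t x = k2 \<bar>x\<bar>"
      using pair_h_eq(2)[OF t, of x] by (simp add: c_def s_def k2_def e2[of "- \<bar>x\<bar>", simplified])
    moreover have "\<bar>x\<bar> \<in> {q..}" using False inside_iff[of x t] by (simp add: c_def q_def)
    ultimately show ?thesis unfolding k_def by (auto intro!: add_increasing)
  qed
  have kk: "k \<bar>x\<bar> \<le> k x + k (- x)" for x by (cases "0 \<le> x") (auto simp: add_increasing add_increasing2)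
  have "(\<integral>\<^sup>+x. ennreal (pair_h t x) \<partial>lborel) \<le> (\<integral>\<^sup>+x. k x + k (- x) \<partial>lborel)"
    by (intro nn_integral_mono order_trans[OF hk kk])
  also have "\<dots> = (\<integral>\<^sup>+x. k x \<partial>lborel) + (\<integral>\<^sup>+x. k (- x) \<partial>lborel)" by (rule nn_integral_add) auto
  also have "(\<integral>\<^sup>+x. k (- x) \<partial>lborel) = (\<integral>\<^sup>+x. k x \<partial>lborel)"
    using nn_integral_real_affine[OF km, of "-1" 0] by simp
  also have "(\<integral>\<^sup>+x. k x \<partial>lborel) = (\<integral>\<^sup>+x. ennreal (k1 x) * indicator {0..q} x \<partial>lborel) + (\<integral>\<^sup>+x. ennreal (k2 x) * indicator {q..} x \<partial>lborel)"
    unfolding k_def by (rule nn_integral_add) auto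
  also have "(\<integral>\<^sup>+x. ennreal (k1 x) * indicator {0..q} x \<partial>lborel) = ennreal (3 / s\<^sup>2 * exp (2 * q) - 3 / s\<^sup>2 * exp (2 * 0))"
  proof (rule nn_integral_FTC_Icc)
    fix x :: real
    have "((\<lambda>x. exp (2 * x)) has_real_derivative 2 * exp (2 * x)) (at x)" by (auto intro!: derivative_eq_intros)
    from DERIV_cmult[OF this, of "3 / s\<^sup>2"]
    show "DERIV (\<lambda>x. 3 / s\<^sup>2 * exp (2 * x)) x :> k1 x" by (simp add: k1_def)
  qed (use q s in \<open>auto simp: k1_def\<close>)
  also have "3 / s\<^sup>2 * exp (2 * q) - 3 / s\<^sup>2 * exp (2 * 0) = 3"
  proof -
    have "exp (2 * q) = s\<^sup>2 + 1" using e2[of q] q(2) cosh_sq[of t] by (simp add: c_def s_def)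
    then show ?thesis using s by (simp add: field_simps)
  qed
  also have "(\<integral>\<^sup>+x. ennreal (k2 x) * indicator {q..} x \<partial>lborel) = ennreal (0 - - (3 / 4 * s\<^sup>2 * exp (- (2 * q))))"
  proof (rule nn_integral_FTC_atLeast)
    show "DERIV (\<lambda>x. - (3 / 4 * s\<^sup>2 * exp (- (2 * x)))) x :> k2 x" for x unfolding k2_def by (auto intro!: derivative_eq_intros)
    have "((\<lambda>x::real. exp (- (2 * x))) \<longlongrightarrow> 0) at_top" by real_asymp
    then have "((\<lambda>x. - (3 / 4 * s\<^sup>2 * exp (- (2 * x)))) \<longlongrightarrow> - (3 / 4 * s\<^sup>2 * 0)) at_top" by (intro tendsto_intros)
    then show "((\<lambda>x. - (3 / 4 * s\<^sup>2 * exp (- (2 * x)))) \<longlongrightarrow> 0) at_top" by simp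
  qed (auto simp: k2_def)
  also have "\<dots> \<le> ennreal 1"
  proof (rule ennreal_leI)
    have "exp (- (2 * q)) = 1 / (s\<^sup>2 + 1)"
      using e2[of q] q(2) cosh_sq[of t] by (simp add: c_def s_def exp_minus divide_inverse)
    moreover have "s\<^sup>2 * (1 / (s\<^sup>2 + 1)) \<le> 1" using s by (simp add: field_simps add_pos_pos)
    ultimately have "s\<^sup>2 * exp (- (2 * q)) \<le> 1" by simp
    then have "3 / 4 * (s\<^sup>2 * exp (- (2 * q))) \<le> 1" by linarith
    then show "0 - - (3 / 4 * s\<^sup>2 * exp (- (2 * q))) \<le> 1" by (simp only: mult.assoc diff_0 minus_minus)
  qed
  finally have "(\<integral>\<^sup>+x. ennreal (pair_h t x) \<partial>lborel) \<le> (ennreal 3 + ennreal 1) + (ennreal 3 + ennreal 1)"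
    by (auto intro: add_mono order_trans)
  also have "\<dots> = ennreal 8" by (simp add: ennreal_plus[symmetric] del: ennreal_plus)
  finally show ?thesis .
qed

lemma pair_source:
  assumes t: "0 < t" shows "CH_source pair_u pair_ux t x = pair_F t x"
proof -
  have m: "pair_h t \<in> borel_measurable borel"
    unfolding energy_density_def[abs_def]
    by (intro borel_measurable_add borel_measurable_power borel_measurable_times borel_measurable_const
        borel_measurable_continuous_onI[OF pair_u_cont_x[OF less_imp_le[OF t]]] pair_ux_measurable_x)
  have "(LINT y|lborel. CH_kernel (x - y) * pair_h t y) = pair_F t x"
  proof (rule kernel_integral[where P="pair_P t" and S="{pair_q t, - pair_q t}" and B="pair_bound (cosh t) (sinh t)"])
    show "integrable lborel (pair_h t)"
    proof (rule integrableI_nonneg)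
      show "(\<integral>\<^sup>+x. ennreal (pair_h t x) \<partial>lborel) < \<infinity>" by (rule le_less_trans[OF pair_energy]) (use t in auto)
    qed (use m in \<open>auto simp: energy_density_def\<close>)
  qed (use pair_PF_cont[OF t] pair_bounds[OF t] pair_P_DERIV[OF t] pair_F_DERIV[OF t] in auto)
  then show ?thesis by (simp add: CH_source_def CH_kernel_def energy_density_def)
qed

lemma pair_equation:
  assumes t: "0 < t" shows "pair_u t x * pair_ux t x = pair_F t x - pair_ut t x"
proof (cases "exp \<bar>x\<bar> < cosh t")
  case True
  have "sinh t \<noteq> 0" using t by simp
  then show ?thesis using True pair_u_eq(1)[OF t, of x]
    by (simp add: pair_ux_def pair_F_def pair_ut_def field_simps power2_eq_square)
next
  case False
  then show ?thesis using pair_u_eq(2)[OF t, of x]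
    by (simp add: pair_ux_def pair_F_def pair_ut_def algebra_simps power2_eq_square)
qed

lemma pair_u_DERIV_t:
  assumes t: "0 < t" and x: "exp \<bar>x\<bar> \<noteq> cosh t"
  shows "((\<lambda>t. pair_u t x) has_real_derivative pair_ut t x) (at t)"
proof -
  have *: "((\<lambda>t. pair_u t x) has_real_derivative pair_ut t x) (at t)"
    if "open A" "t \<in> A" "\<And>r. r \<in> A \<Longrightarrow> pair_u r x = k r" "(k has_real_derivative pair_ut t x) (at t)" for A k
  proof -
    have "eventually (\<lambda>r. pair_u r x = k r) (nhds t)"
      using eventually_nhds_in_open[OF that(1,2)] by eventually_elim (rule that(3))
    then show ?thesis using DERIV_cong_ev[of t t "\<lambda>t. pair_u t x" k "pair_ut t x" "pair_ut t x"] that(4) by simp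
  qed
  have s: "sinh t \<noteq> 0" using t by simp
  consider "exp \<bar>x\<bar> < cosh t" | "cosh t < exp \<bar>x\<bar>" using x by linarith
  then show ?thesis
  proof cases
    case 1
    show ?thesis
    proof (rule *[of "{r. 0 < r \<and> exp \<bar>x\<bar> < cosh r}" "\<lambda>r. 2 * sinh x / sinh r"])
      show "open {r. 0 < r \<and> exp \<bar>x\<bar> < cosh r}" by (intro open_Collect_conj open_Collect_less continuous_intros)
      show "((\<lambda>r. 2 * sinh x / sinh r) has_real_derivative pair_ut t x) (at t)"
        using 1 s by (auto simp: pair_ut_def power2_eq_square intro!: derivative_eq_intros)
    qed (use 1 t pair_u_eq(1) in auto)
  next
    case 2
    show ?thesis
    proof (rule *[of "{r. 0 < r \<and> cosh r < exp \<bar>x\<bar>}" "\<lambda>r. sgn x * (sinh r * exp (- \<bar>x\<bar>))"])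
      show "open {r. 0 < r \<and> cosh r < exp \<bar>x\<bar>}" by (intro open_Collect_conj open_Collect_less continuous_intros)
      show "((\<lambda>r. sgn x * (sinh r * exp (- \<bar>x\<bar>))) has_real_derivative pair_ut t x) (at t)"
        using 2 by (auto simp: pair_ut_def intro!: derivative_eq_intros)
    qed (use 2 t pair_u_eq(2) in auto)
  qed
qed

text \<open>
  A test function and its time derivative live in a compact box at positive distance from the
  line \<open>t = 0\<close>, on which the bounds for the pair are uniform.
\<close>
lemma test_function_time_derivative:
  fixes \<phi> :: "real \<times> real \<Rightarrow> real"
  assumes \<phi>: "test_function_on ({0<..} \<times> UNIV) \<phi>"
  obtains \<phi>t a b r B where "\<And>t x. ((\<lambda>s. \<phi> (s, x)) has_real_derivative \<phi>t (t, x)) (at t)"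
    "continuous_on UNIV \<phi>" "continuous_on UNIV \<phi>t" "0 < a" "a < b" "0 \<le> B"
    "\<And>p. \<bar>\<phi> p\<bar> \<le> B" "\<And>p. \<bar>\<phi>t p\<bar> \<le> B"
    "\<And>p. p \<notin> {a<..<b} \<times> {- r..r} \<Longrightarrow> \<phi> p = 0" "\<And>p. p \<notin> {a<..<b} \<times> {- r..r} \<Longrightarrow> \<phi>t p = 0"
proof -
  obtain K where K: "compact K" "K \<subseteq> {0<..} \<times> UNIV" "\<And>p. p \<notin> K \<Longrightarrow> \<phi> p = 0"
    using \<phi> unfolding test_function_on_def by blast
  have C1: "C_k 1 \<phi>" using \<phi> unfolding test_function_on_def by blast
  then have diff: "\<phi> differentiable (at p)" for p
    unfolding One_nat_def C_k.simps(2) by blast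
  define \<phi>t where "\<phi>t p = frechet_derivative \<phi> (at p) (1, 0)" for p
  have c\<phi>: "continuous_on UNIV \<phi>"
    using diff by (simp add: continuous_at_imp_continuous_on differentiable_imp_continuous_within)
  have "(1, 0) \<in> (Basis :: (real \<times> real) set)" by (simp add: Basis_prod_def)
  then have ct: "continuous_on UNIV \<phi>t"
    using C1 unfolding \<phi>t_def[abs_def] One_nat_def C_k.simps by blast
  have d: "((\<lambda>s. \<phi> (s, x)) has_real_derivative \<phi>t (t, x)) (at t)" for t x
  proof -
    define D where "D = frechet_derivative \<phi> (at (t, x))"
    have D: "(\<phi> has_derivative D) (at (t, x))"
      unfolding D_def using diff frechet_derivative_works by blast
    have "((\<lambda>s. (s, x)) has_derivative (\<lambda>h. (h, 0))) (at t)"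
      by (intro has_derivative_Pair has_derivative_ident has_derivative_const)
    then have "((\<lambda>s. \<phi> (s, x)) has_derivative (\<lambda>h. D (h, 0))) (at t)"
      using has_derivative_compose[of "\<lambda>s. (s, x)" "\<lambda>h. (h, 0)" t UNIV \<phi> D] D by simp
    moreover have "(\<lambda>h. D (h, 0)) = (*) (D (1, 0))"
    proof
      fix h show "D (h, 0) = D (1, 0) * h"
      using linear_cmul[OF bounded_linear.linear[OF has_derivative_bounded_linear[OF D]], of h "(1, 0)"]
      by (simp add: mult.commute)
    qed
    ultimately show ?thesis unfolding has_field_derivative_def \<phi>t_def D_def by simp
  qed
  have zt: "\<phi>t p = 0" if p: "p \<notin> K" for p
  proof -
    obtain t x where tx: "p = (t, x)" by (cases p)
    have "open (- K)" using K(1) by (simp add: compact_imp_closed open_Compl)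
    then obtain e where e: "e > 0" "ball p e \<subseteq> - K" using p open_contains_ball by blast
    have "\<phi> (s, x) = 0" if "dist s t < e" for s
    proof -
      have "dist p (s, x) = dist s t" unfolding tx by (simp add: dist_Pair_Pair dist_commute)
      then have "(s, x) \<in> ball p e" using that by simp
      then show ?thesis using e(2) K(3) by blast
    qed
    then have "eventually (\<lambda>s. \<phi> (s, x) = 0) (nhds t)"
      unfolding eventually_nhds_metric using e(1) by blast
    then have "((\<lambda>_. 0) has_real_derivative \<phi>t (t, x)) (at t)"
      using DERIV_cong_ev[of t t "\<lambda>s. \<phi> (s, x)" "\<lambda>_. 0" "\<phi>t (t, x)"] d[of x t] by auto
    then show ?thesis unfolding tx using DERIV_unique[OF _ DERIV_const] by blast
  qed
  obtain R where R: "\<And>p. p \<in> K \<Longrightarrow> norm p \<le> R" using compact_imp_bounded[OF K(1)] unfolding bounded_iff by blast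
  obtain m where m: "0 < m" "\<And>p. p \<in> K \<Longrightarrow> m \<le> fst p"
  proof (cases "K = {}")
    case False
    have "compact (fst ` K)" by (rule compact_continuous_image[OF _ K(1)]) (intro continuous_intros)
    then obtain m where "m \<in> fst ` K" "\<And>y. y \<in> fst ` K \<Longrightarrow> m \<le> y"
      using compact_attains_inf[of "fst ` K"] False by auto
    then show thesis using that[of m] K(2) by fastforce
  qed (use that[of 1] in auto)
  define b where "b = \<bar>R\<bar> + m + 1"
  have sub: "K \<subseteq> {m/2<..<b} \<times> {- b..b}"
  proof
    fix p assume p: "p \<in> K"
    have "\<bar>fst p\<bar> \<le> norm p" "\<bar>snd p\<bar> \<le> norm p" 
      using norm_fst_le[of "fst p" "snd p"] norm_snd_le[of "snd p" "fst p"] by auto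
    then have "m / 2 < fst p" "fst p < b" "- b \<le> snd p" "snd p \<le> b"
      using R[OF p] m(2)[OF p] m(1) unfolding b_def by linarith+
    then show "p \<in> {m/2<..<b} \<times> {- b..b}" by (simp add: mem_Times_iff)
  qed
  obtain B1 where B1: "0 \<le> B1" "\<And>p. \<bar>\<phi> p\<bar> \<le> B1" using compact_support_bounded[OF K(1) c\<phi> K(3)] by blast
  obtain B2 where B2: "0 \<le> B2" "\<And>p. \<bar>\<phi>t p\<bar> \<le> B2" using compact_support_bounded[OF K(1) ct zt] by blast
  show thesis
  proof (rule that[of \<phi>t "m / 2" b "max B1 B2" b])
    show "\<bar>\<phi> p\<bar> \<le> max B1 B2" "\<bar>\<phi>t p\<bar> \<le> max B1 B2" for p using B1(2)[of p] B2(2)[of p] by auto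
    show "\<phi> p = 0" "\<phi>t p = 0" if "p \<notin> {m / 2<..<b} \<times> {- b..b}" for p using that sub K(3) zt by blast+
  qed (use d c\<phi> ct m B1 in \<open>auto simp: b_def\<close>)
qed

lemma integrable_bounded_support:
  fixes f :: "real \<times> real \<Rightarrow> real"
  assumes "f \<in> borel_measurable borel" "\<And>p. p \<in> {a..b} \<times> {c..d} \<Longrightarrow> \<bar>f p\<bar> \<le> B" "\<And>p. p \<notin> {a..b} \<times> {c..d} \<Longrightarrow> f p = 0"
  shows "integrable lborel f"
proof (rule Bochner_Integration.integrable_bound)
  have "bounded ({a..b} \<times> {c..d})" by (intro bounded_Times) auto
  then have "emeasure lborel ({a..b} \<times> {c..d}) < \<infinity>" by (rule emeasure_bounded_finite)
  moreover have "{a..b} \<times> {c..d} \<in> sets borel" by (intro borel_closed closed_Times) auto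
  ultimately show "integrable lborel (\<lambda>p. indicator ({a..b} \<times> {c..d}) p * B)"
    by (intro integrable_mult_left integrable_real_indicator) auto
  show "AE p in lborel. norm (f p) \<le> norm (indicator ({a..b} \<times> {c..d}) p * B)"
  proof (rule AE_I2)
    fix p show "norm (f p) \<le> norm (indicator ({a..b} \<times> {c..d}) p * B)"
      using assms(2)[of p] assms(3)[of p] by (cases "p \<in> {a..b} \<times> {c..d}") auto
  qed
qed (use assms(1) in simp)

text \<open>
  By the pointwise equation \<open>u_t + u u_x = F\<close> the difference of the two sides is the integral of
  \<open>- (u \<phi>)_t\<close>, and this vanishes on each line \<open>x = const\<close> by the fundamental theorem of
  calculus. On such a line the time derivative fails to exist at most once, when a peak passes.
\<close>
lemma pair_distributional:
  fixes \<phi> :: "real \<times> real \<Rightarrow> real"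
  assumes "test_function_on ({0<..} \<times> UNIV) \<phi>"
  shows "(LINT (t, x)|lborel. - pair_u t x * deriv (\<lambda>s. \<phi> (s, x)) t + pair_u t x * pair_ux t x * \<phi> (t, x)) =
    (LINT (t, x)|lborel. CH_source pair_u pair_ux t x * \<phi> (t, x))"
proof -
  obtain \<phi>t a b r B where d: "\<And>t x. ((\<lambda>s. \<phi> (s, x)) has_real_derivative \<phi>t (t, x)) (at t)"
    and c: "continuous_on UNIV \<phi>" "continuous_on UNIV \<phi>t" and ab: "0 < a" "a < b" and B0: "0 \<le> B"
    and B: "\<And>p. \<bar>\<phi> p\<bar> \<le> B" "\<And>p. \<bar>\<phi>t p\<bar> \<le> B"
    and z: "\<And>p. p \<notin> {a<..<b} \<times> {- r..r} \<Longrightarrow> \<phi> p = 0" "\<And>p. p \<notin> {a<..<b} \<times> {- r..r} \<Longrightarrow> \<phi>t p = 0"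
    by (rule test_function_time_derivative[OF assms]) (rule that)
  have deriv: "deriv (\<lambda>s. \<phi> (s, x)) t = \<phi>t (t, x)" for t x using d by (rule DERIV_imp_deriv)
  define L where "L = pair_bound (cosh b) (sinh a)"
  have L: "pair_bound (cosh t) (sinh t) \<le> L" "sinh t \<le> cosh b" if t: "t \<in> {a..b}" for t
  proof -
    have ch: "1 \<le> cosh t" "cosh t \<le> cosh b" and sh: "0 < sinh a" "sinh a \<le> sinh t"
      using t ab cosh_real_nonneg_le_iff[of t b] by (auto simp: cosh_real_ge_1)
    have cc: "(cosh t)\<^sup>2 \<le> (cosh b)\<^sup>2" using ch by (intro power_mono) auto
    have ss: "(sinh a)\<^sup>2 \<le> (sinh t)\<^sup>2" "0 < (sinh a)\<^sup>2" using sh by (auto intro!: power_mono)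
    have "6 * (cosh t)\<^sup>2 / (sinh t)\<^sup>2 \<le> 6 * (cosh b)\<^sup>2 / (sinh a)\<^sup>2"
      using cc ss by (intro frac_le) auto
    then show "pair_bound (cosh t) (sinh t) \<le> L" unfolding L_def pair_bound_def using cc ch by linarith
    have "sinh t \<le> cosh t" by (simp add: sinh_def cosh_def)
    then show "sinh t \<le> cosh b" using ch by linarith
  qed
  have bounds: "\<bar>pair_u t x\<bar> \<le> cosh b" "\<bar>pair_ut t x\<bar> \<le> L" "\<bar>pair_F t x\<bar> \<le> L" if "t \<in> {a..b}" for t x
    using pair_bounds(2,3)[of t x] pair_u_bound[of t x] L[OF that] that ab by auto
  have m[measurable]: "\<phi> \<in> borel_measurable borel" "\<phi>t \<in> borel_measurable borel"
    using c by (auto intro: borel_measurable_continuous_onI)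
  \<comment> \<open>\<open>\<Psi>\<close> is the time derivative of \<open>- u \<phi>\<close>, and \<open>\<Theta>\<close> is what the right-hand side integrates.\<close>
  define \<Psi> where "\<Psi> p = - (pair_ut (fst p) (snd p) * \<phi> p + pair_u (fst p) (snd p) * \<phi>t p)" for p
  define \<Theta> where "\<Theta> p = pair_F (fst p) (snd p) * \<phi> p" for p
  have \<Psi>m: "\<Psi> \<in> borel_measurable borel" unfolding \<Psi>_def[abs_def]
    by (intro borel_measurable_uminus borel_measurable_add borel_measurable_times pair_measurable m)
  have \<Theta>m: "\<Theta> \<in> borel_measurable borel" unfolding \<Theta>_def[abs_def]
    by (intro borel_measurable_times pair_measurable m)
  have \<Psi>0: "\<Psi> p = 0" and \<Theta>0: "\<Theta> p = 0" if "p \<notin> {a<..<b} \<times> {- r..r}" for p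
    using z[OF that] by (auto simp: \<Psi>_def \<Theta>_def)
  have L0: "0 \<le> L" using L(1)[of a] pair_bounds(2)[of a 0] ab by force
  have \<Psi>b: "\<bar>\<Psi> (t, x)\<bar> \<le> L * B + cosh b * B" if "t \<in> {a..b}" for t x
  proof -
    have "\<bar>\<Psi> (t, x)\<bar> \<le> \<bar>pair_ut t x * \<phi> (t, x)\<bar> + \<bar>pair_u t x * \<phi>t (t, x)\<bar>"
      unfolding \<Psi>_def by simp
    also have "\<dots> \<le> L * B + cosh b * B"
      unfolding abs_mult using bounds[OF that, of x] B L0 by (intro add_mono mult_mono) (auto simp: cosh_real_nonneg)
    finally show ?thesis .
  qed
  have \<Psi>i: "integrable lborel \<Psi>"
    by (rule integrable_bounded_support[OF \<Psi>m, of a b "- r" r]) (use \<Psi>b \<Psi>0 in \<open>fastforce+\<close>)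
  have \<Theta>i: "integrable lborel \<Theta>"
  proof (rule integrable_bounded_support[OF \<Theta>m, of a b "- r" r "L * B"])
    fix p :: "real \<times> real" assume "p \<in> {a..b} \<times> {- r..r}"
    then have "fst p \<in> {a..b}" by auto
    then show "\<bar>\<Theta> p\<bar> \<le> L * B"
      unfolding \<Theta>_def abs_mult using bounds(3) B L0 by (intro mult_mono) auto
  next
    fix p :: "real \<times> real" assume "p \<notin> {a..b} \<times> {- r..r}"
    then show "\<Theta> p = 0" by (intro \<Theta>0) auto
  qed
  have slice: "(LINT t|lborel. \<Psi> (t, x)) = 0" for x
  proof -
    define k where "k t = - (pair_ut t x * \<phi> (t, x) + pair_u t x * \<phi>t (t, x))" for t
    have km: "k \<in> borel_measurable borel"
    proof -
      have "(\<lambda>t. \<Psi> (t, x)) \<in> borel_measurable borel"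
        by (rule measurable_compose[OF _ \<Psi>m]) (auto simp: borel_prod[symmetric])
      then show ?thesis by (simp add: \<Psi>_def k_def[abs_def])
    qed
    have "(LINT t|lborel. \<Psi> (t, x)) = (LINT t:{a..b}|lborel. k t)"
      unfolding set_lebesgue_integral_def
    proof (rule Bochner_Integration.integral_cong[OF refl])
      fix t show "\<Psi> (t, x) = indicator {a..b} t *\<^sub>R k t"
        using \<Psi>0[of "(t, x)"] by (cases "t \<in> {a..b}") (auto simp: \<Psi>_def k_def)
    qed
    also have "\<dots> = - (pair_u b x * \<phi> (b, x)) - - (pair_u a x * \<phi> (a, x))"
    proof (rule FTC_finite_exceptions[where S="{t. 0 < t \<and> cosh t = exp \<bar>x\<bar>}"])
      have "inj_on cosh {t::real. 0 < t}"
        by (rule inj_onI) (metis cosh_real_strict_mono less_imp_le linorder_cases mem_Collect_eq order_less_irrefl)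
      then have "finite (cosh -` {exp \<bar>x\<bar>} \<inter> {t::real. 0 < t})" by (intro finite_vimage_IntI) auto
      moreover have "cosh -` {exp \<bar>x\<bar>} \<inter> {t::real. 0 < t} = {t. 0 < t \<and> cosh t = exp \<bar>x\<bar>}" by auto
      ultimately show "finite {t::real. 0 < t \<and> cosh t = exp \<bar>x\<bar>}" by simp
      have "continuous_on {a..b} (\<lambda>t. case (t, x) of (t, x) \<Rightarrow> pair_u t x)"
        by (rule continuous_on_compose2[OF pair_u_cont]) (use ab in \<open>auto intro!: continuous_intros\<close>)
      moreover have "continuous_on {a..b} (\<lambda>t. \<phi> (t, x))"
        by (rule continuous_on_compose2[OF c(1)]) (auto intro!: continuous_intros)
      ultimately show "continuous_on {a..b} (\<lambda>t. - (pair_u t x * \<phi> (t, x)))"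
        by (intro continuous_on_minus continuous_on_mult) auto
      show "((\<lambda>t. - (pair_u t x * \<phi> (t, x))) has_real_derivative k t) (at t)"
        if t: "a < t" "t \<notin> {t. 0 < t \<and> cosh t = exp \<bar>x\<bar>}" for t
      proof -
        have "((\<lambda>t. pair_u t x) has_real_derivative pair_ut t x) (at t)" using t ab by (intro pair_u_DERIV_t) auto
        from DERIV_minus[OF DERIV_mult[OF this d[of x t]]] show ?thesis by (simp add: k_def algebra_simps)
      qed
      show "set_integrable lborel {a..b} k"
        by (rule set_integrable_bounded_Icc[OF km, where B="L * B + cosh b * B"])
           (use \<Psi>b in \<open>auto simp: \<Psi>_def k_def\<close>)
    qed (use ab in auto)
    also have "\<dots> = 0" using z(1)[of "(a, x)"] z(1)[of "(b, x)"] by simp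
    finally show ?thesis .
  qed
  have "integrable (lborel \<Otimes>\<^sub>M lborel) (case_prod (\<lambda>t x. \<Psi> (t, x)))" using \<Psi>i by (simp add: lborel_prod case_prod_unfold)
  from lborel_pair.integral_snd[OF this] have \<Psi>int: "(LINT p|lborel. \<Psi> p) = 0"
    by (simp add: slice lborel_prod case_prod_unfold)
  have e1: "(\<lambda>(t, x). - pair_u t x * deriv (\<lambda>s. \<phi> (s, x)) t + pair_u t x * pair_ux t x * \<phi> (t, x)) = (\<lambda>p. \<Psi> p + \<Theta> p)"
  proof (rule ext, clarify)
    fix t x
    show "- pair_u t x * deriv (\<lambda>s. \<phi> (s, x)) t + pair_u t x * pair_ux t x * \<phi> (t, x) = \<Psi> (t, x) + \<Theta> (t, x)"
    proof (cases "0 < t")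
      case True
      show ?thesis unfolding deriv pair_equation[OF True] by (simp add: \<Psi>_def \<Theta>_def algebra_simps)
    next
      case False
      then have "(t, x) \<notin> {a<..<b} \<times> {- r..r}" using ab by auto
      then show ?thesis using z[of "(t, x)"] by (simp add: deriv \<Psi>_def \<Theta>_def)
    qed
  qed
  have e2: "(\<lambda>(t, x). CH_source pair_u pair_ux t x * \<phi> (t, x)) = \<Theta>"
  proof (rule ext, clarify)
    fix t x
    show "CH_source pair_u pair_ux t x * \<phi> (t, x) = \<Theta> (t, x)"
    proof (cases "0 < t")
      case True
      then show ?thesis by (simp add: pair_source \<Theta>_def)
    next
      case False
      then have "(t, x) \<notin> {a<..<b} \<times> {- r..r}" using ab by auto
      then show ?thesis using z[of "(t, x)"] by (simp add: \<Theta>_def)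
    qed
  qed
  show ?thesis unfolding e1 e2 using \<Psi>i \<Theta>i \<Psi>int by simp
qed

theorem pair_weak_solution: "CH_weak_solution (\<lambda>_. 0) pair_u pair_ux"
  unfolding CH_weak_solution_def
proof (intro conjI allI impI)
  show "continuous_on ({0..} \<times> UNIV) (\<lambda>(t, x). pair_u t x)" by (rule pair_u_cont)
  show "set_borel_measurable borel ({0..} \<times> UNIV) (\<lambda>(t, x). pair_ux t x)"
    unfolding set_borel_measurable_def case_prod_unfold
    by (intro borel_measurable_scaleR borel_measurable_indicator pair_measurable borel_closed closed_Times) auto
  show "has_weak_derivative (pair_u t) (pair_ux t)" if "0 \<le> t" for t
  proof (cases "t = 0")
    case True
    have "locally_integrable (\<lambda>x. 0)" by (simp add: locally_integrable_def set_integrable_def)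
    then show ?thesis
      using weak_derivative_of_piecewise_C1[of "\<lambda>x. 0" "{}" "\<lambda>x. 0"] True by (simp add: pair_u_0[abs_def] pair_ux_def[abs_def])
  next
    case False
    then have t: "0 < t" using that by simp
    show ?thesis
    proof (rule weak_derivative_of_piecewise_C1[of _ "{pair_q t, - pair_q t}"])
      show "locally_integrable (pair_ux t)" unfolding locally_integrable_def
        by (intro allI set_integrable_bounded_Icc[OF pair_ux_measurable_x]) (use pair_ux_bound[OF t] in auto)
    qed (use t pair_u_cont_x pair_u_DERIV_x[OF t] in auto)
  qed
  show "\<exists>C. AE t in lborel. 0 \<le> t \<longrightarrow> (\<integral>\<^sup>+ x. ennreal ((pair_u t x)\<^sup>2 + 1 / 2 * (pair_ux t x)\<^sup>2) \<partial>lborel) \<le> ennreal C"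
    using pair_energy by (intro exI[of _ 8] AE_I2) (simp add: energy_density_def)
  show "pair_u 0 x = 0" for x by (rule pair_u_0)
qed (rule pair_distributional)

text \<open>
  The peaks move with the velocity \<open>\<plusminus> tanh t\<close>, which is the value of \<open>u\<close> there.
\<close>
lemma pair_q_solution: "solution_from 0 pair_u pair_q" "solution_from 0 pair_u (\<lambda>t. - pair_q t)"
proof -
  have d: "(pair_q has_real_derivative sinh t / cosh t) (at t)" for t
    unfolding pair_q_def[abs_def] by (auto intro!: derivative_eq_intros simp: cosh_real_pos)
  have u: "pair_u t (pair_q t) = sinh t / cosh t \<and> pair_u t (- pair_q t) = - (sinh t / cosh t)" if "0 \<le> t" for t
  proof (cases "t = 0")
    case True then show ?thesis by (simp add: pair_u_0)
  next
    case False
    then have t: "0 < t" using that by simp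
    have q: "0 < pair_q t" by (rule pair_q_pos[OF t])
    have e: "exp (- pair_q t) = 1 / cosh t" by (simp add: exp_minus exp_pair_q divide_inverse)
    have "pair_u t (pair_q t) = sgn (pair_q t) * (sinh t * exp (- \<bar>pair_q t\<bar>))"
      "pair_u t (- pair_q t) = sgn (- pair_q t) * (sinh t * exp (- \<bar>- pair_q t\<bar>))"
      by (rule pair_u_eq(2)[OF t], use q in \<open>simp add: exp_pair_q\<close>)+
    then show ?thesis using q e by simp
  qed
  show "solution_from 0 pair_u pair_q" "solution_from 0 pair_u (\<lambda>t. - pair_q t)"
    unfolding solution_from_def
    using has_field_derivative_at_within[OF d] has_field_derivative_at_within[OF DERIV_minus[OF d]] u by simp_all
qed

section \<open>Dependence of the limit on the characteristics\<close>

text \<open>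
  The characteristics \<open>- q\<close> and \<open>q\<close> both start at the origin, and \<open>b\<close> is any characteristic from
  \<open>1\<close>. Between \<open>q\<close> and \<open>b\<close> the slope is negative; between \<open>- q\<close> and \<open>q\<close> it is at least
  \<open>2 / sinh t\<close>, so the energy there is at least \<open>8 * q / (sinh t)\<^sup>2\<close>, which stays above \<open>1\<close>.
\<close>
theorem limits_differ:
  obtains b \<Lambda> where "characteristic pair_u pair_ux 0 (\<lambda>t. - pair_q t)" "characteristic pair_u pair_ux 0 pair_q"
    "characteristic pair_u pair_ux 1 b" "(positive_energy pair_ux (\<lambda>t. - pair_q t) b \<longlongrightarrow> \<Lambda>) (at_right 0)"
    "(positive_energy pair_ux pair_q b \<longlongrightarrow> 0) (at_right 0)" "\<Lambda> \<noteq> 0"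
proof -
  interpret CH_solution "\<lambda>_. 0" pair_u pair_ux by unfold_locales (rule pair_weak_solution)
  obtain b where b: "b 0 = 1" "solution_from 0 pair_u b" by (rule peano[OF u_cont u_bound, of 1])
  have q0: "pair_q 0 = 0" by (simp add: pair_q_def)
  obtain \<Lambda> where \<Lambda>: "(positive_energy pair_ux (\<lambda>t. - pair_q t) b \<longlongrightarrow> \<Lambda>) (at_right 0)"
    using positive_energy_right_limit[OF pair_q_solution(2) b(2)] by blast
  have "positive_energy pair_ux pair_q b t = 0" if t: "0 < t" for t
  proof -
    have "indicator {pair_q t..b t} x *\<^sub>R (max (pair_ux t x) 0)\<^sup>2 = 0" for x
    proof (cases "pair_q t \<le> x")
      case True
      then have "\<not> exp \<bar>x\<bar> < cosh t" using inside_iff[of x t] by auto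
      then have "pair_ux t x \<le> 0" using t by (simp add: pair_ux_def)
      then show ?thesis by (simp add: max_absorb2)
    qed simp
    then show ?thesis unfolding positive_energy_def set_lebesgue_integral_def
      by (simp only: Bochner_Integration.integral_zero)
  qed
  then have \<Lambda>0: "(positive_energy pair_ux pair_q b \<longlongrightarrow> 0) (at_right 0)"
    by (intro tendsto_eventually) (auto simp: eventually_at_filter)
  have ev: "eventually (\<lambda>t. 1 \<le> positive_energy pair_ux (\<lambda>t. - pair_q t) b t) (at_right 0)"
  proof -
    have "((\<lambda>t. b t - pair_q t) \<longlongrightarrow> b 0 - pair_q 0) (at 0 within {0..})"
      using solution_from_continuous[OF b(2)] solution_from_continuous[OF pair_q_solution(1)]
      unfolding continuous_on_def by (intro tendsto_diff) auto
    then have "((\<lambda>t. b t - pair_q t) \<longlongrightarrow> 1) (at_right 0)"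
      unfolding b(1) q0 diff_zero by (rule tendsto_within_subset) auto
    then have e1: "eventually (\<lambda>t. 0 < b t - pair_q t) (at_right 0)" by (rule order_tendstoD) simp
    have "(cosh \<longlongrightarrow> cosh 0) (at_right (0::real))" by (intro tendsto_intros)
    then have e2: "eventually (\<lambda>t::real. cosh t < 2) (at_right 0)" by (rule order_tendstoD) simp
    have e3: "eventually (\<lambda>t::real. 0 < t) (at_right 0)" by (simp add: eventually_at_filter)
    show ?thesis using e1 e2 e3
    proof eventually_elim
      case (elim t)
      define q c s where "q = pair_q t" and "c = cosh t" and "s = sinh t"
      have t: "0 < t" and bq: "q < b t" and c: "1 < c" "c < 2" and s: "0 < s" and sc: "s\<^sup>2 = c\<^sup>2 - 1"
        using elim cosh_gt_1[of t] cosh_sq[of t] by (auto simp: q_def c_def s_def)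
      \<comment> \<open>\<open>q = - ln (1 / c)\<close> and \<open>ln r \<le> r - 1\<close>.\<close>
      have q: "0 < q" "1 - 1 / c \<le> q"
        using pair_q_pos[OF t] ln_le_minus_one[of "1 / c"] c
        by (auto simp: q_def pair_q_def c_def ln_div)
      have "8 * q / s\<^sup>2 = (LINT x:{- q..q}|lborel. 4 / s\<^sup>2)"
        using set_integral_const_Icc[of "- q" q "4 / s\<^sup>2"] q s by simp
      also have "\<dots> \<le> (LINT x:{- q..b t}|lborel. (max (pair_ux t x) 0)\<^sup>2)"
        unfolding set_lebesgue_integral_def
      proof (rule integral_mono_AE)
        show "integrable lborel (\<lambda>x. indicator {- q..q} x *\<^sub>R (4 / s\<^sup>2))"
          using set_integrable_const_Icc unfolding set_integrable_def .
        show "integrable lborel (\<lambda>x. indicator {- q..b t} x *\<^sub>R (max (pair_ux t x) 0)\<^sup>2)"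
          using locally_integrableD[OF uxp2_li[of t]] t unfolding set_integrable_def by simp
        show "AE x in lborel. indicator {- q..q} x *\<^sub>R (4 / s\<^sup>2) \<le> indicator {- q..b t} x *\<^sub>R (max (pair_ux t x) 0)\<^sup>2"
          using AE_lborel_not_in[of q "- q"]
        proof eventually_elim
          case (elim x)
          show ?case
          proof (cases "\<bar>x\<bar> < q")
            case True
            have "2 / s \<le> 2 * cosh x / s" using s cosh_real_ge_1[of x] by (intro divide_right_mono) auto
            moreover have "pair_ux t x = 2 * cosh x / s" using True inside_iff[of x t] by (simp add: pair_ux_def q_def s_def)
            ultimately have "2 / s \<le> max (pair_ux t x) 0" by simp
            then have "(2 / s)\<^sup>2 \<le> (max (pair_ux t x) 0)\<^sup>2" using s by (intro power_mono) auto
            then show ?thesis using True bq by (simp add: power_divide abs_less_iff)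
          next
            case False
            then have "x \<notin> {- q..q}" using elim by (auto simp: abs_if split: if_splits)
            then show ?thesis by simp
          qed
        qed
      qed
      finally have le: "8 * q / s\<^sup>2 \<le> positive_energy pair_ux (\<lambda>t. - pair_q t) b t"
        by (simp add: positive_energy_def q_def)
      \<comment> \<open>\<open>s\<^sup>2 = (c - 1) * (c + 1)\<close>, and \<open>c * (c + 1) \<le> 6\<close> for times at which \<open>cosh t < 2\<close>.\<close>
      have "s\<^sup>2 \<le> 6 * (1 - 1 / c)"
      proof -
        have "(c - 1) * (c * (c + 1)) \<le> (c - 1) * (2 * 3)" using c by (intro mult_left_mono mult_mono) auto
        then have "c * (c\<^sup>2 - 1) \<le> 6 * (c - 1)" by (simp add: power2_eq_square algebra_simps)
        then show ?thesis unfolding sc using c by (simp add: field_simps)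
      qed
      also have "\<dots> \<le> 6 * q" using q(2) by (intro mult_left_mono) auto
      finally have "s\<^sup>2 \<le> 8 * q" using q(1) by linarith
      then have "1 \<le> 8 * q / s\<^sup>2" using s by (simp add: pos_le_divide_eq)
      then show ?case using le by linarith
    qed
  qed
  have "1 \<le> \<Lambda>" by (rule tendsto_lowerbound[OF \<Lambda> ev]) simp
  moreover have "characteristic pair_u pair_ux 0 (\<lambda>t. - pair_q t)" "characteristic pair_u pair_ux 0 pair_q" "characteristic pair_u pair_ux 1 b"
    using solution_is_characteristic[OF pair_q_solution(2)] solution_is_characteristic[OF pair_q_solution(1)]
      solution_is_characteristic[OF b(2)] q0 b(1) by simp_all
  ultimately show thesis using that \<Lambda> \<Lambda>0 by auto
qed

section \<open>Leftmost characteristics, and conclusion\<close>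

context CH_solution
begin

lemma leftmost_characteristic_exists: "\<exists>z. leftmost_characteristic u ux \<zeta> z"
proof -
  obtain z where z: "z 0 = \<zeta>" "solution_from 0 u z"
    "\<And>w t. solution_from 0 u w \<Longrightarrow> w 0 = \<zeta> \<Longrightarrow> 0 \<le> t \<Longrightarrow> z t \<le> w t"
    using leftmost_solution[OF u_cont u_bound, of \<zeta>] by blast
  have "characteristic u ux \<zeta> z" using solution_is_characteristic[OF z(2)] z(1) by simp
  then show ?thesis using z(3) characteristic_solution unfolding leftmost_characteristic_def by blast
qed

lemma leftmost_characteristic_unique:
  assumes "leftmost_characteristic u ux \<zeta> z" "leftmost_characteristic u ux \<zeta> w" "0 \<le> t" shows "z t = w t"
  using assms unfolding leftmost_characteristic_def by (meson order_antisym)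

text \<open>
  Leftmost characteristics agree at all times \<open>t \<ge> 0\<close>, so the energy is the same function near
  \<open>0\<close>; its limit exists because they are characteristics.
\<close>
lemma leftmost_limit_unique:
  "\<exists>!\<Lambda>. \<exists>a b. leftmost_characteristic u ux \<alpha> a \<and> leftmost_characteristic u ux \<beta> b \<and>
    (positive_energy ux a b \<longlongrightarrow> \<Lambda>) (at_right 0)"
proof -
  obtain a b where a: "leftmost_characteristic u ux \<alpha> a" and b: "leftmost_characteristic u ux \<beta> b"
    using leftmost_characteristic_exists by blast
  have "solution_from 0 u a" "solution_from 0 u b"
    using a b characteristic_solution unfolding leftmost_characteristic_def by blast+
  then obtain \<Lambda> where \<Lambda>: "(positive_energy ux a b \<longlongrightarrow> \<Lambda>) (at_right 0)"
    using positive_energy_right_limit by blast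
  show ?thesis
  proof (rule ex1I[of _ \<Lambda>])
    show "\<exists>a b. leftmost_characteristic u ux \<alpha> a \<and> leftmost_characteristic u ux \<beta> b \<and> (positive_energy ux a b \<longlongrightarrow> \<Lambda>) (at_right 0)"
      using a b \<Lambda> by blast
    fix \<Lambda>' assume "\<exists>a b. leftmost_characteristic u ux \<alpha> a \<and> leftmost_characteristic u ux \<beta> b \<and> (positive_energy ux a b \<longlongrightarrow> \<Lambda>') (at_right 0)"
    then obtain a' b' where a': "leftmost_characteristic u ux \<alpha> a'" and b': "leftmost_characteristic u ux \<beta> b'"
      and \<Lambda>': "(positive_energy ux a' b' \<longlongrightarrow> \<Lambda>') (at_right 0)" by blast
    have "positive_energy ux a' b' t = positive_energy ux a b t" if "0 < t" for t
      using leftmost_characteristic_unique[OF a a', of t] leftmost_characteristic_unique[OF b b', of t] that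
      by (simp add: positive_energy_def)
    then have "eventually (\<lambda>t. positive_energy ux a' b' t = positive_energy ux a b t) (at_right 0)"
      by (auto simp: eventually_at_filter)
    then have "(positive_energy ux a b \<longlongrightarrow> \<Lambda>') (at_right 0)" using \<Lambda>' tendsto_cong by blast
    then show "\<Lambda>' = \<Lambda>" using \<Lambda> tendsto_unique[OF _ _ \<Lambda>] by (metis trivial_limit_at_right_real)
  qed
qed

lemma characteristic_energy_BV_and_limit:
  assumes "characteristic u ux \<alpha> a" "characteristic u ux \<beta> b"
  shows "locally_bounded_variation (positive_energy ux a b)"
    and "\<exists>\<Lambda>. (positive_energy ux a b \<longlongrightarrow> \<Lambda>) (at_right 0)"
  using positive_energy_bounded_variation positive_energy_right_limit characteristic_solution assms by blast+

end

theorem theorem2p7: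
  shows
    "(\<forall>u0 u ux \<alpha> \<beta>. CH_weak_solution u0 u ux \<and> \<alpha> \<le> \<beta> \<longrightarrow>
        (\<forall>a b. characteristic u ux \<alpha> a \<and> characteristic u ux \<beta> b \<longrightarrow>
           locally_bounded_variation (positive_energy ux a b) \<and>
           (\<exists>\<Lambda>. (positive_energy ux a b \<longlongrightarrow> \<Lambda>) (at_right 0))) \<and>
        (\<exists>!\<Lambda>. \<exists>a b. leftmost_characteristic u ux \<alpha> a \<and> leftmost_characteristic u ux \<beta> b \<and>
           (positive_energy ux a b \<longlongrightarrow> \<Lambda>) (at_right 0)))
     \<and>
     (\<exists>u0 u ux \<alpha> \<beta> a b a' b' \<Lambda> \<Lambda>'. CH_weak_solution u0 u ux \<and> \<alpha> < \<beta> \<and>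
        characteristic u ux \<alpha> a \<and> characteristic u ux \<beta> b \<and>
        characteristic u ux \<alpha> a' \<and> characteristic u ux \<beta> b' \<and>
        (positive_energy ux a b \<longlongrightarrow> \<Lambda>) (at_right 0) \<and>
        (positive_energy ux a' b' \<longlongrightarrow> \<Lambda>') (at_right 0) \<and> \<Lambda> \<noteq> \<Lambda>')"
proof (intro conjI allI impI)
  fix u0 :: "real \<Rightarrow> real" and u ux and \<alpha> \<beta> :: real and a b
  assume "CH_weak_solution u0 u ux \<and> \<alpha> \<le> \<beta>" and ab: "characteristic u ux \<alpha> a \<and> characteristic u ux \<beta> b"
  then have "CH_solution u0 u ux" by (simp add: CH_solution.intro)
  from CH_solution.characteristic_energy_BV_and_limit[OF this conjunct1[OF ab] conjunct2[OF ab]]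
  show "locally_bounded_variation (positive_energy ux a b)" "\<exists>\<Lambda>. (positive_energy ux a b \<longlongrightarrow> \<Lambda>) (at_right 0)" .
next
  fix u0 :: "real \<Rightarrow> real" and u ux and \<alpha> \<beta> :: real
  assume "CH_weak_solution u0 u ux \<and> \<alpha> \<le> \<beta>"
  then have "CH_solution u0 u ux" by (simp add: CH_solution.intro)
  then show "\<exists>!\<Lambda>. \<exists>a b. leftmost_characteristic u ux \<alpha> a \<and> leftmost_characteristic u ux \<beta> b \<and>
      (positive_energy ux a b \<longlongrightarrow> \<Lambda>) (at_right 0)"
    by (rule CH_solution.leftmost_limit_unique)
next
  obtain b \<Lambda> where "characteristic pair_u pair_ux 0 (\<lambda>t. - pair_q t)" "characteristic pair_u pair_ux 0 pair_q"
    "characteristic pair_u pair_ux 1 b" "(positive_energy pair_ux (\<lambda>t. - pair_q t) b \<longlongrightarrow> \<Lambda>) (at_right 0)"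
    "(positive_energy pair_ux pair_q b \<longlongrightarrow> 0) (at_right 0)" "\<Lambda> \<noteq> 0"
    by (rule limits_differ)
  then have "CH_weak_solution (\<lambda>_. 0) pair_u pair_ux \<and> (0::real) < 1 \<and>
      characteristic pair_u pair_ux 0 (\<lambda>t. - pair_q t) \<and> characteristic pair_u pair_ux 1 b \<and>
      characteristic pair_u pair_ux 0 pair_q \<and> characteristic pair_u pair_ux 1 b \<and>
      (positive_energy pair_ux (\<lambda>t. - pair_q t) b \<longlongrightarrow> \<Lambda>) (at_right 0) \<and>
      (positive_energy pair_ux pair_q b \<longlongrightarrow> 0) (at_right 0) \<and> \<Lambda> \<noteq> 0"
    by (intro conjI pair_weak_solution zero_less_one)
  then show "\<exists>u0 u ux \<alpha> \<beta> a b a' b' \<Lambda> \<Lambda>'. CH_weak_solution u0 u ux \<and> \<alpha> < \<beta> \<and>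
        characteristic u ux \<alpha> a \<and> characteristic u ux \<beta> b \<and>
        characteristic u ux \<alpha> a' \<and> characteristic u ux \<beta> b' \<and>
        (positive_energy ux a b \<longlongrightarrow> \<Lambda>) (at_right 0) \<and>
        (positive_energy ux a' b' \<longlongrightarrow> \<Lambda>') (at_right 0) \<and> \<Lambda> \<noteq> \<Lambda>'"
    by - (rule exI)+
qed

end
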